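(* Assume the continuum hypothesis. Let $\mathcal U$ be any ultrafilter on any set $I$. Then one cannot embed a property (T) von Neumann algebra $M$ into $L(F_2)^{\mathcal U}$ in such a way that $M$ contains the diagonal copy of $L(F_2)$; that is, no von Neumann algebra $M$ with $D_{\mathcal U}(L(F_2))\subset M\subset L(F_2)^{\mathcal U}$ has property (T).
   Context: $F_2$ is the free group on two generators, and $L(F_2)=\{u_g\}_{g\in F_2}''\subset\mathbb B(\ell^2F_2)$ is its group von Neumann algebra with canonical trace $\tau$. For a tracial von Neumann algebra $(N,\tau)$ and an ultrafilter $\mathcal U$ (not necessarily non-principal) on a set $I$, the ultrapower $N^{\mathcal U}$ is the quotient of $\ell^\infty(I,N)$ by the closed ideal of all $(x_n)_{n\in I}$ with $\lim_{n\to\mathcal U}\|x_n\|_2=0$, where $\|x\|_2=\tau(x^*x)^{1/2}$; it carries the trace $\tau^{\mathcal U}((x_n)_{\mathcal U})=\lim_{n\to\mathcal U}\tau(x_n)$. The diagonal embedding $D_{\mathcal U}:N\to N^{\mathcal U}$ sends $x$ to the class of the constant family $x_n=x$. Embeddings of tracial von Neumann algebras are unital, normal, trace-preserving injective $*$-homomorphisms. A tracial von Neumann algebra $(M,\tau)$ has property (T) if for every $\varepsilon>0$ there are a finite set $F\subset M$ and $\delta>0$ such that, whenever $\mathcal H$ is an $M$-$M$ Hilbert bimodule (normal on both sides) and $\xi\in\mathcal H$ satisfies $\|\langle\,\cdot\,\xi,\xi\rangle-\tau\|\le\delta$, $\|\langle\xi\,\cdot\,,\xi\rangle-\tau\|\le\delta$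 and $\|y\xi-\xi y\|\le\delta$ for all $y\in F$, there is $\xi_0\in\mathcal H$ with $\|\xi-\xi_0\|\le\varepsilon$ and $y\xi_0=\xi_0y$ for all $y\in M$. *)

theory Defs
  imports "HOL-Analysis.Analysis" "HOL-Algebra.QuotRing" "HOL-Algebra.Module"
    "HOL-Library.Equipollence"
begin

definition continuum_hypothesis :: bool where
  "continuum_hypothesis \<longleftrightarrow> (\<forall>S :: real set. uncountable S \<longrightarrow> S \<approx> (UNIV :: real set))"

definition ultrafilter :: "'i filter \<Rightarrow> bool" where
  "ultrafilter U \<longleftrightarrow> U \<noteq> bot \<and> (\<forall>P. eventually P U \<or> eventually (\<lambda>i. \<not> P i) U)"


section \<open>Free groups\<close>

text \<open>The pair \<open>(a, True)\<close> is the generator \<open>a\<close>, and \<open>(a, False)\<close> is its inverse.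
  The group consists of the reduced words.\<close>

definition flip :: "'g \<times> bool \<Rightarrow> 'g \<times> bool" where
  "flip x = (fst x, \<not> snd x)"

definition reduced :: "('g \<times> bool) list \<Rightarrow> bool" where
  "reduced w \<longleftrightarrow> successively (\<lambda>x y. y \<noteq> flip x) w"

fun cancel_cons :: "'g \<times> bool \<Rightarrow> ('g \<times> bool) list \<Rightarrow> ('g \<times> bool) list" where
  "cancel_cons x [] = [x]"
| "cancel_cons x (y # w) = (if y = flip x then w else x # y # w)"

definition free_group :: "'g set \<Rightarrow> ('g \<times> bool) list monoid" where
  "free_group S =
     \<lparr>carrier = {w. reduced w \<and> fst ` set w \<subseteq> S}, mult = foldr cancel_cons, one = []\<rparr>"

abbreviation F2 :: "(bool \<times> bool) list monoid" where
  "F2 \<equiv> free_group (UNIV :: bool set)"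

lemma flip_flip [simp]: "flip (flip x) = x"
  by (simp add: flip_def)

lemma fst_flip [simp]: "fst (flip x) = fst x"
  by (simp add: flip_def)

lemma flip_neq [simp]: "flip x \<noteq> x" "x \<noteq> flip x"
  by (auto simp: flip_def prod_eq_iff)

lemma flip_eq_iff: "y = flip x \<longleftrightarrow> x = flip y"
  by (metis flip_flip)

lemma reduced_Nil [simp]: "reduced []"
  by (simp add: reduced_def)

lemma reduced_Cons: "reduced (x # w) \<longleftrightarrow> reduced w \<and> (w \<noteq> [] \<longrightarrow> hd w \<noteq> flip x)"
  by (auto simp: reduced_def successively_Cons)

lemma reduced_cancel_cons: "reduced w \<Longrightarrow> reduced (cancel_cons x w)"
  by (cases w) (auto simp: reduced_Cons)

lemma set_cancel_cons: "set (cancel_cons x w) \<subseteq> insert x (set w)"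
  by (cases w) auto

lemma cancel_cons_flip: "reduced w \<Longrightarrow> cancel_cons x (cancel_cons (flip x) w) = w"
  by (cases w rule: remdups_adj.cases) (auto simp: reduced_Cons)

lemma reduced_foldr: "reduced v \<Longrightarrow> reduced (foldr cancel_cons u v)"
  by (induction u) (auto simp: reduced_cancel_cons)

lemma set_foldr: "set (foldr cancel_cons u v) \<subseteq> set u \<union> set v"
  by (induction u) (use set_cancel_cons in \<open>fastforce+\<close>)

lemma foldr_cancel_cons:
  assumes "reduced w"
  shows "foldr cancel_cons (cancel_cons x v) w = cancel_cons x (foldr cancel_cons v w)"
proof (cases v)
  case (Cons y v')
  show ?thesis
    using cancel_cons_flip[OF reduced_foldr[OF assms], of x v'] by (auto simp: Cons)
qed simp

lemma foldr_assoc: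
  assumes "reduced w"
  shows "foldr cancel_cons (foldr cancel_cons u v) w
       = foldr cancel_cons u (foldr cancel_cons v w)"
  by (induction u) (auto simp: foldr_cancel_cons assms)

lemma foldr_Nil: "reduced u \<Longrightarrow> foldr cancel_cons u [] = u"
proof (induction u)
  case (Cons x u)
  then show ?case by (cases u) (auto simp: reduced_Cons)
qed simp

lemma foldr_left_inverse: "foldr cancel_cons (rev (map flip u)) (foldr cancel_cons u []) = []"
proof (induction u)
  case (Cons x u)
  show ?case
    using cancel_cons_flip[OF reduced_foldr, of "[]" "flip x" u] Cons by simp
qed simp

lemma group_free_group: "group (free_group S)"
proof (rule groupI)
  fix u assume u: "u \<in> carrier (free_group S)"
  define v where "v = foldr cancel_cons (rev (map flip u)) []"
  have "set v \<subseteq> flip ` set u"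
    using set_foldr[of "rev (map flip u)" "[]"] by (auto simp: v_def)
  then have "v \<in> carrier (free_group S)"
    using u by (fastforce simp: free_group_def v_def reduced_foldr)
  moreover have "foldr cancel_cons v u = []"
    using u foldr_assoc[of u "rev (map flip u)" "[]"] foldr_left_inverse[of u] foldr_Nil[of u]
    by (simp add: v_def free_group_def)
  ultimately show "\<exists>v\<in>carrier (free_group S). v \<otimes>\<^bsub>free_group S\<^esub> u = \<one>\<^bsub>free_group S\<^esub>"
    by (auto simp: free_group_def)
next
  fix u v assume "u \<in> carrier (free_group S)" "v \<in> carrier (free_group S)"
  then show "u \<otimes>\<^bsub>free_group S\<^esub> v \<in> carrier (free_group S)"
    using set_foldr[of u v] by (fastforce simp: free_group_def reduced_foldr)
qed (auto simp: free_group_def foldr_assoc)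


section \<open>Hilbert spaces\<close>

definition complex_field :: "complex ring" where
  "complex_field = \<lparr>carrier = UNIV, mult = (*), one = 1, zero = 0, add = (+)\<rparr>"

lemma cring_complex_field: "cring complex_field"
  by (rule cringI)
     (auto simp: complex_field_def algebra_simps intro!: abelian_groupI comm_monoidI,
       metis add.right_inverse)

text \<open>A Hilbert space inherits the meaningless fields \<open>mult\<close> and \<open>one\<close> from the record
  of modules. Inner products are linear in the first argument.\<close>

record 'h hilbert = "(complex, 'h) module" +
  ip :: "'h \<Rightarrow> 'h \<Rightarrow> complex"

definition hnorm :: "('h, 'm) hilbert_scheme \<Rightarrow> 'h \<Rightarrow> real" where
  "hnorm H x = sqrt (Re (ip H x x))"

locale hilbert_space = module complex_field H for H (structure) +
  assumes ip_add: "\<lbrakk>x \<in> carrier H; y \<in> carrier H; z \<in> carrier H\<rbrakk>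
      \<Longrightarrow> ip H (x \<oplus> y) z = ip H x z + ip H y z"
    and ip_smult: "\<lbrakk>x \<in> carrier H; y \<in> carrier H\<rbrakk> \<Longrightarrow> ip H (a \<odot>\<^bsub>H\<^esub> x) y = a * ip H x y"
    and ip_cnj: "\<lbrakk>x \<in> carrier H; y \<in> carrier H\<rbrakk> \<Longrightarrow> ip H y x = cnj (ip H x y)"
    and ip_pos: "\<lbrakk>x \<in> carrier H; x \<noteq> \<zero>\<rbrakk> \<Longrightarrow> Re (ip H x x) > 0"
    and complete: "\<lbrakk>\<And>n. X n \<in> carrier H;
        \<And>e. e > 0 \<Longrightarrow> \<exists>N. \<forall>m\<ge>N. \<forall>n\<ge>N. hnorm H (X m \<ominus> X n) < e\<rbrakk>
      \<Longrightarrow> \<exists>x\<in>carrier H. (\<lambda>n. hnorm H (X n \<ominus> x)) \<longlonglongrightarrow> 0"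

text \<open>Operators are undefined off the carrier, so that equality of operators is
  equality of functions.\<close>

definition bounded_operators :: "('h, 'm) hilbert_scheme \<Rightarrow> ('h \<Rightarrow> 'h) set" where
  "bounded_operators H = {T \<in> carrier H \<rightarrow>\<^sub>E carrier H.
     (\<forall>x\<in>carrier H. \<forall>y\<in>carrier H. T (x \<oplus>\<^bsub>H\<^esub> y) = T x \<oplus>\<^bsub>H\<^esub> T y) \<and>
     (\<forall>a. \<forall>x\<in>carrier H. T (a \<odot>\<^bsub>H\<^esub> x) = a \<odot>\<^bsub>H\<^esub> T x) \<and>
     (\<exists>K. \<forall>x\<in>carrier H. hnorm H (T x) \<le> K * hnorm H x)}"

definition operator_norm :: "('h, 'm) hilbert_scheme \<Rightarrow> ('h \<Rightarrow> 'h) \<Rightarrow> real" where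
  "operator_norm H T = (SUP x\<in>{x \<in> carrier H. hnorm H x \<le> 1}. hnorm H (T x))"

definition adjoint_operator :: "('h, 'm) hilbert_scheme \<Rightarrow> ('h \<Rightarrow> 'h) \<Rightarrow> 'h \<Rightarrow> 'h" where
  "adjoint_operator H T = (THE S. S \<in> bounded_operators H \<and>
     (\<forall>x\<in>carrier H. \<forall>y\<in>carrier H. ip H (T x) y = ip H x (S y)))"

definition commutant :: "('h, 'm) hilbert_scheme \<Rightarrow> ('h \<Rightarrow> 'h) set \<Rightarrow> ('h \<Rightarrow> 'h) set" where
  "commutant H X = {T \<in> bounded_operators H.
     \<forall>S\<in>X. compose (carrier H) T S = compose (carrier H) S T}"

definition von_neumann_algebra :: "('h, 'm) hilbert_scheme \<Rightarrow> ('h \<Rightarrow> 'h) set \<Rightarrow> bool" where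
  "von_neumann_algebra H M \<longleftrightarrow>
     hilbert_space H \<and> M \<subseteq> bounded_operators H \<and>
     adjoint_operator H ` M \<subseteq> M \<and> commutant H (commutant H M) = M"


section \<open>Normed star-algebras\<close>

record 'a star_algebra = "(complex, 'a) module" +
  star :: "'a \<Rightarrow> 'a"
  nrm :: "'a \<Rightarrow> real"

definition operator_algebra :: "('h, 'm) hilbert_scheme \<Rightarrow> ('h \<Rightarrow> 'h) set \<Rightarrow> ('h \<Rightarrow> 'h) star_algebra"
  where
  "operator_algebra H M =
     \<lparr>carrier = M, mult = compose (carrier H), one = (\<lambda>x\<in>carrier H. x),
      zero = (\<lambda>x\<in>carrier H. \<zero>\<^bsub>H\<^esub>), add = (\<lambda>S T. \<lambda>x\<in>carrier H. S x \<oplus>\<^bsub>H\<^esub> T x),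
      smult = (\<lambda>a T. \<lambda>x\<in>carrier H. a \<odot>\<^bsub>H\<^esub> T x),
      star = adjoint_operator H, nrm = operator_norm H\<rparr>"

definition opposite :: "('a, 'm) star_algebra_scheme \<Rightarrow> ('a, 'm) star_algebra_scheme" where
  "opposite A = A\<lparr>mult := (\<lambda>x y. y \<otimes>\<^bsub>A\<^esub> x)\<rparr>"

definition self_adjoint :: "('a, 'm) star_algebra_scheme \<Rightarrow> 'a set" where
  "self_adjoint A = {x \<in> carrier A. star A x = x}"

definition algebra_le :: "('a, 'm) star_algebra_scheme \<Rightarrow> 'a \<Rightarrow> 'a \<Rightarrow> bool" where
  "algebra_le A x y \<longleftrightarrow> (\<exists>a\<in>carrier A. y \<ominus>\<^bsub>A\<^esub> x = star A a \<otimes>\<^bsub>A\<^esub> a)"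

definition is_supremum :: "('a, 'm) star_algebra_scheme \<Rightarrow> 'a set \<Rightarrow> 'a \<Rightarrow> bool" where
  "is_supremum A S s \<longleftrightarrow> s \<in> self_adjoint A \<and> (\<forall>x\<in>S. algebra_le A x s) \<and>
     (\<forall>t\<in>self_adjoint A. (\<forall>x\<in>S. algebra_le A x t) \<longrightarrow> algebra_le A s t)"

text \<open>The range of an increasing net of self-adjoint elements.\<close>

definition directed :: "('a, 'm) star_algebra_scheme \<Rightarrow> 'a set \<Rightarrow> bool" where
  "directed A S \<longleftrightarrow> S \<noteq> {} \<and> S \<subseteq> self_adjoint A \<and>
     (\<forall>x\<in>S. \<forall>y\<in>S. \<exists>z\<in>S. algebra_le A x z \<and> algebra_le A y z)"

definition normal_map ::
  "('a, 'm) star_algebra_scheme \<Rightarrow> ('b, 'n) star_algebra_scheme \<Rightarrow> ('a \<Rightarrow> 'b) \<Rightarrow> bool" where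
  "normal_map A B f \<longleftrightarrow>
     (\<forall>S s. directed A S \<and> is_supremum A S s \<longrightarrow> is_supremum B (f ` S) (f s))"

definition normal_functional :: "('a, 'm) star_algebra_scheme \<Rightarrow> ('a \<Rightarrow> complex) \<Rightarrow> bool" where
  "normal_functional A \<phi> \<longleftrightarrow>
     (\<forall>S s. directed A S \<and> is_supremum A S s \<longrightarrow> Re (\<phi> s) = (SUP x\<in>S. Re (\<phi> x)))"

definition star_hom ::
  "('a, 'm) star_algebra_scheme \<Rightarrow> ('b, 'n) star_algebra_scheme \<Rightarrow> ('a \<Rightarrow> 'b) set" where
  "star_hom A B = {f \<in> ring_hom A B.
     (\<forall>a. \<forall>x\<in>carrier A. f (a \<odot>\<^bsub>A\<^esub> x) = a \<odot>\<^bsub>B\<^esub> f x) \<and>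
     (\<forall>x\<in>carrier A. f (star A x) = star B (f x))}"

definition faithful_normal_tracial_state ::
  "('a, 'm) star_algebra_scheme \<Rightarrow> ('a \<Rightarrow> complex) \<Rightarrow> bool" where
  "faithful_normal_tracial_state A \<tau> \<longleftrightarrow>
     (\<forall>x\<in>carrier A. \<forall>y\<in>carrier A. \<tau> (x \<oplus>\<^bsub>A\<^esub> y) = \<tau> x + \<tau> y) \<and>
     (\<forall>a. \<forall>x\<in>carrier A. \<tau> (a \<odot>\<^bsub>A\<^esub> x) = a * \<tau> x) \<and>
     \<tau> \<one>\<^bsub>A\<^esub> = 1 \<and>
     (\<forall>x\<in>carrier A. \<forall>y\<in>carrier A. \<tau> (x \<otimes>\<^bsub>A\<^esub> y) = \<tau> (y \<otimes>\<^bsub>A\<^esub> x)) \<and>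
     (\<forall>x\<in>carrier A. \<tau> (star A x \<otimes>\<^bsub>A\<^esub> x) \<in> \<real>\<^sub>\<ge>\<^sub>0) \<and>
     (\<forall>x\<in>carrier A. \<tau> (star A x \<otimes>\<^bsub>A\<^esub> x) = 0 \<longrightarrow> x = \<zero>\<^bsub>A\<^esub>) \<and>
     normal_functional A \<tau>"

definition tracial_von_neumann_algebra ::
  "('h, 'm) hilbert_scheme \<Rightarrow> ('h \<Rightarrow> 'h) set \<Rightarrow> (('h \<Rightarrow> 'h) \<Rightarrow> complex) \<Rightarrow> bool" where
  "tracial_von_neumann_algebra H M \<tau> \<longleftrightarrow>
     von_neumann_algebra H M \<and> faithful_normal_tracial_state (operator_algebra H M) \<tau>"

definition tracial_embedding ::
  "('a, 'm) star_algebra_scheme \<Rightarrow> ('a \<Rightarrow> complex) \<Rightarrow>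
   ('b, 'n) star_algebra_scheme \<Rightarrow> ('b \<Rightarrow> complex) \<Rightarrow> ('a \<Rightarrow> 'b) \<Rightarrow> bool" where
  "tracial_embedding A \<tau> B \<sigma> f \<longleftrightarrow>
     f \<in> star_hom A B \<and> inj_on f (carrier A) \<and> normal_map A B f \<and>
     (\<forall>x\<in>carrier A. \<sigma> (f x) = \<tau> x)"


section \<open>Group von Neumann algebras\<close>

definition ell2 :: "'g set \<Rightarrow> ('g \<Rightarrow> complex) hilbert" where
  "ell2 S =
     \<lparr>carrier = {f. (\<forall>x. x \<notin> S \<longrightarrow> f x = 0) \<and> (\<lambda>x. (cmod (f x))\<^sup>2) summable_on S},
      mult = undefined, one = undefined,
      zero = (\<lambda>x. 0), add = (\<lambda>f g x. f x + g x), smult = (\<lambda>a f x. a * f x),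
      ip = (\<lambda>f g. \<Sum>\<^sub>\<infinity>x\<in>S. f x * cnj (g x))\<rparr>"

lemma ell2_carrier:
  "f \<in> carrier (ell2 S) \<longleftrightarrow>
     (\<forall>x. x \<notin> S \<longrightarrow> f x = 0) \<and> (\<lambda>x. (cmod (f x))\<^sup>2) summable_on S"
  by (simp add: ell2_def)

lemma ell2_lincomb:
  assumes f: "f \<in> carrier (ell2 S)" and g: "g \<in> carrier (ell2 S)"
  shows "(\<lambda>x. a * f x + b * g x) \<in> carrier (ell2 S)"
proof -
  have "(cmod (a * f x + b * g x))\<^sup>2 \<le> 2 * (cmod a)\<^sup>2 * (cmod (f x))\<^sup>2 + 2 * (cmod b)\<^sup>2 * (cmod (g x))\<^sup>2" for x
  proof -
    have "(cmod (a * f x + b * g x))\<^sup>2 \<le> (cmod (a * f x) + cmod (b * g x))\<^sup>2"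
      by (intro power_mono norm_triangle_ineq) auto
    also have "\<dots> \<le> 2 * (cmod (a * f x))\<^sup>2 + 2 * (cmod (b * g x))\<^sup>2"
      using sum_squares_ge_zero[of "cmod (a * f x) - cmod (b * g x)" 0]
      by (simp add: power2_eq_square algebra_simps)
    finally show ?thesis by (simp add: norm_mult power_mult_distrib)
  qed
  moreover have "(\<lambda>x. 2 * (cmod a)\<^sup>2 * (cmod (f x))\<^sup>2 + 2 * (cmod b)\<^sup>2 * (cmod (g x))\<^sup>2) summable_on S"
    using f g by (intro summable_on_add summable_on_cmult_right) (auto simp: ell2_carrier)
  ultimately have "(\<lambda>x. (cmod (a * f x + b * g x))\<^sup>2) summable_on S"
    by (intro summable_on_comparison_test[where g = "\<lambda>x. (cmod (a * f x + b * g x))\<^sup>2"]) auto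
  then show ?thesis
    using f g by (auto simp: ell2_carrier)
qed

lemma ell2_ip_summable:
  assumes f: "f \<in> carrier (ell2 S)" and g: "g \<in> carrier (ell2 S)"
  shows "(\<lambda>x. f x * cnj (g x)) summable_on S"
proof (rule abs_summable_summable, rule summable_on_comparison_test)
  show "(\<lambda>x. (cmod (f x))\<^sup>2 + (cmod (g x))\<^sup>2) summable_on S"
    using f g by (intro summable_on_add) (auto simp: ell2_carrier)
  fix x
  show "norm (f x * cnj (g x)) \<le> (cmod (f x))\<^sup>2 + (cmod (g x))\<^sup>2"
    using sum_squares_bound[of "cmod (f x)" "cmod (g x)"]
      mult_nonneg_nonneg[OF norm_ge_zero[of "f x"] norm_ge_zero[of "g x"]]
    unfolding norm_mult complex_mod_cnj by linarith
qed auto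

lemma ell2_add_group: "abelian_group (ell2 S)"
proof (rule abelian_groupI)
  fix f g assume "f \<in> carrier (ell2 S)" "g \<in> carrier (ell2 S)"
  then show "f \<oplus>\<^bsub>ell2 S\<^esub> g \<in> carrier (ell2 S)"
    using ell2_lincomb[of f S g 1 1] by (simp add: ell2_def)
next
  fix f assume "f \<in> carrier (ell2 S)"
  then show "\<exists>g\<in>carrier (ell2 S). g \<oplus>\<^bsub>ell2 S\<^esub> f = \<zero>\<^bsub>ell2 S\<^esub>"
    using ell2_lincomb[of f S f 0 "-1"]
    by (intro bexI[of _ "\<lambda>x. 0 * f x + (- 1) * f x"]) (auto simp: ell2_def)
qed (auto simp: ell2_def algebra_simps)

lemma ell2_minus:
  assumes "f \<in> carrier (ell2 S)" "g \<in> carrier (ell2 S)"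
  shows "f \<ominus>\<^bsub>ell2 S\<^esub> g = (\<lambda>x. f x - g x)"
proof -
  interpret abelian_group "ell2 S" by (rule ell2_add_group)
  have "(\<lambda>x. - g x) \<in> carrier (ell2 S)"
    using assms by (simp add: ell2_carrier)
  then have "\<ominus>\<^bsub>ell2 S\<^esub> g = (\<lambda>x. - g x)"
    using assms by (intro minus_equality) (auto simp: ell2_def)
  then show ?thesis
    by (simp add: a_minus_def) (simp add: ell2_def)
qed

lemma ell2_ip_self:
  assumes "f \<in> carrier (ell2 S)"
  shows "ip (ell2 S) f f = of_real (\<Sum>\<^sub>\<infinity>x\<in>S. (cmod (f x))\<^sup>2)"
proof -
  have "ip (ell2 S) f f = (\<Sum>\<^sub>\<infinity>x\<in>S. complex_of_real ((cmod (f x))\<^sup>2))"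
    by (simp add: ell2_def flip: complex_norm_square)
  also have "\<dots> = of_real (\<Sum>\<^sub>\<infinity>x\<in>S. (cmod (f x))\<^sup>2)"
    using assms
    by (intro infsumI) (simp add: has_sum_of_real_iff ell2_carrier del: of_real_power)
  finally show ?thesis .
qed

lemma ell2_norm:
  "f \<in> carrier (ell2 S) \<Longrightarrow> hnorm (ell2 S) f = sqrt (\<Sum>\<^sub>\<infinity>x\<in>S. (cmod (f x))\<^sup>2)"
  by (simp add: hnorm_def ell2_ip_self)

lemma ell2_norm_nonneg: "f \<in> carrier (ell2 S) \<Longrightarrow> 0 \<le> hnorm (ell2 S) f"
  by (simp add: ell2_norm infsum_nonneg)

lemma ell2_finite_sum_le:
  assumes "f \<in> carrier (ell2 S)" "finite F" "F \<subseteq> S"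
  shows "(\<Sum>x\<in>F. (cmod (f x))\<^sup>2) \<le> (hnorm (ell2 S) f)\<^sup>2"
  using assms
  by (simp add: ell2_norm infsum_nonneg ell2_carrier finite_sum_le_infsum)

lemma ell2_complete:
  assumes X: "\<And>n. X n \<in> carrier (ell2 S)"
    and cauchy: "\<And>e. e > 0 \<Longrightarrow> \<exists>N. \<forall>m\<ge>N. \<forall>n\<ge>N. hnorm (ell2 S) (X m \<ominus>\<^bsub>ell2 S\<^esub> X n) < e"
  shows "\<exists>f\<in>carrier (ell2 S). (\<lambda>n. hnorm (ell2 S) (X n \<ominus>\<^bsub>ell2 S\<^esub> f)) \<longlonglongrightarrow> 0"
proof -
  have diff: "(\<lambda>x. X m x - X n x) \<in> carrier (ell2 S)" for m n
    using ell2_lincomb[OF X[of m] X[of n], of 1 "-1"] by simp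
  have cauchy': "\<exists>N. \<forall>m\<ge>N. \<forall>n\<ge>N. hnorm (ell2 S) (\<lambda>x. X m x - X n x) < e" if "e > 0" for e
    using cauchy[OF that] by (simp add: ell2_minus X)
  have "convergent (\<lambda>n. X n x)" for x
  proof (cases "x \<in> S")
    case True
    have "Cauchy (\<lambda>n. X n x)"
    proof (rule CauchyI)
      fix e :: real assume e: "e > 0"
      obtain N where N: "\<And>m n. m \<ge> N \<Longrightarrow> n \<ge> N \<Longrightarrow> hnorm (ell2 S) (\<lambda>x. X m x - X n x) < e"
        using cauchy'[OF e] by blast
      have "norm (X m x - X n x) < e" if "m \<ge> N" "n \<ge> N" for m n
      proof -
        have "(cmod (X m x - X n x))\<^sup>2 \<le> (hnorm (ell2 S) (\<lambda>x. X m x - X n x))\<^sup>2"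
          using ell2_finite_sum_le[OF diff[of m n], of "{x}"] True by simp
        then have "cmod (X m x - X n x) \<le> hnorm (ell2 S) (\<lambda>x. X m x - X n x)"
          by (rule power2_le_imp_le) (rule ell2_norm_nonneg[OF diff])
        then show ?thesis using N[OF that] by linarith
      qed
      then show "\<exists>M. \<forall>m\<ge>M. \<forall>n\<ge>M. norm (X m x - X n x) < e" by blast
    qed
    then show ?thesis by (rule Cauchy_convergent)
  next
    case False
    then show ?thesis using X by (simp add: ell2_carrier convergent_const)
  qed
  then obtain f where f: "\<And>x. (\<lambda>n. X n x) \<longlonglongrightarrow> f x"
    unfolding convergent_def by metis
  have f0: "f x = 0" if "x \<notin> S" for x
    using f[of x] X that LIMSEQ_unique[of "\<lambda>n. X n x" 0 "f x"] by (simp add: ell2_carrier)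
  have tail: "\<exists>N. \<forall>n\<ge>N. (\<lambda>x. X n x - f x) \<in> carrier (ell2 S) \<and>
      hnorm (ell2 S) (\<lambda>x. X n x - f x) \<le> e" if e: "e > 0" for e
  proof -
    obtain N where N: "\<And>m n. m \<ge> N \<Longrightarrow> n \<ge> N \<Longrightarrow> hnorm (ell2 S) (\<lambda>x. X m x - X n x) < e"
      using cauchy'[OF e] by blast
    have "(\<lambda>x. X n x - f x) \<in> carrier (ell2 S) \<and> hnorm (ell2 S) (\<lambda>x. X n x - f x) \<le> e"
      if n: "n \<ge> N" for n
    proof -
      have fin: "(\<Sum>x\<in>F. (cmod (X n x - f x))\<^sup>2) \<le> e\<^sup>2" if F: "finite F" "F \<subseteq> S" for F
      proof (rule tendsto_upperbound)
        show "(\<lambda>m. \<Sum>x\<in>F. (cmod (X n x - X m x))\<^sup>2) \<longlonglongrightarrow> (\<Sum>x\<in>F. (cmod (X n x - f x))\<^sup>2)"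
          by (intro tendsto_intros f)
        have "(\<Sum>x\<in>F. (cmod (X n x - X m x))\<^sup>2) \<le> e\<^sup>2" if "m \<ge> N" for m
        proof -
          have "(hnorm (ell2 S) (\<lambda>x. X n x - X m x))\<^sup>2 \<le> e\<^sup>2"
            using N[OF n that] by (intro power_mono) (auto simp: ell2_norm_nonneg[OF diff])
          then show ?thesis using ell2_finite_sum_le[OF diff F, of n m] by linarith
        qed
        then show "\<forall>\<^sub>F m in sequentially. (\<Sum>x\<in>F. (cmod (X n x - X m x))\<^sup>2) \<le> e\<^sup>2"
          by (auto simp: eventually_sequentially)
      qed simp
      have sm: "(\<lambda>x. (cmod (X n x - f x))\<^sup>2) summable_on S"
        by (rule nonneg_bdd_above_summable_on) (auto intro!: bdd_aboveI[of _ "e\<^sup>2"] fin)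
      have "(\<Sum>\<^sub>\<infinity>x\<in>S. (cmod (X n x - f x))\<^sup>2) \<le> e\<^sup>2"
        by (rule infsum_le_finite_sums[OF sm fin])
      moreover have mem: "(\<lambda>x. X n x - f x) \<in> carrier (ell2 S)"
        using sm f0 X by (auto simp: ell2_carrier)
      ultimately have "hnorm (ell2 S) (\<lambda>x. X n x - f x) \<le> e"
        using e by (simp add: ell2_norm real_le_lsqrt infsum_nonneg)
      with mem show ?thesis ..
    qed
    then show ?thesis by blast
  qed
  obtain n where "(\<lambda>x. X n x - f x) \<in> carrier (ell2 S)"
    using tail[of 1] by auto
  then have fc: "f \<in> carrier (ell2 S)"
    using ell2_lincomb[OF X[of n], of "\<lambda>x. X n x - f x" 1 "-1"] by simp
  have "(\<lambda>n. hnorm (ell2 S) (\<lambda>x. X n x - f x)) \<longlonglongrightarrow> 0"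
  proof (rule LIMSEQ_I)
    fix e :: real assume "e > 0"
    then obtain N where N: "\<forall>n\<ge>N. (\<lambda>x. X n x - f x) \<in> carrier (ell2 S) \<and>
        hnorm (ell2 S) (\<lambda>x. X n x - f x) \<le> e / 2"
      using tail[of "e / 2"] by auto
    have "norm (hnorm (ell2 S) (\<lambda>x. X n x - f x) - 0) < e" if "n \<ge> N" for n
      using N that \<open>e > 0\<close> ell2_norm_nonneg[of "\<lambda>x. X n x - f x" S] by fastforce
    then show "\<exists>N. \<forall>n\<ge>N. norm (hnorm (ell2 S) (\<lambda>x. X n x - f x) - 0) < e"
      by blast
  qed
  then show ?thesis using fc by (intro bexI[of _ f]) (simp_all add: ell2_minus X fc)
qed

lemma hilbert_space_ell2: "hilbert_space (ell2 S)"
proof -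
  interpret cring complex_field by (rule cring_complex_field)
  interpret abelian_group "ell2 S" by (rule ell2_add_group)
  show ?thesis
  proof unfold_locales
    fix a f assume "f \<in> carrier (ell2 S)"
    then show "a \<odot>\<^bsub>ell2 S\<^esub> f \<in> carrier (ell2 S)"
      using ell2_lincomb[of f S f a 0] by (simp add: ell2_def)
  next
    fix f g h assume "f \<in> carrier (ell2 S)" "g \<in> carrier (ell2 S)" "h \<in> carrier (ell2 S)"
    then show "ip (ell2 S) (f \<oplus>\<^bsub>ell2 S\<^esub> g) h = ip (ell2 S) f h + ip (ell2 S) g h"
      using infsum_add[OF ell2_ip_summable ell2_ip_summable, of f S h g h]
      by (simp add: ell2_def algebra_simps)
  next
    fix f g a assume "f \<in> carrier (ell2 S)" "g \<in> carrier (ell2 S)"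
    then show "ip (ell2 S) (a \<odot>\<^bsub>ell2 S\<^esub> f) g = a * ip (ell2 S) f g"
      using infsum_cmult_right[of a "\<lambda>x. f x * cnj (g x)" S] ell2_ip_summable[of f S g]
      by (simp add: ell2_def mult.assoc)
  next
    fix f g assume "f \<in> carrier (ell2 S)" "g \<in> carrier (ell2 S)"
    then show "ip (ell2 S) g f = cnj (ip (ell2 S) f g)"
      by (simp add: ell2_def infsum_cnj[symmetric] mult.commute)
  next
    fix f assume f: "f \<in> carrier (ell2 S)" "f \<noteq> \<zero>\<^bsub>ell2 S\<^esub>"
    then obtain x where x: "x \<in> S" "f x \<noteq> 0"
      by (auto simp: ell2_def fun_eq_iff)
    have "0 < (cmod (f x))\<^sup>2" using x by simp
    also have "\<dots> \<le> (hnorm (ell2 S) f)\<^sup>2"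
      using ell2_finite_sum_le[OF f(1), of "{x}"] x by simp
    also have "\<dots> = Re (ip (ell2 S) f f)"
      using f(1) by (simp add: ell2_norm ell2_ip_self infsum_nonneg)
    finally show "0 < Re (ip (ell2 S) f f)" .
  next
    fix X :: "nat \<Rightarrow> 'a \<Rightarrow> complex"
    assume "\<And>n. X n \<in> carrier (ell2 S)"
      "\<And>e. e > 0 \<Longrightarrow> \<exists>N. \<forall>m\<ge>N. \<forall>n\<ge>N. hnorm (ell2 S) (X m \<ominus>\<^bsub>ell2 S\<^esub> X n) < e"
    then show "\<exists>f\<in>carrier (ell2 S). (\<lambda>n. hnorm (ell2 S) (X n \<ominus>\<^bsub>ell2 S\<^esub> f)) \<longlonglongrightarrow> 0"
      by (rule ell2_complete)
  qed (auto simp: ell2_def complex_field_def algebra_simps)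
qed

definition left_translation :: "('g, 'm) monoid_scheme \<Rightarrow> 'g \<Rightarrow> ('g \<Rightarrow> complex) \<Rightarrow> 'g \<Rightarrow> complex"
  where
  "left_translation G g = (\<lambda>f\<in>carrier (ell2 (carrier G)).
     \<lambda>h. if h \<in> carrier G then f (inv\<^bsub>G\<^esub> g \<otimes>\<^bsub>G\<^esub> h) else 0)"

definition group_vN_algebra ::
  "('g, 'm) monoid_scheme \<Rightarrow> (('g \<Rightarrow> complex) \<Rightarrow> 'g \<Rightarrow> complex) star_algebra" where
  "group_vN_algebra G =
     (let H = ell2 (carrier G) in
      operator_algebra H (commutant H (commutant H (left_translation G ` carrier G))))"

definition group_trace ::
  "('g, 'm) monoid_scheme \<Rightarrow> (('g \<Rightarrow> complex) \<Rightarrow> 'g \<Rightarrow> complex) \<Rightarrow> complex" where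
  "group_trace G T =
     (let \<delta> = (\<lambda>h. if h = \<one>\<^bsub>G\<^esub> then 1 else 0) in ip (ell2 (carrier G)) (T \<delta>) \<delta>)"


section \<open>Tracial ultrapowers\<close>

definition norm2 :: "('a, 'm) star_algebra_scheme \<Rightarrow> ('a \<Rightarrow> complex) \<Rightarrow> 'a \<Rightarrow> real" where
  "norm2 A \<tau> x = sqrt (Re (\<tau> (star A x \<otimes>\<^bsub>A\<^esub> x)))"

definition ell_infinity :: "('a, 'm) star_algebra_scheme \<Rightarrow> ('i \<Rightarrow> 'a) star_algebra" where
  "ell_infinity A =
     \<lparr>carrier = {x. (\<forall>i. x i \<in> carrier A) \<and> (\<exists>K. \<forall>i. nrm A (x i) \<le> K)},
      mult = (\<lambda>x y i. x i \<otimes>\<^bsub>A\<^esub> y i), one = (\<lambda>i. \<one>\<^bsub>A\<^esub>),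
      zero = (\<lambda>i. \<zero>\<^bsub>A\<^esub>), add = (\<lambda>x y i. x i \<oplus>\<^bsub>A\<^esub> y i),
      smult = (\<lambda>a x i. a \<odot>\<^bsub>A\<^esub> x i), star = (\<lambda>x i. star A (x i)),
      nrm = (\<lambda>x. SUP i. nrm A (x i))\<rparr>"

definition null_families ::
  "('a, 'm) star_algebra_scheme \<Rightarrow> ('a \<Rightarrow> complex) \<Rightarrow> 'i filter \<Rightarrow> ('i \<Rightarrow> 'a) set" where
  "null_families A \<tau> U =
     {x \<in> carrier (ell_infinity A). ((\<lambda>i. norm2 A \<tau> (x i)) \<longlongrightarrow> 0) U}"

text \<open>The first five fields are those of the quotient ring
  \<open>ell_infinity A Quot null_families A \<tau> U\<close>, and \<open>nrm\<close> is the quotient norm.\<close>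

definition ultrapower ::
  "('a, 'm) star_algebra_scheme \<Rightarrow> ('a \<Rightarrow> complex) \<Rightarrow> 'i filter \<Rightarrow> ('i \<Rightarrow> 'a) set star_algebra"
  where
  "ultrapower A \<tau> U =
     (let L = ell_infinity A; J = null_families A \<tau> U; Q = L Quot J in
      \<lparr>carrier = carrier Q, mult = mult Q, one = one Q, zero = zero Q, add = add Q,
       smult = (\<lambda>a X. \<Union>x\<in>X. J +>\<^bsub>L\<^esub> (a \<odot>\<^bsub>L\<^esub> x)),
       star = (\<lambda>X. \<Union>x\<in>X. J +>\<^bsub>L\<^esub> star L x),
       nrm = (\<lambda>X. INF x\<in>X. nrm L x)\<rparr>)"

definition ultrapower_trace ::
  "('a \<Rightarrow> complex) \<Rightarrow> 'i filter \<Rightarrow> ('i \<Rightarrow> 'a) set \<Rightarrow> complex" where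
  "ultrapower_trace \<tau> U X = (THE c. \<forall>x\<in>X. ((\<lambda>i. \<tau> (x i)) \<longlongrightarrow> c) U)"

definition diagonal ::
  "('a, 'm) star_algebra_scheme \<Rightarrow> ('a \<Rightarrow> complex) \<Rightarrow> 'i filter \<Rightarrow> 'a \<Rightarrow> ('i \<Rightarrow> 'a) set" where
  "diagonal A \<tau> U x = null_families A \<tau> U +>\<^bsub>ell_infinity A\<^esub> (\<lambda>i. x)"


section \<open>Property (T)\<close>

abbreviation all_operators :: "('h, 'm) hilbert_scheme \<Rightarrow> ('h \<Rightarrow> 'h) star_algebra" where
  "all_operators H \<equiv> operator_algebra H (bounded_operators H)"

text \<open>Here \<open>l x\<close> is \<open>\<xi> \<mapsto> x \<xi>\<close> and \<open>r y\<close> is \<open>\<xi> \<mapsto> \<xi> y\<close>.\<close>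

definition normal_bimodule ::
  "('a, 'm) star_algebra_scheme \<Rightarrow> ('h, 'n) hilbert_scheme \<Rightarrow>
   ('a \<Rightarrow> 'h \<Rightarrow> 'h) \<Rightarrow> ('a \<Rightarrow> 'h \<Rightarrow> 'h) \<Rightarrow> bool" where
  "normal_bimodule A H l r \<longleftrightarrow>
     hilbert_space H \<and>
     l \<in> star_hom A (all_operators H) \<and> normal_map A (all_operators H) l \<and>
     r \<in> star_hom (opposite A) (all_operators H) \<and> normal_map (opposite A) (all_operators H) r \<and>
     (\<forall>x\<in>carrier A. \<forall>y\<in>carrier A. \<forall>\<xi>\<in>carrier H. l x (r y \<xi>) = r y (l x \<xi>))"

text \<open>HOL cannot quantify over all Hilbert spaces inside a formula, so the Hilbert spaces
  below have their vectors in the type \<^typ>\<open>nat \<Rightarrow> 'a\<close>, where \<^typ>\<open>'a\<close> is the type of the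
  elements of the algebra. For an algebra \<open>M \<noteq> 0\<close> this loses nothing, and any \<open>F\<close> and \<open>\<delta>\<close>
  that work here work for all bimodules. Indeed, let \<open>K\<close> be the closed linear span of \<open>M \<xi> M\<close>.
  The orthogonal projection onto \<open>K\<close> commutes with both actions, hence it maps a central
  vector to a central vector that is at least as close to \<open>\<xi>\<close>; so \<open>K\<close> may replace the
  bimodule. Every element of \<open>K\<close> is the limit of a sequence of finite sums of vectors
  \<open>x \<xi> y\<close>, so \<open>K\<close> has at most as many elements as \<^typ>\<open>nat \<Rightarrow> 'a\<close> and can be realized there.\<close>

definition property_T :: "('a, 'm) star_algebra_scheme \<Rightarrow> ('a \<Rightarrow> complex) \<Rightarrow> bool" where
  "property_T A \<tau> \<longleftrightarrow>
     (\<forall>\<epsilon>>0. \<exists>F \<delta>. finite F \<and> F \<subseteq> carrier A \<and> \<delta> > 0 \<and>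
       (\<forall>(H :: (nat \<Rightarrow> 'a) hilbert) l r. \<forall>\<xi>\<in>carrier H.
          normal_bimodule A H l r \<and>
          (\<forall>x\<in>carrier A. nrm A x \<le> 1 \<longrightarrow> cmod (ip H (l x \<xi>) \<xi> - \<tau> x) \<le> \<delta>) \<and>
          (\<forall>x\<in>carrier A. nrm A x \<le> 1 \<longrightarrow> cmod (ip H (r x \<xi>) \<xi> - \<tau> x) \<le> \<delta>) \<and>
          (\<forall>y\<in>F. hnorm H (l y \<xi> \<ominus>\<^bsub>H\<^esub> r y \<xi>) \<le> \<delta>)
          \<longrightarrow> (\<exists>\<xi>\<^sub>0\<in>carrier H. hnorm H (\<xi> \<ominus>\<^bsub>H\<^esub> \<xi>\<^sub>0) \<le> \<epsilon> \<and>
                 (\<forall>y\<in>carrier A. l y \<xi>\<^sub>0 = r y \<xi>\<^sub>0))))"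

end

theory Submission
  imports Defs "HOL-Library.Function_Algebras"
begin

text \<open>
  The idea is to set a one-parameter group of automorphisms of \<open>L(F\<^sub>2)\<close> against the rigidity
  of \<open>M\<close>.  Let \<open>a\<close> and \<open>b\<close> be the generators of \<open>F\<^sub>2\<close>.  The character
  \<open>w \<mapsto> cis (t e(w))\<close>, where \<open>e\<close> is the exponent sum of \<open>a\<close>, gives an automorphism of
  \<open>L(F\<^sub>2)\<close> that multiplies \<open>u\<^sub>a\<close> by \<open>cis t\<close> and fixes \<open>u\<^sub>b\<close>.  It is implemented by the diagonal
  unitary of the character, and it tends to the identity in the 2-norm, pointwise, as \<open>t\<close>
  tends to 0.

  Suppose that \<open>M\<close> has property (T), and let \<open>F\<close> and \<open>\<delta>\<close> be as in its definition for
  \<open>\<epsilon> = 1/2\<close>.  Represent each \<open>x \<in> F\<close> by a bounded family \<open>(x\<^sub>i)\<close> in \<open>L(F\<^sub>2)\<close>.  At every index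
  \<open>i\<close> the parameter is slowed down until the automorphism moves the finitely many \<open>x\<^sub>i\<close> by at
  most \<open>\<delta>\<close>, but not further: take the largest \<open>s\<^sub>i\<close> among \<open>1, 1/2, 1/4, \<dots>\<close> with this property.
  Since doubling the parameter at most doubles the displacement (\<open>twist_doubling\<close>), either
  \<open>s\<^sub>i = 1\<close>, or some \<open>x\<^sub>i\<close> is moved by more than \<open>\<delta>/2\<close>.

  The automorphisms with parameters \<open>s\<^sub>i\<close> twist the right action of \<open>M\<close> on the standard bimodule
  of the ultrapower, and the unit vector \<open>\<xi>\<close> is almost central in the \<open>M\<close>-\<open>M\<close> bimodule which it
  generates.  Property (T) provides a central vector \<open>v\<close> near \<open>\<xi>\<close>.  Now \<open>M\<close> contains the constant
  families \<open>u\<^sub>a\<close> and \<open>u\<^sub>b\<close>.  Commuting with them means that \<open>v\<^sub>i(g\<inverse> h g)\<close> and \<open>v\<^sub>i(h)\<close> differ by a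
  phase, up to a small error in \<open>\<ell>\<^sup>2\<close>, for \<open>g\<close> one of the generators.  So the mass of
  \<open>\<bar>v\<^sub>i\<bar>\<^sup>2\<close> is almost invariant under conjugation, and the paradoxical decomposition of
  \<open>F\<^sub>2 - {1}\<close> by the last letter of a word, due to Murray and von Neumann, forces it to sit at
  the unit (\<open>paradoxical_mass\<close>).  Hence \<open>v\<close> is a nonzero multiple of \<open>\<xi>\<close>, and \<open>\<xi>\<close> itself is
  central (\<open>unit_vector_central\<close>).

  Centrality of \<open>\<xi>\<close> for \<open>u\<^sub>a\<close> says that \<open>cis s\<^sub>i\<close> tends to 1, which excludes \<open>s\<^sub>i = 1\<close> for most
  \<open>i\<close>.  Centrality for the elements of \<open>F\<close> says that the displacements tend to 0, which
  contradicts the choice of \<open>s\<^sub>i\<close>.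

  The other lemmas supply the analysis.  Adjoints come from the Riesz representation theorem.
  A homomorphism into the bounded operators is shown to be normal by testing on a dense set of
  vectors (\<open>normal_mapI\<close>); this uses that positive operators are squares, since the order of an
  algebra is defined by squares.  The bimodule is built as a set of bounded families with a
  semi-inner product, the limit of inner products along \<open>U\<close>, and is then transported to a
  Hilbert space with vectors in \<^typ>\<open>nat \<Rightarrow> 'a\<close>.  This is possible because each of its vectors is
  determined by a sequence of finite lists of pairs of elements of \<open>M\<close>.
\<close>

section \<open>Geometry of Hilbert spaces\<close>

context hilbert_space
begin

lemma smult_in [simp, intro]: "x \<in> carrier H \<Longrightarrow> a \<odot> x \<in> carrier H"
  by (rule smult_closed) (simp_all add: complex_field_def)

lemma ip_add_right:
  "\<lbrakk>x \<in> carrier H; y \<in> carrier H; z \<in> carrier H\<rbrakk> \<Longrightarrow> ip H x (y \<oplus> z) = ip H x y + ip H x z"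
  using ip_cnj[of "y \<oplus> z" x] ip_cnj[of y x] ip_cnj[of z x] by (simp add: ip_add)

lemma ip_smult_right:
  "\<lbrakk>x \<in> carrier H; y \<in> carrier H\<rbrakk> \<Longrightarrow> ip H x (a \<odot> y) = cnj a * ip H x y"
  using ip_cnj[of "a \<odot> y" x] ip_cnj[of y x] by (simp add: ip_smult)

lemma ip_zero_left [simp]: "y \<in> carrier H \<Longrightarrow> ip H \<zero> y = 0"
  using ip_add[of \<zero> \<zero> y] by simp

lemma ip_zero_right [simp]: "y \<in> carrier H \<Longrightarrow> ip H y \<zero> = 0"
  using ip_add_right[of y \<zero> \<zero>] by simp

lemma ip_diff:
  "\<lbrakk>x \<in> carrier H; y \<in> carrier H; z \<in> carrier H\<rbrakk> \<Longrightarrow> ip H (x \<ominus> y) z = ip H x z - ip H y z"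
  using ip_add[of "\<ominus> y" y z] by (simp add: ip_add minus_eq l_neg eq_neg_iff_add_eq_0)

lemma ip_diff_right:
  "\<lbrakk>x \<in> carrier H; y \<in> carrier H; z \<in> carrier H\<rbrakk> \<Longrightarrow> ip H z (x \<ominus> y) = ip H z x - ip H z y"
  using ip_cnj[of "x \<ominus> y" z] ip_cnj[of y z] ip_cnj[of x z] by (simp add: ip_diff)

lemma ip_self: "x \<in> carrier H \<Longrightarrow> ip H x x = of_real ((hnorm H x)\<^sup>2)"
proof -
  assume x: "x \<in> carrier H"
  then have "Re (ip H x x) \<ge> 0"
    by (cases "x = \<zero>") (use ip_pos[OF x] in auto)
  moreover have "Im (ip H x x) = 0"
    using ip_cnj[OF x x] by (metis add.inverse_inverse cnj.sel(2) equal_neg_zero)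
  ultimately show ?thesis by (simp add: hnorm_def complex_eq_iff)
qed

lemma hnorm_nonneg [simp]: "x \<in> carrier H \<Longrightarrow> 0 \<le> hnorm H x"
  using ip_pos[of x] by (cases "x = \<zero>") (auto simp: hnorm_def)

lemma hnorm_zero [simp]: "hnorm H \<zero> = 0"
  by (simp add: hnorm_def)

lemma hnorm_eq_0: "x \<in> carrier H \<Longrightarrow> hnorm H x = 0 \<longleftrightarrow> x = \<zero>"
  using ip_pos[of x] by (cases "x = \<zero>") (auto simp: hnorm_def)

text \<open>Equations between vectors are proved by pairing both sides with all vectors, which turns
  them into equations between complex numbers.\<close>

lemma vector_eqI:
  assumes "x \<in> carrier H" "y \<in> carrier H" "\<And>z. z \<in> carrier H \<Longrightarrow> ip H x z = ip H y z"
  shows "x = y"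
proof -
  have "ip H (x \<ominus> y) (x \<ominus> y) = 0" using assms by (simp add: ip_diff)
  then have "x \<ominus> y = \<zero>" using assms ip_pos[of "x \<ominus> y"] by fastforce
  then show ?thesis using assms by (metis a_minus_def minus_equality minus_minus add.inv_closed)
qed

lemma vector_eqI_right:
  assumes "x \<in> carrier H" "y \<in> carrier H" "\<And>z. z \<in> carrier H \<Longrightarrow> ip H z x = ip H z y"
  shows "x = y"
  using assms ip_cnj by (metis vector_eqI)

lemma hnorm_smult: "x \<in> carrier H \<Longrightarrow> hnorm H (a \<odot> x) = cmod a * hnorm H x"
proof -
  assume x: "x \<in> carrier H"
  have "complex_of_real ((hnorm H (a \<odot> x))\<^sup>2) = a * cnj a * ip H x x"
    using x by (simp add: ip_self[symmetric] ip_smult ip_smult_right del: of_real_power)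
  also have "\<dots> = complex_of_real ((cmod a * hnorm H x)\<^sup>2)"
    using x by (simp add: ip_self complex_norm_square[symmetric] power_mult_distrib)
  finally have "complex_of_real ((hnorm H (a \<odot> x))\<^sup>2) = complex_of_real ((cmod a * hnorm H x)\<^sup>2)" .
  then show ?thesis
    using x by (simp only: of_real_eq_iff) (simp add: power2_eq_iff_nonneg)
qed

lemma ip_sub_expand:
  assumes "x \<in> carrier H" "y \<in> carrier H"
  shows "(hnorm H (x \<ominus> y))\<^sup>2 = (hnorm H x)\<^sup>2 + (hnorm H y)\<^sup>2 - 2 * Re (ip H x y)"
    and "(hnorm H (x \<oplus> y))\<^sup>2 = (hnorm H x)\<^sup>2 + (hnorm H y)\<^sup>2 + 2 * Re (ip H x y)"
proof -
  have n: "(hnorm H z)\<^sup>2 = Re (ip H z z)" if "z \<in> carrier H" for z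
    using ip_self[OF that] by simp
  have c: "Re (ip H y x) = Re (ip H x y)"
    using ip_cnj[OF assms] by simp
  show "(hnorm H (x \<ominus> y))\<^sup>2 = (hnorm H x)\<^sup>2 + (hnorm H y)\<^sup>2 - 2 * Re (ip H x y)"
    using assms c by (simp add: n ip_diff ip_diff_right)
  show "(hnorm H (x \<oplus> y))\<^sup>2 = (hnorm H x)\<^sup>2 + (hnorm H y)\<^sup>2 + 2 * Re (ip H x y)"
    using assms c by (simp add: n ip_add ip_add_right)
qed

lemma parallelogram:
  assumes "x \<in> carrier H" "y \<in> carrier H"
  shows "(hnorm H (x \<ominus> y))\<^sup>2 = 2 * (hnorm H x)\<^sup>2 + 2 * (hnorm H y)\<^sup>2 - (hnorm H (x \<oplus> y))\<^sup>2"
  using ip_sub_expand[OF assms] by simp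

lemma Cauchy_Schwarz:
  assumes x: "x \<in> carrier H" and y: "y \<in> carrier H"
  shows "cmod (ip H x y) \<le> hnorm H x * hnorm H y"
proof (cases "hnorm H y = 0")
  case True
  then show ?thesis using x y by (simp add: hnorm_eq_0)
next
  case False
  define N where "N = (hnorm H y)\<^sup>2"
  define c where "c = ip H x y"
  have N: "N > 0" using False by (simp add: N_def)
  define a where "a = c / of_real N"
  have "0 \<le> (hnorm H (x \<ominus> a \<odot> y))\<^sup>2" by simp
  also have "\<dots> = (hnorm H x)\<^sup>2 + (cmod a)\<^sup>2 * N - 2 * Re (cnj a * c)"
    using x y by (simp add: ip_sub_expand hnorm_smult power_mult_distrib ip_smult_right N_def c_def)
  also have "cnj a * c = of_real ((cmod c)\<^sup>2 / N)"
    by (simp add: a_def complex_norm_square mult.commute del: of_real_power)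
  also have "(cmod a)\<^sup>2 * N = (cmod c)\<^sup>2 / N"
    using N by (simp add: a_def norm_divide power_divide power2_eq_square)
  finally have "(cmod c)\<^sup>2 / N \<le> (hnorm H x)\<^sup>2" by simp
  then have "(cmod c)\<^sup>2 \<le> (hnorm H x * hnorm H y)\<^sup>2"
    using N by (simp add: N_def field_simps power_mult_distrib)
  then show ?thesis
    using x y by (simp add: c_def)
qed

lemma hnorm_triangle:
  assumes x: "x \<in> carrier H" and y: "y \<in> carrier H"
  shows "hnorm H (x \<oplus> y) \<le> hnorm H x + hnorm H y"
proof (rule power2_le_imp_le)
  have "Re (ip H x y) \<le> hnorm H x * hnorm H y"
    using Cauchy_Schwarz[OF x y] complex_Re_le_cmod order_trans by blast
  then show "(hnorm H (x \<oplus> y))\<^sup>2 \<le> (hnorm H x + hnorm H y)\<^sup>2"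
    using x y by (simp add: ip_sub_expand power2_sum)
qed (use assms in simp)

lemma hnorm_triangle_minus:
  assumes x: "x \<in> carrier H" and y: "y \<in> carrier H"
  shows "hnorm H (x \<ominus> y) \<le> hnorm H x + hnorm H y"
proof (rule power2_le_imp_le)
  have "- Re (ip H x y) \<le> hnorm H x * hnorm H y"
    using Cauchy_Schwarz[OF x y] abs_Re_le_cmod[of "ip H x y"] by linarith
  then show "(hnorm H (x \<ominus> y))\<^sup>2 \<le> (hnorm H x + hnorm H y)\<^sup>2"
    using x y by (simp add: ip_sub_expand power2_sum)
qed (use assms in simp)

lemma hnorm_minus_commute:
  assumes x: "x \<in> carrier H" and y: "y \<in> carrier H"
  shows "hnorm H (x \<ominus> y) = hnorm H (y \<ominus> x)"
proof -
  have "(hnorm H (x \<ominus> y))\<^sup>2 = (hnorm H (y \<ominus> x))\<^sup>2"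
    using x y ip_cnj[OF x y] by (simp add: ip_sub_expand)
  then show ?thesis using x y by simp
qed

lemma diff_add_vec: 
  assumes "x \<in> carrier H" "y \<in> carrier H" "z \<in> carrier H"
  shows "x \<ominus> z = (x \<ominus> y) \<oplus> (y \<ominus> z)"
  by (rule vector_eqI) (use assms in \<open>auto simp: ip_add ip_diff\<close>)

lemma hnorm_triangle3:
  assumes "x \<in> carrier H" "y \<in> carrier H" "z \<in> carrier H"
  shows "hnorm H (x \<ominus> z) \<le> hnorm H (x \<ominus> y) + hnorm H (y \<ominus> z)"
  using hnorm_triangle[of "x \<ominus> y" "y \<ominus> z"] assms diff_add_vec[OF assms] by simp

lemma hnorm_diff_ge:
  assumes "x \<in> carrier H" "y \<in> carrier H"
  shows "\<bar>hnorm H x - hnorm H y\<bar> \<le> hnorm H (x \<ominus> y)"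
proof -
  have "x \<ominus> \<zero> = x" "y \<ominus> \<zero> = y"
    using assms by (auto intro!: vector_eqI simp: ip_diff)
  then show ?thesis
    using hnorm_triangle3[of x y \<zero>] hnorm_triangle3[of y x \<zero>] hnorm_minus_commute[of x y] assms
    by auto
qed

text \<open>The representing vector is the minimizer of \<open>\<parallel>x\<parallel>\<^sup>2 - 2 Re \<phi>(x)\<close>.  A minimizing
  sequence converges by the parallelogram law, and the first variation at the limit vanishes.\<close>

lemma Riesz_representation:
  assumes add: "\<And>x y. x \<in> carrier H \<Longrightarrow> y \<in> carrier H \<Longrightarrow> \<phi> (x \<oplus> y) = \<phi> x + \<phi> y"
    and smult: "\<And>a x. x \<in> carrier H \<Longrightarrow> \<phi> (a \<odot> x) = a * \<phi> x"
    and bound: "\<And>x. x \<in> carrier H \<Longrightarrow> cmod (\<phi> x) \<le> C * hnorm H x"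
  shows "\<exists>w\<in>carrier H. \<forall>x\<in>carrier H. \<phi> x = ip H x w"
proof -
  define J where "J x = (hnorm H x)\<^sup>2 - 2 * Re (\<phi> x)" for x
  define m where "m = (INF x\<in>carrier H. J x)"
  have lower: "- C\<^sup>2 \<le> J x" if x: "x \<in> carrier H" for x
  proof -
    have "Re (\<phi> x) \<le> C * hnorm H x"
      using bound[OF x] complex_Re_le_cmod order_trans by blast
    moreover have "0 \<le> (hnorm H x - C)\<^sup>2" by simp
    ultimately show ?thesis by (simp add: J_def power2_eq_square algebra_simps)
  qed
  have m_le: "m \<le> J x" if "x \<in> carrier H" for x
    unfolding m_def using that lower by (intro cINF_lower bdd_belowI2) auto
  have "\<exists>x\<in>carrier H. J x < m + 1 / (real n + 1)" for n
  proof (rule ccontr)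
    assume "\<not> ?thesis"
    then have "m + 1 / (real n + 1) \<le> m"
      unfolding m_def[of] by (intro cINF_greatest) (auto simp: not_less m_def)
    then show False by (smt (verit) divide_pos_pos of_nat_0_le_iff)
  qed
  then obtain X where X: "X n \<in> carrier H" "J (X n) < m + 1 / (real n + 1)" for n
    by metis
  have par: "(hnorm H (x \<ominus> y))\<^sup>2 \<le> 2 * (J x + J y - 2 * m)"
    if x: "x \<in> carrier H" and y: "y \<in> carrier H" for x y
  proof -
    define z where "z = (1/2) \<odot> (x \<oplus> y)"
    have z: "z \<in> carrier H" using x y by (simp add: z_def)
    have "(hnorm H z)\<^sup>2 = (hnorm H (x \<oplus> y))\<^sup>2 / 4"
      using x y by (simp add: z_def hnorm_smult power_divide norm_divide)
    moreover have "Re (\<phi> z) = (Re (\<phi> x) + Re (\<phi> y)) / 2"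
      using x y by (simp add: z_def smult add)
    ultimately show ?thesis
      using parallelogram[OF x y] m_le[OF z] by (simp add: J_def field_simps)
  qed
  have "\<exists>x\<in>carrier H. (\<lambda>n. hnorm H (X n \<ominus> x)) \<longlonglongrightarrow> 0"
  proof (rule complete)
    fix e :: real assume e: "e > 0"
    obtain N :: nat where N: "4 / (real N + 1) < e\<^sup>2"
      using reals_Archimedean[of "e\<^sup>2 / 4"] e by (auto simp: field_simps)
    have "hnorm H (X k \<ominus> X n) < e" if kn: "k \<ge> N" "n \<ge> N" for k n
    proof -
      have "1 / (real k + 1) \<le> 1 / (real N + 1)" "1 / (real n + 1) \<le> 1 / (real N + 1)"
        using kn by (auto intro!: divide_left_mono)
      then have "(hnorm H (X k \<ominus> X n))\<^sup>2 < e\<^sup>2"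
        using par[OF X(1)[of k] X(1)[of n]] X(2)[of k] X(2)[of n] N by simp
      then show ?thesis using e by (simp add: power2_less_imp_less)
    qed
    then show "\<exists>N. \<forall>m\<ge>N. \<forall>n\<ge>N. hnorm H (X m \<ominus> X n) < e" by blast
  qed (use X in simp)
  then obtain w where w: "w \<in> carrier H" "(\<lambda>n. hnorm H (X n \<ominus> w)) \<longlonglongrightarrow> 0" by blast
  have "\<phi> v = ip H v w" if v: "v \<in> carrier H" for v
  proof -
    define d where "d = ip H v w - \<phi> v"
    have lim: "(\<lambda>n. ip H v (X n)) \<longlonglongrightarrow> ip H v w"
    proof (rule LIM_zero_cancel, rule tendsto_norm_zero_cancel, rule Lim_null_comparison)
      show "\<forall>\<^sub>F n in sequentially. norm (norm (ip H v (X n) - ip H v w)) \<le> hnorm H v * hnorm H (X n \<ominus> w)"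
        using Cauchy_Schwarz[OF v, of "X _ \<ominus> w"] X(1) w v by (simp add: ip_diff_right)
      show "(\<lambda>n. hnorm H v * hnorm H (X n \<ominus> w)) \<longlonglongrightarrow> 0"
        using tendsto_mult_right_zero[OF w(2)] .
    qed
    have ineq: "0 \<le> 2 * Re (a * d) + (cmod a)\<^sup>2 * (hnorm H v)\<^sup>2" for a
    proof -
      have *: "- (1 / (real n + 1)) \<le> 2 * Re (a * (ip H v (X n) - \<phi> v)) + (cmod a)\<^sup>2 * (hnorm H v)\<^sup>2" for n
      proof -
        have "m \<le> J (X n \<oplus> a \<odot> v)" using X v by (intro m_le) simp
        also have "\<dots> = J (X n) + 2 * Re (cnj a * ip H (X n) v) - 2 * Re (a * \<phi> v) + (cmod a)\<^sup>2 * (hnorm H v)\<^sup>2"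
          using X(1)[of n] v
          by (simp add: J_def ip_sub_expand add smult hnorm_smult power_mult_distrib ip_smult_right)
        also have "Re (cnj a * ip H (X n) v) = Re (a * ip H v (X n))"
          using ip_cnj[OF v X(1)[of n]] by simp
        finally show ?thesis using X(2)[of n] by (simp add: algebra_simps)
      qed
      have "(\<lambda>n. 2 * Re (a * (ip H v (X n) - \<phi> v)) + (cmod a)\<^sup>2 * (hnorm H v)\<^sup>2)
          \<longlonglongrightarrow> 2 * Re (a * (ip H v w - \<phi> v)) + (cmod a)\<^sup>2 * (hnorm H v)\<^sup>2"
        by (intro tendsto_intros lim)
      moreover have "(\<lambda>n. - (1 / (real n + 1))) \<longlonglongrightarrow> - 0"
        using LIMSEQ_inverse_real_of_nat by (intro tendsto_minus) (simp add: inverse_eq_divide add.commute)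
      ultimately show ?thesis
        using LIMSEQ_le[of "\<lambda>n. - (1 / (real n + 1))" "- 0"] * by (simp add: d_def)
    qed
    have "d = 0"
    proof (rule ccontr)
      assume "d \<noteq> 0"
      (* Adding 1 keeps the denominator positive when v = 0. *)
      define V where "V = (hnorm H v)\<^sup>2 + 1"
      have V: "V > 0" by (simp add: V_def add_nonneg_pos)
      have "0 \<le> 2 * Re (- (of_real (1/V) * cnj d) * d) + (cmod (- (of_real (1/V) * cnj d)))\<^sup>2 * (hnorm H v)\<^sup>2"
        by (rule ineq)
      also have "cnj d * d = of_real ((cmod d)\<^sup>2)" by (simp add: complex_norm_square mult.commute del: of_real_power)
      then have "Re (- (of_real (1/V) * cnj d) * d) = - ((cmod d)\<^sup>2 / V)"
        by (simp add: mult.assoc)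
      also have "(cmod (- (of_real (1/V) * cnj d)))\<^sup>2 * (hnorm H v)\<^sup>2 = (cmod d)\<^sup>2 / V * ((V - 1) / V)"
      proof -
        have "(hnorm H v)\<^sup>2 = V - 1" by (simp add: V_def)
        then show ?thesis using V by (simp add: norm_mult norm_divide power_mult_distrib power_divide power2_eq_square)
      qed
      also have "2 * - ((cmod d)\<^sup>2 / V) + (cmod d)\<^sup>2 / V * ((V - 1) / V) = (cmod d)\<^sup>2 / V * (- 1 - 1 / V)"
        using V by (simp add: field_simps)
      also have "\<dots> < 0" using V \<open>d \<noteq> 0\<close> by (intro mult_pos_neg) (auto simp: field_simps)
      finally show False by simp
    qed
    then show ?thesis by (simp add: d_def)
  qed
  then show ?thesis using w(1) by blast
qed

end

section \<open>Bounded operators and their adjoints\<close>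

context hilbert_space
begin

lemma tendsto_ip:
  assumes X: "\<And>n. X n \<in> carrier H" "x \<in> carrier H" "(\<lambda>n. hnorm H (X n \<ominus> x)) \<longlonglongrightarrow> 0"
    and Y: "\<And>n. Y n \<in> carrier H" "y \<in> carrier H" "(\<lambda>n. hnorm H (Y n \<ominus> y)) \<longlonglongrightarrow> 0"
  shows "(\<lambda>n. ip H (X n) (Y n)) \<longlonglongrightarrow> ip H x y"
proof (rule LIM_zero_cancel, rule Lim_null_comparison)
  let ?b = "\<lambda>n. hnorm H (X n \<ominus> x) * (hnorm H y + hnorm H (Y n \<ominus> y)) + hnorm H x * hnorm H (Y n \<ominus> y)"
  have "norm (ip H (X n) (Y n) - ip H x y) \<le> ?b n" for n
  proof -
    have "ip H (X n) (Y n) - ip H x y = ip H (X n \<ominus> x) (Y n) + ip H x (Y n \<ominus> y)"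
      using X Y by (simp add: ip_diff ip_diff_right)
    also have "norm \<dots> \<le> hnorm H (X n \<ominus> x) * hnorm H (Y n) + hnorm H x * hnorm H (Y n \<ominus> y)"
      by (intro order_trans[OF norm_triangle_ineq] add_mono Cauchy_Schwarz) (use X Y in auto)
    also have "hnorm H (Y n) \<le> hnorm H y + hnorm H (Y n \<ominus> y)"
      using hnorm_diff_ge[of "Y n" y] Y by simp
    finally show ?thesis using X by (simp add: mult_left_mono)
  qed
  then show "\<forall>\<^sub>F n in sequentially. norm (ip H (X n) (Y n) - ip H x y) \<le> ?b n" by simp
  have "?b \<longlonglongrightarrow> 0 * (hnorm H y + 0) + hnorm H x * 0"
    by (intro tendsto_intros X Y)
  then show "?b \<longlonglongrightarrow> 0" by simp
qed

lemma op_closed: "T \<in> bounded_operators H \<Longrightarrow> x \<in> carrier H \<Longrightarrow> T x \<in> carrier H"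
  by (auto simp: bounded_operators_def)

lemma op_add:
  "\<lbrakk>T \<in> bounded_operators H; x \<in> carrier H; y \<in> carrier H\<rbrakk> \<Longrightarrow> T (x \<oplus> y) = T x \<oplus> T y"
  by (auto simp: bounded_operators_def)

lemma op_smult:
  "\<lbrakk>T \<in> bounded_operators H; x \<in> carrier H\<rbrakk> \<Longrightarrow> T (a \<odot> x) = a \<odot> T x"
  by (auto simp: bounded_operators_def)

text \<open>A positive bound is more convenient than an arbitrary one: it may be divided by.\<close>

lemma op_bound:
  assumes "T \<in> bounded_operators H"
  obtains K where "K > 0" "\<And>x. x \<in> carrier H \<Longrightarrow> hnorm H (T x) \<le> K * hnorm H x"
proof -
  obtain K where K: "\<forall>x\<in>carrier H. hnorm H (T x) \<le> K * hnorm H x"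
    using assms by (auto simp: bounded_operators_def)
  have "hnorm H (T x) \<le> (\<bar>K\<bar> + 1) * hnorm H x" if x: "x \<in> carrier H" for x
  proof -
    have "K * hnorm H x \<le> (\<bar>K\<bar> + 1) * hnorm H x"
      using x by (intro mult_right_mono) auto
    then show ?thesis using K x by fastforce
  qed
  then show ?thesis using that[of "\<bar>K\<bar> + 1"] by auto
qed

lemma op_undefined:
  "T \<in> bounded_operators H \<Longrightarrow> x \<notin> carrier H \<Longrightarrow> T x = undefined"
  by (auto simp: bounded_operators_def)

lemma op_eqI:
  assumes "S \<in> bounded_operators H" "T \<in> bounded_operators H"
    "\<And>x. x \<in> carrier H \<Longrightarrow> S x = T x"
  shows "S = T"
  using assms by (intro ext) (metis op_undefined)

lemma restrict_in_bounded_operators: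
  assumes "\<And>x. x \<in> carrier H \<Longrightarrow> t x \<in> carrier H"
    and "\<And>x y. x \<in> carrier H \<Longrightarrow> y \<in> carrier H \<Longrightarrow> t (x \<oplus> y) = t x \<oplus> t y"
    and "\<And>a x. x \<in> carrier H \<Longrightarrow> t (a \<odot> x) = a \<odot> t x"
    and "\<And>x. x \<in> carrier H \<Longrightarrow> hnorm H (t x) \<le> K * hnorm H x"
  shows "(\<lambda>x\<in>carrier H. t x) \<in> bounded_operators H"
proof -
  have "\<exists>K. \<forall>x\<in>carrier H. hnorm H (t x) \<le> K * hnorm H x" using assms(4) by blast
  then show ?thesis using assms(1-3) unfolding bounded_operators_def by simp
qed

lemma op_zero: "T \<in> bounded_operators H \<Longrightarrow> T \<zero> = \<zero>"
  using op_add[of T \<zero> \<zero>] op_closed[of T \<zero>] 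
  by (metis add.l_cancel_one zero_closed l_zero)

lemma op_diff:
  assumes "T \<in> bounded_operators H" "x \<in> carrier H" "y \<in> carrier H"
  shows "T (x \<ominus> y) = T x \<ominus> T y"
proof -
  have "x \<ominus> y = x \<oplus> (-1) \<odot> y"
    using assms by (intro vector_eqI) (auto simp: ip_diff ip_add ip_smult)
  moreover have "T x \<ominus> T y = T x \<oplus> (-1) \<odot> T y"
    using assms by (intro vector_eqI) (auto simp: ip_diff ip_add ip_smult op_closed)
  ultimately show ?thesis using assms by (simp add: op_add op_smult)
qed

lemma compose_in_bounded_operators:
  assumes S: "S \<in> bounded_operators H" and T: "T \<in> bounded_operators H"
  shows "compose (carrier H) S T \<in> bounded_operators H"
proof -
  obtain K where K: "K > 0" "\<And>x. x \<in> carrier H \<Longrightarrow> hnorm H (S x) \<le> K * hnorm H x"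
    using op_bound[OF S] by blast
  obtain L where L: "L > 0" "\<And>x. x \<in> carrier H \<Longrightarrow> hnorm H (T x) \<le> L * hnorm H x"
    using op_bound[OF T] by blast
  have "hnorm H (S (T x)) \<le> (K * L) * hnorm H x" if x: "x \<in> carrier H" for x
    using order_trans[OF K(2)[OF op_closed[OF T x]] mult_left_mono[OF L(2)[OF x], of K]] K(1)
    by (simp add: mult.assoc)
  then show ?thesis
    unfolding compose_def using S T
    by (intro restrict_in_bounded_operators) (auto simp: op_closed op_add op_smult)
qed

lemma add_in_bounded_operators:
  assumes S: "S \<in> bounded_operators H" and T: "T \<in> bounded_operators H"
  shows "(\<lambda>x\<in>carrier H. S x \<oplus> T x) \<in> bounded_operators H"
proof -
  obtain K where K: "K > 0" "\<And>x. x \<in> carrier H \<Longrightarrow> hnorm H (S x) \<le> K * hnorm H x"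
    using op_bound[OF S] by blast
  obtain L where L: "L > 0" "\<And>x. x \<in> carrier H \<Longrightarrow> hnorm H (T x) \<le> L * hnorm H x"
    using op_bound[OF T] by blast
  have "hnorm H (S x \<oplus> T x) \<le> (K + L) * hnorm H x" if x: "x \<in> carrier H" for x
    using K(2)[OF x] L(2)[OF x] hnorm_triangle[OF op_closed[OF S x] op_closed[OF T x]]
    by (simp add: algebra_simps)
  then show ?thesis
  proof (intro restrict_in_bounded_operators)
    show "S (x \<oplus> y) \<oplus> T (x \<oplus> y) = S x \<oplus> T x \<oplus> (S y \<oplus> T y)" if "x \<in> carrier H" "y \<in> carrier H" for x y
      using that S T by (intro vector_eqI) (simp_all add: op_closed op_add ip_add)
    show "S (a \<odot> x) \<oplus> T (a \<odot> x) = a \<odot> (S x \<oplus> T x)" if "x \<in> carrier H" for x a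
      using that S T by (intro vector_eqI) (simp_all add: op_closed op_smult ip_add ip_smult distrib_left)
  qed (use S T in \<open>simp_all add: op_closed\<close>)
qed

lemma smult_in_bounded_operators:
  assumes T: "T \<in> bounded_operators H"
  shows "(\<lambda>x\<in>carrier H. a \<odot> T x) \<in> bounded_operators H"
proof -
  obtain L where L: "L > 0" "\<And>x. x \<in> carrier H \<Longrightarrow> hnorm H (T x) \<le> L * hnorm H x"
    using op_bound[OF T] by blast
  have "hnorm H (a \<odot> T x) \<le> (cmod a * L) * hnorm H x" if x: "x \<in> carrier H" for x
    using mult_left_mono[OF L(2)[OF x], of "cmod a"] op_closed[OF T x]
    by (simp add: hnorm_smult mult.assoc)
  then show ?thesis
  proof (intro restrict_in_bounded_operators)
    show "a \<odot> T (x \<oplus> y) = a \<odot> T x \<oplus> a \<odot> T y" if "x \<in> carrier H" "y \<in> carrier H" for x y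
      using that T by (intro vector_eqI) (simp_all add: op_closed op_add ip_add ip_smult distrib_left)
    show "a \<odot> T (b \<odot> x) = b \<odot> (a \<odot> T x)" if "x \<in> carrier H" for x b
      using that T by (intro vector_eqI) (simp_all add: op_closed op_smult ip_smult)
  qed (use T in \<open>simp_all add: op_closed\<close>)
qed

lemma id_in_bounded_operators: "(\<lambda>x\<in>carrier H. x) \<in> bounded_operators H"
  by (rule restrict_in_bounded_operators[where K = 1]) auto

lemma zero_in_bounded_operators: "(\<lambda>x\<in>carrier H. \<zero>) \<in> bounded_operators H"
  by (rule restrict_in_bounded_operators[where K = 1])
     (auto intro!: vector_eqI simp: ip_smult)

lemma adjoint_exists:
  assumes T: "T \<in> bounded_operators H"
  shows "\<exists>S\<in>bounded_operators H. \<forall>x\<in>carrier H. \<forall>y\<in>carrier H. ip H (T x) y = ip H x (S y)"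
proof -
  obtain K where K: "K > 0" "\<And>x. x \<in> carrier H \<Longrightarrow> hnorm H (T x) \<le> K * hnorm H x"
    using op_bound[OF T] by blast
  have "\<exists>w\<in>carrier H. \<forall>x\<in>carrier H. ip H (T x) y = ip H x w" if y: "y \<in> carrier H" for y
  proof (rule Riesz_representation[where \<phi> = "\<lambda>x. ip H (T x) y"])
    show "cmod (ip H (T x) y) \<le> (K * hnorm H y) * hnorm H x" if x: "x \<in> carrier H" for x
      using Cauchy_Schwarz[OF op_closed[OF T x] y] mult_right_mono[OF K(2)[OF x] hnorm_nonneg[OF y]]
      by (simp add: mult_ac)
  qed (use T y in \<open>auto simp: op_closed op_add op_smult ip_add ip_smult\<close>)
  then obtain S where S: "S y \<in> carrier H" "ip H (T x) y = ip H x (S y)"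
    if "y \<in> carrier H" "x \<in> carrier H" for x y by metis
  have "(\<lambda>y\<in>carrier H. S y) \<in> bounded_operators H"
  proof (rule restrict_in_bounded_operators)
    fix y assume y: "y \<in> carrier H"
    show Sy: "S y \<in> carrier H" using S(1)[OF y y] .
    have "(hnorm H (S y))\<^sup>2 = Re (ip H (T (S y)) y)"
      using S(2)[OF y Sy] ip_self[OF Sy] by simp
    also have "\<dots> \<le> hnorm H (T (S y)) * hnorm H y"
      using Cauchy_Schwarz[OF op_closed[OF T Sy] y] complex_Re_le_cmod order_trans by blast
    also have "\<dots> \<le> K * hnorm H (S y) * hnorm H y"
      using K(2)[OF Sy] y by (simp add: mult_right_mono)
    finally have "hnorm H (S y) * hnorm H (S y) \<le> hnorm H (S y) * (K * hnorm H y)"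
      by (simp add: power2_eq_square algebra_simps)
    then show "hnorm H (S y) \<le> K * hnorm H y"
      using K(1) y hnorm_nonneg[OF Sy] by (cases "hnorm H (S y) = 0") auto
  next
    show "S (x \<oplus> y) = S x \<oplus> S y" if "x \<in> carrier H" "y \<in> carrier H" for x y
      using that by (intro vector_eqI_right) (simp_all add: S(1)[OF that(1,1)] S(1)[OF that(2,2)]
          S(1)[of "x \<oplus> y"] ip_add_right S(2)[OF that(1), symmetric] S(2)[OF that(2), symmetric]
          S(2)[of "x \<oplus> y", symmetric] op_closed[OF T])
    show "S (a \<odot> x) = a \<odot> S x" if "x \<in> carrier H" for x a
      using that by (intro vector_eqI_right) (simp_all add: S(1)[OF that that]
          S(1)[of "a \<odot> x"] ip_smult_right S(2)[OF that, symmetric]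
          S(2)[of "a \<odot> x", symmetric] op_closed[OF T])
  qed
  then show ?thesis using S by (intro bexI[of _ "\<lambda>y\<in>carrier H. S y"]) auto
qed

lemma adjoint_unique:
  assumes S: "S \<in> bounded_operators H"
    and "\<And>x y. x \<in> carrier H \<Longrightarrow> y \<in> carrier H \<Longrightarrow> ip H (T x) y = ip H x (S y)"
  shows "adjoint_operator H T = S"
  unfolding adjoint_operator_def
proof (rule the_equality)
  fix R assume "R \<in> bounded_operators H \<and>
     (\<forall>x\<in>carrier H. \<forall>y\<in>carrier H. ip H (T x) y = ip H x (R y))"
  then have R: "R \<in> bounded_operators H"
    "\<And>x y. x \<in> carrier H \<Longrightarrow> y \<in> carrier H \<Longrightarrow> ip H x (R y) = ip H (T x) y" by auto
  show "R = S"
  proof (rule op_eqI[OF R(1) S], rule vector_eqI_right)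
    fix y z assume "y \<in> carrier H" "z \<in> carrier H"
    then show "ip H z (R y) = ip H z (S y)" using R(2)[of z y] assms(2)[of z y] by simp
  qed (use R(1) S in \<open>simp_all add: op_closed\<close>)
qed (use assms in auto)

lemma
  assumes T: "T \<in> bounded_operators H"
  shows adjoint_in_bounded_operators: "adjoint_operator H T \<in> bounded_operators H"
    and ip_adjoint: "x \<in> carrier H \<Longrightarrow> y \<in> carrier H \<Longrightarrow>
      ip H (T x) y = ip H x (adjoint_operator H T y)"
proof -
  obtain S where S: "S \<in> bounded_operators H"
    "\<And>x y. x \<in> carrier H \<Longrightarrow> y \<in> carrier H \<Longrightarrow> ip H (T x) y = ip H x (S y)"
    using adjoint_exists[OF T] by blast
  have "adjoint_operator H T = S" using S by (rule adjoint_unique)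
  then show "adjoint_operator H T \<in> bounded_operators H"
    and "x \<in> carrier H \<Longrightarrow> y \<in> carrier H \<Longrightarrow> ip H (T x) y = ip H x (adjoint_operator H T y)"
    using S by auto
qed

lemma ip_adjoint_left:
  assumes T: "T \<in> bounded_operators H" and x: "x \<in> carrier H" and y: "y \<in> carrier H"
  shows "ip H (adjoint_operator H T x) y = ip H x (T y)"
proof -
  have "ip H (adjoint_operator H T x) y = cnj (ip H y (adjoint_operator H T x))"
    by (rule ip_cnj[OF y op_closed[OF adjoint_in_bounded_operators[OF T] x]])
  also have "\<dots> = cnj (ip H (T y) x)" by (simp only: ip_adjoint[OF T y x])
  also have "\<dots> = ip H x (T y)" by (rule ip_cnj[OF op_closed[OF T y] x, symmetric])
  finally show ?thesis .
qed

text \<open>Test the adjoint on its own values: \<open>\<parallel>S y\<parallel>\<^sup>2 = \<langle>T S y, y\<rangle>\<close>, where \<open>S\<close> is the adjoint.\<close>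

lemma adjoint_bound:
  assumes T: "T \<in> bounded_operators H" and K: "\<And>x. x \<in> carrier H \<Longrightarrow> hnorm H (T x) \<le> K * hnorm H x"
    and y: "y \<in> carrier H"
  shows "hnorm H (adjoint_operator H T y) \<le> K * hnorm H y"
proof (rule ccontr)
  define z where "z = adjoint_operator H T y"
  have z: "z \<in> carrier H" unfolding z_def by (rule op_closed[OF adjoint_in_bounded_operators[OF T] y])
  assume "\<not> ?thesis"
  then have less: "K * hnorm H y < hnorm H z" by (simp add: z_def)
  have "0 \<le> K * hnorm H y"
    using K[OF y] hnorm_nonneg[OF op_closed[OF T y]] by linarith
  with less have "hnorm H z * (K * hnorm H y) < hnorm H z * hnorm H z"
    by (intro mult_strict_left_mono) auto
  also have "hnorm H z * hnorm H z = Re (ip H z z)"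
    using ip_self[OF z] by (simp add: power2_eq_square)
  also have "ip H z z = ip H (T z) y"
    using ip_adjoint[OF T z y] by (simp only: z_def)
  also have "Re \<dots> \<le> hnorm H (T z) * hnorm H y"
    using Cauchy_Schwarz[OF op_closed[OF T z] y] complex_Re_le_cmod order_trans by blast
  also have "\<dots> \<le> (K * hnorm H z) * hnorm H y"
    by (rule mult_right_mono[OF K[OF z] hnorm_nonneg[OF y]])
  finally show False by (simp add: mult_ac)
qed

lemma adjoint_adjoint:
  "T \<in> bounded_operators H \<Longrightarrow> adjoint_operator H (adjoint_operator H T) = T"
  by (rule adjoint_unique) (auto simp: ip_adjoint_left)

lemma adjoint_compose:
  assumes "S \<in> bounded_operators H" "T \<in> bounded_operators H"
  shows "adjoint_operator H (compose (carrier H) S T) =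
    compose (carrier H) (adjoint_operator H T) (adjoint_operator H S)"
  using assms
  by (intro adjoint_unique compose_in_bounded_operators adjoint_in_bounded_operators)
     (auto simp: compose_eq ip_adjoint op_closed adjoint_in_bounded_operators)

lemma adjoint_add:
  assumes "S \<in> bounded_operators H" "T \<in> bounded_operators H"
  shows "adjoint_operator H (\<lambda>x\<in>carrier H. S x \<oplus> T x) =
    (\<lambda>x\<in>carrier H. adjoint_operator H S x \<oplus> adjoint_operator H T x)"
  using assms
  by (intro adjoint_unique add_in_bounded_operators adjoint_in_bounded_operators)
     (auto simp: ip_adjoint op_closed adjoint_in_bounded_operators ip_add ip_add_right)

lemma adjoint_smult:
  assumes "T \<in> bounded_operators H"
  shows "adjoint_operator H (\<lambda>x\<in>carrier H. a \<odot> T x) =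
    (\<lambda>x\<in>carrier H. cnj a \<odot> adjoint_operator H T x)"
  using assms
  by (intro adjoint_unique smult_in_bounded_operators adjoint_in_bounded_operators)
     (auto simp: ip_adjoint op_closed adjoint_in_bounded_operators ip_smult ip_smult_right)

lemma adjoint_id: "adjoint_operator H (\<lambda>x\<in>carrier H. x) = (\<lambda>x\<in>carrier H. x)"
  by (intro adjoint_unique id_in_bounded_operators) auto

end

context hilbert_space
begin

lemma operator_norm_bound:
  assumes T: "T \<in> bounded_operators H" and x: "x \<in> carrier H"
  shows "hnorm H (T x) \<le> operator_norm H T * hnorm H x"
proof (cases "hnorm H x = 0")
  case True
  then have "x = \<zero>" using x by (simp add: hnorm_eq_0)
  then show ?thesis by (simp add: op_zero[OF T])
next
  case False
  then have n: "hnorm H x > 0" using hnorm_nonneg[OF x] by simp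
  define y where "y = complex_of_real (1 / hnorm H x) \<odot> x"
  have y: "y \<in> carrier H" "hnorm H y = 1"
    using x n by (simp_all add: y_def hnorm_smult norm_divide)
  obtain K where K: "K > 0" "\<And>x. x \<in> carrier H \<Longrightarrow> hnorm H (T x) \<le> K * hnorm H x"
    using op_bound[OF T] by blast
  have "bdd_above ((\<lambda>x. hnorm H (T x)) ` {x \<in> carrier H. hnorm H x \<le> 1})"
  proof (rule bdd_aboveI2)
    fix z assume z: "z \<in> {x \<in> carrier H. hnorm H x \<le> 1}"
    then have "K * hnorm H z \<le> K * 1" using K(1) by (intro mult_left_mono) auto
    then show "hnorm H (T z) \<le> K" using K(2)[of z] z by simp
  qed
  then have "hnorm H (T y) \<le> operator_norm H T"
    unfolding operator_norm_def using y by (intro cSUP_upper) auto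
  moreover have "hnorm H (T y) = hnorm H (T x) / hnorm H x"
    using x n by (simp add: y_def op_smult[OF T] hnorm_smult op_closed[OF T] norm_divide)
  ultimately show ?thesis using n by (simp add: field_simps)
qed

end

section \<open>Square roots of positive operators\<close>

text \<open>The scalar iteration \<open>y \<mapsto> (1 + y\<^sup>2) / 2\<close> from \<open>0\<close>, which increases to \<open>1\<close>.  It majorizes
  the operator iteration below.\<close>

fun sqrt_bound :: "nat \<Rightarrow> real" where
  "sqrt_bound 0 = 0"
| "sqrt_bound (Suc n) = (1 + (sqrt_bound n)\<^sup>2) / 2"

lemma sqrt_bound_range: "0 \<le> sqrt_bound n \<and> sqrt_bound n \<le> 1"
proof (induction n)
  case (Suc n)
  then have "(sqrt_bound n)\<^sup>2 \<le> 1" by (simp add: power_le_one)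
  then show ?case by simp
qed simp

lemma sqrt_bound_step:
  "sqrt_bound (Suc (Suc n)) - sqrt_bound (Suc n) = (1/2) * ((sqrt_bound (Suc n))\<^sup>2 - (sqrt_bound n)\<^sup>2)"
proof -
  have *: "a - s = (1/2) * (s\<^sup>2 - r\<^sup>2)" if "a = (1 + s\<^sup>2) / 2" "s = (1 + r\<^sup>2) / 2" for a s r :: real
    using that by argo
  show ?thesis by (intro * sqrt_bound.simps(2))
qed

lemma sqrt_bound_mono: "incseq sqrt_bound"
proof (rule incseq_SucI)
  fix n
  have "0 \<le> (1 - sqrt_bound n)\<^sup>2" by simp
  then show "sqrt_bound n \<le> sqrt_bound (Suc n)"
    by (simp add: power2_eq_square algebra_simps)
qed

lemma sqrt_bound_Cauchy: "Cauchy sqrt_bound"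
  using incseq_convergent[OF sqrt_bound_mono, of 1] sqrt_bound_range
  by (metis convergent_def convergent_Cauchy)

context hilbert_space
begin

lemma tendsto_hnorm:
  assumes "\<And>n. X n \<in> carrier H" "x \<in> carrier H" "(\<lambda>n. hnorm H (X n \<ominus> x)) \<longlonglongrightarrow> 0"
  shows "(\<lambda>n. hnorm H (X n)) \<longlonglongrightarrow> hnorm H x"
proof (rule LIM_zero_cancel, rule Lim_null_comparison)
  show "\<forall>\<^sub>F n in sequentially. norm (hnorm H (X n) - hnorm H x) \<le> hnorm H (X n \<ominus> x)"
    using hnorm_diff_ge[OF assms(1,2)] by simp
qed (fact assms(3))

text \<open>Iterating \<open>Y \<mapsto> (X + Y\<^sup>2) / 2\<close> from \<open>0\<close>, the limit \<open>Z\<close> satisfies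
  \<open>(1 - Z)\<^sup>2 = 1 - X\<close>.  The same iteration for the number \<open>1\<close> in place of the contraction
  \<open>X\<close> dominates all the increments, so the convergence is uniform.\<close>

lemma contraction_sqrt:
  assumes X: "\<And>x. x \<in> carrier H \<Longrightarrow> X x \<in> carrier H"
    and X_add: "\<And>x y. x \<in> carrier H \<Longrightarrow> y \<in> carrier H \<Longrightarrow> X (x \<oplus> y) = X x \<oplus> X y"
    and X_smult: "\<And>a x. x \<in> carrier H \<Longrightarrow> X (a \<odot> x) = a \<odot> X x"
    and X_sa: "\<And>x y. x \<in> carrier H \<Longrightarrow> y \<in> carrier H \<Longrightarrow> ip H (X x) y = ip H x (X y)"
    and X_bound: "\<And>x. x \<in> carrier H \<Longrightarrow> hnorm H (X x) \<le> hnorm H x"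
  obtains Z where "\<And>x. x \<in> carrier H \<Longrightarrow> Z x \<in> carrier H"
    "\<And>x y. x \<in> carrier H \<Longrightarrow> y \<in> carrier H \<Longrightarrow> Z (x \<oplus> y) = Z x \<oplus> Z y"
    "\<And>a x. x \<in> carrier H \<Longrightarrow> Z (a \<odot> x) = a \<odot> Z x"
    "\<And>x y. x \<in> carrier H \<Longrightarrow> y \<in> carrier H \<Longrightarrow> ip H (Z x) y = ip H x (Z y)"
    "\<And>x. x \<in> carrier H \<Longrightarrow> hnorm H (Z x) \<le> hnorm H x"
    "\<And>x. x \<in> carrier H \<Longrightarrow> Z x = (1/2) \<odot> (X x \<oplus> Z (Z x))"
proof -
  define Y where "Y = rec_nat (\<lambda>x. \<zero>) (\<lambda>n Yn x. (1/2) \<odot> (X x \<oplus> Yn (Yn x)))"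
  have Y0: "Y 0 x = \<zero>" and YS: "Y (Suc n) x = (1/2) \<odot> (X x \<oplus> Y n (Y n x))" for n x
    by (simp_all add: Y_def)
  have Yc: "Y n x \<in> carrier H" if "x \<in> carrier H" for n x
    using that by (induction n arbitrary: x) (simp_all add: Y0 YS X)
  have Y_add: "Y n (x \<oplus> y) = Y n x \<oplus> Y n y" if "x \<in> carrier H" "y \<in> carrier H" for n x y
    using that
  proof (induction n arbitrary: x y)
    case (Suc n)
    then show ?case
      by (intro vector_eqI) (simp_all add: YS Yc X X_add ip_add ip_smult algebra_simps)
  qed (simp add: Y0)
  have Y_smult: "Y n (a \<odot> x) = a \<odot> Y n x" if "x \<in> carrier H" for n x a
    using that
  proof (induction n arbitrary: x)
    case 0
    then show ?case by (intro vector_eqI) (simp_all add: Y0 ip_smult)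
  next
    case (Suc n)
    then show ?case
      by (intro vector_eqI) (simp_all add: YS Yc X X_smult ip_add ip_smult algebra_simps)
  qed
  have Y_sa: "ip H (Y n x) y = ip H x (Y n y)" if "x \<in> carrier H" "y \<in> carrier H" for n x y
    using that
  proof (induction n arbitrary: x y)
    case (Suc n)
    have "ip H (Y n (Y n x)) y = ip H x (Y n (Y n y))"
      using Suc.IH[of "Y n x" y] Suc.IH[of x "Y n y"] Suc.prems Yc by simp
    then show ?case
      using Suc.prems by (simp add: YS Yc X X_sa ip_add ip_add_right ip_smult ip_smult_right)
  qed (simp add: Y0)
  have Y_diff: "Y n (x \<ominus> y) = Y n x \<ominus> Y n y" if "x \<in> carrier H" "y \<in> carrier H" for n x y
    using that by (intro vector_eqI) (simp_all add: Yc Y_sa ip_diff)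
  have Y_bound: "hnorm H (Y n x) \<le> sqrt_bound n * hnorm H x" if "x \<in> carrier H" for n x
    using that
  proof (induction n arbitrary: x)
    case (Suc n)
    have "hnorm H (Y n (Y n x)) \<le> sqrt_bound n * (sqrt_bound n * hnorm H x)"
      using order_trans[OF Suc.IH[of "Y n x"] mult_left_mono[OF Suc.IH[of x]]]
        Suc.prems Yc sqrt_bound_range[of n] by blast
    moreover have "hnorm H (X x \<oplus> Y n (Y n x)) \<le> hnorm H (X x) + hnorm H (Y n (Y n x))"
      using Suc.prems by (intro hnorm_triangle) (simp_all add: X Yc)
    ultimately show ?case
      using X_bound[OF Suc.prems] Suc.prems
      by (simp add: YS hnorm_smult X Yc norm_divide power2_eq_square algebra_simps)
  qed (simp add: Y0)
  have Y_step: "hnorm H (Y (Suc n) x \<ominus> Y n x) \<le> (sqrt_bound (Suc n) - sqrt_bound n) * hnorm H x"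
    if "x \<in> carrier H" for n x
    using that
  proof (induction n arbitrary: x)
    case 0
    have "Y (Suc 0) x \<ominus> Y 0 x = (1/2) \<odot> X x"
      using 0 by (intro vector_eqI) (simp_all add: YS Y0 ip_diff ip_smult X ip_add)
    then show ?case using X_bound[OF 0] 0 by (simp add: hnorm_smult X norm_divide)
  next
    case (Suc n)
    have factor: "(1/2) * (s * ((s - r) * h) + (s - r) * (r * h)) = (1/2) * (s\<^sup>2 - r\<^sup>2) * h"
      for s r h :: real by (simp add: power2_eq_square algebra_simps)
    let ?r = "sqrt_bound n" and ?s = "sqrt_bound (Suc n)"
    let ?d = "Y (Suc n) x \<ominus> Y n x"
    have d: "?d \<in> carrier H" using Suc.prems by (simp add: Yc)
    define u where "u = Y (Suc n) ?d"
    define v where "v = Y (Suc n) (Y n x) \<ominus> Y n (Y n x)"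
    have uv: "u \<in> carrier H" "v \<in> carrier H"
      using Suc.prems d by (simp_all add: u_def v_def Yc)
    have *: "Y (Suc (Suc n)) x \<ominus> Y (Suc n) x = (1/2) \<odot> (u \<oplus> v)"
    proof -
      have "Y (Suc (Suc n)) x = (1/2) \<odot> (X x \<oplus> Y (Suc n) (Y (Suc n) x))"
        "Y (Suc n) x = (1/2) \<odot> (X x \<oplus> Y n (Y n x))" by (rule YS)+
      moreover have "u = Y (Suc n) (Y (Suc n) x) \<ominus> Y (Suc n) (Y n x)"
        using Suc.prems by (simp add: u_def Y_diff Yc)
      ultimately show ?thesis
        using Suc.prems X Yc uv
        by (intro vector_eqI) (simp_all add: v_def ip_diff ip_add ip_smult algebra_simps)
    qed
    have hu: "hnorm H u \<le> ?s * ((?s - ?r) * hnorm H x)"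
      unfolding u_def
      using order_trans[OF Y_bound[OF d] mult_left_mono[OF Suc.IH[OF Suc.prems]]]
        sqrt_bound_range[of "Suc n"] by blast
    have hv: "hnorm H v \<le> (?s - ?r) * (?r * hnorm H x)"
      unfolding v_def
      using order_trans[OF Suc.IH[OF Yc[OF Suc.prems]] mult_left_mono[OF Y_bound[OF Suc.prems]]]
        incseq_SucD[OF sqrt_bound_mono, of n] by auto
    have "hnorm H (Y (Suc (Suc n)) x \<ominus> Y (Suc n) x) = (1/2) * hnorm H (u \<oplus> v)"
      unfolding * using uv by (simp add: hnorm_smult norm_divide)
    also have "\<dots> \<le> (1/2) * (?s * ((?s - ?r) * hnorm H x) + (?s - ?r) * (?r * hnorm H x))"
      by (intro mult_left_mono order_trans[OF hnorm_triangle[OF uv]] add_mono hu hv) simp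
    also have "\<dots> = (1/2) * (?s\<^sup>2 - ?r\<^sup>2) * hnorm H x"
      using factor[of ?s ?r "hnorm H x"] .
    also have "(1/2) * (?s\<^sup>2 - ?r\<^sup>2) = sqrt_bound (Suc (Suc n)) - sqrt_bound (Suc n)"
      by (rule sqrt_bound_step[symmetric])
    finally show ?case .
  qed
  have Y_dist: "hnorm H (Y m x \<ominus> Y n x) \<le> (sqrt_bound m - sqrt_bound n) * hnorm H x"
    if "x \<in> carrier H" "n \<le> m" for m n x
    using that(2)
  proof (induction m rule: dec_induct)
    case base
    have "Y n x \<ominus> Y n x = \<zero>" using Yc[OF that(1)] by (simp add: r_neg a_minus_def)
    then show ?case by simp
  next
    case (step m)
    have "hnorm H (Y (Suc m) x \<ominus> Y n x) \<le> hnorm H (Y (Suc m) x \<ominus> Y m x) + hnorm H (Y m x \<ominus> Y n x)"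
      using that by (intro hnorm_triangle3 Yc)
    also have "\<dots> \<le> (sqrt_bound (Suc m) - sqrt_bound m) * hnorm H x
        + (sqrt_bound m - sqrt_bound n) * hnorm H x"
      using Y_step[OF that(1)] step.IH by (intro add_mono)
    finally show ?case by (simp add: algebra_simps)
  qed
  have "\<exists>z\<in>carrier H. (\<lambda>n. hnorm H (Y n x \<ominus> z)) \<longlonglongrightarrow> 0" if x: "x \<in> carrier H" for x
  proof (rule complete)
    fix e :: real assume e: "e > 0"
    define c where "c = hnorm H x + 1"
    have c: "c > 0" "hnorm H x \<le> c" using x by (auto simp: c_def add_nonneg_pos)
    obtain N where N: "\<And>m n. m \<ge> N \<Longrightarrow> n \<ge> N \<Longrightarrow> norm (sqrt_bound m - sqrt_bound n) < e / c"
      using CauchyD[OF sqrt_bound_Cauchy, of "e / c"] e c by auto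
    have *: "hnorm H (Y m x \<ominus> Y n x) < e" if "n \<ge> N" "m \<ge> n" for m n
    proof -
      have r: "0 \<le> sqrt_bound m - sqrt_bound n"
        using sqrt_bound_mono that(2) by (simp add: incseq_def)
      have "hnorm H (Y m x \<ominus> Y n x) \<le> (sqrt_bound m - sqrt_bound n) * c"
        using order_trans[OF Y_dist[OF x that(2)] mult_left_mono[OF c(2) r]] .
      also have "\<dots> < e"
        using N[of m n] that c r by (simp add: field_simps)
      finally show ?thesis .
    qed
    have "hnorm H (Y m x \<ominus> Y n x) < e" if "n \<ge> N" "m \<ge> N" for m n
      using *[of n m] *[of m n] that hnorm_minus_commute[OF Yc[OF x] Yc[OF x], of m n]
      by (cases "m \<ge> n") auto
    then show "\<exists>N. \<forall>m\<ge>N. \<forall>n\<ge>N. hnorm H (Y m x \<ominus> Y n x) < e" by blast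
  qed (use x Yc in simp)
  then obtain Z where Z: "Z x \<in> carrier H" "(\<lambda>n. hnorm H (Y n x \<ominus> Z x)) \<longlonglongrightarrow> 0"
    if "x \<in> carrier H" for x by metis
  have lim: "(\<lambda>n. ip H (Y n x) y) \<longlonglongrightarrow> ip H (Z x) y" if "x \<in> carrier H" "y \<in> carrier H" for x y
    using tendsto_ip[OF Yc[OF that(1)] Z[OF that(1)], of "\<lambda>_. y" y] that
    by (simp add: r_neg a_minus_def)
  have Z_sa: "ip H (Z x) y = ip H x (Z y)" if x: "x \<in> carrier H" and y: "y \<in> carrier H" for x y
  proof (rule LIMSEQ_unique[OF lim[OF x y]])
    have "(\<lambda>n. cnj (ip H (Y n y) x)) \<longlonglongrightarrow> cnj (ip H (Z y) x)"
      by (intro tendsto_cnj lim y x)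
    then show "(\<lambda>n. ip H (Y n x) y) \<longlonglongrightarrow> ip H x (Z y)"
      using ip_cnj[OF Yc[OF y] x] ip_cnj[OF Z(1)[OF y] x] Y_sa[OF x y] by simp
  qed
  have ZZ: "(\<lambda>n. ip H (Y n (Y n x)) y) \<longlonglongrightarrow> ip H (Z (Z x)) y"
    if x: "x \<in> carrier H" and y: "y \<in> carrier H" for x y
    using tendsto_ip[OF Yc[OF x] Z[OF x] Yc[OF y] Z[OF y]] Y_sa[OF Yc[OF x] y] Z_sa[OF Z(1)[OF x] y]
    by simp
  show thesis
  proof (rule that[of Z])
    fix x y assume x: "x \<in> carrier H" and y: "y \<in> carrier H"
    show "Z (x \<oplus> y) = Z x \<oplus> Z y"
    proof (rule vector_eqI)
      fix w assume w: "w \<in> carrier H"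
      show "ip H (Z (x \<oplus> y)) w = ip H (Z x \<oplus> Z y) w"
        using x y w by (simp add: Z_sa ip_add Z(1))
    qed (use x y Z in auto)
  next
    fix x a assume x: "x \<in> carrier H"
    show "Z (a \<odot> x) = a \<odot> Z x"
    proof (rule vector_eqI)
      fix w assume w: "w \<in> carrier H"
      show "ip H (Z (a \<odot> x)) w = ip H (a \<odot> Z x) w"
        using x w by (simp add: Z_sa ip_smult Z(1))
    qed (use x Z in auto)
  next
    fix x assume x: "x \<in> carrier H"
    show "hnorm H (Z x) \<le> hnorm H x"
    proof (rule tendsto_upperbound[OF tendsto_hnorm[OF Yc[OF x] Z[OF x]]])
      have "hnorm H (Y n x) \<le> hnorm H x" for n
        using order_trans[OF Y_bound[OF x] mult_right_mono[of _ 1]] sqrt_bound_range x by simp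
      then show "\<forall>\<^sub>F n in sequentially. hnorm H (Y n x) \<le> hnorm H x" by simp
    qed simp
    show "Z x = (1/2) \<odot> (X x \<oplus> Z (Z x))"
    proof (rule vector_eqI)
      fix w assume w: "w \<in> carrier H"
      have "(\<lambda>n. ip H (Y (Suc n) x) w) \<longlonglongrightarrow> ip H (Z x) w"
        using LIMSEQ_Suc[OF lim[OF x w]] .
      moreover have "(\<lambda>n. (1/2) * (ip H (X x) w + ip H (Y n (Y n x)) w))
          \<longlonglongrightarrow> (1/2) * (ip H (X x) w + ip H (Z (Z x)) w)"
        by (intro tendsto_intros ZZ x w)
      moreover have "ip H (Y (Suc n) x) w = (1/2) * (ip H (X x) w + ip H (Y n (Y n x)) w)" for n
        using x w by (simp only: YS) (simp add: ip_smult ip_add X Yc)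
      ultimately have "ip H (Z x) w = (1/2) * (ip H (X x) w + ip H (Z (Z x)) w)"
        by (simp only: LIMSEQ_unique)
      then show "ip H (Z x) w = ip H ((1/2) \<odot> (X x \<oplus> Z (Z x))) w"
        using x w by (simp add: ip_smult ip_add X Z(1))
    qed (use x X Z in auto)
  qed (use Z Z_sa in auto)
qed

text \<open>After scaling, \<open>R = K (1 - X)\<close> where \<open>X\<close> is a self-adjoint contraction, and then
  \<open>\<surd>K (1 - Z)\<close> is a square root of \<open>R\<close>.  That \<open>X\<close> is a contraction amounts to
  \<open>\<parallel>R x\<parallel>\<^sup>2 \<le> K \<langle>R x, x\<rangle>\<close>, the Cauchy-Schwarz inequality for the form of \<open>R\<close>.\<close>

lemma positive_operator_is_square:
  assumes R: "R \<in> bounded_operators H"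
    and sa: "\<And>x y. x \<in> carrier H \<Longrightarrow> y \<in> carrier H \<Longrightarrow> ip H (R x) y = ip H x (R y)"
    and pos: "\<And>x. x \<in> carrier H \<Longrightarrow> 0 \<le> Re (ip H (R x) x)"
  shows "\<exists>c\<in>bounded_operators H. R = compose (carrier H) (adjoint_operator H c) c"
proof -
  obtain K where K: "K > 0" "\<And>x. x \<in> carrier H \<Longrightarrow> hnorm H (R x) \<le> K * hnorm H x"
    using op_bound[OF R] by blast
  define k where "k = complex_of_real (1 / K)"
  define X where "X x = x \<ominus> k \<odot> R x" for x
  have Rc: "R x \<in> carrier H" if "x \<in> carrier H" for x using op_closed[OF R that] .
  have form: "(hnorm H (R x))\<^sup>2 \<le> K * Re (ip H (R x) x)" if x: "x \<in> carrier H" for x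
  proof -
    define y where "y = R x"
    have y: "y \<in> carrier H" using Rc x by (simp add: y_def)
    have "0 \<le> Re (ip H (R (x \<ominus> k \<odot> y)) (x \<ominus> k \<odot> y))"
      using x y by (intro pos) simp
    also have "\<dots> = Re (ip H (R x) x) - 2 / K * (hnorm H y)\<^sup>2 + 1 / K\<^sup>2 * Re (ip H (R y) y)"
    proof -
      have "ip H (R y) x = ip H y y" using sa[OF y x] by (simp add: y_def)
      moreover have "ip H (R x) y = ip H y y" by (simp add: y_def)
      ultimately show ?thesis
        using x y Rc ip_self[OF y]
        by (simp add: op_diff[OF R] op_smult[OF R] ip_diff ip_diff_right ip_smult ip_smult_right k_def
            power2_eq_square algebra_simps)
    qed
    also have "Re (ip H (R y) y) \<le> K * (hnorm H y)\<^sup>2"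
    proof -
      have "Re (ip H (R y) y) \<le> hnorm H (R y) * hnorm H y"
        using Cauchy_Schwarz[OF Rc[OF y] y] complex_Re_le_cmod order_trans by blast
      also have "\<dots> \<le> (K * hnorm H y) * hnorm H y"
        by (rule mult_right_mono[OF K(2)[OF y] hnorm_nonneg[OF y]])
      finally show ?thesis by (simp add: power2_eq_square mult_ac)
    qed
    finally have "0 \<le> Re (ip H (R x) x) - 2 / K * (hnorm H y)\<^sup>2 + 1 / K\<^sup>2 * (K * (hnorm H y)\<^sup>2)"
      using K(1) by (simp add: divide_right_mono)
    also have "1 / K\<^sup>2 * (K * (hnorm H y)\<^sup>2) = 1 / K * (hnorm H y)\<^sup>2"
      using K(1) by (simp add: power2_eq_square)
    finally have "(hnorm H y)\<^sup>2 / K \<le> Re (ip H (R x) x)" by simp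
    then show ?thesis using K(1) by (simp add: y_def field_simps)
  qed
  obtain Z where Z: "\<And>x. x \<in> carrier H \<Longrightarrow> Z x \<in> carrier H"
    "\<And>x y. x \<in> carrier H \<Longrightarrow> y \<in> carrier H \<Longrightarrow> Z (x \<oplus> y) = Z x \<oplus> Z y"
    "\<And>a x. x \<in> carrier H \<Longrightarrow> Z (a \<odot> x) = a \<odot> Z x"
    "\<And>x y. x \<in> carrier H \<Longrightarrow> y \<in> carrier H \<Longrightarrow> ip H (Z x) y = ip H x (Z y)"
    "\<And>x. x \<in> carrier H \<Longrightarrow> hnorm H (Z x) \<le> hnorm H x"
    "\<And>x. x \<in> carrier H \<Longrightarrow> Z x = (1/2) \<odot> (X x \<oplus> Z (Z x))"
  proof (rule contraction_sqrt[of X])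
    fix x y assume x: "x \<in> carrier H" and y: "y \<in> carrier H"
    show "X (x \<oplus> y) = X x \<oplus> X y"
      using x y Rc by (intro vector_eqI) (simp_all add: X_def op_add[OF R] ip_add ip_diff ip_smult algebra_simps)
    show "ip H (X x) y = ip H x (X y)"
      using x y Rc by (simp add: X_def ip_diff ip_diff_right ip_smult ip_smult_right sa k_def)
  next
    fix x a assume x: "x \<in> carrier H"
    show "X x \<in> carrier H" using x Rc by (simp add: X_def)
    show "X (a \<odot> x) = a \<odot> X x"
      using x Rc by (intro vector_eqI) (simp_all add: X_def op_smult[OF R] ip_diff ip_smult algebra_simps)
    have "Re (ip H x (k \<odot> R x)) = Re (ip H (R x) x) / K"
      using sa[OF x x] x Rc by (simp add: ip_smult_right k_def)
    then have "(hnorm H (X x))\<^sup>2 = (hnorm H x)\<^sup>2 + (hnorm H (R x))\<^sup>2 / K\<^sup>2 - 2 * (Re (ip H (R x) x) / K)"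
      using x Rc by (simp add: X_def ip_sub_expand hnorm_smult k_def power_divide norm_divide)
    also have "(hnorm H (R x))\<^sup>2 / K\<^sup>2 \<le> (K * Re (ip H (R x) x)) / K\<^sup>2"
      using form[OF x] by (simp add: divide_right_mono)
    also have "\<dots> = Re (ip H (R x) x) / K" using K(1) by (simp add: power2_eq_square)
    finally have "(hnorm H (X x))\<^sup>2 \<le> (hnorm H x)\<^sup>2"
      using order_trans[of _ "(hnorm H x)\<^sup>2 - Re (ip H (R x) x) / K" "(hnorm H x)\<^sup>2"]
        divide_nonneg_pos[OF pos[OF x] K(1)] by simp
    then show "hnorm H (X x) \<le> hnorm H x"
      by (rule power2_le_imp_le) (simp add: x)
  qed (rule that; assumption)
  define k' where "k' = complex_of_real (sqrt K)"
  define c where "c = (\<lambda>x\<in>carrier H. k' \<odot> (x \<ominus> Z x))"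
  have c: "c \<in> bounded_operators H"
    unfolding c_def
  proof (rule restrict_in_bounded_operators)
    fix x y a assume x: "x \<in> carrier H"
    show "k' \<odot> (x \<ominus> Z x) \<in> carrier H" using x Z(1) by simp
    show "k' \<odot> (x \<oplus> y \<ominus> Z (x \<oplus> y)) = k' \<odot> (x \<ominus> Z x) \<oplus> k' \<odot> (y \<ominus> Z y)" if y: "y \<in> carrier H"
      using x y Z(1,2) by (intro vector_eqI) (simp_all add: ip_add ip_diff ip_smult algebra_simps)
    show "k' \<odot> (a \<odot> x \<ominus> Z (a \<odot> x)) = a \<odot> (k' \<odot> (x \<ominus> Z x))"
      using x Z(1,3) by (intro vector_eqI) (simp_all add: ip_diff ip_smult algebra_simps)
    have "hnorm H (k' \<odot> (x \<ominus> Z x)) = sqrt K * hnorm H (x \<ominus> Z x)"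
      using x Z(1) K(1) by (simp add: hnorm_smult k'_def)
    also have "\<dots> \<le> sqrt K * (2 * hnorm H x)"
      using hnorm_triangle_minus[OF x Z(1)[OF x]] Z(5)[OF x] K(1) by (intro mult_left_mono) auto
    finally show "hnorm H (k' \<odot> (x \<ominus> Z x)) \<le> (sqrt K * 2) * hnorm H x" by simp
  qed
  have c_sa: "ip H (c x) y = ip H x (c y)" if "x \<in> carrier H" "y \<in> carrier H" for x y
    using that Z(1,4) by (simp add: c_def ip_smult ip_smult_right ip_diff ip_diff_right k'_def)
  have "R = compose (carrier H) c c"
  proof (rule op_eqI[OF R compose_in_bounded_operators[OF c c]], rule vector_eqI)
    fix x w assume x: "x \<in> carrier H" and w: "w \<in> carrier H"
    have zx: "ip H (Z x) w = (1/2) * (ip H (X x) w + ip H (Z (Z x)) w)"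
      using x w arg_cong[OF Z(6)[OF x], of "\<lambda>v. ip H v w"] Z(1) X_def Rc
      by (simp add: ip_smult ip_add)
    have Zd: "Z (x \<ominus> Z x) = Z x \<ominus> Z (Z x)"
      using x Z(1) by (intro vector_eqI) (simp_all add: Z(4) ip_diff)
    have kk: "k' * k' = of_real K" "of_real K * k = 1"
      using K(1) by (simp_all add: k'_def k_def flip: of_real_mult)
    have "ip H (compose (carrier H) c c x) w = ip H (k' \<odot> (k' \<odot> (x \<ominus> Z x) \<ominus> Z (k' \<odot> (x \<ominus> Z x)))) w"
      using x Z(1) by (simp add: compose_eq c_def)
    also have "\<dots> = k' * k' * (ip H x w - 2 * ip H (Z x) w + ip H (Z (Z x)) w)"
      using x w Z(1) by (simp add: Z(3) Zd ip_smult ip_diff algebra_simps)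
    also have "\<dots> = of_real K * k * ip H (R x) w"
    proof -
      have "ip H x w - 2 * ip H (Z x) w + ip H (Z (Z x)) w = ip H x w - ip H (X x) w"
      proof -
        have "p - 2 * ((1/2) * (q + z)) + z = p - q" for p q z :: complex
          by (simp add: field_simps)
        then show ?thesis unfolding zx .
      qed
      also have "\<dots> = k * ip H (R x) w" using x w Rc by (simp add: X_def ip_diff ip_smult)
      finally show ?thesis by (simp only: kk(1) mult.assoc)
    qed
    finally show "ip H (R x) w = ip H (compose (carrier H) c c x) w" by (simp add: kk)
  qed (use Rc c in \<open>simp_all add: compose_eq op_closed\<close>)
  moreover have "adjoint_operator H c = c" by (rule adjoint_unique[OF c c_sa])
  ultimately show ?thesis using c by (intro bexI[of _ c]) simp_all
qed

end

section \<open>Algebras of operators and normality\<close>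

text \<open>Closure under the algebraic operations, the part of being a von Neumann algebra that the
  order and the homomorphisms refer to.\<close>

definition star_subalgebra :: "('h, 'm) hilbert_scheme \<Rightarrow> ('h \<Rightarrow> 'h) set \<Rightarrow> bool" where
  "star_subalgebra H M \<longleftrightarrow> M \<subseteq> bounded_operators H \<and> (\<lambda>x\<in>carrier H. x) \<in> M \<and>
     (\<forall>S\<in>M. \<forall>T\<in>M. compose (carrier H) S T \<in> M \<and> (\<lambda>x\<in>carrier H. S x \<oplus>\<^bsub>H\<^esub> T x) \<in> M) \<and>
     (\<forall>a. \<forall>T\<in>M. (\<lambda>x\<in>carrier H. a \<odot>\<^bsub>H\<^esub> T x) \<in> M) \<and> (\<forall>T\<in>M. adjoint_operator H T \<in> M)"

context hilbert_space
begin

lemma commutant_iff: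
  assumes "X \<subseteq> bounded_operators H"
  shows "T \<in> commutant H X \<longleftrightarrow>
    T \<in> bounded_operators H \<and> (\<forall>S\<in>X. \<forall>x\<in>carrier H. T (S x) = S (T x))"
proof -
  have "compose (carrier H) T S = compose (carrier H) S T \<longleftrightarrow> (\<forall>x\<in>carrier H. T (S x) = S (T x))"
    for S by (auto simp: compose_def fun_eq_iff restrict_def)
  then show ?thesis by (auto simp: commutant_def)
qed

lemma commutant_subset: "commutant H X \<subseteq> bounded_operators H"
  by (auto simp: commutant_def)

lemma star_subalgebra_all_operators: "star_subalgebra H (bounded_operators H)"
  unfolding star_subalgebra_def
  by (intro conjI ballI allI subset_refl id_in_bounded_operators compose_in_bounded_operators
      add_in_bounded_operators smult_in_bounded_operators adjoint_in_bounded_operators)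

lemma commutant_algebra:
  assumes X: "X \<subseteq> bounded_operators H"
  shows "(\<lambda>x\<in>carrier H. x) \<in> commutant H X"
    and "\<And>S T. S \<in> commutant H X \<Longrightarrow> T \<in> commutant H X \<Longrightarrow> compose (carrier H) S T \<in> commutant H X"
    and "\<And>S T. S \<in> commutant H X \<Longrightarrow> T \<in> commutant H X \<Longrightarrow> (\<lambda>x\<in>carrier H. S x \<oplus> T x) \<in> commutant H X"
    and "\<And>a T. T \<in> commutant H X \<Longrightarrow> (\<lambda>x\<in>carrier H. a \<odot> T x) \<in> commutant H X"
proof -
  note iff = commutant_iff[OF X]
  have c: "S x \<in> carrier H" if "S \<in> X" "x \<in> carrier H" for S x
    by (rule op_closed[OF subsetD[OF X that(1)] that(2)])
  have D: "T \<in> bounded_operators H" "R \<in> X \<Longrightarrow> x \<in> carrier H \<Longrightarrow> T (R x) = R (T x)"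
    if "T \<in> commutant H X" for T R x
    using that unfolding iff by blast+
  show "(\<lambda>x\<in>carrier H. x) \<in> commutant H X"
    unfolding iff by (intro conjI ballI id_in_bounded_operators) (simp add: c)
  show "compose (carrier H) S T \<in> commutant H X"
    if S: "S \<in> commutant H X" and T: "T \<in> commutant H X" for S T
    unfolding iff
  proof (intro conjI ballI compose_in_bounded_operators D(1)[OF S] D(1)[OF T])
    fix R x assume R: "R \<in> X" and x: "x \<in> carrier H"
    have "S (T (R x)) = R (S (T x))"
      unfolding D(2)[OF T R x] by (rule D(2)[OF S R op_closed[OF D(1)[OF T] x]])
    then show "compose (carrier H) S T (R x) = R (compose (carrier H) S T x)"
      by (simp only: compose_eq[OF x] compose_eq[OF c[OF R x]])
  qed
  show "(\<lambda>x\<in>carrier H. S x \<oplus> T x) \<in> commutant H X"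
    if S: "S \<in> commutant H X" and T: "T \<in> commutant H X" for S T
    unfolding iff
  proof (intro conjI ballI add_in_bounded_operators D(1)[OF S] D(1)[OF T])
    fix R x assume R: "R \<in> X" and x: "x \<in> carrier H"
    have "R (S x \<oplus> T x) = R (S x) \<oplus> R (T x)"
      by (intro op_add subsetD[OF X R] op_closed[OF D(1)[OF S] x] op_closed[OF D(1)[OF T] x])
    then show "(\<lambda>x\<in>carrier H. S x \<oplus> T x) (R x) = R ((\<lambda>x\<in>carrier H. S x \<oplus> T x) x)"
      by (simp only: restrict_apply' x c[OF R x] D(2)[OF S R x] D(2)[OF T R x])
  qed
  show "(\<lambda>x\<in>carrier H. a \<odot> T x) \<in> commutant H X" if T: "T \<in> commutant H X" for a T
    unfolding iff
  proof (intro conjI ballI smult_in_bounded_operators D(1)[OF T])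
    fix R x assume R: "R \<in> X" and x: "x \<in> carrier H"
    have "R (a \<odot> T x) = a \<odot> R (T x)"
      by (intro op_smult subsetD[OF X R] op_closed[OF D(1)[OF T] x])
    then show "(\<lambda>x\<in>carrier H. a \<odot> T x) (R x) = R ((\<lambda>x\<in>carrier H. a \<odot> T x) x)"
      by (simp only: restrict_apply' x c[OF R x] D(2)[OF T R x])
  qed
qed

lemma star_subalgebra_von_neumann:
  assumes "von_neumann_algebra H M"
  shows "star_subalgebra H M"
proof -
  define X where "X = commutant H M"
  have X: "X \<subseteq> bounded_operators H" by (auto simp: X_def commutant_def)
  have M: "M = commutant H X" "\<And>T. T \<in> M \<Longrightarrow> adjoint_operator H T \<in> M"
    using assms by (auto simp: X_def von_neumann_algebra_def)
  show ?thesis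
    unfolding star_subalgebra_def
  proof (intro conjI ballI allI M(2))
    show "M \<subseteq> bounded_operators H" unfolding M(1) by (rule commutant_subset)
  qed (use commutant_algebra[OF X] in \<open>simp_all add: M(1)[symmetric]\<close>)
qed

lemma abelian_group_operator_algebra:
  assumes M: "star_subalgebra H M"
  shows "abelian_group (operator_algebra H M)"
proof -
  have B: "T \<in> bounded_operators H" if "T \<in> M" for T
    using M that by (auto simp: star_subalgebra_def)
  have add: "(\<lambda>x\<in>carrier H. S x \<oplus> T x) \<in> M" if "S \<in> M" "T \<in> M" for S T
    using M that by (auto simp: star_subalgebra_def)
  have smult: "(\<lambda>x\<in>carrier H. a \<odot> T x) \<in> M" if "T \<in> M" for a T
    using M that by (auto simp: star_subalgebra_def)
  have one: "(\<lambda>x\<in>carrier H. x) \<in> M" using M by (auto simp: star_subalgebra_def)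
  have z: "0 \<odot> v = \<zero>" if "v \<in> carrier H" for v
    using that by (intro vector_eqI) (simp_all add: ip_smult)
  have zero: "(\<lambda>x\<in>carrier H. \<zero>) \<in> M"
  proof -
    have "(\<lambda>x\<in>carrier H. 0 \<odot> (\<lambda>x\<in>carrier H. x) x) = (\<lambda>x\<in>carrier H. \<zero>)"
      by (rule restrict_ext) (simp add: z)
    then show ?thesis using smult[OF one, of 0] by simp
  qed
  let ?A = "operator_algebra H M"
  have A: "carrier ?A = M" "\<zero>\<^bsub>?A\<^esub> = (\<lambda>x\<in>carrier H. \<zero>)"
    "S \<oplus>\<^bsub>?A\<^esub> T = (\<lambda>x\<in>carrier H. S x \<oplus> T x)" for S T
    by (simp_all add: operator_algebra_def)
  show ?thesis
  proof (rule abelian_groupI; unfold A)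
    fix S T assume S: "S \<in> M" and T: "T \<in> M"
    show "(\<lambda>x\<in>carrier H. S x \<oplus> T x) \<in> M" by (rule add[OF S T])
    show "(\<lambda>x\<in>carrier H. S x \<oplus> T x) = (\<lambda>x\<in>carrier H. T x \<oplus> S x)"
      using B S T by (intro restrict_ext) (simp add: a_comm op_closed)
    fix R assume R: "R \<in> M"
    show "(\<lambda>x\<in>carrier H. (\<lambda>x\<in>carrier H. S x \<oplus> T x) x \<oplus> R x) =
        (\<lambda>x\<in>carrier H. S x \<oplus> (\<lambda>x\<in>carrier H. T x \<oplus> R x) x)"
      using B S T R by (intro restrict_ext) (simp add: a_assoc op_closed)
  next
    show "(\<lambda>x\<in>carrier H. \<zero>) \<in> M" by (rule zero)
  next
    fix T assume T: "T \<in> M"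
    show "(\<lambda>x\<in>carrier H. (\<lambda>x\<in>carrier H. \<zero>) x \<oplus> T x) = T"
      using B[OF T] by (intro op_eqI add_in_bounded_operators zero_in_bounded_operators)
        (simp_all add: op_closed)
    show "\<exists>S\<in>M. (\<lambda>x\<in>carrier H. S x \<oplus> T x) = (\<lambda>x\<in>carrier H. \<zero>)"
    proof (rule bexI[OF _ smult[OF T, of "- 1"]])
      have "- 1 \<odot> v \<oplus> v = \<zero>" if "v \<in> carrier H" for v
        using that by (intro vector_eqI) (simp_all add: ip_add ip_smult)
      then show "(\<lambda>x\<in>carrier H. (\<lambda>x\<in>carrier H. - 1 \<odot> T x) x \<oplus> T x) = (\<lambda>x\<in>carrier H. \<zero>)"
        using B[OF T] by (intro restrict_ext) (simp add: op_closed)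
    qed
  qed
qed

lemma all_operators_add_apply:
  "x \<in> carrier H \<Longrightarrow> (S \<oplus>\<^bsub>operator_algebra H M\<^esub> T) x = S x \<oplus> T x"
  by (simp add: operator_algebra_def)

text \<open>On bounded operators the order by squares is the order of quadratic forms.\<close>

lemma algebra_le_all_operators_iff:
  assumes S: "S \<in> bounded_operators H" "adjoint_operator H S = S"
    and T: "T \<in> bounded_operators H" "adjoint_operator H T = T"
  shows "algebra_le (all_operators H) S T \<longleftrightarrow>
    (\<forall>x\<in>carrier H. Re (ip H (S x) x) \<le> Re (ip H (T x) x))"
proof -
  interpret A: abelian_group "all_operators H"
    by (rule abelian_group_operator_algebra[OF star_subalgebra_all_operators])
  have car: "carrier (all_operators H) = bounded_operators H" by (simp add: operator_algebra_def)
  define R where "R = T \<ominus>\<^bsub>all_operators H\<^esub> S"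
  have R: "R \<in> bounded_operators H"
    using A.minus_closed[of T S] S T car by (simp add: R_def)
  have "S \<in> carrier (all_operators H)" "T \<in> carrier (all_operators H)"
    using S T by (simp_all add: car)
  then have "T = R \<oplus>\<^bsub>all_operators H\<^esub> S"
    by (simp add: R_def a_minus_def A.a_assoc A.l_neg)
  then have RS: "T x = R x \<oplus> S x" if "x \<in> carrier H" for x
    using all_operators_add_apply[OF that] by metis
  have ipR: "ip H (R x) y = ip H (T x) y - ip H (S x) y" if "x \<in> carrier H" "y \<in> carrier H" for x y
    using that RS[OF that(1)] R S(1) by (simp add: ip_add op_closed)
  have sa: "ip H (R x) y = ip H x (R y)" if x: "x \<in> carrier H" and y: "y \<in> carrier H" for x y
  proof -
    have "ip H (T x) y = ip H x (T y)" "ip H (S x) y = ip H x (S y)"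
      using ip_adjoint[OF T(1) x y] ip_adjoint[OF S(1) x y] S T by simp_all
    moreover have "ip H x (R y) = ip H x (T y) - ip H x (S y)"
      using x y RS[OF y] R S(1) by (simp add: ip_add_right op_closed)
    ultimately show ?thesis using ipR[OF x y] by simp
  qed
  have le: "algebra_le (all_operators H) S T \<longleftrightarrow>
      (\<exists>c\<in>bounded_operators H. R = compose (carrier H) (adjoint_operator H c) c)"
    by (simp add: algebra_le_def R_def) (simp add: operator_algebra_def)
  show ?thesis
  proof
    assume "algebra_le (all_operators H) S T"
    then obtain c where c: "c \<in> bounded_operators H" "R = compose (carrier H) (adjoint_operator H c) c"
      using le by blast
    show "\<forall>x\<in>carrier H. Re (ip H (S x) x) \<le> Re (ip H (T x) x)"
    proof
      fix x assume x: "x \<in> carrier H"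
      have "ip H (R x) x = ip H (c x) (c x)"
        using x c(1) ip_adjoint_left[OF c(1) op_closed[OF c(1) x] x] by (simp add: c(2) compose_eq)
      then have "0 \<le> Re (ip H (R x) x)"
        using ip_self[OF op_closed[OF c(1) x]] by simp
      then show "Re (ip H (S x) x) \<le> Re (ip H (T x) x)" using ipR[OF x x] by simp
    qed
  next
    assume "\<forall>x\<in>carrier H. Re (ip H (S x) x) \<le> Re (ip H (T x) x)"
    then show "algebra_le (all_operators H) S T"
      unfolding le using ipR by (intro positive_operator_is_square[OF R sa]) auto
  qed
qed

text \<open>Let \<open>s\<close> be the supremum of \<open>S\<close> and \<open>T\<close> an upper bound of its image.  For \<open>x \<in> S\<close> write
  \<open>s - x = a\<^sup>* a\<close>; then \<open>\<langle>f(s) d, d\<rangle>\<close> exceeds \<open>\<langle>f(x) d, d\<rangle>\<close> by \<open>\<parallel>f(a) d\<parallel>\<^sup>2\<close>, which is at most a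
  constant times \<open>t(s - x)\<close>, and normality of \<open>t\<close> makes this arbitrarily small.  So
  \<open>\<langle>f(s) d, d\<rangle> \<le> \<langle>T d, d\<rangle>\<close> on the dense set \<open>D\<close>, hence everywhere.\<close>

lemma normal_mapI:
  assumes A: "abelian_group A"
    and f_in: "\<And>x. x \<in> carrier A \<Longrightarrow> f x \<in> bounded_operators H"
    and f_add: "\<And>x y. x \<in> carrier A \<Longrightarrow> y \<in> carrier A \<Longrightarrow> f (x \<oplus>\<^bsub>A\<^esub> y) = f x \<oplus>\<^bsub>all_operators H\<^esub> f y"
    and f_star: "\<And>x. x \<in> carrier A \<Longrightarrow> f (star A x) = adjoint_operator H (f x)"
    and f_square: "\<And>x v. x \<in> carrier A \<Longrightarrow> v \<in> carrier H \<Longrightarrow>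
      f (star A x \<otimes>\<^bsub>A\<^esub> x) v = adjoint_operator H (f x) (f x v)"
    and t_add: "\<And>x y. x \<in> carrier A \<Longrightarrow> y \<in> carrier A \<Longrightarrow> t (x \<oplus>\<^bsub>A\<^esub> y) = t x + t y"
    and t_pos: "\<And>x. x \<in> carrier A \<Longrightarrow> 0 \<le> Re (t (star A x \<otimes>\<^bsub>A\<^esub> x))"
    and t_normal: "normal_functional A t"
    and D: "D \<subseteq> carrier H" "\<And>v e. v \<in> carrier H \<Longrightarrow> e > 0 \<Longrightarrow> \<exists>d\<in>D. hnorm H (d \<ominus> v) < e"
    and bound: "\<And>d. d \<in> D \<Longrightarrow>
      \<exists>C. \<forall>a\<in>carrier A. hnorm H (f a d) \<le> C * sqrt (Re (t (star A a \<otimes>\<^bsub>A\<^esub> a)))"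
  shows "normal_map A (all_operators H) f"
  unfolding normal_map_def
proof (intro allI impI, elim conjE)
  fix S s assume dir: "directed A S" and sup: "is_supremum A S s"
  interpret A: abelian_group A by (rule A)
  have S: "S \<noteq> {}" "\<And>x. x \<in> S \<Longrightarrow> x \<in> carrier A \<and> star A x = x"
    using dir by (auto simp: directed_def self_adjoint_def)
  have s: "s \<in> carrier A" "star A s = s" "\<And>x. x \<in> S \<Longrightarrow> algebra_le A x s"
    using sup by (auto simp: is_supremum_def self_adjoint_def)
  have sa: "adjoint_operator H (f x) = f x" if "x \<in> S \<or> x = s" for x
    using that S(2) s f_star by metis
  have split: "\<exists>a\<in>carrier A. t s = t x + t (star A a \<otimes>\<^bsub>A\<^esub> a) \<and>
      (\<forall>v\<in>carrier H. ip H (f s v) v = ip H (f x v) v + of_real ((hnorm H (f a v))\<^sup>2))"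
    if x: "x \<in> S" for x
  proof -
    obtain a where a: "a \<in> carrier A" "s \<ominus>\<^bsub>A\<^esub> x = star A a \<otimes>\<^bsub>A\<^esub> a"
      using s(3)[OF x] by (auto simp: algebra_le_def)
    have xc: "x \<in> carrier A" using S(2) x by blast
    define q where "q = star A a \<otimes>\<^bsub>A\<^esub> a"
    have q: "q \<in> carrier A" using a A.minus_closed[OF s(1) xc] by (simp add: q_def)
    have sq: "s = x \<oplus>\<^bsub>A\<^esub> q"
    proof -
      have "s = (s \<ominus>\<^bsub>A\<^esub> x) \<oplus>\<^bsub>A\<^esub> x"
        using s(1) xc by (simp add: a_minus_def A.a_assoc A.l_neg)
      also have "s \<ominus>\<^bsub>A\<^esub> x = q" by (simp only: a(2) q_def)
      finally show ?thesis using A.a_comm[OF q xc] by simp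
    qed
    have "ip H (f s v) v = ip H (f x v) v + of_real ((hnorm H (f a v))\<^sup>2)" if v: "v \<in> carrier H" for v
    proof -
      have "f s v = f x v \<oplus> f q v"
        unfolding sq f_add[OF xc q] by (rule all_operators_add_apply[OF v])
      moreover have "ip H (f q v) v = of_real ((hnorm H (f a v))\<^sup>2)"
      proof -
        have fav: "f a v \<in> carrier H" by (rule op_closed[OF f_in[OF a(1)] v])
        show ?thesis
          unfolding q_def f_square[OF a(1) v] ip_adjoint_left[OF f_in[OF a(1)] fav v]
          by (rule ip_self[OF fav])
      qed
      ultimately show ?thesis
        using v f_in[OF xc] f_in[OF q] by (simp add: ip_add op_closed)
    qed
    moreover have "t s = t x + t q" unfolding sq by (rule t_add[OF xc q])
    ultimately show ?thesis using a(1) by (auto simp: q_def)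
  qed
  note le_iff = algebra_le_all_operators_iff
  show "is_supremum (all_operators H) (f ` S) (f s)"
    unfolding is_supremum_def
  proof (intro conjI ballI impI)
    show "f s \<in> self_adjoint (all_operators H)"
      using f_in[OF s(1)] sa[of s] by (simp add: self_adjoint_def operator_algebra_def)
  next
    fix y assume "y \<in> f ` S"
    then obtain x where x: "x \<in> S" "y = f x" by blast
    show "algebra_le (all_operators H) y (f s)"
      unfolding x(2)
    proof (subst le_iff)
      show "\<forall>v\<in>carrier H. Re (ip H (f x v) v) \<le> Re (ip H (f s v) v)"
        using split[OF x(1)] by auto
    qed (use S(2) x s f_in sa in auto)
  next
    fix T assume "T \<in> self_adjoint (all_operators H)"
      and ub: "\<forall>y\<in>f ` S. algebra_le (all_operators H) y T"
    then have T: "T \<in> bounded_operators H" "adjoint_operator H T = T"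
      by (auto simp: self_adjoint_def operator_algebra_def)
    have ub': "Re (ip H (f x v) v) \<le> Re (ip H (T v) v)" if "x \<in> S" "v \<in> carrier H" for x v
    proof -
      have "algebra_le (all_operators H) (f x) T" using ub that by blast
      then show ?thesis using le_iff[OF _ _ T, of "f x"] that S(2) f_in sa by auto
    qed
    have onD: "Re (ip H (f s d) d) \<le> Re (ip H (T d) d)" if d: "d \<in> D" for d
    proof (rule field_le_epsilon)
      fix e :: real assume e: "e > 0"
      obtain C where C: "\<And>a. a \<in> carrier A \<Longrightarrow> hnorm H (f a d) \<le> C * sqrt (Re (t (star A a \<otimes>\<^bsub>A\<^esub> a)))"
        using bound[OF d] by blast
      have dc: "d \<in> carrier H" using D d by blast
      define e' where "e' = e / (C\<^sup>2 + 1)"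
      have C1: "C\<^sup>2 + 1 > 0" by (simp add: add_nonneg_pos)
      have e': "e' > 0" using e C1 by (simp add: e'_def)
      have "Re (t s) = (SUP x\<in>S. Re (t x))"
        using t_normal dir sup by (auto simp: normal_functional_def)
      moreover have "bdd_above ((\<lambda>x. Re (t x)) ` S)"
      proof (rule bdd_aboveI2)
        show "Re (t x) \<le> Re (t s)" if "x \<in> S" for x
          using split[OF that] t_pos by fastforce
      qed
      ultimately have "\<exists>x\<in>S. Re (t s) - e' < Re (t x)"
        using less_cSUP_iff[OF S(1), of "\<lambda>x. Re (t x)" "Re (t s) - e'"] e' by simp
      then obtain x where x: "x \<in> S" "Re (t s) - e' < Re (t x)" by blast
      obtain a where a: "a \<in> carrier A" "t s = t x + t (star A a \<otimes>\<^bsub>A\<^esub> a)"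
        "ip H (f s d) d = ip H (f x d) d + of_real ((hnorm H (f a d))\<^sup>2)"
        using split[OF x(1)] dc by blast
      have ta: "0 \<le> Re (t (star A a \<otimes>\<^bsub>A\<^esub> a))" "Re (t (star A a \<otimes>\<^bsub>A\<^esub> a)) < e'"
        using t_pos[OF a(1)] a(2) x(2) by auto
      have "(hnorm H (f a d))\<^sup>2 \<le> (C * sqrt (Re (t (star A a \<otimes>\<^bsub>A\<^esub> a))))\<^sup>2"
        using C[OF a(1)] hnorm_nonneg[OF op_closed[OF f_in[OF a(1)] dc]] by (rule power_mono)
      also have "\<dots> = C\<^sup>2 * Re (t (star A a \<otimes>\<^bsub>A\<^esub> a))"
        using ta by (simp add: power_mult_distrib)
      also have "\<dots> \<le> C\<^sup>2 * e'" using ta by (intro mult_left_mono) auto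
      also have "\<dots> \<le> (C\<^sup>2 + 1) * e'" using e' by simp
      also have "\<dots> = e" using C1 by (simp add: e'_def)
      finally show "Re (ip H (f s d) d) \<le> Re (ip H (T d) d) + e"
        using ub'[OF x(1) dc] a(3) by simp
    qed
    show "algebra_le (all_operators H) (f s) T"
    proof (subst le_iff)
      show "\<forall>v\<in>carrier H. Re (ip H (f s v) v) \<le> Re (ip H (T v) v)"
      proof
        fix v assume v: "v \<in> carrier H"
        have "\<forall>n. \<exists>d\<in>D. hnorm H (d \<ominus> v) < 1 / (real n + 1)"
          using D(2)[OF v] by simp
        then obtain d where d: "\<And>n. d n \<in> D" "\<And>n. hnorm H (d n \<ominus> v) < 1 / (real n + 1)" by metis
        have dc: "d n \<in> carrier H" for n using d D by blast
        have lim: "(\<lambda>n. hnorm H (d n \<ominus> v)) \<longlonglongrightarrow> 0"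
        proof (rule Lim_null_comparison)
          show "\<forall>\<^sub>F n in sequentially. norm (hnorm H (d n \<ominus> v)) \<le> 1 / (real n + 1)"
            using less_imp_le[OF d(2)] dc v by simp
          show "(\<lambda>n. 1 / (real n + 1)) \<longlonglongrightarrow> 0"
            using LIMSEQ_inverse_real_of_nat by (simp add: inverse_eq_divide add.commute)
        qed
        have op_lim: "(\<lambda>n. ip H (R (d n)) (d n)) \<longlonglongrightarrow> ip H (R v) v"
          if R: "R \<in> bounded_operators H" for R
        proof (rule tendsto_ip)
          obtain K where K: "K > 0" "\<And>x. x \<in> carrier H \<Longrightarrow> hnorm H (R x) \<le> K * hnorm H x"
            using op_bound[OF R] by blast
          show "(\<lambda>n. hnorm H (R (d n) \<ominus> R v)) \<longlonglongrightarrow> 0"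
          proof (rule Lim_null_comparison)
            show "\<forall>\<^sub>F n in sequentially. norm (hnorm H (R (d n) \<ominus> R v)) \<le> K * hnorm H (d n \<ominus> v)"
              using K(2)[of "d _ \<ominus> v"] dc v R by (simp add: op_diff[symmetric] op_closed)
            show "(\<lambda>n. K * hnorm H (d n \<ominus> v)) \<longlonglongrightarrow> 0"
              using tendsto_mult_right_zero[OF lim] .
          qed
        qed (use dc v lim op_closed[OF R dc] op_closed[OF R v] in simp_all)
        show "Re (ip H (f s v) v) \<le> Re (ip H (T v) v)"
          using LIMSEQ_le[OF tendsto_Re[OF op_lim[OF f_in[OF s(1)]]] tendsto_Re[OF op_lim[OF T(1)]]]
            onD[OF d(1)] by blast
      qed
    qed (use T s f_in sa in auto)
  qed
qed

end

section \<open>The regular representations of a group\<close>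

lemma ell2_zero: "\<zero>\<^bsub>ell2 S\<^esub> = (\<lambda>x. 0)"
  and ell2_add: "f \<oplus>\<^bsub>ell2 S\<^esub> g = (\<lambda>x. f x + g x)"
  and ell2_smult: "a \<odot>\<^bsub>ell2 S\<^esub> f = (\<lambda>x. a * f x)"
  and ell2_ip: "ip (ell2 S) f g = (\<Sum>\<^sub>\<infinity>x\<in>S. f x * cnj (g x))"
  by (simp_all add: ell2_def)

lemma ell2_reindex:
  assumes p: "bij_betw p S S" and f: "f \<in> carrier (ell2 S)"
  shows "(\<lambda>x. if x \<in> S then f (p x) else 0) \<in> carrier (ell2 S)"
proof -
  have "(\<lambda>x. (cmod (f (p x)))\<^sup>2) summable_on S"
    using f summable_on_reindex_bij_betw[OF p, of "\<lambda>x. (cmod (f x))\<^sup>2"] by (simp add: ell2_carrier)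
  then show ?thesis by (simp add: ell2_carrier cong: summable_on_cong)
qed

lemma ell2_reindex_ip:
  assumes p: "bij_betw p S S"
  shows "ip (ell2 S) (\<lambda>x. if x \<in> S then f (p x) else 0) (\<lambda>x. if x \<in> S then g (p x) else 0)
    = ip (ell2 S) f g"
  using infsum_reindex_bij_betw[OF p, of "\<lambda>x. f x * cnj (g x)"]
  by (simp add: ell2_ip cong: infsum_cong)

lemma ell2_cnj:
  "f \<in> carrier (ell2 S) \<Longrightarrow> (\<lambda>x. cnj (f x)) \<in> carrier (ell2 S)"
  by (auto simp: ell2_carrier)

lemma ell2_cnj_ip: "ip (ell2 S) (\<lambda>x. cnj (f x)) (\<lambda>x. cnj (g x)) = cnj (ip (ell2 S) f g)"
  by (simp add: ell2_ip infsum_cnj[symmetric])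

definition delta :: "'g \<Rightarrow> 'g \<Rightarrow> complex" where
  "delta h = (\<lambda>x. if x = h then 1 else 0)"

lemma delta_in: "h \<in> S \<Longrightarrow> delta h \<in> carrier (ell2 S)"
proof -
  assume h: "h \<in> S"
  have "(\<lambda>x. (cmod (delta h x))\<^sup>2) summable_on S"
    using summable_on_cong_neutral[of "{h}" S "\<lambda>x. (cmod (delta h x))\<^sup>2" "\<lambda>x. (cmod (delta h x))\<^sup>2"] h
    by (auto simp: delta_def)
  then show ?thesis using h by (auto simp: ell2_carrier delta_def)
qed

lemma ip_delta: 
  assumes "h \<in> S" shows "ip (ell2 S) f (delta h) = f h"
proof -
  have "(\<Sum>\<^sub>\<infinity>x\<in>S. f x * cnj (delta h x)) = (\<Sum>\<^sub>\<infinity>x\<in>{h}. f x * cnj (delta h x))"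
    by (rule infsum_cong_neutral) (use assms in \<open>auto simp: delta_def\<close>)
  then show ?thesis by (simp add: ell2_ip delta_def)
qed

text \<open>A locale of its own, so that the names below do not enter the additive groups of rings and
  modules, which are also instances of the locale of groups.\<close>

locale group_l2 = group
begin

abbreviation L2 :: "('a \<Rightarrow> complex) hilbert" where "L2 \<equiv> ell2 (carrier G)"

definition rtrans :: "'a \<Rightarrow> ('a \<Rightarrow> complex) \<Rightarrow> 'a \<Rightarrow> complex" where
  "rtrans g f = (\<lambda>h. if h \<in> carrier G then f (h \<otimes> g) else 0)"

definition ltrans :: "'a \<Rightarrow> ('a \<Rightarrow> complex) \<Rightarrow> 'a \<Rightarrow> complex" where
  "ltrans g f = (\<lambda>h. if h \<in> carrier G then f (inv g \<otimes> h) else 0)"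

text \<open>The modular conjugation \<open>J\<close> of the left regular representation.\<close>

definition conj_inv :: "('a \<Rightarrow> complex) \<Rightarrow> 'a \<Rightarrow> complex" where
  "conj_inv f = (\<lambda>h. if h \<in> carrier G then cnj (f (inv h)) else 0)"

definition twist :: "('a \<Rightarrow> complex) \<Rightarrow> ('a \<Rightarrow> complex) \<Rightarrow> 'a \<Rightarrow> complex" where
  "twist \<omega> f = (\<lambda>h. \<omega> h * f h)"

lemma left_translation_apply: "f \<in> carrier L2 \<Longrightarrow> left_translation G g f = ltrans g f"
  by (simp add: left_translation_def ltrans_def)

lemma bij_rtrans: "g \<in> carrier G \<Longrightarrow> bij_betw (\<lambda>h. h \<otimes> g) (carrier G) (carrier G)"
  by (rule bij_betw_byWitness[of _ "\<lambda>h. h \<otimes> inv g"]) (auto simp: m_assoc)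

lemma bij_ltrans: "g \<in> carrier G \<Longrightarrow> bij_betw (\<lambda>h. g \<otimes> h) (carrier G) (carrier G)"
  by (rule bij_betw_byWitness[of _ "\<lambda>h. inv g \<otimes> h"]) (auto simp: m_assoc[symmetric])

lemma bij_inv: "bij_betw (\<lambda>h. inv h) (carrier G) (carrier G)"
  by (rule bij_betw_byWitness[of _ "\<lambda>h. inv h"]) auto

lemma rtrans_in: "g \<in> carrier G \<Longrightarrow> f \<in> carrier L2 \<Longrightarrow> rtrans g f \<in> carrier L2"
  unfolding rtrans_def by (rule ell2_reindex[OF bij_rtrans])

lemma ltrans_in: "g \<in> carrier G \<Longrightarrow> f \<in> carrier L2 \<Longrightarrow> ltrans g f \<in> carrier L2"
  unfolding ltrans_def by (rule ell2_reindex[OF bij_ltrans]) auto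

lemma rtrans_ip: "g \<in> carrier G \<Longrightarrow> ip L2 (rtrans g f) (rtrans g f') = ip L2 f f'"
  unfolding rtrans_def by (rule ell2_reindex_ip[OF bij_rtrans])

lemma ltrans_ip: "g \<in> carrier G \<Longrightarrow> ip L2 (ltrans g f) (ltrans g f') = ip L2 f f'"
  unfolding ltrans_def by (rule ell2_reindex_ip[OF bij_ltrans]) auto

lemma ell2_eqI:
  "\<lbrakk>f \<in> carrier L2; f' \<in> carrier L2; \<And>h. h \<in> carrier G \<Longrightarrow> f h = f' h\<rbrakk> \<Longrightarrow> f = f'"
  unfolding ell2_carrier by (intro ext) metis

lemma rtrans_inv: "g \<in> carrier G \<Longrightarrow> f \<in> carrier L2 \<Longrightarrow> rtrans (inv g) (rtrans g f) = f"
  by (auto simp: rtrans_def fun_eq_iff m_assoc ell2_carrier)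

lemma ltrans_inv: "g \<in> carrier G \<Longrightarrow> f \<in> carrier L2 \<Longrightarrow> ltrans (inv g) (ltrans g f) = f"
  by (auto simp: ltrans_def fun_eq_iff m_assoc[symmetric] ell2_carrier)

lemma rtrans_ip_adjoint:
  assumes "g \<in> carrier G" "f \<in> carrier L2"
  shows "ip L2 (rtrans g f) f' = ip L2 f (rtrans (inv g) f')"
  using rtrans_ip[of "inv g" "rtrans g f" f'] assms by (simp add: rtrans_inv)

lemma ltrans_ip_adjoint:
  assumes "g \<in> carrier G" "f \<in> carrier L2"
  shows "ip L2 (ltrans g f) f' = ip L2 f (ltrans (inv g) f')"
  using ltrans_ip[of "inv g" "ltrans g f" f'] assms by (simp add: ltrans_inv)

lemma conj_inv_in: "f \<in> carrier L2 \<Longrightarrow> conj_inv f \<in> carrier L2"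
  unfolding conj_inv_def using ell2_reindex[OF bij_inv ell2_cnj] .

lemma conj_inv_ip: "ip L2 (conj_inv f) (conj_inv f') = cnj (ip L2 f f')"
  using ell2_reindex_ip[OF bij_inv, of "\<lambda>x. cnj (f x)" "\<lambda>x. cnj (f' x)"]
  by (simp add: conj_inv_def ell2_cnj_ip)

lemma conj_inv_conj_inv: "f \<in> carrier L2 \<Longrightarrow> conj_inv (conj_inv f) = f"
  by (auto simp: conj_inv_def fun_eq_iff ell2_carrier)

lemma conj_inv_add: "conj_inv (\<lambda>x. f x + g x) = (\<lambda>x. conj_inv f x + conj_inv g x)"
  and conj_inv_smult: "conj_inv (\<lambda>x. a * f x) = (\<lambda>x. cnj a * conj_inv f x)"
  by (auto simp: conj_inv_def fun_eq_iff)

lemma conj_inv_ltrans: "g \<in> carrier G \<Longrightarrow> conj_inv (ltrans g f) = rtrans g (conj_inv f)"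
  by (auto simp: conj_inv_def ltrans_def rtrans_def fun_eq_iff inv_mult_group)

lemma conj_inv_rtrans: "g \<in> carrier G \<Longrightarrow> conj_inv (rtrans g f) = ltrans g (conj_inv f)"
  by (auto simp: conj_inv_def ltrans_def rtrans_def fun_eq_iff inv_mult_group)

lemma conj_inv_delta: "conj_inv (delta \<one>) = delta \<one>"
  by (auto simp: conj_inv_def delta_def fun_eq_iff inv_eq_1_iff)

definition unit_character :: "('a \<Rightarrow> complex) \<Rightarrow> bool" where
  "unit_character \<omega> \<longleftrightarrow> (\<forall>g\<in>carrier G. \<forall>h\<in>carrier G. \<omega> (g \<otimes> h) = \<omega> g * \<omega> h) \<and>
     (\<forall>g\<in>carrier G. cmod (\<omega> g) = 1)"

lemma unit_characterD:
  assumes "unit_character \<omega>"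
  shows "g \<in> carrier G \<Longrightarrow> h \<in> carrier G \<Longrightarrow> \<omega> (g \<otimes> h) = \<omega> g * \<omega> h"
    and "g \<in> carrier G \<Longrightarrow> \<omega> g * cnj (\<omega> g) = 1"
    and "g \<in> carrier G \<Longrightarrow> cmod (\<omega> g) = 1"
    and "\<omega> \<one> = 1"
    and "g \<in> carrier G \<Longrightarrow> \<omega> (inv g) = cnj (\<omega> g)"
proof -
  show mult: "g \<in> carrier G \<Longrightarrow> h \<in> carrier G \<Longrightarrow> \<omega> (g \<otimes> h) = \<omega> g * \<omega> h" for g h
    using assms by (simp add: unit_character_def)
  show norm: "g \<in> carrier G \<Longrightarrow> cmod (\<omega> g) = 1" for g
    using assms by (simp add: unit_character_def)
  then show cnj: "g \<in> carrier G \<Longrightarrow> \<omega> g * cnj (\<omega> g) = 1" for g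
    by (simp add: complex_norm_square[symmetric] del: of_real_power)
  have "\<omega> \<one> * \<omega> \<one> = \<omega> \<one>" using mult[of \<one> \<one>] by simp
  moreover have "\<omega> \<one> \<noteq> 0" using norm[of \<one>] by auto
  ultimately show one: "\<omega> \<one> = 1" by simp
  show "\<omega> (inv g) = cnj (\<omega> g)" if g: "g \<in> carrier G"
  proof -
    have "\<omega> g * \<omega> (inv g) = \<omega> g * cnj (\<omega> g)" using mult[of g "inv g"] g cnj[OF g] one by simp
    moreover have "\<omega> g \<noteq> 0" using norm[OF g] by auto
    ultimately show ?thesis by simp
  qed
qed

lemma unit_character_cnj: "unit_character \<omega> \<Longrightarrow> unit_character (\<lambda>g. cnj (\<omega> g))"
  by (simp add: unit_character_def)

lemma twist_in:
  assumes "unit_character \<omega>" "f \<in> carrier L2"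
  shows "twist \<omega> f \<in> carrier L2"
proof -
  have "(\<lambda>h. (cmod (twist \<omega> f h))\<^sup>2) summable_on carrier G \<longleftrightarrow> (\<lambda>h. (cmod (f h))\<^sup>2) summable_on carrier G"
    by (rule summable_on_cong) (simp add: twist_def norm_mult unit_characterD(3)[OF assms(1)])
  then show ?thesis using assms by (auto simp: ell2_carrier twist_def)
qed

lemma twist_ip:
  assumes "unit_character \<omega>"
  shows "ip L2 (twist \<omega> f) (twist \<omega> f') = ip L2 f f'"
  unfolding ell2_ip
proof (rule infsum_cong)
  fix h assume h: "h \<in> carrier G"
  have "twist \<omega> f h * cnj (twist \<omega> f' h) = (\<omega> h * cnj (\<omega> h)) * (f h * cnj (f' h))"
    by (simp add: twist_def)
  then show "twist \<omega> f h * cnj (twist \<omega> f' h) = f h * cnj (f' h)"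
    by (simp only: unit_characterD(2)[OF assms h] mult_1)
qed

lemma twist_ip_adjoint:
  "ip L2 (twist \<omega> f) f' = ip L2 f (twist (\<lambda>g. cnj (\<omega> g)) f')"
  unfolding ell2_ip by (rule infsum_cong) (simp add: twist_def)

lemma twist_twist_cnj:
  assumes "unit_character \<omega>" "f \<in> carrier L2"
  shows "twist \<omega> (twist (\<lambda>g. cnj (\<omega> g)) f) = f" "twist (\<lambda>g. cnj (\<omega> g)) (twist \<omega> f) = f"
proof -
  have *: "\<omega> h * (cnj (\<omega> h) * f h) = f h" for h
    using unit_characterD(2)[OF assms(1), of h] assms(2)
    by (cases "h \<in> carrier G") (auto simp: ell2_carrier mult.assoc[symmetric])
  show "twist \<omega> (twist (\<lambda>g. cnj (\<omega> g)) f) = f"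
    unfolding twist_def by (intro ext *)
  show "twist (\<lambda>g. cnj (\<omega> g)) (twist \<omega> f) = f"
    unfolding twist_def by (intro ext) (simp only: mult.left_commute[of "cnj _"] *)
qed

lemma twist_add: "twist \<omega> (\<lambda>x. f x + g x) = (\<lambda>x. twist \<omega> f x + twist \<omega> g x)"
  and twist_smult: "twist \<omega> (\<lambda>x. a * f x) = (\<lambda>x. a * twist \<omega> f x)"
  by (auto simp: twist_def fun_eq_iff algebra_simps)

lemma twist_ltrans:
  assumes "unit_character \<omega>" "g \<in> carrier G"
  shows "twist \<omega> (ltrans g f) = (\<lambda>x. \<omega> g * ltrans g (twist \<omega> f) x)"
proof
  fix h
  show "twist \<omega> (ltrans g f) h = \<omega> g * ltrans g (twist \<omega> f) h"
  proof (cases "h \<in> carrier G")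
    case True
    have "\<omega> h = \<omega> g * \<omega> (inv g \<otimes> h)"
      using True assms(2) unit_characterD(1)[OF assms(1), of g "inv g \<otimes> h"]
      by (simp add: m_assoc[symmetric])
    then show ?thesis using True by (simp add: twist_def ltrans_def)
  qed (simp add: twist_def ltrans_def)
qed

lemma twist_delta: "unit_character \<omega> \<Longrightarrow> twist \<omega> (delta \<one>) = delta \<one>"
  by (auto simp: twist_def delta_def fun_eq_iff unit_characterD)

definition right_invariant :: "(('a \<Rightarrow> complex) \<Rightarrow> 'a \<Rightarrow> complex) \<Rightarrow> bool" where
  "right_invariant T \<longleftrightarrow> T \<in> bounded_operators L2 \<and>
     (\<forall>g\<in>carrier G. \<forall>f\<in>carrier L2. T (rtrans g f) = rtrans g (T f))"

text \<open>The right action of \<open>T\<^sup>*\<close>, conjugated by the diagonal unitary of \<open>\<omega>\<close>.  As \<open>J\<close> commutes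
  with that unitary, this is right multiplication by the image of \<open>T\<^sup>*\<close> under the automorphism
  that belongs to \<open>\<omega>\<close>.  It is antilinear in \<open>T\<close> and preserves products.\<close>

definition twisted_right ::
  "('a \<Rightarrow> complex) \<Rightarrow> (('a \<Rightarrow> complex) \<Rightarrow> 'a \<Rightarrow> complex) \<Rightarrow> ('a \<Rightarrow> complex) \<Rightarrow> 'a \<Rightarrow> complex" where
  "twisted_right \<omega> T f = twist \<omega> (conj_inv (T (conj_inv (twist (\<lambda>g. cnj (\<omega> g)) f))))"

abbreviation vN :: "(('a \<Rightarrow> complex) \<Rightarrow> 'a \<Rightarrow> complex) set" where
  "vN \<equiv> carrier (group_vN_algebra G)"

interpretation L2: hilbert_space L2 by (rule hilbert_space_ell2)

lemma vN_eq: "vN = commutant L2 (commutant L2 (left_translation G ` carrier G))"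
  by (simp add: group_vN_algebra_def operator_algebra_def Let_def)

lemma left_translation_bounded: "g \<in> carrier G \<Longrightarrow> left_translation G g \<in> bounded_operators L2"
proof -
  assume g: "g \<in> carrier G"
  have "(\<lambda>f\<in>carrier L2. ltrans g f) \<in> bounded_operators L2"
  proof (rule L2.restrict_in_bounded_operators)
    fix f assume f: "f \<in> carrier L2"
    show "ltrans g f \<in> carrier L2" by (rule ltrans_in[OF g f])
    show "hnorm L2 (ltrans g f) \<le> 1 * hnorm L2 f" by (simp add: hnorm_def ltrans_ip[OF g])
  qed (auto simp: ltrans_def ell2_add ell2_smult fun_eq_iff)
  moreover have "(\<lambda>f\<in>carrier L2. ltrans g f) = left_translation G g"
    unfolding left_translation_def ltrans_def ..
  ultimately show ?thesis by simp
qed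

lemma rtrans_bounded: "g \<in> carrier G \<Longrightarrow> (\<lambda>f\<in>carrier L2. rtrans g f) \<in> bounded_operators L2"
proof (rule L2.restrict_in_bounded_operators)
  fix f assume g: "g \<in> carrier G" and f: "f \<in> carrier L2"
  show "rtrans g f \<in> carrier L2" by (rule rtrans_in[OF g f])
  show "hnorm L2 (rtrans g f) \<le> 1 * hnorm L2 f" by (simp add: hnorm_def rtrans_ip[OF g])
qed (auto simp: rtrans_def ell2_add ell2_smult fun_eq_iff)

lemma left_commutant_iff:
  "S \<in> commutant L2 (left_translation G ` carrier G) \<longleftrightarrow>
    S \<in> bounded_operators L2 \<and> (\<forall>g\<in>carrier G. \<forall>f\<in>carrier L2. S (ltrans g f) = ltrans g (S f))"
proof -
  have sub: "left_translation G ` carrier G \<subseteq> bounded_operators L2"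
    using left_translation_bounded by auto
  have "left_translation G g (S f) = ltrans g (S f)" if "S \<in> bounded_operators L2" "f \<in> carrier L2" for g f
    by (rule left_translation_apply[OF L2.op_closed[OF that]])
  then show ?thesis
    unfolding L2.commutant_iff[OF sub] by (auto simp: left_translation_apply)
qed

lemma vN_commute:
  assumes T: "T \<in> vN" and S: "S \<in> commutant L2 (left_translation G ` carrier G)" and f: "f \<in> carrier L2"
  shows "T (S f) = S (T f)"
  using T S f unfolding vN_eq L2.commutant_iff[OF L2.commutant_subset] by blast

lemma vN_bounded: "T \<in> vN \<Longrightarrow> T \<in> bounded_operators L2"
  unfolding vN_eq using L2.commutant_subset by blast

lemma left_translation_in_vN: "g \<in> carrier G \<Longrightarrow> left_translation G g \<in> vN"
  unfolding vN_eq L2.commutant_iff[OF L2.commutant_subset]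
proof (intro conjI ballI left_translation_bounded)
  fix S f assume g: "g \<in> carrier G" and S: "S \<in> commutant L2 (left_translation G ` carrier G)"
    and f: "f \<in> carrier L2"
  then have "S (ltrans g f) = ltrans g (S f)" and B: "S \<in> bounded_operators L2"
    by (auto simp: left_commutant_iff)
  then show "left_translation G g (S f) = S (left_translation G g f)"
    using f L2.op_closed[OF B f] by (simp add: left_translation_apply)
qed

text \<open>Right translations commute with left ones, so they lie in the commutant of the left
  regular representation.\<close>

lemma vN_right_invariant:
  assumes T: "T \<in> vN" shows "right_invariant T"
  unfolding right_invariant_def
proof (intro conjI ballI)
  fix g f assume g: "g \<in> carrier G" and f: "f \<in> carrier L2"
  have "(\<lambda>f\<in>carrier L2. rtrans g f) \<in> commutant L2 (left_translation G ` carrier G)"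
    unfolding left_commutant_iff
    using rtrans_bounded[OF g] g
    by (auto simp: ltrans_in rtrans_in) (auto simp: rtrans_def ltrans_def fun_eq_iff m_assoc)
  from vN_commute[OF T this f] show "T (rtrans g f) = rtrans g (T f)"
    using f L2.op_closed[OF vN_bounded[OF T] f] by simp
qed (rule vN_bounded[OF T])

lemma right_invariant_adjoint:
  assumes T: "right_invariant T" shows "right_invariant (adjoint_operator L2 T)"
proof -
  have B: "T \<in> bounded_operators L2" using T by (simp add: right_invariant_def)
  note B' = L2.adjoint_in_bounded_operators[OF B]
  have "adjoint_operator L2 T (rtrans g f) = rtrans g (adjoint_operator L2 T f)"
    if g: "g \<in> carrier G" and f: "f \<in> carrier L2" for g f
  proof (rule L2.vector_eqI)
    fix w assume w: "w \<in> carrier L2"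
    have gi: "inv g \<in> carrier G" using g by simp
    have "ip L2 (adjoint_operator L2 T (rtrans g f)) w = ip L2 (rtrans g f) (T w)"
      by (rule L2.ip_adjoint_left[OF B rtrans_in[OF g f] w])
    also have "\<dots> = ip L2 f (rtrans (inv g) (T w))" by (rule rtrans_ip_adjoint[OF g f])
    also have "rtrans (inv g) (T w) = T (rtrans (inv g) w)"
      using T gi w by (simp add: right_invariant_def)
    also have "ip L2 f \<dots> = ip L2 (adjoint_operator L2 T f) (rtrans (inv g) w)"
      by (rule L2.ip_adjoint_left[OF B f rtrans_in[OF gi w], symmetric])
    also have "\<dots> = ip L2 (rtrans g (adjoint_operator L2 T f)) w"
      by (rule rtrans_ip_adjoint[OF g L2.op_closed[OF B' f], symmetric])
    finally show "ip L2 (adjoint_operator L2 T (rtrans g f)) w = ip L2 (rtrans g (adjoint_operator L2 T f)) w" .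
  qed (use rtrans_in[OF g] f L2.op_closed[OF B'] in blast)+
  then show ?thesis using B' by (simp add: right_invariant_def)
qed

text \<open>The \<open>h\<close>-th coefficient of \<open>T\<^sup>* \<delta>\<^sub>1\<close> is \<open>\<langle>\<delta>\<^sub>1, T \<delta>\<^sub>h\<rangle>\<close>, and \<open>\<delta>\<^sub>h\<close> is a right translate of
  \<open>\<delta>\<^sub>1\<close>.  This identity carries the trace property of the group von Neumann algebra.\<close>

lemma conj_inv_right_invariant_delta:
  assumes T: "right_invariant T"
  shows "conj_inv (T (delta \<one>)) = adjoint_operator L2 T (delta \<one>)"
proof -
  have B: "T \<in> bounded_operators L2" using T by (simp add: right_invariant_def)
  note B' = L2.adjoint_in_bounded_operators[OF B]
  have d: "delta h \<in> carrier L2" if "h \<in> carrier G" for h using delta_in[OF that] .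
  note d1 = d[OF one_closed]
  show ?thesis
  proof (rule ell2_eqI)
    fix h assume h: "h \<in> carrier G"
    have rd: "delta h = rtrans (inv h) (delta \<one>)"
    proof
      fix x
      have "x \<in> carrier G \<Longrightarrow> x \<otimes> inv h = \<one> \<longleftrightarrow> x = h"
        using h by (metis inv_closed inv_inv inv_equality r_inv)
      then show "delta h x = rtrans (inv h) (delta \<one>) x" using h by (auto simp: delta_def rtrans_def)
    qed
    have "adjoint_operator L2 T (delta \<one>) h = ip L2 (adjoint_operator L2 T (delta \<one>)) (delta h)"
      using ip_delta[OF h] by simp
    also have "\<dots> = ip L2 (delta \<one>) (T (delta h))" by (rule L2.ip_adjoint_left[OF B d1 d[OF h]])
    also have "T (delta h) = rtrans (inv h) (T (delta \<one>))"
      unfolding rd using T h d1 by (simp add: right_invariant_def)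
    also have "ip L2 (delta \<one>) \<dots> = cnj (ip L2 \<dots> (delta \<one>))"
      using h by (intro L2.ip_cnj rtrans_in L2.op_closed[OF B d1] d1) simp
    also have "\<dots> = cnj (T (delta \<one>) (inv h))"
      using h by (simp add: ip_delta) (simp add: rtrans_def)
    finally show "conj_inv (T (delta \<one>)) h = adjoint_operator L2 T (delta \<one>) h"
      using h by (simp add: conj_inv_def)
  qed (use conj_inv_in L2.op_closed[OF B d1] L2.op_closed[OF B' d1] in auto)
qed

lemma norm2_group_trace:
  assumes "T \<in> vN"
  shows "norm2 (group_vN_algebra G) (group_trace G) T = hnorm L2 (T (delta \<one>))"
proof -
  note B = vN_bounded[OF assms]
  have d1: "delta \<one> \<in> carrier L2" by (simp add: delta_in)
  have "group_trace G (star (group_vN_algebra G) T \<otimes>\<^bsub>group_vN_algebra G\<^esub> T)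
      = ip L2 (adjoint_operator L2 T (T (delta \<one>))) (delta \<one>)"
    unfolding group_trace_def Let_def delta_def[symmetric]
    by (simp add: group_vN_algebra_def operator_algebra_def Let_def compose_eq d1)
  also have "\<dots> = ip L2 (T (delta \<one>)) (T (delta \<one>))"
    by (rule L2.ip_adjoint_left[OF B L2.op_closed[OF B d1] d1])
  finally show ?thesis by (simp add: norm2_def hnorm_def)
qed

end

context group_l2
begin

interpretation L2: hilbert_space L2 by (rule hilbert_space_ell2)

lemma op_L2_add: "T \<in> bounded_operators L2 \<Longrightarrow> f \<in> carrier L2 \<Longrightarrow> g \<in> carrier L2 \<Longrightarrow>
    T (\<lambda>x. f x + g x) = (\<lambda>x. T f x + T g x)"
  using L2.op_add[of T f g] by (simp add: ell2_add)

lemma op_L2_smult: "T \<in> bounded_operators L2 \<Longrightarrow> f \<in> carrier L2 \<Longrightarrow>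
    T (\<lambda>x. a * f x) = (\<lambda>x. a * T f x)"
  using L2.op_smult[of T f a] by (simp add: ell2_smult)

lemma hnorm_conj_inv: "hnorm L2 (conj_inv f) = hnorm L2 f"
  by (simp add: hnorm_def conj_inv_ip)

lemma hnorm_twist: "unit_character \<omega> \<Longrightarrow> hnorm L2 (twist \<omega> f) = hnorm L2 f"
  by (simp add: hnorm_def twist_ip)

lemma twisted_right_inner_in:
  assumes "unit_character \<omega>" "f \<in> carrier L2"
  shows "conj_inv (twist (\<lambda>g. cnj (\<omega> g)) f) \<in> carrier L2"
  by (intro conj_inv_in twist_in unit_character_cnj assms)

lemma twisted_right_in:
  assumes "unit_character \<omega>" "T \<in> bounded_operators L2" "f \<in> carrier L2"
  shows "twisted_right \<omega> T f \<in> carrier L2"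
  unfolding twisted_right_def
  by (rule twist_in[OF assms(1) conj_inv_in[OF L2.op_closed[OF assms(2) twisted_right_inner_in[OF assms(1,3)]]]])

lemma twisted_right_add_arg:
  assumes "unit_character \<omega>" "T \<in> bounded_operators L2" "f \<in> carrier L2" "g \<in> carrier L2"
  shows "twisted_right \<omega> T (\<lambda>x. f x + g x) = (\<lambda>x. twisted_right \<omega> T f x + twisted_right \<omega> T g x)"
  using assms by (simp add: twisted_right_def twist_add conj_inv_add op_L2_add twisted_right_inner_in)

lemma twisted_right_smult_arg:
  assumes "unit_character \<omega>" "T \<in> bounded_operators L2" "f \<in> carrier L2"
  shows "twisted_right \<omega> T (\<lambda>x. a * f x) = (\<lambda>x. a * twisted_right \<omega> T f x)"
  using assms by (simp add: twisted_right_def twist_smult conj_inv_smult op_L2_smult twisted_right_inner_in)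

lemma twisted_right_bound:
  assumes "unit_character \<omega>" "f \<in> carrier L2"
    and "\<And>f. f \<in> carrier L2 \<Longrightarrow> hnorm L2 (T f) \<le> K * hnorm L2 f"
  shows "hnorm L2 (twisted_right \<omega> T f) \<le> K * hnorm L2 f"
  using assms(3)[OF twisted_right_inner_in[OF assms(1,2)]]
  by (simp add: twisted_right_def hnorm_twist hnorm_conj_inv assms(1) unit_character_cnj)

lemma twisted_right_add:
  "twisted_right \<omega> (\<lambda>f x. S f x + T f x) g = (\<lambda>x. twisted_right \<omega> S g x + twisted_right \<omega> T g x)"
  by (simp add: twisted_right_def conj_inv_add twist_add)

lemma twisted_right_smult:
  "twisted_right \<omega> (\<lambda>f x. a * T f x) g = (\<lambda>x. cnj a * twisted_right \<omega> T g x)"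
  by (simp add: twisted_right_def conj_inv_smult twist_smult)

lemma twisted_right_comp:
  assumes "unit_character \<omega>" "T \<in> bounded_operators L2" "f \<in> carrier L2"
  shows "twisted_right \<omega> S (twisted_right \<omega> T f) = twisted_right \<omega> (\<lambda>f. S (T f)) f"
proof -
  note T = L2.op_closed[OF assms(2) twisted_right_inner_in[OF assms(1,3)]]
  show ?thesis
    unfolding twisted_right_def
    by (simp add: twist_twist_cnj(2)[OF assms(1) conj_inv_in[OF T]] conj_inv_conj_inv[OF T])
qed

lemma twisted_right_cong:
  assumes "unit_character \<omega>" "f \<in> carrier L2" "\<And>f. f \<in> carrier L2 \<Longrightarrow> S f = T f"
  shows "twisted_right \<omega> S f = twisted_right \<omega> T f"
  using assms(3)[OF twisted_right_inner_in[OF assms(1,2)]] by (simp add: twisted_right_def)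

lemma twisted_right_ip:
  assumes w: "unit_character \<omega>" and T: "T \<in> bounded_operators L2"
    and f: "f \<in> carrier L2" and g: "g \<in> carrier L2"
  shows "ip L2 (twisted_right \<omega> T f) g = ip L2 f (twisted_right \<omega> (adjoint_operator L2 T) g)"
proof -
  let ?w = "\<lambda>g. cnj (\<omega> g)"
  let ?c = "\<lambda>f. conj_inv (twist ?w f)"
  have c: "?c f \<in> carrier L2" "?c g \<in> carrier L2"
    using twisted_right_inner_in[OF w] f g by auto
  have J: "ip L2 (conj_inv a) b = cnj (ip L2 a (conj_inv b))" if "b \<in> carrier L2" for a b
    using conj_inv_ip[of a "conj_inv b"] that by (simp add: conj_inv_conj_inv)
  have J': "ip L2 a (conj_inv b) = cnj (ip L2 (conj_inv a) b)" if "a \<in> carrier L2" for a b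
    using conj_inv_ip[of "conj_inv a" b] that by (simp add: conj_inv_conj_inv)
  have tg: "twist ?w g \<in> carrier L2" "twist ?w f \<in> carrier L2"
    by (intro twist_in unit_character_cnj w f g)+
  have "ip L2 (twisted_right \<omega> T f) g = ip L2 (conj_inv (T (?c f))) (twist ?w g)"
    unfolding twisted_right_def by (rule twist_ip_adjoint)
  also have "\<dots> = cnj (ip L2 (T (?c f)) (?c g))" by (rule J[OF tg(1)])
  also have "\<dots> = cnj (ip L2 (?c f) (adjoint_operator L2 T (?c g)))"
    by (simp only: L2.ip_adjoint[OF T c])
  also have "\<dots> = ip L2 (twist ?w f) (conj_inv (adjoint_operator L2 T (?c g)))"
    by (rule J'[OF tg(2), symmetric])
  also have "\<dots> = ip L2 f (twisted_right \<omega> (adjoint_operator L2 T) g)"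
    unfolding twisted_right_def by (simp add: twist_ip_adjoint)
  finally show ?thesis .
qed

lemma twisted_right_delta:
  assumes "unit_character \<omega>" "right_invariant T"
  shows "twisted_right \<omega> T (delta \<one>) = twist \<omega> (adjoint_operator L2 T (delta \<one>))"
  using assms by (simp add: twisted_right_def twist_delta unit_character_cnj conj_inv_delta
      conj_inv_right_invariant_delta)

text \<open>Moving a left translation past the diagonal unitary and its inverse costs a phase and its
  conjugate, and these cancel.\<close>

lemma twisted_right_ltrans:
  assumes w: "unit_character \<omega>" and T: "right_invariant T" and g: "g \<in> carrier G" and f: "f \<in> carrier L2"
  shows "twisted_right \<omega> T (ltrans g f) = ltrans g (twisted_right \<omega> T f)"
proof -
  have B: "T \<in> bounded_operators L2" using T by (simp add: right_invariant_def)
  let ?w = "\<lambda>g. cnj (\<omega> g)"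
  define u where "u = conj_inv (twist ?w f)"
  have u: "u \<in> carrier L2" unfolding u_def by (rule twisted_right_inner_in[OF w f])
  have "conj_inv (twist ?w (ltrans g f)) = (\<lambda>x. \<omega> g * rtrans g u x)"
    by (simp add: twist_ltrans[OF unit_character_cnj[OF w] g] conj_inv_smult conj_inv_ltrans[OF g] u_def)
  then have "twisted_right \<omega> T (ltrans g f)
      = twist \<omega> (conj_inv (\<lambda>x. \<omega> g * rtrans g (T u) x))"
    using T g u by (simp add: twisted_right_def op_L2_smult[OF B rtrans_in[OF g u]] right_invariant_def)
  also have "\<dots> = (\<lambda>x. (\<omega> g * cnj (\<omega> g)) * ltrans g (twist \<omega> (conj_inv (T u))) x)"
    by (simp add: conj_inv_smult conj_inv_rtrans[OF g] twist_smult twist_ltrans[OF w g] mult_ac)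
  also have "\<dots> = ltrans g (twisted_right \<omega> T f)"
    by (simp add: unit_characterD(2)[OF w g] twisted_right_def u_def)
  finally show ?thesis .
qed

lemma vN_twisted_right_commute:
  assumes w: "unit_character \<omega>" and T: "right_invariant T" and S: "S \<in> vN" and f: "f \<in> carrier L2"
  shows "S (twisted_right \<omega> T f) = twisted_right \<omega> T (S f)"
proof -
  have B: "T \<in> bounded_operators L2" using T by (simp add: right_invariant_def)
  obtain K where K: "\<And>f. f \<in> carrier L2 \<Longrightarrow> hnorm L2 (T f) \<le> K * hnorm L2 f"
    using L2.op_bound[OF B] by blast
  let ?R = "\<lambda>f\<in>carrier L2. twisted_right \<omega> T f"
  have "?R \<in> bounded_operators L2"
    by (rule L2.restrict_in_bounded_operators)
       (auto simp: twisted_right_in[OF w B] ell2_add ell2_smult twisted_right_add_arg[OF w B]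
         twisted_right_smult_arg[OF w B] intro: twisted_right_bound[OF w _ K])
  then have "?R \<in> commutant L2 (left_translation G ` carrier G)"
    unfolding left_commutant_iff by (simp add: twisted_right_ltrans[OF w T] ltrans_in)
  from vN_commute[OF S this f] show ?thesis
    using f L2.op_closed[OF vN_bounded[OF S] f] by simp
qed

text \<open>Since \<open>S \<delta>\<^sub>1\<close> is also the result of right multiplication by \<open>S\<close>, and right
  multiplications commute with \<open>T\<close>, the vector \<open>T S \<delta>\<^sub>1\<close> depends on \<open>T\<close> only through \<open>T \<delta>\<^sub>1\<close>,
  boundedly.  So an operator that is small in 2-norm is small at \<open>S \<delta>\<^sub>1\<close>.\<close>

lemma vN_right_multiplication:
  assumes S: "S \<in> vN" and K: "\<And>f. f \<in> carrier L2 \<Longrightarrow> hnorm L2 (S f) \<le> K * hnorm L2 f"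
  obtains A where "A \<in> bounded_operators L2" "\<And>T. T \<in> vN \<Longrightarrow> T (S (delta \<one>)) = A (T (delta \<one>))"
    "\<And>f. f \<in> carrier L2 \<Longrightarrow> hnorm L2 (A f) \<le> K * hnorm L2 f"
proof -
  let ?S = "adjoint_operator L2 S"
  note B = vN_bounded[OF S] and B' = L2.adjoint_in_bounded_operators[OF vN_bounded[OF S]]
  have w: "unit_character (\<lambda>_. 1)" by (simp add: unit_character_def)
  have ri: "right_invariant ?S" by (rule right_invariant_adjoint[OF vN_right_invariant[OF S]])
  have d1: "delta \<one> \<in> carrier L2" by (simp add: delta_in)
  have Sd: "S (delta \<one>) = twisted_right (\<lambda>_. 1) ?S (delta \<one>)"
    unfolding twisted_right_delta[OF w ri] by (simp add: L2.adjoint_adjoint[OF B] twist_def)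
  let ?A = "\<lambda>f\<in>carrier L2. twisted_right (\<lambda>_. 1) ?S f"
  have bound: "hnorm L2 (twisted_right (\<lambda>_. 1) ?S f) \<le> K * hnorm L2 f" if "f \<in> carrier L2" for f
    by (rule twisted_right_bound[OF w that L2.adjoint_bound[OF B K]])
  show ?thesis
  proof (rule that[of ?A])
    show "?A \<in> bounded_operators L2"
      by (rule L2.restrict_in_bounded_operators)
         (auto simp: twisted_right_in[OF w B'] ell2_add ell2_smult twisted_right_add_arg[OF w B']
           twisted_right_smult_arg[OF w B'] intro: bound)
    show "T (S (delta \<one>)) = ?A (T (delta \<one>))" if T: "T \<in> vN" for T
      using vN_twisted_right_commute[OF w ri T d1] L2.op_closed[OF vN_bounded[OF T] d1]
      by (simp only: Sd restrict_apply')
    show "hnorm L2 (?A f) \<le> K * hnorm L2 f" if "f \<in> carrier L2" for f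
      using bound[OF that] that by simp
  qed
qed

lemma adjoint_left_translation:
  assumes g: "g \<in> carrier G"
  shows "adjoint_operator L2 (left_translation G g) = left_translation G (inv g)"
  by (rule L2.adjoint_unique)
     (use g in \<open>auto simp: left_translation_bounded left_translation_apply ltrans_ip_adjoint\<close>)

text \<open>On \<open>u\<^sub>g\<close> the twist is visible only as the phase \<open>\<omega> g\<close>.\<close>

lemma twisted_right_left_translation:
  assumes w: "unit_character \<omega>" and g: "g \<in> carrier G" and f: "f \<in> carrier L2" and h: "h \<in> carrier G"
  shows "twisted_right \<omega> (adjoint_operator L2 (left_translation G g)) f h = \<omega> g * f (h \<otimes> inv g)"
proof -
  let ?w = "\<lambda>g. cnj (\<omega> g)"
  note u = twisted_right_inner_in[OF w f]
  have "twisted_right \<omega> (adjoint_operator L2 (left_translation G g)) f h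
      = \<omega> h * cnj (ltrans (inv g) (conj_inv (twist ?w f)) (inv h))"
    using h by (simp add: twisted_right_def adjoint_left_translation[OF g] left_translation_apply[OF u])
      (simp add: twist_def conj_inv_def)
  also have "\<dots> = \<omega> h * (cnj (\<omega> (h \<otimes> inv g)) * f (h \<otimes> inv g))"
    using g h by (simp add: ltrans_def conj_inv_def twist_def inv_mult_group)
  also have "\<dots> = (\<omega> h * cnj (\<omega> h)) * (\<omega> g * f (h \<otimes> inv g))"
    using g h by (simp add: unit_characterD[OF w])
  finally show ?thesis by (simp add: unit_characterD(2)[OF w h])
qed

end

section \<open>Hilbert spaces from semi-inner products\<close>

text \<open>The image filter clusters at some point of the compact set, and an ultrafilter converges to
  each of its cluster points.\<close>

lemma ultrafilter_tendsto_compact: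
  fixes f :: "'i \<Rightarrow> 'a::topological_space"
  assumes U: "ultrafilter U" and S: "compact S" and f: "\<And>i. f i \<in> S"
  shows "\<exists>l\<in>S. (f \<longlongrightarrow> l) U"
proof -
  have "filtermap f U \<noteq> bot" using U by (simp add: ultrafilter_def filtermap_bot_iff)
  moreover have "\<forall>\<^sub>F x in filtermap f U. x \<in> S" by (simp add: eventually_filtermap f)
  ultimately obtain l where l: "l \<in> S" "inf (nhds l) (filtermap f U) \<noteq> bot"
    using S unfolding compact_filter by blast
  have "(f \<longlongrightarrow> l) U"
  proof (rule topological_tendstoI)
    fix T assume T: "open T" "l \<in> T"
    show "\<forall>\<^sub>F i in U. f i \<in> T"
    proof (rule ccontr)
      assume "\<not> ?thesis"
      then have "\<forall>\<^sub>F i in U. f i \<notin> T" using U by (auto simp: ultrafilter_def)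
      then have "\<forall>\<^sub>F x in filtermap f U. x \<notin> T" by (simp add: eventually_filtermap)
      moreover have "\<forall>\<^sub>F x in nhds l. x \<in> T" using T by (rule eventually_nhds_in_open)
      ultimately have "\<forall>\<^sub>F x in inf (nhds l) (filtermap f U). False"
        by (auto simp: eventually_inf)
      then show False using l(2) by (simp add: trivial_limit_def)
    qed
  qed
  then show ?thesis using l(1) by blast
qed

lemma ultrafilter_tendsto_bounded:
  fixes f :: "'i \<Rightarrow> complex"
  assumes "ultrafilter U" and "\<And>i. cmod (f i) \<le> K"
  shows "(f \<longlongrightarrow> Lim U f) U"
proof -
  obtain l where "(f \<longlongrightarrow> l) U"
    using ultrafilter_tendsto_compact[OF assms(1) compact_cball[of 0 K], of f] assms(2)
    by (auto simp: dist_norm)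
  then show ?thesis using assms(1) tendsto_Lim[of U f l] by (auto simp: ultrafilter_def)
qed

lemma ultrafilter_not_bot: "ultrafilter U \<Longrightarrow> U \<noteq> bot"
  by (simp add: ultrafilter_def)

text \<open>The vectors are not identified when their difference is null, so that operations can be
  defined on representatives.\<close>

locale semi_inner_product =
  fixes V :: "'v::ab_group_add set" and sc :: "complex \<Rightarrow> 'v \<Rightarrow> 'v" and B :: "'v \<Rightarrow> 'v \<Rightarrow> complex"
  assumes V_zero: "0 \<in> V" and V_add: "\<lbrakk>v \<in> V; w \<in> V\<rbrakk> \<Longrightarrow> v + w \<in> V"
    and V_sc: "v \<in> V \<Longrightarrow> sc a v \<in> V"
    and sc_add: "sc a (v + w) = sc a v + sc a w" and sc_add_left: "sc (a + b) v = sc a v + sc b v"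
    and sc_sc: "sc a (sc b v) = sc (a * b) v" and sc_one: "sc 1 v = v"
    and B_add: "\<lbrakk>u \<in> V; v \<in> V; w \<in> V\<rbrakk> \<Longrightarrow> B (u + v) w = B u w + B v w"
    and B_sc: "\<lbrakk>v \<in> V; w \<in> V\<rbrakk> \<Longrightarrow> B (sc a v) w = a * B v w"
    and B_cnj: "\<lbrakk>v \<in> V; w \<in> V\<rbrakk> \<Longrightarrow> B w v = cnj (B v w)"
    and B_pos: "v \<in> V \<Longrightarrow> 0 \<le> Re (B v v)"
begin

text \<open>Convergence is expressed through the square of the seminorm; the factors 2 below replace
  the triangle inequality.\<close>

definition q :: "'v \<Rightarrow> real" where "q v = Re (B v v)"

lemma sc_zero: "sc 0 v = 0"
  using sc_add_left[of 0 0 v] by simp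

lemma sc_minus: "sc (- 1) v = - v"
  using sc_add_left[of 1 "-1" v] by (simp add: sc_zero sc_one eq_neg_iff_add_eq_0 add.commute)

lemma V_minus: "v \<in> V \<Longrightarrow> - v \<in> V"
  using V_sc[of v "-1"] by (simp add: sc_minus)

lemma V_diff: "v \<in> V \<Longrightarrow> w \<in> V \<Longrightarrow> v - w \<in> V"
  using V_add[of v "- w"] V_minus[of w] by simp

lemma B_minus: "v \<in> V \<Longrightarrow> w \<in> V \<Longrightarrow> B (- v) w = - B v w"
  using B_sc[of v w "-1"] by (simp add: sc_minus)

lemma B_diff: "u \<in> V \<Longrightarrow> v \<in> V \<Longrightarrow> w \<in> V \<Longrightarrow> B (u - v) w = B u w - B v w"
  using B_add[of u "- v" w] by (simp add: V_minus B_minus)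

lemma B_add_right: "\<lbrakk>u \<in> V; v \<in> V; w \<in> V\<rbrakk> \<Longrightarrow> B w (u + v) = B w u + B w v"
  using B_cnj[of "u + v" w] B_cnj[of u w] B_cnj[of v w] by (simp add: V_add B_add)

lemma B_diff_right: "\<lbrakk>u \<in> V; v \<in> V; w \<in> V\<rbrakk> \<Longrightarrow> B w (u - v) = B w u - B w v"
  using B_cnj[of "u - v" w] B_cnj[of u w] B_cnj[of v w] by (simp add: V_diff B_diff)

lemma B_sc_right: "\<lbrakk>v \<in> V; w \<in> V\<rbrakk> \<Longrightarrow> B w (sc a v) = cnj a * B w v"
  using B_cnj[of "sc a v" w] B_cnj[of v w] by (simp add: V_sc B_sc)

lemma q_nonneg: "v \<in> V \<Longrightarrow> 0 \<le> q v"
  by (simp add: q_def B_pos)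

lemma q_sc: "v \<in> V \<Longrightarrow> q (sc a v) = (cmod a)\<^sup>2 * q v"
proof -
  assume v: "v \<in> V"
  have "B (sc a v) (sc a v) = (a * cnj a) * B v v"
    using v by (simp add: B_sc B_sc_right V_sc)
  also have "a * cnj a = of_real ((cmod a)\<^sup>2)" by (rule complex_norm_square[symmetric])
  finally show ?thesis by (simp add: q_def del: of_real_power)
qed

lemma q_minus: "v \<in> V \<Longrightarrow> q (- v) = q v"
  using q_sc[of v "-1"] by (simp add: sc_minus)

lemma q_add: "\<lbrakk>v \<in> V; w \<in> V\<rbrakk> \<Longrightarrow> q (v + w) = q v + q w + 2 * Re (B v w)"
  using B_cnj[of v w] by (simp add: q_def B_add B_add_right V_add)

lemma q_diff: "\<lbrakk>v \<in> V; w \<in> V\<rbrakk> \<Longrightarrow> q (v - w) = q v + q w - 2 * Re (B v w)"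
  using B_cnj[of v w] by (simp add: q_def B_diff B_diff_right V_diff)

lemma q_add_le: "\<lbrakk>v \<in> V; w \<in> V\<rbrakk> \<Longrightarrow> q (v + w) \<le> 2 * q v + 2 * q w"
  using q_add[of v w] q_diff[of v w] q_nonneg[OF V_diff[of v w]] by simp

lemma q_diff_le: "\<lbrakk>v \<in> V; w \<in> V\<rbrakk> \<Longrightarrow> q (v - w) \<le> 2 * q v + 2 * q w"
  using q_add[of v w] q_diff[of v w] q_nonneg[OF V_add[of v w]] by simp

lemma q_triangle: "\<lbrakk>u \<in> V; v \<in> V; w \<in> V\<rbrakk> \<Longrightarrow> q (u - w) \<le> 2 * q (u - v) + 2 * q (v - w)"
  using q_add_le[of "u - v" "v - w"] by (simp add: V_diff)

lemma q_commute: "\<lbrakk>v \<in> V; w \<in> V\<rbrakk> \<Longrightarrow> q (v - w) = q (w - v)"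
  using q_minus[of "v - w"] by (simp add: V_diff)

lemma null_orthogonal:
  assumes v: "v \<in> V" and w: "w \<in> V" "q w = 0"
  shows "B v w = 0"
proof (rule ccontr)
  assume ne: "B v w \<noteq> 0"
  define n where "n = (cmod (B v w))\<^sup>2"
  have n: "n > 0" using ne by (simp add: n_def)
  (* This t makes the quadratic expression below equal to -1. *)
  define t where "t = (q v + 1) / (2 * n)"
  define a where "a = - (of_real t * B v w)"
  have "0 \<le> q (v + sc a w)" using v w by (simp add: q_nonneg V_add V_sc)
  also have "\<dots> = q v + 2 * Re (cnj a * B v w)"
    using v w by (simp add: q_add V_sc q_sc B_sc_right)
  also have "cnj a * B v w = - of_real (t * n)"
    by (simp add: a_def n_def complex_norm_square mult_ac del: of_real_power)
  also have "q v + 2 * Re (- of_real (t * n)) = - 1"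
    using n by (simp add: t_def field_simps)
  finally show False by simp
qed

lemma q_null_add:
  assumes "v \<in> V" "w \<in> V" "q (v - w) = 0"
  shows "q v = q w" "u \<in> V \<Longrightarrow> B v u = B w u" "u \<in> V \<Longrightarrow> B u v = B u w"
proof -
  show r: "B u v = B u w" if "u \<in> V" for u
    using null_orthogonal[OF that V_diff[OF assms(1,2)] assms(3)] assms that by (simp add: B_diff_right)
  show l: "B v u = B w u" if "u \<in> V" for u
    using r[OF that] B_cnj[of u v] B_cnj[of u w] that assms by simp
  show "q v = q w" using l[OF assms(1)] r[OF assms(2)] by (simp add: q_def)
qed

end

text \<open>The function \<open>code\<close> separates exactly the vectors that are not identified by the
  seminorm.  It represents the quotient in whichever type is wanted.\<close>

locale realized_semi_inner_product = semi_inner_product V sc B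
  for V :: "'v::ab_group_add set" and sc B +
  fixes code :: "'v \<Rightarrow> 'w"
  assumes code: "\<lbrakk>v \<in> V; w \<in> V\<rbrakk> \<Longrightarrow> code v = code w \<longleftrightarrow> q (v - w) = 0"
    and q_complete: "\<lbrakk>\<And>n. X n \<in> V;
      \<And>e. e > 0 \<Longrightarrow> \<exists>N. \<forall>m\<ge>N. \<forall>n\<ge>N. q (X m - X n) < e\<rbrakk>
      \<Longrightarrow> \<exists>v\<in>V. (\<lambda>n. q (X n - v)) \<longlonglongrightarrow> 0"
begin

definition decode :: "'w \<Rightarrow> 'v" where "decode k = (SOME v. v \<in> V \<and> code v = k)"

definition realization :: "'w hilbert" where
  "realization = \<lparr>carrier = code ` V, mult = undefined, one = undefined, zero = code 0,
     add = (\<lambda>k l. code (decode k + decode l)), smult = (\<lambda>a k. code (sc a (decode k))),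
     ip = (\<lambda>k l. B (decode k) (decode l))\<rparr>"

lemma decode:
  assumes "v \<in> V"
  shows "decode (code v) \<in> V" "q (decode (code v) - v) = 0"
proof -
  have "\<exists>w. w \<in> V \<and> code w = code v" using assms by blast
  then have "decode (code v) \<in> V \<and> code (decode (code v)) = code v"
    unfolding decode_def by (rule someI_ex)
  then show "decode (code v) \<in> V" "q (decode (code v) - v) = 0"
    using code[of "decode (code v)" v] assms by auto
qed

lemma realization_carrier: "carrier realization = code ` V"
  and realization_zero: "\<zero>\<^bsub>realization\<^esub> = code 0"
  by (simp_all add: realization_def)

lemma realization_add:
  assumes "v \<in> V" "w \<in> V"
  shows "code v \<oplus>\<^bsub>realization\<^esub> code w = code (v + w)"
proof -
  have *: "(decode (code v) + decode (code w)) - (v + w) = (decode (code v) - v) + (decode (code w) - w)"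
    by (simp add: algebra_simps)
  have "q ((decode (code v) + decode (code w)) - (v + w)) = 0"
    unfolding * using q_add_le[of "decode (code v) - v" "decode (code w) - w"] decode assms
      q_nonneg[of "(decode (code v) - v) + (decode (code w) - w)"]
    by (simp add: V_diff V_add)
  then have "code (decode (code v) + decode (code w)) = code (v + w)"
    using decode assms by (subst code) (auto simp: V_add)
  then show ?thesis by (simp add: realization_def)
qed

lemma realization_smult:
  assumes "v \<in> V"
  shows "a \<odot>\<^bsub>realization\<^esub> code v = code (sc a v)"
proof -
  have "sc a (decode (code v)) - sc a v = sc a (decode (code v) - v)"
    using sc_add[of a "decode (code v) - v" v] by simp
  then have "q (sc a (decode (code v)) - sc a v) = 0"
    using decode assms by (simp add: q_sc V_diff)
  then have "code (sc a (decode (code v))) = code (sc a v)"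
    using decode assms by (subst code) (auto simp: V_sc)
  then show ?thesis by (simp add: realization_def)
qed

lemma realization_ip:
  assumes "v \<in> V" "w \<in> V"
  shows "ip realization (code v) (code w) = B v w"
  using q_null_add(2)[OF decode(1)[OF assms(1)] assms(1) decode(2)[OF assms(1)] decode(1)[OF assms(2)]]
    q_null_add(3)[OF decode(1)[OF assms(2)] assms(2) decode(2)[OF assms(2)] assms(1)]
  by (simp add: realization_def)

lemma realization_hnorm: "v \<in> V \<Longrightarrow> hnorm realization (code v) = sqrt (q v)"
  by (simp add: hnorm_def realization_ip q_def)

lemma realization_abelian_group: "abelian_group realization"
proof (rule abelian_groupI; unfold realization_carrier realization_zero)
  fix x y assume "x \<in> code ` V" "y \<in> code ` V"
  then obtain v w where [simp]: "x = code v" "y = code w" and v: "v \<in> V" "w \<in> V" by blast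
  show "x \<oplus>\<^bsub>realization\<^esub> y \<in> code ` V" using v by (simp add: realization_add V_add)
  show "x \<oplus>\<^bsub>realization\<^esub> y = y \<oplus>\<^bsub>realization\<^esub> x"
    using v by (simp add: realization_add add.commute)
  fix z assume "z \<in> code ` V"
  then obtain u where [simp]: "z = code u" and u: "u \<in> V" by blast
  show "x \<oplus>\<^bsub>realization\<^esub> y \<oplus>\<^bsub>realization\<^esub> z = x \<oplus>\<^bsub>realization\<^esub> (y \<oplus>\<^bsub>realization\<^esub> z)"
    using u v by (simp add: realization_add V_add add.assoc)
next
  show "code 0 \<in> code ` V" by (simp add: V_zero)
next
  fix x assume "x \<in> code ` V"
  then obtain v where [simp]: "x = code v" and v: "v \<in> V" by blast
  show "code 0 \<oplus>\<^bsub>realization\<^esub> x = x" using v by (simp add: realization_add V_zero)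
  show "\<exists>y\<in>code ` V. y \<oplus>\<^bsub>realization\<^esub> x = code 0"
    using v by (intro bexI[of _ "code (- v)"]) (auto simp: realization_add V_minus)
qed

lemma realization_minus:
  assumes "v \<in> V" "w \<in> V"
  shows "code v \<ominus>\<^bsub>realization\<^esub> code w = code (v - w)"
proof -
  interpret abelian_group realization by (rule realization_abelian_group)
  have "\<ominus>\<^bsub>realization\<^esub> code w = code (- w)"
    using assms by (intro minus_equality)
      (auto simp: realization_add V_minus realization_zero realization_carrier)
  then show ?thesis using assms by (simp add: a_minus_def realization_add V_minus)
qed

lemma hilbert_space_realization: "hilbert_space realization"
proof -
  interpret cring complex_field by (rule cring_complex_field)
  interpret abelian_group realization by (rule realization_abelian_group)
  show ?thesis
  proof (unfold_locales; (unfold realization_carrier realization_zero)?)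
    fix a x assume "x \<in> code ` V"
    then obtain v where [simp]: "x = code v" and v: "v \<in> V" by blast
    show "a \<odot>\<^bsub>realization\<^esub> x \<in> code ` V" using v by (simp add: realization_smult V_sc)
  next
    fix a b x assume "x \<in> code ` V"
    then obtain v where [simp]: "x = code v" and v: "v \<in> V" by blast
    show "(a \<oplus>\<^bsub>complex_field\<^esub> b) \<odot>\<^bsub>realization\<^esub> x = a \<odot>\<^bsub>realization\<^esub> x \<oplus>\<^bsub>realization\<^esub> b \<odot>\<^bsub>realization\<^esub> x"
      using v by (simp add: realization_smult realization_add V_sc sc_add_left)
        (simp add: complex_field_def sc_add_left)
    show "(a \<otimes>\<^bsub>complex_field\<^esub> b) \<odot>\<^bsub>realization\<^esub> x = a \<odot>\<^bsub>realization\<^esub> (b \<odot>\<^bsub>realization\<^esub> x)"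
      using v by (simp add: realization_smult V_sc sc_sc) (simp add: complex_field_def)
    show "\<one>\<^bsub>complex_field\<^esub> \<odot>\<^bsub>realization\<^esub> x = x"
      using v by (simp add: realization_smult) (simp add: complex_field_def sc_one)
  next
    fix a x y assume "x \<in> code ` V" "y \<in> code ` V"
    then obtain v w where [simp]: "x = code v" "y = code w" and v: "v \<in> V" "w \<in> V" by blast
    show "a \<odot>\<^bsub>realization\<^esub> (x \<oplus>\<^bsub>realization\<^esub> y) = a \<odot>\<^bsub>realization\<^esub> x \<oplus>\<^bsub>realization\<^esub> a \<odot>\<^bsub>realization\<^esub> y"
      using v by (simp add: realization_smult realization_add V_sc V_add sc_add)
    show "ip realization (a \<odot>\<^bsub>realization\<^esub> x) y = a * ip realization x y"
      using v by (simp add: realization_smult realization_ip V_sc B_sc)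
    show "ip realization y x = cnj (ip realization x y)"
      using v by (simp add: realization_ip B_cnj[OF v, symmetric])
  next
    fix x y z assume "x \<in> code ` V" "y \<in> code ` V" "z \<in> code ` V"
    then obtain u v w where [simp]: "x = code u" "y = code v" "z = code w"
      and v: "u \<in> V" "v \<in> V" "w \<in> V" by blast
    show "ip realization (x \<oplus>\<^bsub>realization\<^esub> y) z = ip realization x z + ip realization y z"
      using v by (simp add: realization_add realization_ip V_add B_add)
  next
    fix x assume x: "x \<in> code ` V" "x \<noteq> code 0"
    then obtain v where [simp]: "x = code v" and v: "v \<in> V" by blast
    have "q v \<noteq> 0" using x code[OF v V_zero] by simp
    then show "0 < Re (ip realization x x)"
      using v q_nonneg[OF v] by (simp add: realization_ip q_def)
  next
    fix X :: "nat \<Rightarrow> 'w"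
    assume X: "\<And>n. X n \<in> code ` V"
      and C: "\<And>e. e > 0 \<Longrightarrow> \<exists>N. \<forall>m\<ge>N. \<forall>n\<ge>N. hnorm realization (X m \<ominus>\<^bsub>realization\<^esub> X n) < e"
    have "\<forall>n. \<exists>v. v \<in> V \<and> X n = code v" using X by blast
    then obtain Y where Y: "\<And>n. Y n \<in> V" "\<And>n. X n = code (Y n)" by metis
    have "\<exists>v\<in>V. (\<lambda>n. q (Y n - v)) \<longlonglongrightarrow> 0"
    proof (rule q_complete)
      fix e :: real assume e: "e > 0"
      have "\<exists>N. \<forall>m\<ge>N. \<forall>n\<ge>N. hnorm realization (X m \<ominus>\<^bsub>realization\<^esub> X n) < sqrt e"
        by (rule C) (simp add: e)
      then obtain N where N: "\<And>m n. m \<ge> N \<Longrightarrow> n \<ge> N \<Longrightarrow> hnorm realization (X m \<ominus>\<^bsub>realization\<^esub> X n) < sqrt e"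
        by blast
      have "q (Y m - Y n) < e" if "m \<ge> N" "n \<ge> N" for m n
        using N[OF that] by (simp add: Y realization_minus realization_hnorm V_diff)
      then show "\<exists>N. \<forall>m\<ge>N. \<forall>n\<ge>N. q (Y m - Y n) < e" by blast
    qed (rule Y(1))
    then obtain v where v: "v \<in> V" "(\<lambda>n. q (Y n - v)) \<longlonglongrightarrow> 0" by blast
    have "(\<lambda>n. hnorm realization (X n \<ominus>\<^bsub>realization\<^esub> code v)) \<longlonglongrightarrow> 0"
      using tendsto_real_sqrt[OF v(2)] by (simp add: Y realization_minus realization_hnorm V_diff v(1))
    then show "\<exists>x\<in>code ` V. (\<lambda>n. hnorm realization (X n \<ominus>\<^bsub>realization\<^esub> x)) \<longlonglongrightarrow> 0"
      using v(1) by blast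
  qed
qed

definition realize_op :: "('v \<Rightarrow> 'v) \<Rightarrow> 'w \<Rightarrow> 'w" where
  "realize_op t = (\<lambda>k\<in>code ` V. code (t (decode k)))"

lemma
  assumes t_in: "\<And>v. v \<in> V \<Longrightarrow> t v \<in> V"
    and t_add: "\<And>v w. v \<in> V \<Longrightarrow> w \<in> V \<Longrightarrow> t (v + w) = t v + t w"
    and t_sc: "\<And>v a. v \<in> V \<Longrightarrow> t (sc a v) = sc a (t v)"
    and t_bound: "\<And>v. v \<in> V \<Longrightarrow> q (t v) \<le> C\<^sup>2 * q v"
  shows realize_op_code: "v \<in> V \<Longrightarrow> realize_op t (code v) = code (t v)"
    and realize_op_in: "realize_op t \<in> bounded_operators realization"
proof -
  interpret R: hilbert_space realization by (rule hilbert_space_realization)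
  have t_diff: "t (v - w) = t v - t w" if "v \<in> V" "w \<in> V" for v w
    using t_add[OF V_diff[OF that] that(2)] by simp
  show app: "realize_op t (code v) = code (t v)" if v: "v \<in> V" for v
  proof -
    have "q (t (decode (code v) - v)) = 0"
      using t_bound[of "decode (code v) - v"] q_nonneg[OF t_in[of "decode (code v) - v"]] decode[OF v] v
      by (simp add: V_diff)
    then have "code (t (decode (code v))) = code (t v)"
      unfolding t_diff[OF decode(1)[OF v] v] code[OF t_in[OF decode(1)[OF v]] t_in[OF v]] .
    then show ?thesis using v by (simp add: realize_op_def)
  qed
  have "realize_op t = (\<lambda>k\<in>carrier realization. realize_op t k)"
    by (auto simp: realize_op_def realization_carrier)
  also have "\<dots> \<in> bounded_operators realization"
  proof (rule R.restrict_in_bounded_operators; unfold realization_carrier)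
    fix x assume "x \<in> code ` V"
    then obtain v where [simp]: "x = code v" and v: "v \<in> V" by blast
    show "realize_op t x \<in> code ` V" using v by (simp add: app t_in)
    show "hnorm realization (realize_op t x) \<le> \<bar>C\<bar> * hnorm realization x"
      using real_sqrt_le_mono[OF t_bound[OF v]]
      by (simp add: app[OF v] realization_hnorm v t_in[OF v] real_sqrt_mult)
    fix a show "realize_op t (a \<odot>\<^bsub>realization\<^esub> x) = a \<odot>\<^bsub>realization\<^esub> realize_op t x"
      by (simp add: realization_smult app[OF v] app[OF V_sc[OF v]] v t_sc[OF v] t_in[OF v])
    fix y assume "y \<in> code ` V"
    then obtain w where [simp]: "y = code w" and w: "w \<in> V" by blast
    show "realize_op t (x \<oplus>\<^bsub>realization\<^esub> y) = realize_op t x \<oplus>\<^bsub>realization\<^esub> realize_op t y"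
      by (simp add: realization_add v w app[OF v] app[OF w] app[OF V_add[OF v w]] t_add[OF v w]
          t_in[OF v] t_in[OF w])
  qed
  finally show "realize_op t \<in> bounded_operators realization" .
qed

end

section \<open>Ultraproducts of square-summable functions\<close>

definition bounded_families :: "'g set \<Rightarrow> ('i \<Rightarrow> 'g \<Rightarrow> complex) set" where
  "bounded_families S = {v. (\<forall>i. v i \<in> carrier (ell2 S)) \<and> (\<exists>C. \<forall>i. hnorm (ell2 S) (v i) \<le> C)}"

definition scale_family :: "complex \<Rightarrow> ('i \<Rightarrow> 'g \<Rightarrow> complex) \<Rightarrow> 'i \<Rightarrow> 'g \<Rightarrow> complex" where
  "scale_family a v = (\<lambda>i x. a * v i x)"

text \<open>The ultraproduct of copies of \<open>\<ell>\<^sup>2\<close>, as a semi-inner product on bounded families.\<close>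

locale ultraproduct =
  fixes S :: "'g set" and U :: "'i filter"
  assumes ultra: "ultrafilter U"
begin

abbreviation H :: "('g \<Rightarrow> complex) hilbert" where "H \<equiv> ell2 S"
abbreviation W :: "('i \<Rightarrow> 'g \<Rightarrow> complex) set" where "W \<equiv> bounded_families S"

definition uip :: "('i \<Rightarrow> 'g \<Rightarrow> complex) \<Rightarrow> ('i \<Rightarrow> 'g \<Rightarrow> complex) \<Rightarrow> complex" where
  "uip v w = Lim U (\<lambda>i. ip H (v i) (w i))"

sublocale H: hilbert_space H by (rule hilbert_space_ell2)

lemma W_in: "v \<in> W \<Longrightarrow> v i \<in> carrier H"
  by (simp add: bounded_families_def)

lemma W_bound: assumes "v \<in> W" obtains C where "C > 0" "\<And>i. hnorm H (v i) \<le> C"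
proof -
  obtain C where "\<forall>i. hnorm H (v i) \<le> C" using assms by (auto simp: bounded_families_def)
  then have "\<And>i. hnorm H (v i) \<le> \<bar>C\<bar> + 1" by (meson abs_ge_self add_increasing2 order_trans zero_le_one)
  then show ?thesis using that[of "\<bar>C\<bar> + 1"] by auto
qed

lemma W_I: "(\<And>i. v i \<in> carrier H) \<Longrightarrow> (\<And>i. hnorm H (v i) \<le> C) \<Longrightarrow> v \<in> W"
  by (auto simp: bounded_families_def)

lemma add_apply: "(v + w) i = v i \<oplus>\<^bsub>H\<^esub> w i" for v w :: "'i \<Rightarrow> 'g \<Rightarrow> complex"
  by (simp add: plus_fun_def ell2_add)

lemma diff_apply: "v \<in> W \<Longrightarrow> w \<in> W \<Longrightarrow> (v - w) i = v i \<ominus>\<^bsub>H\<^esub> w i"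
  by (simp add: fun_diff_def ell2_minus W_in)

lemma scale_apply: "scale_family a v i = a \<odot>\<^bsub>H\<^esub> v i"
  by (simp add: scale_family_def ell2_smult)

lemma W_zero: "0 \<in> W"
proof (rule W_I)
  have *: "(0 :: 'i \<Rightarrow> 'g \<Rightarrow> complex) i = \<zero>\<^bsub>H\<^esub>" for i
    by (simp add: ell2_zero zero_fun_def)
  show "(0 :: 'i \<Rightarrow> 'g \<Rightarrow> complex) i \<in> carrier H"
    "hnorm H ((0 :: 'i \<Rightarrow> 'g \<Rightarrow> complex) i) \<le> 0" for i
    by (simp_all only: * H.zero_closed H.hnorm_zero order_refl)
qed

lemma W_add: assumes "v \<in> W" "w \<in> W" shows "v + w \<in> W"
proof -
  obtain C D where "\<And>i. hnorm H (v i) \<le> C" "\<And>i. hnorm H (w i) \<le> D"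
    using W_bound assms by metis
  then have "hnorm H (v i \<oplus>\<^bsub>H\<^esub> w i) \<le> C + D" for i
    using H.hnorm_triangle[OF W_in[OF assms(1)] W_in[OF assms(2)], of i i] add_mono order_trans by blast
  then show ?thesis
    using assms by (intro W_I[of _ "C + D"]) (simp_all only: add_apply H.a_closed W_in)
qed

lemma W_scale: assumes "v \<in> W" shows "scale_family a v \<in> W"
proof -
  obtain C where C: "\<And>i. hnorm H (v i) \<le> C" using W_bound assms by metis
  have "hnorm H (a \<odot>\<^bsub>H\<^esub> v i) \<le> cmod a * C" for i
    by (simp add: H.hnorm_smult W_in[OF assms] C mult_left_mono)
  then show ?thesis
    using assms by (intro W_I[of _ "cmod a * C"]) (simp_all only: scale_apply H.smult_in W_in)
qed

lemma uip_tendsto: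
  assumes v: "v \<in> W" and w: "w \<in> W"
  shows "((\<lambda>i. ip H (v i) (w i)) \<longlongrightarrow> uip v w) U"
proof -
  obtain C where C: "C > 0" "\<And>i. hnorm H (v i) \<le> C" using W_bound[OF v] by blast
  obtain D where D: "D > 0" "\<And>i. hnorm H (w i) \<le> D" using W_bound[OF w] by blast
  have "cmod (ip H (v i) (w i)) \<le> C * D" for i
    by (rule order_trans[OF H.Cauchy_Schwarz[OF W_in[OF v] W_in[OF w]] mult_mono])
       (use C D H.hnorm_nonneg[OF W_in[OF w]] in \<open>auto intro: less_imp_le\<close>)
  then show ?thesis unfolding uip_def by (rule ultrafilter_tendsto_bounded[OF ultra])
qed

lemma U_unique: "(f \<longlongrightarrow> a) U \<Longrightarrow> (f \<longlongrightarrow> b) U \<Longrightarrow> a = b" for f :: "'i \<Rightarrow> 'c::t2_space"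
  using tendsto_unique[OF ultrafilter_not_bot[OF ultra]] .

sublocale semi_inner_product W scale_family uip
proof
  fix u v w assume u: "u \<in> W" and v: "v \<in> W" and w: "w \<in> W"
  have *: "ip H ((u + v) i) (w i) = ip H (u i) (w i) + ip H (v i) (w i)" for i
    unfolding add_apply by (rule H.ip_add[OF W_in[OF u] W_in[OF v] W_in[OF w]])
  have "((\<lambda>i. ip H ((u + v) i) (w i)) \<longlongrightarrow> uip u w + uip v w) U"
    unfolding * by (intro tendsto_add uip_tendsto u v w)
  then show "uip (u + v) w = uip u w + uip v w"
    by (rule U_unique[OF uip_tendsto[OF W_add[OF u v] w]])
next
  fix v w a assume v: "v \<in> W" and w: "w \<in> W"
  have *: "ip H (scale_family a v i) (w i) = a * ip H (v i) (w i)" for i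
    unfolding scale_apply by (rule H.ip_smult[OF W_in[OF v] W_in[OF w]])
  have "((\<lambda>i. ip H (scale_family a v i) (w i)) \<longlongrightarrow> a * uip v w) U"
    unfolding * by (intro tendsto_mult tendsto_const uip_tendsto v w)
  then show "uip (scale_family a v) w = a * uip v w"
    by (rule U_unique[OF uip_tendsto[OF W_scale[OF v] w]])
next
  fix v w assume v: "v \<in> W" and w: "w \<in> W"
  have *: "cnj (ip H (v i) (w i)) = ip H (w i) (v i)" for i
    by (rule H.ip_cnj[OF W_in[OF v] W_in[OF w], symmetric])
  have "((\<lambda>i. ip H (w i) (v i)) \<longlongrightarrow> cnj (uip v w)) U"
    unfolding *[symmetric] by (intro tendsto_cnj uip_tendsto v w)
  then show "uip w v = cnj (uip v w)"
    by (rule U_unique[OF uip_tendsto[OF w v]])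
next
  fix v assume v: "v \<in> W"
  have "0 \<le> Re (ip H (v i) (v i))" for i
    by (simp add: H.ip_self[OF W_in[OF v]])
  then show "0 \<le> Re (uip v v)"
    by (intro tendsto_lowerbound[OF tendsto_Re[OF uip_tendsto[OF v v]]] ultrafilter_not_bot[OF ultra])
       simp
qed (auto simp: W_zero W_add W_scale, auto simp: scale_family_def plus_fun_def algebra_simps)

lemma q_tendsto: "v \<in> W \<Longrightarrow> ((\<lambda>i. (hnorm H (v i))\<^sup>2) \<longlongrightarrow> q v) U"
  using tendsto_Re[OF uip_tendsto[of v v]] by (simp add: q_def H.ip_self W_in)

lemma q_eqI: "v \<in> W \<Longrightarrow> ((\<lambda>i. (hnorm H (v i))\<^sup>2) \<longlongrightarrow> c) U \<Longrightarrow> q v = c"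
  by (rule U_unique[OF q_tendsto])

lemma q_le_bound:
  assumes v: "v \<in> W" and "\<forall>\<^sub>F i in U. hnorm H (v i) \<le> C"
  shows "q v \<le> C\<^sup>2"
proof (rule tendsto_upperbound[OF q_tendsto[OF v] _ ultrafilter_not_bot[OF ultra]])
  show "\<forall>\<^sub>F i in U. (hnorm H (v i))\<^sup>2 \<le> C\<^sup>2"
    using assms(2) by eventually_elim (simp add: power_mono W_in[OF v])
qed

lemma q_mono_bound:
  assumes v: "v \<in> W" and w: "w \<in> W" and "\<And>i. hnorm H (v i) \<le> C * hnorm H (w i)"
  shows "q v \<le> C\<^sup>2 * q w"
proof (rule tendsto_le[OF ultrafilter_not_bot[OF ultra] _ q_tendsto[OF v]])
  show "((\<lambda>i. C\<^sup>2 * (hnorm H (w i))\<^sup>2) \<longlongrightarrow> C\<^sup>2 * q w) U"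
    by (intro tendsto_mult tendsto_const q_tendsto w)
  have "(hnorm H (v i))\<^sup>2 \<le> (C * hnorm H (w i))\<^sup>2" for i
    by (rule power_mono[OF assms(3)]) (simp add: W_in[OF v])
  then show "\<forall>\<^sub>F i in U. (hnorm H (v i))\<^sup>2 \<le> C\<^sup>2 * (hnorm H (w i))\<^sup>2"
    by (simp add: power_mult_distrib)
qed

text \<open>Off the set of indices where the first increments of a fast Cauchy sequence are small,
  the sequence is frozen.  The frozen sequences converge at every index.\<close>

lemma fast_Cauchy_limit:
  assumes Y: "\<And>k. Y k \<in> W" and fast: "\<And>k. q (Y (Suc k) - Y k) < ((1/2) ^ k)\<^sup>2"
  obtains v where "v \<in> W" "\<And>k. q (Y k - v) \<le> (2 * (1/2) ^ k)\<^sup>2"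
proof -
  define good where "good k i \<longleftrightarrow> (\<forall>j<k. hnorm H (Y (Suc j) i \<ominus>\<^bsub>H\<^esub> Y j i) \<le> (1/2) ^ j)" for k i
  (* Z i follows Y i as long as the increments are small and stays constant afterwards. *)
  define Z where "Z i = rec_nat (Y 0 i) (\<lambda>k z. if good (Suc k) i then Y (Suc k) i else z)" for i
  have Z0: "Z i 0 = Y 0 i" and ZS: "Z i (Suc k) = (if good (Suc k) i then Y (Suc k) i else Z i k)" for i k
    by (simp_all add: Z_def)
  have goodS: "good (Suc k) i \<Longrightarrow> good k i" for k i by (simp add: good_def)
  have Zgood: "good k i \<Longrightarrow> Z i k = Y k i" for k i by (cases k) (simp_all add: Z0 ZS)
  have Zc: "Z i k \<in> carrier H" for i k by (induction k) (simp_all add: Z0 ZS W_in[OF Y])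
  have step: "hnorm H (Z i (Suc k) \<ominus>\<^bsub>H\<^esub> Z i k) \<le> (1/2) ^ k" for i k
  proof (cases "good (Suc k) i")
    case True
    then have "hnorm H (Y (Suc k) i \<ominus>\<^bsub>H\<^esub> Y k i) \<le> (1/2) ^ k"
      unfolding good_def by blast
    then show ?thesis by (simp only: Zgood[OF True] Zgood[OF goodS[OF True]])
  next
    case False
    then show ?thesis using Zc[of i k] by (simp add: ZS H.r_neg a_minus_def)
  qed
  have dist: "hnorm H (Z i (k + n) \<ominus>\<^bsub>H\<^esub> Z i k) \<le> 2 * (1/2) ^ k - 2 * (1/2) ^ (k + n)" for i k n
  proof (induction n)
    case 0
    then show ?case using Zc[of i k] by (simp add: H.r_neg a_minus_def)
  next
    case (Suc n)
    have "hnorm H (Z i (k + Suc n) \<ominus>\<^bsub>H\<^esub> Z i k)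
        \<le> hnorm H (Z i (Suc (k + n)) \<ominus>\<^bsub>H\<^esub> Z i (k + n)) + hnorm H (Z i (k + n) \<ominus>\<^bsub>H\<^esub> Z i k)"
      unfolding add_Suc_right by (rule H.hnorm_triangle3[OF Zc Zc Zc])
    also have "\<dots> \<le> (1/2) ^ (k + n) + (2 * (1/2) ^ k - 2 * (1/2) ^ (k + n))"
      by (intro add_mono step Suc.IH)
    finally show ?case by simp
  qed
  have dist': "hnorm H (Z i m \<ominus>\<^bsub>H\<^esub> Z i k) \<le> 2 * (1/2) ^ k" if "m \<ge> k" for i m k
    using order_trans[OF dist[of i k "m - k"], of "2 * (1/2) ^ k"] that by simp
  have "\<exists>z\<in>carrier H. (\<lambda>n. hnorm H (Z i n \<ominus>\<^bsub>H\<^esub> z)) \<longlonglongrightarrow> 0" for i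
  proof (rule H.complete)
    fix e :: real assume "e > 0"
    then obtain N where "(1/2 :: real) ^ N < e / 4"
      using real_arch_pow_inv[of "e / 4" "1/2"] by auto
    then have N: "4 * (1/2 :: real) ^ N < e" by simp
    have "hnorm H (Z i m \<ominus>\<^bsub>H\<^esub> Z i n) < e" if "m \<ge> N" "n \<ge> N" for m n
    proof -
      have "hnorm H (Z i m \<ominus>\<^bsub>H\<^esub> Z i n) \<le> hnorm H (Z i m \<ominus>\<^bsub>H\<^esub> Z i N) + hnorm H (Z i N \<ominus>\<^bsub>H\<^esub> Z i n)"
        by (rule H.hnorm_triangle3[OF Zc Zc Zc])
      also have "hnorm H (Z i N \<ominus>\<^bsub>H\<^esub> Z i n) = hnorm H (Z i n \<ominus>\<^bsub>H\<^esub> Z i N)"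
        by (rule H.hnorm_minus_commute[OF Zc Zc])
      finally show ?thesis using dist'[OF that(1), of i] dist'[OF that(2), of i] N by simp
    qed
    then show "\<exists>N. \<forall>m\<ge>N. \<forall>n\<ge>N. hnorm H (Z i m \<ominus>\<^bsub>H\<^esub> Z i n) < e" by blast
  qed (rule Zc)
  then obtain v where v: "\<And>i. v i \<in> carrier H" "\<And>i. (\<lambda>n. hnorm H (Z i n \<ominus>\<^bsub>H\<^esub> v i)) \<longlonglongrightarrow> 0"
    by metis
  have near: "hnorm H (Z i k \<ominus>\<^bsub>H\<^esub> v i) \<le> 2 * (1/2) ^ k" for i k
  proof -
    have "(\<lambda>n. hnorm H (Z i n \<ominus>\<^bsub>H\<^esub> v i) + 2 * (1/2) ^ k) \<longlonglongrightarrow> 0 + 2 * (1/2) ^ k"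
      by (intro tendsto_add tendsto_const v(2))
    moreover have "hnorm H (Z i k \<ominus>\<^bsub>H\<^esub> v i) \<le> hnorm H (Z i n \<ominus>\<^bsub>H\<^esub> v i) + 2 * (1/2) ^ k" if "n \<ge> k" for n
      using H.hnorm_triangle3[OF Zc[of i k] Zc[of i n] v(1)[of i]] dist'[OF that, of i]
        H.hnorm_minus_commute[OF Zc[of i n] Zc[of i k]] by simp
    ultimately have "hnorm H (Z i k \<ominus>\<^bsub>H\<^esub> v i) \<le> 0 + 2 * (1/2) ^ k"
      by (intro LIMSEQ_le_const[where X = "\<lambda>n. hnorm H (Z i n \<ominus>\<^bsub>H\<^esub> v i) + 2 * (1/2) ^ k"]) auto
    then show ?thesis by simp
  qed
  have vW: "v \<in> W"
  proof -
    obtain C where C: "\<And>i. hnorm H (Y 0 i) \<le> C" using W_bound[OF Y[of 0]] by metis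
    have "hnorm H (v i) \<le> C + 2" for i
      using near[of i 0] H.hnorm_diff_ge[OF Zc[of i 0] v(1)[of i]] C[of i] by (simp add: Z0)
    then show ?thesis using v(1) by (rule W_I[rotated])
  qed
  show ?thesis
  proof (rule that[OF vW])
    fix k
    have "\<forall>\<^sub>F i in U. good k i"
    proof -
      have "\<forall>\<^sub>F i in U. hnorm H (Y (Suc j) i \<ominus>\<^bsub>H\<^esub> Y j i) \<le> (1/2) ^ j" for j
      proof -
        have "\<forall>\<^sub>F i in U. (hnorm H ((Y (Suc j) - Y j) i))\<^sup>2 < ((1/2) ^ j)\<^sup>2"
          by (rule order_tendstoD(2)[OF q_tendsto[OF V_diff[OF Y Y]] fast])
        then show ?thesis
          by eventually_elim (simp only: diff_apply[OF Y Y], rule power2_le_imp_le, simp_all)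
      qed
      then have "\<forall>\<^sub>F i in U. \<forall>j\<in>{..<k}. hnorm H (Y (Suc j) i \<ominus>\<^bsub>H\<^esub> Y j i) \<le> (1/2) ^ j"
        by (intro eventually_ball_finite) simp_all
      then show ?thesis by (simp add: good_def Ball_def)
    qed
    then have "\<forall>\<^sub>F i in U. hnorm H ((Y k - v) i) \<le> 2 * (1/2) ^ k"
      by eventually_elim (simp only: diff_apply[OF Y vW] Zgood[symmetric] near)
    then show "q (Y k - v) \<le> (2 * (1/2) ^ k)\<^sup>2"
      by (rule q_le_bound[OF V_diff[OF Y vW]])
  qed
qed

text \<open>A subsequence is fast in the sense of \<open>fast_Cauchy_limit\<close>, and a Cauchy sequence
  converges to the limit of any of its subsequences.\<close>

lemma W_complete:
  assumes X: "\<And>n. X n \<in> W" and C: "\<And>e. e > 0 \<Longrightarrow> \<exists>N. \<forall>m\<ge>N. \<forall>n\<ge>N. q (X m - X n) < e"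
  shows "\<exists>v\<in>W. (\<lambda>n. q (X n - v)) \<longlonglongrightarrow> 0"
proof -
  have "\<exists>N. \<forall>m\<ge>N. \<forall>n\<ge>N. q (X m - X n) < ((1/2) ^ k)\<^sup>2" for k by (rule C) simp
  then obtain N where N: "\<And>k m n. m \<ge> N k \<Longrightarrow> n \<ge> N k \<Longrightarrow> q (X m - X n) < ((1/2) ^ k)\<^sup>2"
    by metis
  (* Partial sums dominate every earlier N j, so both r k and r (Suc k) are late enough. *)
  define r where "r k = (\<Sum>j\<le>k. N j)" for k
  have rN: "r k \<ge> N k" "r (Suc k) \<ge> N k" for k
    unfolding r_def by (intro member_le_sum; simp)+
  obtain v where v: "v \<in> W" "\<And>k. q (X (r k) - v) \<le> (2 * (1/2) ^ k)\<^sup>2"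
    using fast_Cauchy_limit[of "\<lambda>k. X (r k)"] X N rN by metis
  have "(\<lambda>n. q (X n - v)) \<longlonglongrightarrow> 0"
  proof (rule LIMSEQ_I)
    fix e :: real assume e: "e > 0"
    obtain k where k: "(1/2 :: real) ^ k < min 1 (e / 10)"
      using real_arch_pow_inv[of "min 1 (e / 10)" "1/2"] e by auto
    have k2: "((1/2 :: real) ^ k)\<^sup>2 \<le> (1/2) ^ k"
      using k by (simp add: power2_eq_square mult_left_le)
    have "q (X n - v) < e" if n: "n \<ge> N k" for n
    proof -
      have "q (X n - v) \<le> 2 * q (X n - X (r k)) + 2 * q (X (r k) - v)"
        by (rule q_triangle[OF X X v(1)])
      also have "\<dots> \<le> 2 * ((1/2) ^ k)\<^sup>2 + 2 * (2 * (1/2) ^ k)\<^sup>2"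
        using N[OF n rN(1)] v(2)[of k] by simp
      also have "\<dots> = 10 * ((1/2) ^ k)\<^sup>2" by (simp add: power_mult_distrib)
      also have "\<dots> < e" using k k2 by simp
      finally show ?thesis .
    qed
    then show "\<exists>N. \<forall>n\<ge>N. norm (q (X n - v) - 0) < e"
      using q_nonneg[OF V_diff[OF X v(1)]] by auto
  qed
  then show ?thesis using v(1) by blast
qed

text \<open>The closure of \<open>D\<close> for the seminorm.\<close>

definition approximable :: "('i \<Rightarrow> 'g \<Rightarrow> complex) set \<Rightarrow> ('i \<Rightarrow> 'g \<Rightarrow> complex) set" where
  "approximable D = {v \<in> W. \<forall>e>0. \<exists>d\<in>D. q (v - d) < e}"

lemma approximableD: "v \<in> approximable D \<Longrightarrow> e > 0 \<Longrightarrow> \<exists>d\<in>D. q (v - d) < e"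
  by (simp add: approximable_def)

lemma approximable_closed:
  assumes D: "D \<subseteq> W" and v: "v \<in> W" and near: "\<And>e. e > 0 \<Longrightarrow> \<exists>w\<in>approximable D. q (v - w) < e"
  shows "v \<in> approximable D"
  unfolding approximable_def
proof (intro CollectI conjI allI impI v)
  fix e :: real assume e: "e > 0"
  obtain w where w: "w \<in> approximable D" "q (v - w) < e / 4" using near[of "e / 4"] e by auto
  obtain d where d: "d \<in> D" "q (w - d) < e / 4" using approximableD[OF w(1), of "e / 4"] e by auto
  have "q (v - d) \<le> 2 * q (v - w) + 2 * q (w - d)"
    using v w d D by (intro q_triangle) (auto simp: approximable_def)
  then have "q (v - d) < e" using w(2) d(2) by simp
  then show "\<exists>d\<in>D. q (v - d) < e" using d(1) by blast
qed

lemma approximable_subset: "D \<subseteq> W \<Longrightarrow> D \<subseteq> approximable D"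
proof
  fix d assume D: "D \<subseteq> W" and d: "d \<in> D"
  have "q (d - d) = 0" using q_sc[OF V_zero, of 0] by (simp add: sc_zero)
  then show "d \<in> approximable D" using D d by (auto simp: approximable_def intro!: bexI[of _ d])
qed

lemma approximable_map:
  assumes D: "D \<subseteq> W" and t_in: "\<And>v. v \<in> W \<Longrightarrow> t v \<in> W"
    and t_diff: "\<And>v w. v \<in> W \<Longrightarrow> w \<in> W \<Longrightarrow> t (v - w) = t v - t w"
    and t_bound: "\<And>v. v \<in> W \<Longrightarrow> q (t v) \<le> C\<^sup>2 * q v"
    and t_D: "\<And>d. d \<in> D \<Longrightarrow> t d \<in> approximable D" and v: "v \<in> approximable D"
  shows "t v \<in> approximable D"
proof (rule approximable_closed[OF D])
  have vW: "v \<in> W" using v by (simp add: approximable_def)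
  then show "t v \<in> W" by (rule t_in)
  fix e :: real assume e: "e > 0"
  have C: "C\<^sup>2 + 1 > 0" by (simp add: add_nonneg_pos)
  obtain d where d: "d \<in> D" "q (v - d) < e / (C\<^sup>2 + 1)"
    using approximableD[OF v, of "e / (C\<^sup>2 + 1)"] e C by auto
  have dW: "d \<in> W" using d D by blast
  have "q (t v - t d) \<le> C\<^sup>2 * q (v - d)"
    using t_bound[OF V_diff[OF vW dW]] by (simp only: t_diff[OF vW dW])
  also have "\<dots> \<le> (C\<^sup>2 + 1) * q (v - d)"
    using q_nonneg[OF V_diff[OF vW dW]] by (intro mult_right_mono) auto
  also have "\<dots> < e" using d(2) C by (simp add: field_simps)
  finally show "\<exists>w\<in>approximable D. q (t v - w) < e" using t_D[OF d(1)] by blast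
qed

lemma approximable_add:
  assumes D: "D \<subseteq> W" and add: "\<And>c d. c \<in> D \<Longrightarrow> d \<in> D \<Longrightarrow> c + d \<in> D"
    and v: "v \<in> approximable D" and w: "w \<in> approximable D"
  shows "v + w \<in> approximable D"
  unfolding approximable_def
proof (intro CollectI conjI allI impI)
  have vw: "v \<in> W" "w \<in> W" using v w by (auto simp: approximable_def)
  then show "v + w \<in> W" by (rule V_add)
  fix e :: real assume e: "e > 0"
  then have e4: "e / 4 > 0" by simp
  obtain c where c: "c \<in> D" "q (v - c) < e / 4" using v e4 unfolding approximable_def by blast
  obtain d where d: "d \<in> D" "q (w - d) < e / 4" using w e4 unfolding approximable_def by blast
  have "c \<in> W" "d \<in> W" using c d D by auto
  then have "q ((v - c) + (w - d)) \<le> 2 * q (v - c) + 2 * q (w - d)"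
    using vw by (intro q_add_le V_diff)
  then have "q ((v + w) - (c + d)) < e" using c(2) d(2) by (simp add: algebra_simps)
  then show "\<exists>d\<in>D. q (v + w - d) < e" using add[OF c(1) d(1)] by blast
qed

lemma approximable_complete:
  assumes D: "D \<subseteq> W" and X: "\<And>n. X n \<in> approximable D"
    and C: "\<And>e. e > 0 \<Longrightarrow> \<exists>N. \<forall>m\<ge>N. \<forall>n\<ge>N. q (X m - X n) < e"
  shows "\<exists>v\<in>approximable D. (\<lambda>n. q (X n - v)) \<longlonglongrightarrow> 0"
proof -
  have XW: "X n \<in> W" for n using X by (simp add: approximable_def)
  obtain v where v: "v \<in> W" "(\<lambda>n. q (X n - v)) \<longlonglongrightarrow> 0"
    using W_complete[OF XW C] by blast
  have "v \<in> approximable D"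
  proof (rule approximable_closed[OF D v(1)])
    fix e :: real assume e: "e > 0"
    obtain n where "q (X n - v) < e"
      using eventually_happens[OF order_tendstoD(2)[OF v(2) e]] by auto
    then show "\<exists>w\<in>approximable D. q (v - w) < e"
      using X[of n] q_commute[OF XW v(1), of n] by auto
  qed
  then show ?thesis using v(2) by blast
qed

end

section \<open>Almost conjugation invariant vectors\<close>

definition restrict_to :: "'g set \<Rightarrow> ('g \<Rightarrow> complex) \<Rightarrow> 'g \<Rightarrow> complex" where
  "restrict_to X f = (\<lambda>h. if h \<in> X then f h else 0)"

lemma restrict_to_in:
  assumes "f \<in> carrier (ell2 S)" shows "restrict_to X f \<in> carrier (ell2 S)"
proof -
  have "(\<lambda>x. (cmod (restrict_to X f x))\<^sup>2) summable_on S"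
    by (rule summable_on_comparison_test[of "\<lambda>x. (cmod (f x))\<^sup>2"])
       (use assms in \<open>auto simp: ell2_carrier restrict_to_def\<close>)
  then show ?thesis using assms by (auto simp: ell2_carrier restrict_to_def)
qed

lemma hnorm_restrict_to_le:
  assumes "f \<in> carrier (ell2 S)" shows "hnorm (ell2 S) (restrict_to X f) \<le> hnorm (ell2 S) f"
proof -
  have "(\<Sum>\<^sub>\<infinity>x\<in>S. (cmod (restrict_to X f x))\<^sup>2) \<le> (\<Sum>\<^sub>\<infinity>x\<in>S. (cmod (f x))\<^sup>2)"
    by (rule infsum_mono) (use assms restrict_to_in[OF assms] in \<open>auto simp: ell2_carrier restrict_to_def\<close>)
  then show ?thesis by (simp add: ell2_norm assms restrict_to_in)
qed

context ultraproduct
begin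

definition res :: "'g set \<Rightarrow> ('i \<Rightarrow> 'g \<Rightarrow> complex) \<Rightarrow> 'i \<Rightarrow> 'g \<Rightarrow> complex" where
  "res X v = (\<lambda>i. restrict_to X (v i))"

lemma res_W: "v \<in> W \<Longrightarrow> res X v \<in> W"
proof -
  assume v: "v \<in> W"
  obtain C where "\<And>i. hnorm H (v i) \<le> C" using W_bound[OF v] by metis
  then show ?thesis
    using hnorm_restrict_to_le[OF W_in[OF v]] order_trans
    unfolding res_def by (intro W_I[of _ C] restrict_to_in W_in[OF v]) blast
qed

lemma res_diff: "res X (v - w) = res X v - res X w"
  by (auto simp: res_def restrict_to_def fun_diff_def fun_eq_iff)

lemma q_res_le: "v \<in> W \<Longrightarrow> q (res X v) \<le> q v"
  using q_mono_bound[of "res X v" v 1] hnorm_restrict_to_le[OF W_in[of v], of X]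
  by (simp only: res_W) (simp add: res_def)

lemma q_res_cong:
  assumes "v \<in> W" "w \<in> W" "q (v - w) = 0"
  shows "q (res X v) = q (res X w)"
proof (rule q_null_add(1)[OF res_W[OF assms(1)] res_W[OF assms(2)]])
  have "q (res X (v - w)) \<le> 0" using q_res_le[OF V_diff[OF assms(1,2)], of X] assms(3) by simp
  then show "q (res X v - res X w) = 0"
    using q_nonneg[OF res_W[OF V_diff[OF assms(1,2)]], of X] by (simp add: res_diff)
qed

lemma q_res_union:
  assumes v: "v \<in> W" and d: "X \<inter> Y = {}"
  shows "q (res (X \<union> Y) v) = q (res X v) + q (res Y v)"
proof -
  have "res (X \<union> Y) v = res X v + res Y v"
    using d by (auto simp: res_def restrict_to_def plus_fun_def fun_eq_iff)
  moreover have "uip (res X v) (res Y v) = 0"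
  proof -
    have "ip H (res X v i) (res Y v i) = 0" for i
      unfolding ell2_ip by (rule infsum_0) (use d in \<open>auto simp: res_def restrict_to_def\<close>)
    then have "((\<lambda>i. ip H (res X v i) (res Y v i)) \<longlongrightarrow> 0) U" by simp
    then show ?thesis by (rule U_unique[OF uip_tendsto[OF res_W[OF v] res_W[OF v]]])
  qed
  ultimately show ?thesis by (simp add: q_add res_W[OF v])
qed

lemma q_res_mono:
  assumes v: "v \<in> W" and "X \<subseteq> Y" shows "q (res X v) \<le> q (res Y v)"
proof -
  have "X \<union> (Y - X) = Y" using assms by blast
  then have "q (res Y v) = q (res X v) + q (res (Y - X) v)"
    using q_res_union[OF v, of X "Y - X"] by (simp add: Int_Diff)
  then show ?thesis using q_nonneg[OF res_W[OF v, of "Y - X"]] by simp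
qed

lemma q_res_union_le:
  assumes v: "v \<in> W" shows "q (res (X \<union> Y) v) \<le> q (res X v) + q (res Y v)"
proof -
  have "X \<union> Y = X \<union> (Y - X)" by blast
  then have "q (res (X \<union> Y) v) = q (res X v) + q (res (Y - X) v)"
    using q_res_union[OF v, of X "Y - X"] by (simp add: Int_Diff)
  then show ?thesis using q_res_mono[OF v, of "Y - X" Y] by simp
qed

lemma q_cong_norm:
  assumes "v \<in> W" "w \<in> W" "\<And>i. hnorm H (v i) = hnorm H (w i)"
  shows "q v = q w"
  using q_tendsto[OF assms(1)] q_tendsto[OF assms(2)] U_unique by (simp add: assms(3))

end

locale group_ultraproduct = group_l2 G + ultraproduct "carrier G" U
  for G (structure) and U :: "'i filter"
begin

lemma ltrans_W: assumes g: "g \<in> carrier G" and v: "v \<in> W" shows "(\<lambda>i. ltrans g (v i)) \<in> W"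
proof -
  obtain C where "\<And>i. hnorm L2 (v i) \<le> C" using W_bound[OF v] by metis
  then show ?thesis
    by (intro W_I[of _ C] ltrans_in[OF g] W_in[OF v]) (simp add: hnorm_def ltrans_ip[OF g])
qed

lemma phase_rtrans_W:
  assumes g: "g \<in> carrier G" and v: "v \<in> W" and z: "\<And>i. cmod (\<zeta> i) = 1"
  shows "(\<lambda>i h. \<zeta> i * rtrans g (v i) h) \<in> W"
    and "hnorm L2 (\<lambda>h. \<zeta> i * rtrans g (v i) h) = hnorm L2 (v i)"
proof -
  have n: "hnorm L2 (\<lambda>h. \<zeta> i * rtrans g (v i) h) = hnorm L2 (v i)" for i
    using H.hnorm_smult[OF rtrans_in[OF g W_in[OF v, of i]], of "\<zeta> i"]
    by (simp add: z ell2_smult) (simp add: hnorm_def rtrans_ip[OF g])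
  then show "hnorm L2 (\<lambda>h. \<zeta> i * rtrans g (v i) h) = hnorm L2 (v i)" .
  obtain C where "\<And>i. hnorm L2 (v i) \<le> C" using W_bound[OF v] by metis
  moreover have "(\<lambda>h. \<zeta> i * rtrans g (v i) h) \<in> carrier L2" for i
    using H.smult_in[OF rtrans_in[OF g W_in[OF v, of i]], of "\<zeta> i"] by (simp add: ell2_smult)
  ultimately show "(\<lambda>i h. \<zeta> i * rtrans g (v i) h) \<in> W"
    by (intro W_I[of _ C]) (simp_all add: n)
qed

text \<open>Conjugation by \<open>g\<close> is split into a left and a right translation, both of which are
  isometric; up to a phase and a null vector they agree on \<open>v\<close>, and phases do not change masses.\<close>

lemma conjugation_invariant_mass:
  assumes g: "g \<in> carrier G" and v: "v \<in> W" and z: "\<And>i. cmod (\<zeta> i) = 1"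
    and inv: "q ((\<lambda>i. ltrans g (v i)) - (\<lambda>i h. \<zeta> i * rtrans (inv g) (v i) h)) = 0"
  shows "q (res {h\<in>carrier G. g \<otimes> h \<in> X} v) = q (res {h\<in>carrier G. h \<otimes> g \<in> X} v)"
proof -
  let ?L = "\<lambda>v i. ltrans g (v i)" and ?R = "\<lambda>v i h. \<zeta> i * rtrans (inv g) (v i) h"
  have gi: "inv g \<in> carrier G" using g by simp
  note LW = ltrans_W[OF g v] and RW = phase_rtrans_W(1)[OF gi v z]
  let ?A = "res {h\<in>carrier G. g \<otimes> h \<in> X} v" and ?B = "res {h\<in>carrier G. h \<otimes> g \<in> X} v"
  have A: "?A \<in> W" and B: "?B \<in> W" using v by (rule res_W)+
  have "q ?A = q (?L ?A)"
    by (rule q_cong_norm[OF A ltrans_W[OF g A]]) (simp add: hnorm_def ltrans_ip[OF g])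
  also have "?L ?A = res X (?L v)"
    using g by (auto simp: res_def restrict_to_def ltrans_def fun_eq_iff m_assoc[symmetric])
  also have "q \<dots> = q (res X (?R v))" by (rule q_res_cong[OF LW RW inv])
  also have "res X (?R v) = ?R ?B"
    using g by (auto simp: res_def restrict_to_def rtrans_def fun_eq_iff m_assoc)
  also have "q (?R ?B) = q ?B"
    by (rule q_cong_norm[OF phase_rtrans_W(1)[OF gi B z] B]) (rule phase_rtrans_W(2)[OF gi B z])
  finally show ?thesis .
qed

lemma conjugation_invariant_mass':
  assumes g: "g \<in> carrier G" and v: "v \<in> W" and z: "\<And>i. cmod (\<zeta> i) = 1"
    and inv: "q ((\<lambda>i. ltrans g (v i)) - (\<lambda>i h. \<zeta> i * rtrans (inv g) (v i) h)) = 0"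
    and E: "E \<subseteq> carrier G"
  shows "q (res {h\<in>carrier G. g \<otimes> h \<otimes> inv g \<in> E} v) = q (res E v)"
    and "q (res {h\<in>carrier G. inv g \<otimes> h \<otimes> g \<in> E} v) = q (res E v)"
proof -
  have "{h\<in>carrier G. g \<otimes> h \<in> {k\<in>carrier G. k \<otimes> inv g \<in> E}} = {h\<in>carrier G. g \<otimes> h \<otimes> inv g \<in> E}"
    "{h\<in>carrier G. h \<otimes> g \<in> {k\<in>carrier G. k \<otimes> inv g \<in> E}} = E"
    using g E by (auto simp: m_assoc)
  then show "q (res {h\<in>carrier G. g \<otimes> h \<otimes> inv g \<in> E} v) = q (res E v)"
    using conjugation_invariant_mass[OF g v z inv, of "{k\<in>carrier G. k \<otimes> inv g \<in> E}"] by simp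
  have "{h\<in>carrier G. h \<otimes> g \<in> {k\<in>carrier G. inv g \<otimes> k \<in> E}} = {h\<in>carrier G. inv g \<otimes> h \<otimes> g \<in> E}"
    "{h\<in>carrier G. g \<otimes> h \<in> {k\<in>carrier G. inv g \<otimes> k \<in> E}} = E"
    using g E by (auto simp: m_assoc[symmetric])
  then show "q (res {h\<in>carrier G. inv g \<otimes> h \<otimes> g \<in> E} v) = q (res E v)"
    using conjugation_invariant_mass[OF g v z inv, of "{k\<in>carrier G. inv g \<otimes> k \<in> E}"] by simp
qed

text \<open>If \<open>m\<close> is the mass of \<open>E\<close>, then all its conjugates by \<open>a\<close> and \<open>b\<close> have mass \<open>m\<close>.  Two
  of them cover everything but the unit, so the total mass is at most \<open>2 m\<close>; three of them are
  disjoint, so it is at least \<open>3 m\<close>.\<close>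

lemma paradoxical_mass:
  assumes a: "a \<in> carrier G" and b: "b \<in> carrier G" and v: "v \<in> W"
    and z: "\<And>i. cmod (\<zeta> i) = 1" "\<And>i. cmod (\<zeta>' i) = 1"
    and inv_a: "q ((\<lambda>i. ltrans a (v i)) - (\<lambda>i h. \<zeta> i * rtrans (inv a) (v i) h)) = 0"
    and inv_b: "q ((\<lambda>i. ltrans b (v i)) - (\<lambda>i h. \<zeta>' i * rtrans (inv b) (v i) h)) = 0"
    and E: "E \<subseteq> carrier G - {\<one>}"
    and cover: "\<And>h. h \<in> carrier G \<Longrightarrow> h \<noteq> \<one> \<Longrightarrow> h \<in> E \<or> inv a \<otimes> h \<otimes> a \<in> E"
    and disj: "\<And>h. h \<in> carrier G \<Longrightarrow> h \<in> E \<Longrightarrow> b \<otimes> h \<otimes> inv b \<notin> E \<and> inv b \<otimes> h \<otimes> b \<notin> E"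
      "\<And>h. h \<in> carrier G \<Longrightarrow> b \<otimes> h \<otimes> inv b \<in> E \<Longrightarrow> inv b \<otimes> h \<otimes> b \<notin> E"
  shows "q (res (carrier G - {\<one>}) v) = 0"
proof -
  have EG: "E \<subseteq> carrier G" using E by blast
  let ?A = "{h\<in>carrier G. inv a \<otimes> h \<otimes> a \<in> E}"
  let ?B = "{h\<in>carrier G. b \<otimes> h \<otimes> inv b \<in> E}" and ?B' = "{h\<in>carrier G. inv b \<otimes> h \<otimes> b \<in> E}"
  let ?G = "carrier G - {\<one>}"
  define m where "m = q (res E v)"
  have A: "q (res ?A v) = m" using conjugation_invariant_mass'(2)[OF a v z(1) inv_a EG] by (simp add: m_def)
  have B: "q (res ?B v) = m" using conjugation_invariant_mass'(1)[OF b v z(2) inv_b EG] by (simp add: m_def)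
  have B': "q (res ?B' v) = m" using conjugation_invariant_mass'(2)[OF b v z(2) inv_b EG] by (simp add: m_def)
  have "q (res ?G v) \<le> q (res (E \<union> ?A) v)" using cover by (intro q_res_mono[OF v]) blast
  also have "\<dots> \<le> m + m" using q_res_union_le[OF v, of E ?A] A by (simp add: m_def)
  finally have upper: "q (res ?G v) \<le> 2 * m" by simp
  have one: "b \<otimes> \<one> \<otimes> inv b = \<one>" "inv b \<otimes> \<one> \<otimes> b = \<one>" using b by simp_all
  have sub: "E \<union> (?B \<union> ?B') \<subseteq> ?G" using E one by auto
  have "E \<inter> (?B \<union> ?B') = {}" "?B \<inter> ?B' = {}" using disj EG by blast+
  then have "q (res (E \<union> (?B \<union> ?B')) v) = m + (m + m)"
    by (simp add: q_res_union[OF v] B B' m_def[symmetric])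
  then have "3 * m \<le> q (res ?G v)" using q_res_mono[OF v sub] by simp
  with upper have "q (res ?G v) \<le> 0" by simp
  then show ?thesis using q_nonneg[OF res_W[OF v, of ?G]] by simp
qed

lemma concentrated_at_one:
  assumes v: "v \<in> W" and c: "q (res (carrier G - {\<one>}) v) = 0"
  shows "q (v - (\<lambda>i h. v i \<one> * delta \<one> h)) = 0"
proof -
  have "v i h = 0" if "h \<notin> carrier G" for i h using W_in[OF v, of i] that by (simp add: ell2_carrier)
  then have "v - (\<lambda>i h. v i \<one> * delta \<one> h) = res (carrier G - {\<one>}) v"
    by (auto simp: fun_diff_def fun_eq_iff res_def restrict_to_def delta_def)
  then show ?thesis using c by simp
qed

end

section \<open>Words in the free group and its circle of automorphisms\<close>

lemma F2_carrier: "w \<in> carrier F2 \<longleftrightarrow> reduced w"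
  by (simp add: free_group_def)

lemma F2_mult: "u \<otimes>\<^bsub>F2\<^esub> v = foldr cancel_cons u v"
  by (simp add: free_group_def)

lemma F2_one: "\<one>\<^bsub>F2\<^esub> = []"
  by (simp add: free_group_def)

lemma group_F2: "group F2"
  by (rule group_free_group)

lemma F2_inv_letter: "inv\<^bsub>F2\<^esub> [x] = [flip x]"
proof -
  interpret group F2 by (rule group_F2)
  show ?thesis
    by (rule inv_equality) (auto simp: F2_carrier F2_mult F2_one reduced_Cons)
qed

text \<open>The letter \<open>y\<close> does not cancel against the last letter of \<open>w\<close>, and \<open>x\<close> can cancel
  only the first letter of \<open>w\<close>.\<close>

lemma last_conjugate:
  assumes w: "reduced w" "w \<noteq> []" "fst (last w) \<noteq> fst y"
  shows "[x] \<otimes>\<^bsub>F2\<^esub> w \<otimes>\<^bsub>F2\<^esub> [y] \<noteq> []" "last ([x] \<otimes>\<^bsub>F2\<^esub> w \<otimes>\<^bsub>F2\<^esub> [y]) = y"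
proof -
  interpret group F2 by (rule group_F2)
  have "y \<noteq> flip (last w)" using w(3) by (auto simp: flip_def)
  then have "reduced (w @ [y])"
    using w(1,2) by (auto simp: reduced_def successively_append_iff)
  then have "w \<otimes>\<^bsub>F2\<^esub> [y] = w @ [y]"
    using foldr_Nil[of "w @ [y]"] by (simp add: F2_mult)
  moreover have "[x] \<otimes>\<^bsub>F2\<^esub> w \<otimes>\<^bsub>F2\<^esub> [y] = [x] \<otimes>\<^bsub>F2\<^esub> (w \<otimes>\<^bsub>F2\<^esub> [y])"
    by (rule m_assoc) (use w in \<open>auto simp: F2_carrier reduced_Cons\<close>)
  ultimately have "[x] \<otimes>\<^bsub>F2\<^esub> w \<otimes>\<^bsub>F2\<^esub> [y] = cancel_cons x (w @ [y])" by (simp add: F2_mult)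
  then show "[x] \<otimes>\<^bsub>F2\<^esub> w \<otimes>\<^bsub>F2\<^esub> [y] \<noteq> []" "last ([x] \<otimes>\<^bsub>F2\<^esub> w \<otimes>\<^bsub>F2\<^esub> [y]) = y"
    using w(2) by (cases w; simp)+
qed

definition gen :: "bool \<Rightarrow> (bool \<times> bool) list" where "gen s = [(s, True)]"

lemma gen_carrier: "gen s \<in> carrier F2"
  by (simp add: gen_def F2_carrier reduced_Cons)

definition ends_in :: "bool \<Rightarrow> (bool \<times> bool) list set" where
  "ends_in s = {w \<in> carrier F2. w \<noteq> [] \<and> fst (last w) = s}"

lemma conjugate_ends_in:
  assumes "w \<in> carrier F2" "w \<noteq> []" "w \<notin> ends_in s"
  shows "gen s \<otimes>\<^bsub>F2\<^esub> w \<otimes>\<^bsub>F2\<^esub> inv\<^bsub>F2\<^esub> (gen s) \<in> ends_in s"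
    "last (gen s \<otimes>\<^bsub>F2\<^esub> w \<otimes>\<^bsub>F2\<^esub> inv\<^bsub>F2\<^esub> (gen s)) = (s, False)"
    "inv\<^bsub>F2\<^esub> (gen s) \<otimes>\<^bsub>F2\<^esub> w \<otimes>\<^bsub>F2\<^esub> gen s \<in> ends_in s"
    "last (inv\<^bsub>F2\<^esub> (gen s) \<otimes>\<^bsub>F2\<^esub> w \<otimes>\<^bsub>F2\<^esub> gen s) = (s, True)"
proof -
  interpret group F2 by (rule group_F2)
  have w: "reduced w" "w \<noteq> []" "fst (last w) \<noteq> s"
    using assms by (auto simp: F2_carrier ends_in_def)
  have inv: "inv\<^bsub>F2\<^esub> (gen s) = [(s, False)]" by (simp add: gen_def F2_inv_letter flip_def)
  have c: "gen s \<otimes>\<^bsub>F2\<^esub> w \<otimes>\<^bsub>F2\<^esub> inv\<^bsub>F2\<^esub> (gen s) \<in> carrier F2"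
    "inv\<^bsub>F2\<^esub> (gen s) \<otimes>\<^bsub>F2\<^esub> w \<otimes>\<^bsub>F2\<^esub> gen s \<in> carrier F2"
    using assms(1) gen_carrier by simp_all
  show "last (gen s \<otimes>\<^bsub>F2\<^esub> w \<otimes>\<^bsub>F2\<^esub> inv\<^bsub>F2\<^esub> (gen s)) = (s, False)"
    "last (inv\<^bsub>F2\<^esub> (gen s) \<otimes>\<^bsub>F2\<^esub> w \<otimes>\<^bsub>F2\<^esub> gen s) = (s, True)"
    unfolding inv using w by (simp_all add: gen_def last_conjugate)
  then show "gen s \<otimes>\<^bsub>F2\<^esub> w \<otimes>\<^bsub>F2\<^esub> inv\<^bsub>F2\<^esub> (gen s) \<in> ends_in s"
    "inv\<^bsub>F2\<^esub> (gen s) \<otimes>\<^bsub>F2\<^esub> w \<otimes>\<^bsub>F2\<^esub> gen s \<in> ends_in s"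
    using c w last_conjugate(1)[of w] unfolding inv by (simp_all add: ends_in_def gen_def)
qed

definition exponent :: "(bool \<times> bool) list \<Rightarrow> int" where
  "exponent w = (\<Sum>x\<leftarrow>w. if fst x then if snd x then 1 else - 1 else 0)"

lemma exponent_cancel_cons: "exponent (cancel_cons x w) = exponent [x] + exponent w"
  by (cases w) (auto simp: exponent_def flip_def)

lemma exponent_mult: "exponent (u \<otimes>\<^bsub>F2\<^esub> v) = exponent u + exponent v"
  by (induction u) (simp_all add: F2_mult exponent_cancel_cons, simp_all add: exponent_def)

definition torus_character :: "real \<Rightarrow> (bool \<times> bool) list \<Rightarrow> complex" where
  "torus_character t w = cis (t * exponent w)"

lemma torus_character_gen: "torus_character t (gen True) = cis t" "torus_character t (gen False) = 1"
  by (simp_all add: torus_character_def exponent_def gen_def)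

interpretation F2: group_l2 F2
  by (simp add: group_l2_def group_F2)

lemma unit_character_torus: "F2.unit_character (torus_character t)"
  unfolding F2.unit_character_def
  by (simp add: torus_character_def exponent_mult cis_mult distrib_left)

interpretation L2: hilbert_space F2.L2 by (rule hilbert_space_ell2)

text \<open>The diagonal unitaries form a one-parameter group of isometries.\<close>

lemma twist_doubling:
  assumes f: "f \<in> carrier F2.L2"
  shows "hnorm F2.L2 (f \<ominus>\<^bsub>F2.L2\<^esub> F2.twist (torus_character (2 * t)) f)
    \<le> 2 * hnorm F2.L2 (f \<ominus>\<^bsub>F2.L2\<^esub> F2.twist (torus_character t) f)"
proof -
  let ?T = "F2.twist (torus_character t)"
  note T = F2.twist_in[OF unit_character_torus[of t]]
  have TT: "F2.twist (torus_character (2 * t)) f = ?T (?T f)"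
    by (auto simp: F2.twist_def torus_character_def fun_eq_iff mult.assoc[symmetric] cis_mult)
  have "hnorm F2.L2 (f \<ominus>\<^bsub>F2.L2\<^esub> ?T (?T f))
      \<le> hnorm F2.L2 (f \<ominus>\<^bsub>F2.L2\<^esub> ?T f) + hnorm F2.L2 (?T f \<ominus>\<^bsub>F2.L2\<^esub> ?T (?T f))"
    by (rule L2.hnorm_triangle3[OF f T[OF f] T[OF T[OF f]]])
  also have "?T f \<ominus>\<^bsub>F2.L2\<^esub> ?T (?T f) = ?T (f \<ominus>\<^bsub>F2.L2\<^esub> ?T f)"
    by (simp add: ell2_minus f T) (simp add: F2.twist_def algebra_simps)
  also have "hnorm F2.L2 \<dots> = hnorm F2.L2 (f \<ominus>\<^bsub>F2.L2\<^esub> ?T f)"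
    by (rule F2.hnorm_twist[OF unit_character_torus])
  finally show ?thesis unfolding TT by simp
qed

lemma ell2_tail:
  assumes f: "f \<in> carrier (ell2 S)" and e: "e > 0"
  shows "\<exists>A. finite A \<and> A \<subseteq> S \<and> hnorm (ell2 S) (restrict_to (S - A) f) < e"
proof -
  let ?n = "\<lambda>x. (cmod (f x))\<^sup>2"
  have s: "?n summable_on S" using f by (simp add: ell2_carrier)
  have "(sum ?n \<longlongrightarrow> infsum ?n S) (finite_subsets_at_top S)"
    using has_sum_infsum[OF s] by (simp add: has_sum_def)
  then have "\<forall>\<^sub>F A in finite_subsets_at_top S. infsum ?n S - e\<^sup>2 < sum ?n A"
    by (rule order_tendstoD) (use e in simp)
  then obtain A where A: "finite A" "A \<subseteq> S" "infsum ?n S - e\<^sup>2 < sum ?n A"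
    by (auto simp: eventually_finite_subsets_at_top)
  have "infsum ?n (S - A) = infsum ?n S - infsum ?n A"
    using A s by (intro infsum_Diff) (auto intro: summable_on_subset_banach)
  then have "infsum ?n (S - A) < e\<^sup>2" using A by simp
  moreover have "(\<Sum>\<^sub>\<infinity>x\<in>S. (cmod (restrict_to (S - A) f x))\<^sup>2) = infsum ?n (S - A)"
    by (rule infsum_cong_neutral) (auto simp: restrict_to_def)
  ultimately have "(hnorm (ell2 S) (restrict_to (S - A) f))\<^sup>2 < e\<^sup>2"
    by (simp add: ell2_norm restrict_to_in[OF f] infsum_nonneg)
  then have "hnorm (ell2 S) (restrict_to (S - A) f) < e"
    using e by (simp add: power_less_imp_less_base)
  then show ?thesis using A by blast
qed

text \<open>Up to a vector of small norm the function has finite support, where continuity is a matter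
  of finitely many coefficients.\<close>

lemma twist_continuous_at_0:
  assumes f: "f \<in> carrier F2.L2" and e: "e > 0"
  shows "\<forall>\<^sub>F k in sequentially. hnorm F2.L2 (f \<ominus>\<^bsub>F2.L2\<^esub> F2.twist (torus_character ((1/2) ^ k)) f) \<le> e"
proof -
  let ?S = "carrier F2" and ?T = "\<lambda>k. F2.twist (torus_character ((1/2) ^ k))"
  note T = F2.twist_in[OF unit_character_torus]
  obtain A where A: "finite A" "A \<subseteq> ?S" "hnorm F2.L2 (restrict_to (?S - A) f) < e / 3"
    using ell2_tail[OF f, of "e / 3"] e by auto
  define g where "g = restrict_to A f"
  define r where "r = restrict_to (?S - A) f"
  have gr: "g \<in> carrier F2.L2" "r \<in> carrier F2.L2" "hnorm F2.L2 r < e / 3"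
    unfolding g_def r_def by (rule restrict_to_in[OF f] A(3))+
  have fgr: "f = (\<lambda>x. g x + r x)"
    using f A(2) by (auto simp: g_def r_def restrict_to_def fun_eq_iff ell2_carrier)
  have lim: "(\<lambda>k. (hnorm F2.L2 (g \<ominus>\<^bsub>F2.L2\<^esub> ?T k g))\<^sup>2) \<longlonglongrightarrow> 0"
  proof -
    have "(hnorm F2.L2 (g \<ominus>\<^bsub>F2.L2\<^esub> ?T k g))\<^sup>2
        = (\<Sum>x\<in>A. (cmod (f x - torus_character ((1/2) ^ k) x * f x))\<^sup>2)" for k
    proof -
      have m: "g \<ominus>\<^bsub>F2.L2\<^esub> ?T k g = (\<lambda>x. g x - ?T k g x)" by (rule ell2_minus[OF gr(1) T[OF gr(1)]])
      have "(hnorm F2.L2 (g \<ominus>\<^bsub>F2.L2\<^esub> ?T k g))\<^sup>2 = (\<Sum>\<^sub>\<infinity>x\<in>?S. (cmod ((g \<ominus>\<^bsub>F2.L2\<^esub> ?T k g) x))\<^sup>2)"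
        using L2.minus_closed[OF gr(1) T[OF gr(1)]] by (simp add: ell2_norm infsum_nonneg)
      also have "\<dots> = (\<Sum>\<^sub>\<infinity>x\<in>A. (cmod (f x - torus_character ((1/2) ^ k) x * f x))\<^sup>2)"
        unfolding m by (rule infsum_cong_neutral) (use A(2) in \<open>auto simp: g_def restrict_to_def F2.twist_def\<close>)
      finally show ?thesis using A(1) by simp
    qed
    moreover have "(\<lambda>k. \<Sum>x\<in>A. (cmod (f x - torus_character ((1/2) ^ k) x * f x))\<^sup>2)
        \<longlonglongrightarrow> (\<Sum>x\<in>A. (cmod (f x - cis (0 * real_of_int (exponent x)) * f x))\<^sup>2)"
      unfolding torus_character_def
    proof (intro tendsto_sum tendsto_power tendsto_norm tendsto_diff tendsto_mult tendsto_const)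
      fix x
      have "(\<lambda>k. (1/2 :: real) ^ k * real_of_int (exponent x)) \<longlonglongrightarrow> 0 * real_of_int (exponent x)"
        by (intro tendsto_mult tendsto_const LIMSEQ_power_zero) simp
      then show "(\<lambda>k. cis ((1/2) ^ k * exponent x)) \<longlonglongrightarrow> cis (0 * real_of_int (exponent x))"
        by (rule tendsto_cis)
    qed
    ultimately show ?thesis by simp
  qed
  have "\<forall>\<^sub>F k in sequentially. (hnorm F2.L2 (g \<ominus>\<^bsub>F2.L2\<^esub> ?T k g))\<^sup>2 < (e / 3)\<^sup>2"
    by (rule order_tendstoD(2)[OF lim]) (use e in simp)
  then show ?thesis
  proof eventually_elim
    case (elim k)
    then have gk: "hnorm F2.L2 (g \<ominus>\<^bsub>F2.L2\<^esub> ?T k g) < e / 3"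
      by (rule power_less_imp_less_base) (use e in simp)
    note m = ell2_minus[OF f T[OF f]] ell2_minus[OF gr(1) T[OF gr(1)]] ell2_minus[OF gr(2) T[OF gr(2)]]
    have split: "f \<ominus>\<^bsub>F2.L2\<^esub> ?T k f = (g \<ominus>\<^bsub>F2.L2\<^esub> ?T k g) \<oplus>\<^bsub>F2.L2\<^esub> (r \<ominus>\<^bsub>F2.L2\<^esub> ?T k r)"
    proof -
      have *: "f x - c * f x = (g x - c * g x) + (r x - c * r x)" for x c
        unfolding fun_cong[OF fgr, of x] by (simp add: algebra_simps)
      show ?thesis unfolding m ell2_add unfolding F2.twist_def by (rule ext) (rule *)
    qed
    have "hnorm F2.L2 (f \<ominus>\<^bsub>F2.L2\<^esub> ?T k f)
        \<le> hnorm F2.L2 (g \<ominus>\<^bsub>F2.L2\<^esub> ?T k g) + hnorm F2.L2 (r \<ominus>\<^bsub>F2.L2\<^esub> ?T k r)"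
      unfolding split by (intro L2.hnorm_triangle L2.minus_closed gr T)
    moreover have "hnorm F2.L2 (r \<ominus>\<^bsub>F2.L2\<^esub> ?T k r) \<le> hnorm F2.L2 r + hnorm F2.L2 (?T k r)"
      by (intro L2.hnorm_triangle_minus gr T)
    moreover have "hnorm F2.L2 (?T k r) = hnorm F2.L2 r" by (rule F2.hnorm_twist[OF unit_character_torus])
    ultimately show ?case using gk gr(3) by linarith
  qed
qed

section \<open>Von Neumann algebras inside the ultrapower\<close>

text \<open>The elements of the ultrapower are cosets, that is, sets of families.  All arguments work with
  the members of these cosets: a family in \<open>\<theta> m\<close> represents \<open>m\<close>.\<close>

locale ultrapower_embedding = group_ultraproduct G U
  for G (structure) and U :: "'i filter" +
  fixes HM :: "'h hilbert" and M :: "('h \<Rightarrow> 'h) set" and \<tau> :: "('h \<Rightarrow> 'h) \<Rightarrow> complex"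
    and \<theta> :: "('h \<Rightarrow> 'h) \<Rightarrow> ('i \<Rightarrow> ('a \<Rightarrow> complex) \<Rightarrow> 'a \<Rightarrow> complex) set"
  assumes tracial: "tracial_von_neumann_algebra HM M \<tau>"
    and embedding: "tracial_embedding (operator_algebra HM M) \<tau>
      (ultrapower (group_vN_algebra G) (group_trace G) U)
      (ultrapower_trace (group_trace G) U) \<theta>"
begin

abbreviation N :: "(('a \<Rightarrow> complex) \<Rightarrow> 'a \<Rightarrow> complex) star_algebra" where "N \<equiv> group_vN_algebra G"
abbreviation J :: "('i \<Rightarrow> ('a \<Rightarrow> complex) \<Rightarrow> 'a \<Rightarrow> complex) set" where "J \<equiv> null_families N (group_trace G) U"
abbreviation A :: "('h \<Rightarrow> 'h) star_algebra" where "A \<equiv> operator_algebra HM M"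
abbreviation d1 :: "'a \<Rightarrow> complex" where "d1 \<equiv> delta \<one>"

sublocale HM: hilbert_space HM
  using tracial by (simp add: tracial_von_neumann_algebra_def von_neumann_algebra_def)

lemma d1_in: "d1 \<in> carrier L2"
  by (rule delta_in) simp

lemma N_simps:
  "mult N = compose (carrier L2)" "one N = (\<lambda>x\<in>carrier L2. x)"
  "zero N = (\<lambda>x\<in>carrier L2. \<zero>\<^bsub>L2\<^esub>)" "add N = (\<lambda>S T. \<lambda>x\<in>carrier L2. S x \<oplus>\<^bsub>L2\<^esub> T x)"
  "smult N = (\<lambda>a T. \<lambda>x\<in>carrier L2. a \<odot>\<^bsub>L2\<^esub> T x)"
  "star N = adjoint_operator L2" "nrm N = operator_norm L2"
  by (simp_all add: group_vN_algebra_def operator_algebra_def Let_def)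

lemma A_simps:
  "carrier A = M" "mult A = compose (carrier HM)" "one A = (\<lambda>x\<in>carrier HM. x)"
  "zero A = (\<lambda>x\<in>carrier HM. \<zero>\<^bsub>HM\<^esub>)" "add A = (\<lambda>S T. \<lambda>x\<in>carrier HM. S x \<oplus>\<^bsub>HM\<^esub> T x)"
  "smult A = (\<lambda>a T. \<lambda>x\<in>carrier HM. a \<odot>\<^bsub>HM\<^esub> T x)"
  "star A = adjoint_operator HM" "nrm A = operator_norm HM"
  by (simp_all add: operator_algebra_def)

lemma M_subalgebra: "star_subalgebra HM M"
  using tracial by (intro HM.star_subalgebra_von_neumann) (simp add: tracial_von_neumann_algebra_def)

lemma M_closed:
  "m \<in> M \<Longrightarrow> n \<in> M \<Longrightarrow> m \<otimes>\<^bsub>A\<^esub> n \<in> M" "m \<in> M \<Longrightarrow> n \<in> M \<Longrightarrow> m \<oplus>\<^bsub>A\<^esub> n \<in> M"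
  "m \<in> M \<Longrightarrow> a \<odot>\<^bsub>A\<^esub> m \<in> M" "m \<in> M \<Longrightarrow> star A m \<in> M" "\<one>\<^bsub>A\<^esub> \<in> M"
  using M_subalgebra by (auto simp: star_subalgebra_def A_simps)

lemma M_bounded: "m \<in> M \<Longrightarrow> m \<in> bounded_operators HM"
  using M_subalgebra by (auto simp: star_subalgebra_def)

lemma M_star:
  "m \<in> M \<Longrightarrow> star A (star A m) = m"
  "m \<in> M \<Longrightarrow> n \<in> M \<Longrightarrow> star A (m \<otimes>\<^bsub>A\<^esub> n) = star A n \<otimes>\<^bsub>A\<^esub> star A m"
  "m \<in> M \<Longrightarrow> n \<in> M \<Longrightarrow> star A (m \<oplus>\<^bsub>A\<^esub> n) = star A m \<oplus>\<^bsub>A\<^esub> star A n"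
  "m \<in> M \<Longrightarrow> star A (a \<odot>\<^bsub>A\<^esub> m) = cnj a \<odot>\<^bsub>A\<^esub> star A m"
  "star A \<one>\<^bsub>A\<^esub> = \<one>\<^bsub>A\<^esub>"
  by (simp_all add: A_simps HM.adjoint_adjoint HM.adjoint_compose HM.adjoint_add HM.adjoint_smult
      HM.adjoint_id M_bounded)

lemma vN_closed:
  "S \<in> vN \<Longrightarrow> T \<in> vN \<Longrightarrow> compose (carrier L2) S T \<in> vN"
  "S \<in> vN \<Longrightarrow> T \<in> vN \<Longrightarrow> (\<lambda>x\<in>carrier L2. S x \<oplus>\<^bsub>L2\<^esub> T x) \<in> vN"
  "T \<in> vN \<Longrightarrow> (\<lambda>x\<in>carrier L2. a \<odot>\<^bsub>L2\<^esub> T x) \<in> vN"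
  "(\<lambda>x\<in>carrier L2. x) \<in> vN"
  unfolding vN_eq using H.commutant_algebra[OF H.commutant_subset] by blast+

definition bounded_vN :: "('i \<Rightarrow> ('a \<Rightarrow> complex) \<Rightarrow> 'a \<Rightarrow> complex) \<Rightarrow> bool" where
  "bounded_vN x \<longleftrightarrow> (\<forall>i. x i \<in> vN) \<and> (\<exists>K. \<forall>i. \<forall>f\<in>carrier L2. hnorm L2 (x i f) \<le> K * hnorm L2 f)"

lemma bounded_vN_in: "bounded_vN x \<Longrightarrow> x i \<in> vN"
  by (simp add: bounded_vN_def)

lemma bounded_vN_op: "bounded_vN x \<Longrightarrow> x i \<in> bounded_operators L2"
  by (rule vN_bounded[OF bounded_vN_in])

lemma bounded_vN_bound:
  assumes "bounded_vN x"
  shows "\<exists>K>0. \<forall>i. \<forall>f\<in>carrier L2. hnorm L2 (x i f) \<le> K * hnorm L2 f"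
proof -
  obtain K where K: "\<forall>i. \<forall>f\<in>carrier L2. hnorm L2 (x i f) \<le> K * hnorm L2 f"
    using assms unfolding bounded_vN_def by blast
  have "hnorm L2 (x i f) \<le> (\<bar>K\<bar> + 1) * hnorm L2 f" if f: "f \<in> carrier L2" for i f
  proof -
    have "K * hnorm L2 f \<le> (\<bar>K\<bar> + 1) * hnorm L2 f"
      by (rule mult_right_mono[OF _ H.hnorm_nonneg[OF f]]) simp
    moreover have "hnorm L2 (x i f) \<le> K * hnorm L2 f" using K f by blast
    ultimately show ?thesis by linarith
  qed
  then show ?thesis by (intro exI[of _ "\<bar>K\<bar> + 1"]) simp
qed

lemma bounded_vN_add:
  assumes x: "bounded_vN x" and y: "bounded_vN y"
  shows "bounded_vN (\<lambda>i. \<lambda>f\<in>carrier L2. x i f \<oplus>\<^bsub>L2\<^esub> y i f)"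
proof -
  obtain K where K': "\<forall>i. \<forall>f\<in>carrier L2. hnorm L2 (x i f) \<le> K * hnorm L2 f"
    using bounded_vN_bound[OF x] by blast
  note K = K'[rule_format]
  obtain L where L': "\<forall>i. \<forall>f\<in>carrier L2. hnorm L2 (y i f) \<le> L * hnorm L2 f"
    using bounded_vN_bound[OF y] by blast
  note L = L'[rule_format]
  have "hnorm L2 (x i f \<oplus>\<^bsub>L2\<^esub> y i f) \<le> (K + L) * hnorm L2 f" if f: "f \<in> carrier L2" for i f
    using H.hnorm_triangle[OF H.op_closed[OF bounded_vN_op[OF x] f] H.op_closed[OF bounded_vN_op[OF y] f], of i i]
      K[OF f, of i] L[OF f, of i] by (simp add: algebra_simps)
  then have "\<forall>i. \<forall>f\<in>carrier L2. hnorm L2 ((\<lambda>f\<in>carrier L2. x i f \<oplus>\<^bsub>L2\<^esub> y i f) f) \<le> (K + L) * hnorm L2 f"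
    by simp
  moreover have "(\<lambda>f\<in>carrier L2. x i f \<oplus>\<^bsub>L2\<^esub> y i f) \<in> vN" for i
    by (rule vN_closed(2)[OF bounded_vN_in[OF x] bounded_vN_in[OF y]])
  ultimately show ?thesis unfolding bounded_vN_def by (intro conjI allI exI[of _ "K + L"]) simp_all
qed

lemma ell_infinity_bounded_vN:
  assumes "x \<in> carrier (ell_infinity N)" shows "bounded_vN x"
proof -
  obtain K where K: "\<And>i. x i \<in> vN" "\<And>i. operator_norm L2 (x i) \<le> K"
    using assms by (auto simp: ell_infinity_def N_simps)
  have "hnorm L2 (x i f) \<le> K * hnorm L2 f" if f: "f \<in> carrier L2" for i f
    using order_trans[OF H.operator_norm_bound[OF vN_bounded[OF K(1)] f]
        mult_right_mono[OF K(2) H.hnorm_nonneg[OF f]]] .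
  then have "\<forall>i. \<forall>f\<in>carrier L2. hnorm L2 (x i f) \<le> K * hnorm L2 f" by simp
  then show ?thesis using K(1) unfolding bounded_vN_def by (intro conjI allI exI[of _ K]) simp_all
qed

lemma J_iff: "j \<in> J \<longleftrightarrow> j \<in> carrier (ell_infinity N) \<and> ((\<lambda>i. hnorm L2 (j i d1)) \<longlongrightarrow> 0) U"
proof -
  have "(\<lambda>i. norm2 N (group_trace G) (j i)) = (\<lambda>i. hnorm L2 (j i d1))"
    if "j \<in> carrier (ell_infinity N)"
    using ell_infinity_bounded_vN[OF that] by (simp add: bounded_vN_def norm2_group_trace)
  then show ?thesis by (auto simp: null_families_def)
qed

lemma zero_in_J: "(\<lambda>i. zero N) \<in> J"
proof -
  have "(\<lambda>f\<in>carrier L2. 0 \<odot>\<^bsub>L2\<^esub> (\<lambda>x\<in>carrier L2. x) f) \<in> vN" by (intro vN_closed)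
  moreover have "(\<lambda>f\<in>carrier L2. 0 \<odot>\<^bsub>L2\<^esub> (\<lambda>x\<in>carrier L2. x) f) = zero N"
    unfolding N_simps by (intro restrict_ext) (simp add: ell2_smult ell2_zero)
  ultimately have "zero N \<in> vN" by simp
  then have "(\<lambda>i. zero N) \<in> carrier (ell_infinity N)" by (auto simp: ell_infinity_def)
  moreover have "hnorm L2 (zero N d1) = 0" by (simp add: N_simps d1_in)
  ultimately show ?thesis unfolding J_iff by simp
qed

lemma coset_iff:
  "z \<in> J +>\<^bsub>ell_infinity N\<^esub> x \<longleftrightarrow> (\<exists>j\<in>J. z = (\<lambda>i. \<lambda>f\<in>carrier L2. j i f \<oplus>\<^bsub>L2\<^esub> x i f))"
  by (auto simp: a_r_coset_def' ell_infinity_def N_simps)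

lemma mem_coset:
  assumes "\<And>i. x i \<in> bounded_operators L2" shows "x \<in> J +>\<^bsub>ell_infinity N\<^esub> x"
proof -
  have "x i = (\<lambda>f\<in>carrier L2. zero N f \<oplus>\<^bsub>L2\<^esub> x i f)" for i
  proof (rule H.op_eqI[OF assms])
    have "zero N \<in> bounded_operators L2" by (simp add: N_simps H.zero_in_bounded_operators)
    then show "(\<lambda>f\<in>carrier L2. zero N f \<oplus>\<^bsub>L2\<^esub> x i f) \<in> bounded_operators L2"
      by (rule H.add_in_bounded_operators[OF _ assms])
    show "x i f = (\<lambda>f\<in>carrier L2. zero N f \<oplus>\<^bsub>L2\<^esub> x i f) f" if "f \<in> carrier L2" for f
      using that H.op_closed[OF assms that] by (simp add: N_simps)
  qed
  then have "x = (\<lambda>i. \<lambda>f\<in>carrier L2. zero N f \<oplus>\<^bsub>L2\<^esub> x i f)" by (rule ext)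
  then show ?thesis unfolding coset_iff by (rule bexI[OF _ zero_in_J])
qed

lemma ultrapower_simps:
  "carrier (ultrapower N (group_trace G) U) = (\<Union>x\<in>carrier (ell_infinity N). {J +>\<^bsub>ell_infinity N\<^esub> x})"
  "one (ultrapower N (group_trace G) U) = J +>\<^bsub>ell_infinity N\<^esub> \<one>\<^bsub>ell_infinity N\<^esub>"
  "mult (ultrapower N (group_trace G) U) X Y =
     (\<Union>a\<in>X. \<Union>b\<in>Y. J +>\<^bsub>ell_infinity N\<^esub> (a \<otimes>\<^bsub>ell_infinity N\<^esub> b))"
  "add (ultrapower N (group_trace G) U) X Y = (\<Union>a\<in>X. \<Union>b\<in>Y. {a \<oplus>\<^bsub>ell_infinity N\<^esub> b})"
  "smult (ultrapower N (group_trace G) U) c X = (\<Union>x\<in>X. J +>\<^bsub>ell_infinity N\<^esub> (c \<odot>\<^bsub>ell_infinity N\<^esub> x))"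
  "star (ultrapower N (group_trace G) U) X = (\<Union>x\<in>X. J +>\<^bsub>ell_infinity N\<^esub> star (ell_infinity N) x)"
  by (simp_all add: ultrapower_def Let_def FactRing_def A_RCOSETS_def' rcoset_mult_def set_add_def')

lemma ell_infinity_simps:
  "one (ell_infinity N) = (\<lambda>i. \<lambda>x\<in>carrier L2. x)"
  "mult (ell_infinity N) x y = (\<lambda>i. compose (carrier L2) (x i) (y i))"
  "add (ell_infinity N) x y = (\<lambda>i. \<lambda>f\<in>carrier L2. x i f \<oplus>\<^bsub>L2\<^esub> y i f)"
  "smult (ell_infinity N) a x = (\<lambda>i. \<lambda>f\<in>carrier L2. a \<odot>\<^bsub>L2\<^esub> x i f)"
  "star (ell_infinity N) x = (\<lambda>i. adjoint_operator L2 (x i))"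
  by (simp_all add: ell_infinity_def N_simps)

lemma \<theta>_hom:
  "m \<in> M \<Longrightarrow> \<theta> m \<in> carrier (ultrapower N (group_trace G) U)"
  "m \<in> M \<Longrightarrow> n \<in> M \<Longrightarrow> \<theta> (m \<otimes>\<^bsub>A\<^esub> n) = \<theta> m \<otimes>\<^bsub>ultrapower N (group_trace G) U\<^esub> \<theta> n"
  "m \<in> M \<Longrightarrow> n \<in> M \<Longrightarrow> \<theta> (m \<oplus>\<^bsub>A\<^esub> n) = \<theta> m \<oplus>\<^bsub>ultrapower N (group_trace G) U\<^esub> \<theta> n"
  "\<theta> \<one>\<^bsub>A\<^esub> = \<one>\<^bsub>ultrapower N (group_trace G) U\<^esub>"
  "m \<in> M \<Longrightarrow> \<theta> (a \<odot>\<^bsub>A\<^esub> m) = a \<odot>\<^bsub>ultrapower N (group_trace G) U\<^esub> \<theta> m"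
  "m \<in> M \<Longrightarrow> \<theta> (star A m) = star (ultrapower N (group_trace G) U) (\<theta> m)"
  "m \<in> M \<Longrightarrow> ultrapower_trace (group_trace G) U (\<theta> m) = \<tau> m"
proof -
  have *: "\<theta> \<in> star_hom A (ultrapower N (group_trace G) U)"
    "\<And>m. m \<in> carrier A \<Longrightarrow> ultrapower_trace (group_trace G) U (\<theta> m) = \<tau> m"
    using embedding unfolding tracial_embedding_def by blast+
  then have r: "\<theta> \<in> ring_hom A (ultrapower N (group_trace G) U)" by (simp add: star_hom_def)
  have c: "m \<in> carrier A" if "m \<in> M" for m using that by (simp add: A_simps)
  show "m \<in> M \<Longrightarrow> \<theta> m \<in> carrier (ultrapower N (group_trace G) U)"
    by (rule ring_hom_closed[OF r c])
  show "m \<in> M \<Longrightarrow> n \<in> M \<Longrightarrow> \<theta> (m \<otimes>\<^bsub>A\<^esub> n) = \<theta> m \<otimes>\<^bsub>ultrapower N (group_trace G) U\<^esub> \<theta> n"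
    by (rule ring_hom_mult[OF r c c])
  show "m \<in> M \<Longrightarrow> n \<in> M \<Longrightarrow> \<theta> (m \<oplus>\<^bsub>A\<^esub> n) = \<theta> m \<oplus>\<^bsub>ultrapower N (group_trace G) U\<^esub> \<theta> n"
    by (rule ring_hom_add[OF r c c])
  show "\<theta> \<one>\<^bsub>A\<^esub> = \<one>\<^bsub>ultrapower N (group_trace G) U\<^esub>" by (rule ring_hom_one[OF r])
  show "m \<in> M \<Longrightarrow> \<theta> (a \<odot>\<^bsub>A\<^esub> m) = a \<odot>\<^bsub>ultrapower N (group_trace G) U\<^esub> \<theta> m"
    "m \<in> M \<Longrightarrow> \<theta> (star A m) = star (ultrapower N (group_trace G) U) (\<theta> m)"
    using *(1) c by (simp_all add: star_hom_def)
  show "m \<in> M \<Longrightarrow> ultrapower_trace (group_trace G) U (\<theta> m) = \<tau> m"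
    by (rule *(2)[OF c])
qed

lemma \<theta>_coset:
  assumes "m \<in> M" obtains x where "x \<in> carrier (ell_infinity N)" "\<theta> m = J +>\<^bsub>ell_infinity N\<^esub> x"
  using \<theta>_hom(1)[OF assms] unfolding ultrapower_simps by blast

lemma \<theta>_bounded_vN:
  assumes m: "m \<in> M" and z: "z \<in> \<theta> m" shows "bounded_vN z"
proof -
  obtain x where x: "x \<in> carrier (ell_infinity N)" "\<theta> m = J +>\<^bsub>ell_infinity N\<^esub> x"
    using \<theta>_coset[OF m] .
  obtain j where j: "j \<in> J" "z = (\<lambda>i. \<lambda>f\<in>carrier L2. j i f \<oplus>\<^bsub>L2\<^esub> x i f)"
    using z unfolding x(2) coset_iff by blast
  have "bounded_vN j" using j(1) ell_infinity_bounded_vN unfolding J_iff by blast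
  then show ?thesis unfolding j(2) by (rule bounded_vN_add[OF _ ell_infinity_bounded_vN[OF x(1)]])
qed

lemma \<theta>_unique:
  assumes m: "m \<in> M" and y: "y \<in> \<theta> m" and z: "z \<in> \<theta> m"
  shows "((\<lambda>i. hnorm L2 (y i d1 \<ominus>\<^bsub>L2\<^esub> z i d1)) \<longlongrightarrow> 0) U"
proof -
  obtain x where x: "x \<in> carrier (ell_infinity N)" "\<theta> m = J +>\<^bsub>ell_infinity N\<^esub> x"
    using \<theta>_coset[OF m] .
  obtain j where j: "j \<in> J" "y = (\<lambda>i. \<lambda>f\<in>carrier L2. j i f \<oplus>\<^bsub>L2\<^esub> x i f)"
    using y unfolding x(2) coset_iff by blast
  obtain k where k: "k \<in> J" "z = (\<lambda>i. \<lambda>f\<in>carrier L2. k i f \<oplus>\<^bsub>L2\<^esub> x i f)"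
    using z unfolding x(2) coset_iff by blast
  have c: "j i d1 \<in> carrier L2" "k i d1 \<in> carrier L2" "x i d1 \<in> carrier L2" for i
  proof -
    have *: "y i d1 \<in> carrier L2" if "y \<in> carrier (ell_infinity N)" for y
      by (rule H.op_closed[OF bounded_vN_op[OF ell_infinity_bounded_vN[OF that]] d1_in])
    show "j i d1 \<in> carrier L2" "k i d1 \<in> carrier L2" "x i d1 \<in> carrier L2"
      using j(1) k(1) x(1) unfolding J_iff by (simp_all add: *)
  qed
  have e: "y i d1 \<ominus>\<^bsub>L2\<^esub> z i d1 = j i d1 \<ominus>\<^bsub>L2\<^esub> k i d1" for i
  proof -
    have "y i d1 = j i d1 \<oplus>\<^bsub>L2\<^esub> x i d1" "z i d1 = k i d1 \<oplus>\<^bsub>L2\<^esub> x i d1"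
      by (simp_all add: j(2) k(2) d1_in)
    then show ?thesis using c[of i] by (intro H.vector_eqI) (simp_all add: H.ip_diff H.ip_add)
  qed
  have "((\<lambda>i. hnorm L2 (j i d1)) \<longlongrightarrow> 0) U" "((\<lambda>i. hnorm L2 (k i d1)) \<longlongrightarrow> 0) U"
    by (rule conjunct2[OF j(1)[unfolded J_iff]] conjunct2[OF k(1)[unfolded J_iff]])+
  from tendsto_add[OF this] have "((\<lambda>i. hnorm L2 (j i d1) + hnorm L2 (k i d1)) \<longlongrightarrow> 0) U" by simp
  then show ?thesis
  proof (rule Lim_null_comparison[rotated])
    have "norm (hnorm L2 (y i d1 \<ominus>\<^bsub>L2\<^esub> z i d1)) \<le> hnorm L2 (j i d1) + hnorm L2 (k i d1)" for i
      unfolding e using H.hnorm_triangle_minus[OF c(1,2), of i i]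
        H.hnorm_nonneg[OF H.minus_closed[OF c(1,2)], of i i] by simp
    then show "\<forall>\<^sub>F i in U. norm (hnorm L2 (y i d1 \<ominus>\<^bsub>L2\<^esub> z i d1)) \<le> hnorm L2 (j i d1) + hnorm L2 (k i d1)"
      by (rule always_eventually[OF allI])
  qed
qed

lemma \<theta>_nonempty: "m \<in> M \<Longrightarrow> \<theta> m \<noteq> {}"
proof -
  assume m: "m \<in> M"
  obtain x where x: "x \<in> carrier (ell_infinity N)" "\<theta> m = J +>\<^bsub>ell_infinity N\<^esub> x"
    using \<theta>_coset[OF m] .
  have "x \<in> \<theta> m" unfolding x(2) by (rule mem_coset[OF bounded_vN_op[OF ell_infinity_bounded_vN[OF x(1)]]])
  then show "\<theta> m \<noteq> {}" by blast
qed

text \<open>The operations of the ultrapower are unions of cosets, and the pointwise operations on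
  representatives land in these unions.\<close>

lemma \<theta>_ops:
  assumes m: "m \<in> M" and x: "x \<in> \<theta> m"
  shows "(\<lambda>i. \<lambda>f\<in>carrier L2. a \<odot>\<^bsub>L2\<^esub> x i f) \<in> \<theta> (a \<odot>\<^bsub>A\<^esub> m)"
    and "(\<lambda>i. adjoint_operator L2 (x i)) \<in> \<theta> (star A m)"
    and "n \<in> M \<Longrightarrow> y \<in> \<theta> n \<Longrightarrow> (\<lambda>i. compose (carrier L2) (x i) (y i)) \<in> \<theta> (m \<otimes>\<^bsub>A\<^esub> n)"
    and "n \<in> M \<Longrightarrow> y \<in> \<theta> n \<Longrightarrow> (\<lambda>i. \<lambda>f\<in>carrier L2. x i f \<oplus>\<^bsub>L2\<^esub> y i f) \<in> \<theta> (m \<oplus>\<^bsub>A\<^esub> n)"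
proof -
  note B = bounded_vN_op[OF \<theta>_bounded_vN]
  show "(\<lambda>i. \<lambda>f\<in>carrier L2. a \<odot>\<^bsub>L2\<^esub> x i f) \<in> \<theta> (a \<odot>\<^bsub>A\<^esub> m)"
    unfolding \<theta>_hom(5)[OF m] ultrapower_simps ell_infinity_simps
    by (rule UN_I[OF x], rule mem_coset, rule H.smult_in_bounded_operators[OF B[OF m x]])
  show "(\<lambda>i. adjoint_operator L2 (x i)) \<in> \<theta> (star A m)"
    unfolding \<theta>_hom(6)[OF m] ultrapower_simps ell_infinity_simps
    by (rule UN_I[OF x], rule mem_coset, rule H.adjoint_in_bounded_operators[OF B[OF m x]])
  assume n: "n \<in> M" and y: "y \<in> \<theta> n"
  show "(\<lambda>i. compose (carrier L2) (x i) (y i)) \<in> \<theta> (m \<otimes>\<^bsub>A\<^esub> n)"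
    unfolding \<theta>_hom(2)[OF m n] ultrapower_simps ell_infinity_simps
    by (rule UN_I[OF x], rule UN_I[OF y], rule mem_coset,
        rule H.compose_in_bounded_operators[OF B[OF m x] B[OF n y]])
  show "(\<lambda>i. \<lambda>f\<in>carrier L2. x i f \<oplus>\<^bsub>L2\<^esub> y i f) \<in> \<theta> (m \<oplus>\<^bsub>A\<^esub> n)"
    unfolding \<theta>_hom(3)[OF m n] ultrapower_simps ell_infinity_simps
    by (rule UN_I[OF x], rule UN_I[OF y]) simp
qed

lemma \<theta>_one: "(\<lambda>i. \<lambda>f\<in>carrier L2. f) \<in> \<theta> \<one>\<^bsub>A\<^esub>"
  unfolding \<theta>_hom(4) ultrapower_simps ell_infinity_simps
  by (rule mem_coset, rule H.id_in_bounded_operators)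

lemma \<theta>_diagonal:
  assumes T: "T \<in> vN" and d: "diagonal N (group_trace G) U ` vN \<subseteq> \<theta> ` M"
  shows "\<exists>m\<in>M. (\<lambda>i. T) \<in> \<theta> m"
proof -
  obtain m where m: "m \<in> M" "diagonal N (group_trace G) U T = \<theta> m" using T d by blast
  have "(\<lambda>i. T) \<in> diagonal N (group_trace G) U T"
    unfolding diagonal_def by (rule mem_coset) (rule vN_bounded[OF T])
  then show ?thesis using m by blast
qed

lemma \<theta>_W: assumes "m \<in> M" "x \<in> \<theta> m" shows "(\<lambda>i. x i d1) \<in> W"
proof -
  obtain K where "\<forall>i. \<forall>f\<in>carrier L2. hnorm L2 (x i f) \<le> K * hnorm L2 f"
    using bounded_vN_bound[OF \<theta>_bounded_vN[OF assms]] by blast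
  then show ?thesis
    by (intro W_I[of _ "K * hnorm L2 d1"] H.op_closed[OF bounded_vN_op[OF \<theta>_bounded_vN[OF assms]]])
      (simp_all add: d1_in)
qed

lemma d1_W: "(\<lambda>i. d1) \<in> W"
  by (rule W_I[of _ "hnorm L2 d1"]) (simp_all add: d1_in)

lemma \<theta>_trace:
  assumes m: "m \<in> M" and x: "x \<in> \<theta> m"
  shows "((\<lambda>i. ip L2 (x i d1) d1) \<longlongrightarrow> \<tau> m) U"
proof -
  have tr: "group_trace G T = ip L2 (T d1) d1" for T
    by (simp add: group_trace_def delta_def Let_def)
  define c where "c = uip (\<lambda>i. x i d1) (\<lambda>i. d1)"
  have c: "((\<lambda>i. ip L2 (x i d1) d1) \<longlongrightarrow> c) U"
    unfolding c_def by (rule uip_tendsto[OF \<theta>_W[OF m x] d1_W])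
  have all: "((\<lambda>i. group_trace G (z i)) \<longlongrightarrow> c) U" if z: "z \<in> \<theta> m" for z
  proof -
    note zc = W_in[OF \<theta>_W[OF m z]] and xc = W_in[OF \<theta>_W[OF m x]]
    have "((\<lambda>i. hnorm L2 (z i d1 \<ominus>\<^bsub>L2\<^esub> x i d1) * hnorm L2 d1) \<longlongrightarrow> 0) U"
      using tendsto_mult_left_zero[OF \<theta>_unique[OF m z x]] .
    moreover have "norm (ip L2 (z i d1) d1 - ip L2 (x i d1) d1)
        \<le> hnorm L2 (z i d1 \<ominus>\<^bsub>L2\<^esub> x i d1) * hnorm L2 d1" for i
      unfolding H.ip_diff[OF zc xc d1_in, symmetric]
      by (rule H.Cauchy_Schwarz[OF H.minus_closed[OF zc xc] d1_in])
    ultimately have "((\<lambda>i. ip L2 (z i d1) d1 - ip L2 (x i d1) d1) \<longlongrightarrow> 0) U"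
      by (rule Lim_null_comparison[OF always_eventually[OF allI], rotated])
    from tendsto_add[OF this c] show ?thesis unfolding tr by simp
  qed
  have "ultrapower_trace (group_trace G) U (\<theta> m) = c"
    unfolding ultrapower_trace_def
  proof (rule the_equality)
    show "\<forall>x\<in>\<theta> m. ((\<lambda>i. group_trace G (x i)) \<longlongrightarrow> c) U" using all by blast
    fix c' assume "\<forall>x\<in>\<theta> m. ((\<lambda>i. group_trace G (x i)) \<longlongrightarrow> c') U"
    then have "((\<lambda>i. group_trace G (x i)) \<longlongrightarrow> c') U" using x by blast
    then show "c' = c" by (rule U_unique[OF _ all[OF x]])
  qed
  then show ?thesis using c \<theta>_hom(7)[OF m] by simp
qed

end

section \<open>The twisted bimodule of an embedding\<close>

text \<open>The right action is twisted at every index by an automorphism of its own.\<close>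

locale twisted_bimodule = ultrapower_embedding G U HM M \<tau> \<theta>
  for G (structure) and U :: "'i filter" and HM :: "'h hilbert" and M \<tau>
    and \<theta> :: "('h \<Rightarrow> 'h) \<Rightarrow> ('i \<Rightarrow> ('a \<Rightarrow> complex) \<Rightarrow> 'a \<Rightarrow> complex) set" +
  fixes \<omega> :: "'i \<Rightarrow> 'a \<Rightarrow> complex"
  assumes \<omega>: "\<And>i. unit_character (\<omega> i)"
begin

text \<open>The choice does not respect the operations of the algebra.  It does so up to null families,
  which act as 0 on the bimodule.\<close>

definition rep :: "('h \<Rightarrow> 'h) \<Rightarrow> 'i \<Rightarrow> ('a \<Rightarrow> complex) \<Rightarrow> 'a \<Rightarrow> complex" where
  "rep m = (SOME x. x \<in> \<theta> m)"

lemma rep_in: "m \<in> M \<Longrightarrow> rep m \<in> \<theta> m"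
  unfolding rep_def using \<theta>_nonempty[of m] by (simp add: some_in_eq)

definition lft :: "('i \<Rightarrow> ('a \<Rightarrow> complex) \<Rightarrow> 'a \<Rightarrow> complex) \<Rightarrow> ('i \<Rightarrow> 'a \<Rightarrow> complex) \<Rightarrow> 'i \<Rightarrow> 'a \<Rightarrow> complex" where
  "lft x v = (\<lambda>i. x i (v i))"

definition rgt :: "('i \<Rightarrow> ('a \<Rightarrow> complex) \<Rightarrow> 'a \<Rightarrow> complex) \<Rightarrow> ('i \<Rightarrow> 'a \<Rightarrow> complex) \<Rightarrow> 'i \<Rightarrow> 'a \<Rightarrow> complex" where
  "rgt x v = (\<lambda>i. twisted_right (\<omega> i) (x i) (v i))"

abbreviation xi :: "'i \<Rightarrow> 'a \<Rightarrow> complex" where "xi \<equiv> (\<lambda>i. d1)"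

definition bounded_map :: "(('i \<Rightarrow> 'a \<Rightarrow> complex) \<Rightarrow> 'i \<Rightarrow> 'a \<Rightarrow> complex) \<Rightarrow> bool" where
  "bounded_map t \<longleftrightarrow> (\<forall>v\<in>W. t v \<in> W) \<and> (\<forall>v\<in>W. \<forall>w\<in>W. t (v + w) = t v + t w) \<and>
     (\<forall>a. \<forall>v\<in>W. t (scale_family a v) = scale_family a (t v)) \<and> (\<exists>C. \<forall>v\<in>W. q (t v) \<le> C\<^sup>2 * q v)"

lemma bounded_mapD:
  assumes "bounded_map t"
  shows "v \<in> W \<Longrightarrow> t v \<in> W" "v \<in> W \<Longrightarrow> w \<in> W \<Longrightarrow> t (v + w) = t v + t w"
    "v \<in> W \<Longrightarrow> t (scale_family a v) = scale_family a (t v)" "\<exists>C. \<forall>v\<in>W. q (t v) \<le> C\<^sup>2 * q v"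
    "v \<in> W \<Longrightarrow> w \<in> W \<Longrightarrow> t (v - w) = t v - t w" "t 0 = 0"
proof -
  show *: "v \<in> W \<Longrightarrow> t v \<in> W" "v \<in> W \<Longrightarrow> w \<in> W \<Longrightarrow> t (v + w) = t v + t w"
    "v \<in> W \<Longrightarrow> t (scale_family a v) = scale_family a (t v)" "\<exists>C. \<forall>v\<in>W. q (t v) \<le> C\<^sup>2 * q v" for v w a
    using assms unfolding bounded_map_def by simp_all
  show "t (v - w) = t v - t w" if "v \<in> W" "w \<in> W"
    using *(2)[OF V_diff[OF that] that(2)] by simp
  show "t 0 = 0" using *(2)[OF V_zero V_zero] by simp
qed

lemma bounded_map_diff:
  assumes s: "bounded_map s" and t: "bounded_map t" shows "bounded_map (\<lambda>v. s v - t v)"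
proof -
  obtain C where C: "\<forall>v\<in>W. q (s v) \<le> C\<^sup>2 * q v" using bounded_mapD(4)[OF s] by blast
  obtain D where D: "\<forall>v\<in>W. q (t v) \<le> D\<^sup>2 * q v" using bounded_mapD(4)[OF t] by blast
  have "q (s v - t v) \<le> (sqrt (2 * C\<^sup>2 + 2 * D\<^sup>2))\<^sup>2 * q v" if v: "v \<in> W" for v
  proof -
    have "q (s v - t v) \<le> 2 * q (s v) + 2 * q (t v)"
      by (rule q_diff_le[OF bounded_mapD(1)[OF s v] bounded_mapD(1)[OF t v]])
    also have "\<dots> \<le> 2 * (C\<^sup>2 * q v) + 2 * (D\<^sup>2 * q v)"
      using C D v by (intro add_mono mult_left_mono) auto
    finally show ?thesis by (simp add: algebra_simps)
  qed
  then have "\<exists>C. \<forall>v\<in>W. q (s v - t v) \<le> C\<^sup>2 * q v" by blast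
  moreover have "scale_family a (v - w) = scale_family a v - scale_family a w" for a and v w :: "'i \<Rightarrow> 'a \<Rightarrow> complex"
    using sc_add[of a "v - w" w] by simp
  ultimately show ?thesis
    unfolding bounded_map_def
    by (simp add: bounded_mapD(1-3)[OF s] bounded_mapD(1-3)[OF t] V_diff)
qed

lemma bounded_map_scale: "bounded_map (scale_family a)"
proof -
  have "scale_family a (scale_family b v) = scale_family b (scale_family a v)" for b and v :: "'i \<Rightarrow> 'a \<Rightarrow> complex"
    by (simp add: sc_sc mult.commute)
  moreover have "\<exists>C. \<forall>v\<in>W. q (scale_family a v) \<le> C\<^sup>2 * q v"
    by (intro exI[of _ "cmod a"]) (simp add: q_sc)
  ultimately show ?thesis unfolding bounded_map_def by (simp add: V_sc sc_add)
qed

lemma bounded_map_lft: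
  assumes x: "bounded_vN x" shows "bounded_map (lft x)"
proof -
  obtain K where K: "K > 0" "\<forall>i. \<forall>f\<in>carrier L2. hnorm L2 (x i f) \<le> K * hnorm L2 f"
    using bounded_vN_bound[OF x] by blast
  note B = bounded_vN_op[OF x]
  have norm: "hnorm L2 (lft x v i) \<le> K * hnorm L2 (v i)" if "v \<in> W" for v i
    unfolding lft_def using K(2) W_in[OF that] by blast
  have inW: "lft x v \<in> W" if v: "v \<in> W" for v
  proof -
    obtain C where "C > 0" and C: "\<And>i. hnorm L2 (v i) \<le> C" using W_bound[OF v] by blast
    show ?thesis
    proof (rule W_I)
      show "lft x v i \<in> carrier L2" for i unfolding lft_def by (rule H.op_closed[OF B W_in[OF v]])
      show "hnorm L2 (lft x v i) \<le> K * C" for i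
        using order_trans[OF norm[OF v] mult_left_mono[OF C]] K(1) by simp
    qed
  qed
  have "\<exists>C. \<forall>v\<in>W. q (lft x v) \<le> C\<^sup>2 * q v"
    using q_mono_bound[OF inW _ norm] by blast
  moreover have "lft x (v + w) = lft x v + lft x w" if "v \<in> W" "w \<in> W" for v w
    unfolding lft_def plus_fun_def using op_L2_add[OF B W_in[OF that(1)] W_in[OF that(2)]] by simp
  moreover have "lft x (scale_family a v) = scale_family a (lft x v)" if "v \<in> W" for a v
    unfolding lft_def scale_family_def using op_L2_smult[OF B W_in[OF that]] by simp
  ultimately show ?thesis unfolding bounded_map_def using inW by blast
qed

lemma bounded_map_rgt:
  assumes x: "bounded_vN x" shows "bounded_map (rgt x)"
proof -
  obtain K where K: "K > 0" "\<forall>i. \<forall>f\<in>carrier L2. hnorm L2 (x i f) \<le> K * hnorm L2 f"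
    using bounded_vN_bound[OF x] by blast
  note B = bounded_vN_op[OF x]
  have norm: "hnorm L2 (rgt x v i) \<le> K * hnorm L2 (v i)" if "v \<in> W" for v i
    unfolding rgt_def using K(2) by (intro twisted_right_bound[OF \<omega> W_in[OF that]]) blast
  have inW: "rgt x v \<in> W" if v: "v \<in> W" for v
  proof -
    obtain C where "C > 0" and C: "\<And>i. hnorm L2 (v i) \<le> C" using W_bound[OF v] by blast
    show ?thesis
    proof (rule W_I)
      show "rgt x v i \<in> carrier L2" for i unfolding rgt_def by (rule twisted_right_in[OF \<omega> B W_in[OF v]])
      show "hnorm L2 (rgt x v i) \<le> K * C" for i
        using order_trans[OF norm[OF v] mult_left_mono[OF C]] K(1) by simp
    qed
  qed
  have "\<exists>C. \<forall>v\<in>W. q (rgt x v) \<le> C\<^sup>2 * q v"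
    using q_mono_bound[OF inW _ norm] by blast
  moreover have "rgt x (v + w) = rgt x v + rgt x w" if "v \<in> W" "w \<in> W" for v w
    unfolding rgt_def plus_fun_def using twisted_right_add_arg[OF \<omega> B W_in[OF that(1)] W_in[OF that(2)]] by simp
  moreover have "rgt x (scale_family a v) = scale_family a (rgt x v)" if "v \<in> W" for a v
    unfolding rgt_def scale_family_def using twisted_right_smult_arg[OF \<omega> B W_in[OF that]] by simp
  ultimately show ?thesis unfolding bounded_map_def using inW by blast
qed

lemma lft_rgt_commute:
  assumes "bounded_vN x" "bounded_vN y" "v \<in> W"
  shows "lft x (rgt y v) = rgt y (lft x v)"
  unfolding lft_def rgt_def
  by (intro ext fun_cong[OF vN_twisted_right_commute[OF \<omega> vN_right_invariant[OF bounded_vN_in[OF assms(2)]]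
        bounded_vN_in[OF assms(1)] W_in[OF assms(3)]]])

lemma lft_compose:
  "v \<in> W \<Longrightarrow> lft (\<lambda>i. compose (carrier L2) (x i) (y i)) v = lft x (lft y v)"
  unfolding lft_def by (intro ext) (simp add: compose_eq W_in)

lemma rgt_compose:
  assumes "bounded_vN x" "bounded_vN y" "v \<in> W"
  shows "rgt (\<lambda>i. compose (carrier L2) (x i) (y i)) v = rgt x (rgt y v)"
  unfolding rgt_def
proof
  fix i
  have "twisted_right (\<omega> i) (compose (carrier L2) (x i) (y i)) (v i)
      = twisted_right (\<omega> i) (\<lambda>f. x i (y i f)) (v i)"
    by (rule twisted_right_cong[OF \<omega> W_in[OF assms(3)]]) (simp add: compose_eq)
  then show "twisted_right (\<omega> i) (compose (carrier L2) (x i) (y i)) (v i)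
      = twisted_right (\<omega> i) (x i) (twisted_right (\<omega> i) (y i) (v i))"
    using twisted_right_comp[OF \<omega> bounded_vN_op[OF assms(2)] W_in[OF assms(3)], of i "x i" i i] by simp
qed

text \<open>A map of bounded families that depends on \<open>x\<close> only through \<open>x \<delta>\<close>, boundedly.\<close>

definition factors :: "(('i \<Rightarrow> ('a \<Rightarrow> complex) \<Rightarrow> 'a \<Rightarrow> complex) \<Rightarrow> 'i \<Rightarrow> 'a \<Rightarrow> complex) \<Rightarrow> bool" where
  "factors t \<longleftrightarrow> (\<exists>C. \<forall>x y. bounded_vN x \<longrightarrow> bounded_vN y \<longrightarrow>
     t x \<in> W \<and> q (t x) \<le> C\<^sup>2 * q (lft x xi) \<and> q (t x - t y) \<le> C\<^sup>2 * q (lft x xi - lft y xi))"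

lemma factorsI:
  assumes tW: "\<And>x. bounded_vN x \<Longrightarrow> t x \<in> W"
    and norm: "\<And>x i. bounded_vN x \<Longrightarrow> hnorm L2 (t x i) \<le> C * hnorm L2 (x i d1)"
    and dist: "\<And>x y i. bounded_vN x \<Longrightarrow> bounded_vN y \<Longrightarrow>
      hnorm L2 (t x i \<ominus>\<^bsub>L2\<^esub> t y i) \<le> C * hnorm L2 (x i d1 \<ominus>\<^bsub>L2\<^esub> y i d1)"
  shows "factors t"
  unfolding factors_def
proof (intro exI[of _ C] allI impI conjI)
  fix x y assume x: "bounded_vN x" and y: "bounded_vN y"
  note lW = bounded_mapD(1)[OF bounded_map_lft d1_W]
  show "t x \<in> W" by (rule tW[OF x])
  show "q (t x) \<le> C\<^sup>2 * q (lft x xi)"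
    by (rule q_mono_bound[OF tW[OF x] lW[OF x]]) (simp add: norm[OF x] lft_def)
  show "q (t x - t y) \<le> C\<^sup>2 * q (lft x xi - lft y xi)"
  proof (rule q_mono_bound[OF V_diff[OF tW[OF x] tW[OF y]] V_diff[OF lW[OF x] lW[OF y]]])
    show "hnorm L2 ((t x - t y) i) \<le> C * hnorm L2 ((lft x xi - lft y xi) i)" for i
      unfolding diff_apply[OF tW[OF x] tW[OF y]] diff_apply[OF lW[OF x] lW[OF y]]
      using dist[OF x y, of i] by (simp add: lft_def)
  qed
qed

lemma bounded_right_multiplications:
  assumes a: "bounded_vN a"
  shows "\<exists>K R. K > 0 \<and> (\<forall>i. R i \<in> bounded_operators L2 \<and>
    (\<forall>T\<in>vN. T (a i d1) = R i (T d1)) \<and> (\<forall>f\<in>carrier L2. hnorm L2 (R i f) \<le> K * hnorm L2 f))"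
proof -
  obtain K where K: "K > 0" "\<forall>i. \<forall>f\<in>carrier L2. hnorm L2 (a i f) \<le> K * hnorm L2 f"
    using bounded_vN_bound[OF a] by blast
  have "\<exists>R. R \<in> bounded_operators L2 \<and> (\<forall>T\<in>vN. T (a i d1) = R (T d1)) \<and>
      (\<forall>f\<in>carrier L2. hnorm L2 (R f) \<le> K * hnorm L2 f)" for i
  proof -
    have "hnorm L2 (a i f) \<le> K * hnorm L2 f" if "f \<in> carrier L2" for f using K(2) that by blast
    from vN_right_multiplication[OF bounded_vN_in[OF a, of i] this]
    show ?thesis by metis
  qed
  then show ?thesis using K(1) by metis
qed

text \<open>At \<open>\<delta>\<^sub>1\<close> the left action of \<open>a\<close> agrees with a right multiplication, and \<open>x\<close> commutes with
  all right multiplications.\<close>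

lemma factors_lft:
  assumes a: "bounded_vN a" and b: "bounded_vN b"
  shows "factors (\<lambda>x. lft x (lft a (rgt b xi)))"
proof -
  obtain K R where R: "K > 0" "\<And>i. R i \<in> bounded_operators L2"
    "\<And>i T. T \<in> vN \<Longrightarrow> T (a i d1) = R i (T d1)"
    "\<And>i f. f \<in> carrier L2 \<Longrightarrow> hnorm L2 (R i f) \<le> K * hnorm L2 f"
    using bounded_right_multiplications[OF a] by metis
  obtain L where L: "L > 0" "\<forall>i. \<forall>f\<in>carrier L2. hnorm L2 (b i f) \<le> L * hnorm L2 f"
    using bounded_vN_bound[OF b] by blast
  note la = bounded_mapD(1)[OF bounded_map_lft[OF a] d1_W]
  let ?T = "\<lambda>i f. twisted_right (\<omega> i) (b i) (R i f)"
  note Bb = bounded_vN_op[OF b]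
  have eq: "lft x (lft a (rgt b xi)) i = ?T i (x i d1)" if x: "bounded_vN x" for x i
  proof -
    have "lft x (lft a (rgt b xi)) = rgt b (lft x (lft a xi))"
      unfolding lft_rgt_commute[OF a b d1_W] by (rule lft_rgt_commute[OF x b la])
    then show ?thesis by (simp add: rgt_def lft_def R(3)[OF bounded_vN_in[OF x]])
  qed
  have c: "x i d1 \<in> carrier L2" if "bounded_vN x" for x i
    by (rule H.op_closed[OF bounded_vN_op[OF that] d1_in])
  have Rc: "R i f \<in> carrier L2" if "f \<in> carrier L2" for i f by (rule H.op_closed[OF R(2) that])
  have bound: "hnorm L2 (?T i f) \<le> (L * K) * hnorm L2 f" if f: "f \<in> carrier L2" for i f
  proof -
    have "hnorm L2 (?T i f) \<le> L * hnorm L2 (R i f)"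
      using L(2) by (intro twisted_right_bound[OF \<omega> Rc[OF f]]) blast
    also have "\<dots> \<le> L * (K * hnorm L2 f)" using R(4)[OF f] L(1) by (intro mult_left_mono) auto
    finally show ?thesis by (simp add: mult.assoc)
  qed
  have diff: "?T i f \<ominus>\<^bsub>L2\<^esub> ?T i g = ?T i (f \<ominus>\<^bsub>L2\<^esub> g)" if f: "f \<in> carrier L2" and g: "g \<in> carrier L2" for i f g
  proof -
    have fg: "f \<ominus>\<^bsub>L2\<^esub> g \<in> carrier L2" by (rule H.minus_closed[OF f g])
    have "f = (\<lambda>x. (f \<ominus>\<^bsub>L2\<^esub> g) x + g x)" by (simp add: ell2_minus[OF f g])
    then have "R i f = (\<lambda>x. R i (f \<ominus>\<^bsub>L2\<^esub> g) x + R i g x)"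
      using op_L2_add[OF R(2) fg g, of i] by simp
    then have "?T i f = (\<lambda>x. ?T i (f \<ominus>\<^bsub>L2\<^esub> g) x + ?T i g x)"
      using twisted_right_add_arg[OF \<omega> Bb Rc[OF fg] Rc[OF g], of i i i i] by simp
    then show ?thesis
      unfolding ell2_minus[OF twisted_right_in[OF \<omega> Bb Rc[OF f]] twisted_right_in[OF \<omega> Bb Rc[OF g]]]
      by (intro ext) simp
  qed
  show ?thesis
  proof (rule factorsI[where C = "L * K"])
    fix x y i assume x: "bounded_vN x"
    show "lft x (lft a (rgt b xi)) \<in> W"
      by (intro bounded_mapD(1)[OF bounded_map_lft[OF x]] bounded_mapD(1)[OF bounded_map_lft[OF a]]
          bounded_mapD(1)[OF bounded_map_rgt[OF b] d1_W])
    show "hnorm L2 (lft x (lft a (rgt b xi)) i) \<le> L * K * hnorm L2 (x i d1)"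
      unfolding eq[OF x] by (rule bound[OF c[OF x]])
    assume y: "bounded_vN y"
    show "hnorm L2 (lft x (lft a (rgt b xi)) i \<ominus>\<^bsub>L2\<^esub> lft y (lft a (rgt b xi)) i)
        \<le> L * K * hnorm L2 (x i d1 \<ominus>\<^bsub>L2\<^esub> y i d1)"
      unfolding eq[OF x] eq[OF y] diff[OF c[OF x] c[OF y]]
      by (rule bound[OF H.minus_closed[OF c[OF x] c[OF y]]])
  qed
qed

lemma factors_rgt:
  assumes a: "bounded_vN a" and b: "bounded_vN b"
  shows "factors (\<lambda>x. rgt x (lft a (rgt b xi)))"
proof -
  obtain K R where R: "K > 0" "\<And>i. R i \<in> bounded_operators L2"
    "\<And>i T. T \<in> vN \<Longrightarrow> T (b i d1) = R i (T d1)"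
    "\<And>i f. f \<in> carrier L2 \<Longrightarrow> hnorm L2 (R i f) \<le> K * hnorm L2 f"
    using bounded_right_multiplications[OF b] by metis
  obtain L where L: "L > 0" "\<forall>i. \<forall>f\<in>carrier L2. hnorm L2 (a i f) \<le> L * hnorm L2 f"
    using bounded_vN_bound[OF a] by blast
  let ?J = "\<lambda>i f. twist (\<omega> i) (conj_inv f)"
  let ?T = "\<lambda>i f. a i (?J i (R i f))"
  have eq: "rgt x (lft a (rgt b xi)) i = ?T i (x i d1)" if x: "bounded_vN x" for x i
  proof -
    have rW: "rgt b xi \<in> W" by (rule bounded_mapD(1)[OF bounded_map_rgt[OF b] d1_W])
    have "rgt x (lft a (rgt b xi)) = lft a (rgt x (rgt b xi))"
      by (rule lft_rgt_commute[OF a x rW, symmetric])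
    moreover have "rgt x (rgt b xi) i = ?J i (R i (x i d1))"
    proof -
      have "rgt x (rgt b xi) i = twisted_right (\<omega> i) (\<lambda>f. x i (b i f)) d1"
        unfolding rgt_def by (rule twisted_right_comp[OF \<omega> bounded_vN_op[OF b] d1_in])
      also have "\<dots> = ?J i (x i (b i d1))"
        by (simp add: twisted_right_def twist_delta[OF unit_character_cnj[OF \<omega>]] conj_inv_delta)
      finally show ?thesis by (simp only: R(3)[OF bounded_vN_in[OF x]])
    qed
    ultimately show ?thesis by (simp add: lft_def)
  qed
  have c: "x i d1 \<in> carrier L2" if "bounded_vN x" for x i
    by (rule H.op_closed[OF bounded_vN_op[OF that] d1_in])
  have Jc: "?J i (R i f) \<in> carrier L2" if "f \<in> carrier L2" for i f
    by (intro twist_in[OF \<omega>] conj_inv_in H.op_closed[OF R(2) that])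
  have bound: "hnorm L2 (?T i f) \<le> (L * K) * hnorm L2 f" if f: "f \<in> carrier L2" for i f
  proof -
    have "hnorm L2 (?T i f) \<le> L * hnorm L2 (?J i (R i f))" using L(2) Jc[OF f] by blast
    also have "\<dots> = L * hnorm L2 (R i f)" by (simp add: hnorm_twist[OF \<omega>] hnorm_conj_inv)
    also have "\<dots> \<le> L * (K * hnorm L2 f)" using R(4)[OF f] L(1) by (intro mult_left_mono) auto
    finally show ?thesis by (simp add: mult.assoc)
  qed
  have diff: "?T i f \<ominus>\<^bsub>L2\<^esub> ?T i g = ?T i (f \<ominus>\<^bsub>L2\<^esub> g)" if f: "f \<in> carrier L2" and g: "g \<in> carrier L2" for i f g
  proof -
    have fg: "f \<ominus>\<^bsub>L2\<^esub> g \<in> carrier L2" by (rule H.minus_closed[OF f g])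
    have "f = (\<lambda>x. (f \<ominus>\<^bsub>L2\<^esub> g) x + g x)" by (simp add: ell2_minus[OF f g])
    then have "R i f = (\<lambda>x. R i (f \<ominus>\<^bsub>L2\<^esub> g) x + R i g x)"
      using op_L2_add[OF R(2) fg g, of i] by simp
    then have "?J i (R i f) = (\<lambda>x. ?J i (R i (f \<ominus>\<^bsub>L2\<^esub> g)) x + ?J i (R i g) x)"
      by (simp add: conj_inv_add twist_add)
    then have "?T i f = (\<lambda>x. ?T i (f \<ominus>\<^bsub>L2\<^esub> g) x + ?T i g x)"
      using op_L2_add[OF bounded_vN_op[OF a] Jc[OF fg] Jc[OF g], of i i i] by simp
    then show ?thesis
      unfolding ell2_minus[OF H.op_closed[OF bounded_vN_op[OF a] Jc[OF f]] H.op_closed[OF bounded_vN_op[OF a] Jc[OF g]]]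
      by (intro ext) simp
  qed
  show ?thesis
  proof (rule factorsI[where C = "L * K"])
    fix x y i assume x: "bounded_vN x"
    show "rgt x (lft a (rgt b xi)) \<in> W"
      by (intro bounded_mapD(1)[OF bounded_map_rgt[OF x]] bounded_mapD(1)[OF bounded_map_lft[OF a]]
          bounded_mapD(1)[OF bounded_map_rgt[OF b] d1_W])
    show "hnorm L2 (rgt x (lft a (rgt b xi)) i) \<le> L * K * hnorm L2 (x i d1)"
      unfolding eq[OF x] by (rule bound[OF c[OF x]])
    assume y: "bounded_vN y"
    show "hnorm L2 (rgt x (lft a (rgt b xi)) i \<ominus>\<^bsub>L2\<^esub> rgt y (lft a (rgt b xi)) i)
        \<le> L * K * hnorm L2 (x i d1 \<ominus>\<^bsub>L2\<^esub> y i d1)"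
      unfolding eq[OF x] eq[OF y] diff[OF c[OF x] c[OF y]]
      by (rule bound[OF H.minus_closed[OF c[OF x] c[OF y]]])
  qed
qed

end

(* Sums of families are not expanded pointwise from here on. *)
declare plus_fun_apply [simp del] zero_fun_apply [simp del] minus_apply [simp del]

context twisted_bimodule
begin

lemma rep_bounded: "m \<in> M \<Longrightarrow> bounded_vN (rep m)"
  by (rule \<theta>_bounded_vN[OF _ rep_in])

lemma \<theta>_null:
  assumes m: "m \<in> M" and x: "x \<in> \<theta> m" and y: "y \<in> \<theta> m"
  shows "q (lft x xi - lft y xi) = 0"
proof -
  have xW: "lft x xi \<in> W" and yW: "lft y xi \<in> W"
    unfolding lft_def by (rule \<theta>_W[OF m x], rule \<theta>_W[OF m y])
  have "((\<lambda>i. (hnorm L2 (x i d1 \<ominus>\<^bsub>L2\<^esub> y i d1))\<^sup>2) \<longlongrightarrow> 0\<^sup>2) U"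
    by (intro tendsto_power \<theta>_unique[OF m x y])
  then have "((\<lambda>i. (hnorm L2 ((lft x xi - lft y xi) i))\<^sup>2) \<longlongrightarrow> 0) U"
    unfolding diff_apply[OF xW yW] by (simp add: lft_def)
  then show ?thesis by (rule q_eqI[OF V_diff[OF xW yW]])
qed

text \<open>Two representatives of the same element differ by a family that is null in 2-norm.\<close>

lemma factors_null:
  assumes t: "factors t" and m: "m \<in> M" and x: "x \<in> \<theta> m" and y: "y \<in> \<theta> m"
  shows "q (t x - t y) = 0"
proof -
  note xb = \<theta>_bounded_vN[OF m x] and yb = \<theta>_bounded_vN[OF m y]
  obtain C where C: "\<forall>x y. bounded_vN x \<longrightarrow> bounded_vN y \<longrightarrow>
     t x \<in> W \<and> q (t x) \<le> C\<^sup>2 * q (lft x xi) \<and> q (t x - t y) \<le> C\<^sup>2 * q (lft x xi - lft y xi)"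
    using t unfolding factors_def by blast
  have "t x \<in> W" "t y \<in> W" "q (t x - t y) \<le> C\<^sup>2 * q (lft x xi - lft y xi)"
    using C xb yb by blast+
  then show ?thesis using \<theta>_null[OF m x y] q_nonneg[OF V_diff[of "t x" "t y"]] by simp
qed

lemma bounded_vN_id: "bounded_vN (\<lambda>i. \<lambda>f\<in>carrier L2. f)"
  by (rule \<theta>_bounded_vN[OF M_closed(5) \<theta>_one])

lemma lft_id: "v \<in> W \<Longrightarrow> lft (\<lambda>i. \<lambda>f\<in>carrier L2. f) v = v"
  unfolding lft_def by (intro ext) (simp add: W_in)

lemma rgt_id: "rgt (\<lambda>i. \<lambda>f\<in>carrier L2. f) xi = xi"
  unfolding rgt_def
  by (intro ext) (simp add: twisted_right_def twist_delta[OF unit_character_cnj[OF \<omega>]] conj_inv_delta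
      d1_in twist_delta[OF \<omega>])

lemma rgt_W: "bounded_vN b \<Longrightarrow> v \<in> W \<Longrightarrow> rgt b v \<in> W"
  by (rule bounded_mapD(1)[OF bounded_map_rgt])

lemma lft_W: "bounded_vN b \<Longrightarrow> v \<in> W \<Longrightarrow> lft b v \<in> W"
  by (rule bounded_mapD(1)[OF bounded_map_lft])

lemma factors_lft1: "bounded_vN b \<Longrightarrow> factors (\<lambda>x. lft x (rgt b xi))"
  using factors_lft[OF bounded_vN_id, of b] by (simp add: lft_id rgt_W d1_W)

lemma factors_rgt1: "factors (\<lambda>x. rgt x xi)"
  using factors_rgt[OF bounded_vN_id bounded_vN_id] by (simp add: rgt_id lft_id d1_W)

text \<open>The vector \<open>x \<xi> y\<close> for the pair \<open>(x, y)\<close>; the right action of \<open>y\<close> applies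
  \<open>twisted_right\<close> to a representative of \<open>y\<^sup>*\<close>.\<close>

definition orbit_vector :: "('h \<Rightarrow> 'h) \<times> ('h \<Rightarrow> 'h) \<Rightarrow> 'i \<Rightarrow> 'a \<Rightarrow> complex" where
  "orbit_vector p = lft (rep (fst p)) (rgt (rep (star A (snd p))) xi)"

definition comb :: "(('h \<Rightarrow> 'h) \<times> ('h \<Rightarrow> 'h)) list \<Rightarrow> 'i \<Rightarrow> 'a \<Rightarrow> complex" where
  "comb ps = sum_list (map orbit_vector ps)"

definition Dset :: "('i \<Rightarrow> 'a \<Rightarrow> complex) set" where
  "Dset = comb ` lists (M \<times> M)"

text \<open>The closed linear span of \<open>M \<xi> M\<close>.  It is this span, and not the whole ultraproduct,
  on which null families act as 0 and whose cardinality is controlled by \<open>M\<close>.\<close>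

definition V :: "('i \<Rightarrow> 'a \<Rightarrow> complex) set" where
  "V = approximable Dset"

lemma orbit_vector_W: "m \<in> M \<Longrightarrow> n \<in> M \<Longrightarrow> orbit_vector (m, n) \<in> W"
  unfolding orbit_vector_def by (simp add: lft_W rgt_W rep_bounded M_closed d1_W)

lemma comb_W: "ps \<in> lists (M \<times> M) \<Longrightarrow> comb ps \<in> W"
  by (induction ps rule: lists.induct) (auto simp: comb_def V_zero V_add orbit_vector_W)

lemma Dset_W: "Dset \<subseteq> W"
  unfolding Dset_def using comb_W by blast

lemma V_W: "v \<in> V \<Longrightarrow> v \<in> W"
  by (simp add: V_def approximable_def)

lemma Dset_V: "Dset \<subseteq> V"
  unfolding V_def by (rule approximable_subset[OF Dset_W])

lemma orbit_vector_Dset: "m \<in> M \<Longrightarrow> n \<in> M \<Longrightarrow> orbit_vector (m, n) \<in> Dset"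
  unfolding Dset_def by (rule image_eqI[of _ _ "[(m, n)]"]) (simp_all add: comb_def)

lemma Dset_add: "c \<in> Dset \<Longrightarrow> d \<in> Dset \<Longrightarrow> c + d \<in> Dset"
proof -
  assume "c \<in> Dset" "d \<in> Dset"
  then obtain ps qs where "ps \<in> lists (M \<times> M)" "c = comb ps" "qs \<in> lists (M \<times> M)" "d = comb qs"
    unfolding Dset_def by blast
  then show ?thesis unfolding Dset_def by (intro image_eqI[of _ _ "ps @ qs"]) (simp_all add: comb_def)
qed

lemma V_addition: "v \<in> V \<Longrightarrow> w \<in> V \<Longrightarrow> v + w \<in> V"
  unfolding V_def by (rule approximable_add[OF Dset_W Dset_add])

lemma Dset_induct [consumes 1, case_names zero add]:
  assumes "d \<in> Dset" and "P 0"
    and "\<And>m n d. m \<in> M \<Longrightarrow> n \<in> M \<Longrightarrow> d \<in> Dset \<Longrightarrow> P d \<Longrightarrow> P (orbit_vector (m, n) + d)"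
  shows "P d"
proof -
  obtain ps where ps: "ps \<in> lists (M \<times> M)" and d: "d = comb ps" using assms(1) unfolding Dset_def by blast
  from ps have "P (comb ps)"
  proof (induction ps)
    case Nil
    then show ?case using assms(2) by (simp add: comb_def)
  next
    case (Cons p ps)
    obtain m n where p: "p = (m, n)" "m \<in> M" "n \<in> M" using Cons.hyps by (cases p) auto
    have "comb (p # ps) = orbit_vector (m, n) + comb ps" by (simp add: comb_def p)
    then show ?case using assms(3)[OF p(2,3) _ Cons.IH] Cons.hyps by (simp add: Dset_def)
  qed
  then show ?thesis unfolding d .
qed

lemma zero_V: "0 \<in> V"
proof -
  have "0 \<in> Dset" unfolding Dset_def by (rule image_eqI[of _ _ "[]"]) (simp_all add: comb_def)
  then show ?thesis using Dset_V by blast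
qed

text \<open>The span of the generators is invariant under the two actions only up to null vectors, so
  invariance is proved for the closure.\<close>

lemma near_V:
  assumes "u \<in> W" "d \<in> V" "q (u - d) = 0" shows "u \<in> V"
  unfolding V_def
proof (rule approximable_closed[OF Dset_W assms(1)])
  fix e :: real assume "e > 0"
  then show "\<exists>w\<in>approximable Dset. q (u - w) < e"
    using assms(2,3) by (intro bexI[of _ d]) (simp_all add: V_def)
qed

lemma bounded_map_V:
  assumes t: "bounded_map t" and g: "\<And>m n. m \<in> M \<Longrightarrow> n \<in> M \<Longrightarrow> t (orbit_vector (m, n)) \<in> V" and v: "v \<in> V"
  shows "t v \<in> V"
proof -
  obtain C where C: "\<forall>v\<in>W. q (t v) \<le> C\<^sup>2 * q v" using bounded_mapD(4)[OF t] by blast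
  have D: "t d \<in> V" if "d \<in> Dset" for d
    using that
  proof (induction rule: Dset_induct)
    case zero
    then show ?case by (simp add: bounded_mapD(6)[OF t] zero_V)
  next
    case (add m n d)
    have "d \<in> W" using add Dset_W by blast
    then have "t (orbit_vector (m, n) + d) = t (orbit_vector (m, n)) + t d"
      by (rule bounded_mapD(2)[OF t orbit_vector_W[OF add.hyps(1,2)]])
    then show ?case using V_addition[OF g[OF add.hyps(1,2)] add.IH] by simp
  qed
  show ?thesis
    unfolding V_def
  proof (rule approximable_map[OF Dset_W, where t = t and C = C])
    show "q (t v) \<le> C\<^sup>2 * q v" if "v \<in> W" for v using C that by blast
    show "t d \<in> approximable Dset" if "d \<in> Dset" for d using D[OF that] by (simp add: V_def)
    show "v \<in> approximable Dset" using v by (simp add: V_def)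
  qed (rule bounded_mapD(1)[OF t] bounded_mapD(5)[OF t]; assumption)+
qed

lemma bounded_map_null:
  assumes t: "bounded_map t" and g: "\<And>m n. m \<in> M \<Longrightarrow> n \<in> M \<Longrightarrow> q (t (orbit_vector (m, n))) = 0" and v: "v \<in> V"
  shows "q (t v) = 0"
proof -
  obtain C where C: "\<forall>v\<in>W. q (t v) \<le> C\<^sup>2 * q v" using bounded_mapD(4)[OF t] by blast
  note tW = bounded_mapD(1)[OF t]
  have D: "q (t d) = 0" if "d \<in> Dset" for d
    using that
  proof (induction rule: Dset_induct)
    case zero
    have "q 0 = 0" using q_sc[OF V_zero, of 0] by (simp add: sc_zero)
    then show ?case by (simp add: bounded_mapD(6)[OF t])
  next
    case (add m n d)
    have d: "d \<in> W" using add Dset_W by blast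
    note gW = orbit_vector_W[OF add.hyps(1,2)]
    have "q (t (orbit_vector (m, n)) + t d) \<le> 0"
      using q_add_le[OF tW[OF gW] tW[OF d]] g[OF add.hyps(1,2)] add.IH by simp
    then show ?case
      using q_nonneg[OF V_add[OF tW[OF gW] tW[OF d]]] by (simp add: bounded_mapD(2)[OF t gW d])
  qed
  have "q (t v) \<le> 0"
  proof (rule field_le_epsilon)
    fix e :: real assume e: "e > 0"
    have C1: "2 * C\<^sup>2 + 1 > 0" by (simp add: add_nonneg_pos)
    obtain d where d: "d \<in> Dset" "q (v - d) < e / (2 * C\<^sup>2 + 1)"
      using approximableD[of v Dset "e / (2 * C\<^sup>2 + 1)"] v e C1 unfolding V_def by auto
    have dW: "d \<in> W" using d(1) Dset_W by blast
    note vd = V_diff[OF V_W[OF v] dW]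
    have "t v = t (v - d) + t d" using bounded_mapD(2)[OF t vd dW] by simp
    then have "q (t v) \<le> 2 * q (t (v - d)) + 2 * q (t d)"
      using q_add_le[OF tW[OF vd] tW[OF dW]] by simp
    also have "\<dots> \<le> 2 * (C\<^sup>2 * q (v - d))" using C vd D[OF d(1)] by simp
    also have "\<dots> \<le> (2 * C\<^sup>2 + 1) * q (v - d)" using q_nonneg[OF vd] by (simp add: algebra_simps)
    also have "\<dots> \<le> e" using d(2) C1 by (simp add: field_simps)
    finally show "q (t v) \<le> 0 + e" by simp
  qed
  then show ?thesis using q_nonneg[OF tW[OF V_W[OF v]]] by simp
qed

lemma lft_cong:
  assumes m: "m \<in> M" and x: "x \<in> \<theta> m" and y: "y \<in> \<theta> m" and v: "v \<in> V"
  shows "q (lft x v - lft y v) = 0"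
proof (rule bounded_map_null[OF bounded_map_diff[OF bounded_map_lft[OF \<theta>_bounded_vN[OF m x]]
        bounded_map_lft[OF \<theta>_bounded_vN[OF m y]]] _ v])
  fix k n assume k: "k \<in> M" and n: "n \<in> M"
  show "q (lft x (orbit_vector (k, n)) - lft y (orbit_vector (k, n))) = 0"
    using factors_null[OF factors_lft[OF rep_bounded[OF k] rep_bounded[OF M_closed(4)[OF n]]] m x y]
    by (simp add: orbit_vector_def)
qed

lemma rgt_cong:
  assumes m: "m \<in> M" and x: "x \<in> \<theta> m" and y: "y \<in> \<theta> m" and v: "v \<in> V"
  shows "q (rgt x v - rgt y v) = 0"
proof (rule bounded_map_null[OF bounded_map_diff[OF bounded_map_rgt[OF \<theta>_bounded_vN[OF m x]]
        bounded_map_rgt[OF \<theta>_bounded_vN[OF m y]]] _ v])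
  fix k n assume k: "k \<in> M" and n: "n \<in> M"
  show "q (rgt x (orbit_vector (k, n)) - rgt y (orbit_vector (k, n))) = 0"
    using factors_null[OF factors_rgt[OF rep_bounded[OF k] rep_bounded[OF M_closed(4)[OF n]]] m x y]
    by (simp add: orbit_vector_def)
qed

lemma lft_V:
  assumes k: "k \<in> M" and x: "x \<in> \<theta> k" and v: "v \<in> V"
  shows "lft x v \<in> V"
proof (rule bounded_map_V[OF bounded_map_lft[OF \<theta>_bounded_vN[OF k x]] _ v])
  fix m n assume m: "m \<in> M" and n: "n \<in> M"
  let ?w = "rgt (rep (star A n)) xi"
  note nb = rep_bounded[OF M_closed(4)[OF n]]
  have w: "?w \<in> W" by (rule rgt_W[OF nb d1_W])
  have km: "k \<otimes>\<^bsub>A\<^esub> m \<in> M" by (rule M_closed(1)[OF k m])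
  have eq: "lft x (orbit_vector (m, n)) = lft (\<lambda>i. compose (carrier L2) (x i) (rep m i)) ?w"
    by (simp add: orbit_vector_def lft_compose[OF w])
  show "lft x (orbit_vector (m, n)) \<in> V"
  proof (rule near_V)
    show "lft x (orbit_vector (m, n)) \<in> W" by (rule lft_W[OF \<theta>_bounded_vN[OF k x] orbit_vector_W[OF m n]])
    show "orbit_vector (k \<otimes>\<^bsub>A\<^esub> m, n) \<in> V" using orbit_vector_Dset[OF km n] Dset_V by blast
    show "q (lft x (orbit_vector (m, n)) - orbit_vector (k \<otimes>\<^bsub>A\<^esub> m, n)) = 0"
      using factors_null[OF factors_lft1[OF nb] km \<theta>_ops(3)[OF k x m rep_in[OF m]] rep_in[OF km]]
      by (simp add: eq) (simp add: orbit_vector_def)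
  qed
qed

text \<open>A right action on a generator \<open>x \<xi> y\<close> changes \<open>y\<close>, but first it has to be moved past
  the left action of \<open>x\<close>.\<close>

lemma rgt_V:
  assumes k: "k \<in> M" and x: "x \<in> \<theta> k" and v: "v \<in> V"
  shows "rgt x v \<in> V"
proof (rule bounded_map_V[OF bounded_map_rgt[OF \<theta>_bounded_vN[OF k x]] _ v])
  fix m n assume m: "m \<in> M" and n: "n \<in> M"
  note xb = \<theta>_bounded_vN[OF k x]
  have n': "star A n \<in> M" by (rule M_closed(4)[OF n])
  have nk: "n \<otimes>\<^bsub>A\<^esub> star A k \<in> M" by (rule M_closed(1)[OF n M_closed(4)[OF k]])
  have st: "star A (n \<otimes>\<^bsub>A\<^esub> star A k) = k \<otimes>\<^bsub>A\<^esub> star A n"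
    using M_star(2)[OF n M_closed(4)[OF k]] M_star(1)[OF k] by simp
  have kn: "k \<otimes>\<^bsub>A\<^esub> star A n \<in> M" by (rule M_closed(1)[OF k n'])
  let ?c = "\<lambda>i. compose (carrier L2) (x i) (rep (star A n) i)"
  note c = \<theta>_ops(3)[OF k x n' rep_in[OF n']]
  have w: "rgt (rep (star A n)) xi \<in> W" by (rule rgt_W[OF rep_bounded[OF n'] d1_W])
  have u: "rgt ?c xi \<in> W" "rgt (rep (k \<otimes>\<^bsub>A\<^esub> star A n)) xi \<in> W"
    by (rule rgt_W[OF \<theta>_bounded_vN[OF kn c] d1_W], rule rgt_W[OF rep_bounded[OF kn] d1_W])
  have eq: "rgt x (orbit_vector (m, n)) = lft (rep m) (rgt ?c xi)"
    using lft_rgt_commute[OF rep_bounded[OF m] xb w] rgt_compose[OF xb rep_bounded[OF n'] d1_W]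
    by (simp add: orbit_vector_def)
  have eq': "orbit_vector (m, n \<otimes>\<^bsub>A\<^esub> star A k) = lft (rep m) (rgt (rep (k \<otimes>\<^bsub>A\<^esub> star A n)) xi)"
    by (simp add: orbit_vector_def st)
  note lb = bounded_map_lft[OF rep_bounded[OF m]]
  obtain C where C: "\<forall>v\<in>W. q (lft (rep m) v) \<le> C\<^sup>2 * q v" using bounded_mapD(4)[OF lb] by blast
  have "q (rgt ?c xi - rgt (rep (k \<otimes>\<^bsub>A\<^esub> star A n)) xi) = 0"
    by (rule factors_null[OF factors_rgt1 kn c rep_in[OF kn]])
  then have "q (lft (rep m) (rgt ?c xi - rgt (rep (k \<otimes>\<^bsub>A\<^esub> star A n)) xi)) \<le> 0"
    using C V_diff[OF u] by fastforce
  then have null: "q (rgt x (orbit_vector (m, n)) - orbit_vector (m, n \<otimes>\<^bsub>A\<^esub> star A k)) = 0"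
    using q_nonneg[OF bounded_mapD(1)[OF lb V_diff[OF u]]]
    unfolding eq eq' bounded_mapD(5)[OF lb u, symmetric] by linarith
  show "rgt x (orbit_vector (m, n)) \<in> V"
  proof (rule near_V[OF _ _ null])
    show "rgt x (orbit_vector (m, n)) \<in> W" by (rule rgt_W[OF xb orbit_vector_W[OF m n]])
    show "orbit_vector (m, n \<otimes>\<^bsub>A\<^esub> star A k) \<in> V" using orbit_vector_Dset[OF m nk] Dset_V by blast
  qed
qed

lemma lft_smult:
  "lft (\<lambda>i. \<lambda>f\<in>carrier L2. a \<odot>\<^bsub>L2\<^esub> x i f) v = scale_family a (lft x v)" if "v \<in> W"
  unfolding lft_def scale_family_def by (intro ext) (simp add: W_in[OF that] ell2_smult)

lemma lft_add:
  "lft (\<lambda>i. \<lambda>f\<in>carrier L2. x i f \<oplus>\<^bsub>L2\<^esub> y i f) v = lft x v + lft y v" if "v \<in> W"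
  unfolding lft_def plus_fun_def by (intro ext) (simp add: W_in[OF that] ell2_add)

lemma rgt_smult:
  "rgt (\<lambda>i. \<lambda>f\<in>carrier L2. a \<odot>\<^bsub>L2\<^esub> x i f) v = scale_family (cnj a) (rgt x v)" if "v \<in> W"
  unfolding rgt_def scale_family_def
proof (intro ext)
  fix i h
  have "twisted_right (\<omega> i) (\<lambda>f\<in>carrier L2. a \<odot>\<^bsub>L2\<^esub> x i f) (v i) = twisted_right (\<omega> i) (\<lambda>f h. a * x i f h) (v i)"
    by (rule twisted_right_cong[OF \<omega> W_in[OF that]]) (simp add: ell2_smult)
  then show "twisted_right (\<omega> i) (\<lambda>f\<in>carrier L2. a \<odot>\<^bsub>L2\<^esub> x i f) (v i) h = cnj a * twisted_right (\<omega> i) (x i) (v i) h"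
    by (simp add: twisted_right_smult)
qed

lemma rgt_add:
  "rgt (\<lambda>i. \<lambda>f\<in>carrier L2. x i f \<oplus>\<^bsub>L2\<^esub> y i f) v = rgt x v + rgt y v" if "v \<in> W"
  unfolding rgt_def plus_fun_def
proof (intro ext)
  fix i h
  have "twisted_right (\<omega> i) (\<lambda>f\<in>carrier L2. x i f \<oplus>\<^bsub>L2\<^esub> y i f) (v i) = twisted_right (\<omega> i) (\<lambda>f h. x i f h + y i f h) (v i)"
    by (rule twisted_right_cong[OF \<omega> W_in[OF that]]) (simp add: ell2_add)
  then show "twisted_right (\<omega> i) (\<lambda>f\<in>carrier L2. x i f \<oplus>\<^bsub>L2\<^esub> y i f) (v i) h =
      twisted_right (\<omega> i) (x i) (v i) h + twisted_right (\<omega> i) (y i) (v i) h"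
    by (simp add: twisted_right_add)
qed

lemma V_scale: "v \<in> V \<Longrightarrow> scale_family a v \<in> V"
proof (rule bounded_map_V[OF bounded_map_scale])
  fix m n assume m: "m \<in> M" and n: "n \<in> M"
  note nb = rep_bounded[OF M_closed(4)[OF n]] and am = M_closed(3)[OF m, of a]
  have w: "rgt (rep (star A n)) xi \<in> W" by (rule rgt_W[OF nb d1_W])
  show "scale_family a (orbit_vector (m, n)) \<in> V"
  proof (rule near_V)
    show "scale_family a (orbit_vector (m, n)) \<in> W" by (rule W_scale[OF orbit_vector_W[OF m n]])
    show "orbit_vector (a \<odot>\<^bsub>A\<^esub> m, n) \<in> V" using orbit_vector_Dset[OF am n] Dset_V by blast
    show "q (scale_family a (orbit_vector (m, n)) - orbit_vector (a \<odot>\<^bsub>A\<^esub> m, n)) = 0"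
      using factors_null[OF factors_lft1[OF nb] am \<theta>_ops(1)[OF m rep_in[OF m]] rep_in[OF am]]
      by (simp add: lft_smult[OF w]) (simp add: orbit_vector_def)
  qed
qed

lemma lft_adjoint:
  assumes x: "bounded_vN x" and v: "v \<in> W" and w: "w \<in> W"
  shows "uip (lft x v) w = uip v (lft (\<lambda>i. adjoint_operator L2 (x i)) w)"
  unfolding uip_def lft_def using H.ip_adjoint[OF bounded_vN_op[OF x] W_in[OF v] W_in[OF w]] by simp

lemma rgt_adjoint:
  assumes x: "bounded_vN x" and v: "v \<in> W" and w: "w \<in> W"
  shows "uip (rgt x v) w = uip v (rgt (\<lambda>i. adjoint_operator L2 (x i)) w)"
  unfolding uip_def rgt_def using twisted_right_ip[OF \<omega> bounded_vN_op[OF x] W_in[OF v] W_in[OF w]] by simp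

end

section \<open>Realization as a normal bimodule\<close>

text \<open>A list of pairs is spread over positions in blocks of three; the first position of a block
  tells whether the list goes on.\<close>

definition list_code :: "'b \<Rightarrow> 'b \<Rightarrow> ('b \<times> 'b) list \<Rightarrow> nat \<Rightarrow> 'b" where
  "list_code z0 z1 ps k =
     (if k div 3 < length ps
      then if k mod 3 = 0 then z1 else if k mod 3 = 1 then fst (ps ! (k div 3)) else snd (ps ! (k div 3))
      else z0)"

lemma list_code_inject:
  assumes z: "z0 \<noteq> z1" and eq: "list_code z0 z1 ps = list_code z0 z1 qs"
  shows "ps = qs"
proof -
  have code: "list_code z0 z1 ps (3 * j) = (if j < length ps then z1 else z0)"
    "list_code z0 z1 ps (3 * j + 1) = (if j < length ps then fst (ps ! j) else z0)"
    "list_code z0 z1 ps (3 * j + 2) = (if j < length ps then snd (ps ! j) else z0)" for ps j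
  proof -
    have "(3 * j + 1) div 3 = j" "(3 * j + 2) div 3 = j" "(3 * j + 1) mod 3 = 1" "(3 * j + 2) mod 3 = 2"
      by presburger+
    then show "list_code z0 z1 ps (3 * j) = (if j < length ps then z1 else z0)"
      "list_code z0 z1 ps (3 * j + 1) = (if j < length ps then fst (ps ! j) else z0)"
      "list_code z0 z1 ps (3 * j + 2) = (if j < length ps then snd (ps ! j) else z0)"
      by (simp_all only: list_code_def) simp_all
  qed
  have less: "j < length ps \<longleftrightarrow> j < length qs" for j
    using fun_cong[OF eq, of "3 * j"] z unfolding code by (simp split: if_splits)
  then have "length ps = length qs" by (metis linorder_neqE_nat less_irrefl)
  then show ?thesis
  proof (rule nth_equalityI)
    fix j assume j: "j < length ps"
    then have j': "j < length qs" using less by simp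
    show "ps ! j = qs ! j"
      using fun_cong[OF eq, of "3 * j + 1"] fun_cong[OF eq, of "3 * j + 2"] j j' unfolding code
      by (simp add: prod_eq_iff)
  qed
qed

context twisted_bimodule
begin

lemma \<tau>_state: "faithful_normal_tracial_state A \<tau>"
  using tracial by (simp add: tracial_von_neumann_algebra_def)

lemma zero_neq_one: "zero A \<noteq> one A"
proof
  assume eq: "zero A = one A"
  have "0 \<odot>\<^bsub>A\<^esub> one A = zero A"
    unfolding A_simps by (intro restrict_ext HM.vector_eqI) (simp_all add: HM.ip_smult)
  moreover have "\<tau> (0 \<odot>\<^bsub>A\<^esub> one A) = 0 * \<tau> (one A)" "\<tau> (one A) = 1"
    using \<tau>_state M_closed(5) by (simp_all add: faithful_normal_tracial_state_def A_simps(1))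
  ultimately show False using eq by simp
qed

definition choice :: "('i \<Rightarrow> 'a \<Rightarrow> complex) \<Rightarrow> nat \<Rightarrow> (('h \<Rightarrow> 'h) \<times> ('h \<Rightarrow> 'h)) list" where
  "choice v n = (SOME ps. ps \<in> lists (M \<times> M) \<and> q (v - comb ps) < 1 / (real n + 1))"

lemma choice:
  assumes v: "v \<in> V"
  shows "choice v n \<in> lists (M \<times> M)" "q (v - comb (choice v n)) < 1 / (real n + 1)"
proof -
  have "(1 :: real) / (real n + 1) > 0" by simp
  then obtain d where "d \<in> Dset" "q (v - d) < 1 / (real n + 1)"
    using approximableD[of v Dset] v unfolding V_def by blast
  then have "\<exists>ps. ps \<in> lists (M \<times> M) \<and> q (v - comb ps) < 1 / (real n + 1)"
    unfolding Dset_def by blast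
  from someI_ex[OF this] show "choice v n \<in> lists (M \<times> M)" "q (v - comb (choice v n)) < 1 / (real n + 1)"
    unfolding choice_def by simp_all
qed

text \<open>For every \<open>n\<close> a list of pairs is chosen whose combination is \<open>1/(n+1)\<close>-close to \<open>v\<close> in
  squared seminorm.  The set to choose from depends on \<open>v\<close> only modulo null vectors, and the
  choices for all \<open>n\<close> determine \<open>v\<close> modulo null vectors.\<close>

definition code :: "('i \<Rightarrow> 'a \<Rightarrow> complex) \<Rightarrow> nat \<Rightarrow> 'h \<Rightarrow> 'h" where
  "code v = (\<lambda>k. list_code (zero A) (one A) (choice v (fst (prod_decode k))) (snd (prod_decode k)))"

lemma code_eq_iff:
  assumes v: "v \<in> V" and w: "w \<in> V"
  shows "code v = code w \<longleftrightarrow> q (v - w) = 0"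
proof
  assume eq: "code v = code w"
  have "choice v n = choice w n" for n
  proof (rule list_code_inject[OF zero_neq_one], rule ext)
    fix j
    show "list_code (zero A) (one A) (choice v n) j = list_code (zero A) (one A) (choice w n) j"
      using fun_cong[OF eq, of "prod_encode (n, j)"] by (simp add: code_def)
  qed
  then have bound: "q (v - w) \<le> 4 / (real n + 1)" for n
  proof -
    let ?d = "comb (choice v n)"
    have d: "?d \<in> W" by (rule comb_W[OF choice(1)[OF v]])
    have "q (v - w) \<le> 2 * q (v - ?d) + 2 * q (?d - w)" by (rule q_triangle[OF V_W[OF v] d V_W[OF w]])
    also have "q (?d - w) = q (w - ?d)" by (rule q_commute[OF d V_W[OF w]])
    finally show ?thesis
      using choice(2)[OF v, of n] choice(2)[OF w, of n] \<open>\<And>n. choice v n = choice w n\<close>[of n] by simp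
  qed
  have "q (v - w) \<le> 0"
  proof (rule field_le_epsilon)
    fix e :: real assume e: "e > 0"
    obtain n :: nat where "4 / e < real n" using reals_Archimedean2 by blast
    then have "4 / (real n + 1) \<le> e" using e by (simp add: field_simps)
    then show "q (v - w) \<le> 0 + e" using bound[of n] by simp
  qed
  then show "q (v - w) = 0" using q_nonneg[OF V_diff[OF V_W[OF v] V_W[OF w]]] by simp
next
  assume null: "q (v - w) = 0"
  have *: "q (v - comb ps) = q (w - comb ps)" if "ps \<in> lists (M \<times> M)" for ps
  proof (rule q_null_add(1))
    show "v - comb ps \<in> W" "w - comb ps \<in> W"
      by (rule V_diff[OF V_W[OF v] comb_W[OF that]], rule V_diff[OF V_W[OF w] comb_W[OF that]])
    have "(v - comb ps) - (w - comb ps) = v - w" by simp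
    then show "q ((v - comb ps) - (w - comb ps)) = 0" using null by simp
  qed
  have "choice v n = choice w n" for n
    unfolding choice_def by (rule arg_cong[where f = Eps], rule ext, rule conj_cong[OF refl], simp only: *)
  then show "code v = code w" by (simp add: code_def)
qed

sublocale VV: realized_semi_inner_product V scale_family uip code
proof unfold_locales
  show "0 \<in> V" by (rule zero_V)
  show "v + w \<in> V" if "v \<in> V" "w \<in> V" for v w by (rule V_addition[OF that])
  show "scale_family a v \<in> V" if "v \<in> V" for v a by (rule V_scale[OF that])
  show "scale_family a (v + w) = scale_family a v + scale_family a w" for a and v w :: "'i \<Rightarrow> 'a \<Rightarrow> complex"
    by (rule sc_add)
  show "scale_family (a + b) v = scale_family a v + scale_family b v" for a b and v :: "'i \<Rightarrow> 'a \<Rightarrow> complex"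
    by (rule sc_add_left)
  show "scale_family a (scale_family b v) = scale_family (a * b) v" for a b and v :: "'i \<Rightarrow> 'a \<Rightarrow> complex"
    by (rule sc_sc)
  show "scale_family 1 v = v" for v :: "'i \<Rightarrow> 'a \<Rightarrow> complex" by (rule sc_one)
  show "uip (u + v) w = uip u w + uip v w" if "u \<in> V" "v \<in> V" "w \<in> V" for u v w
    by (rule B_add[OF V_W[OF that(1)] V_W[OF that(2)] V_W[OF that(3)]])
  show "uip (scale_family a v) w = a * uip v w" if "v \<in> V" "w \<in> V" for v w a
    by (rule B_sc[OF V_W[OF that(1)] V_W[OF that(2)]])
  show "uip w v = cnj (uip v w)" if "v \<in> V" "w \<in> V" for v w
    by (rule B_cnj[OF V_W[OF that(1)] V_W[OF that(2)]])
  show "0 \<le> Re (uip v v)" if "v \<in> V" for v by (rule B_pos[OF V_W[OF that]])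
qed (rule code_eq_iff, assumption+, unfold V_def, rule approximable_complete[OF Dset_W], assumption+)

abbreviation K :: "(nat \<Rightarrow> 'h \<Rightarrow> 'h) hilbert" where "K \<equiv> VV.realization"

sublocale K: hilbert_space K by (rule VV.hilbert_space_realization)

lemma K_carrier: "carrier K = code ` V" by (rule VV.realization_carrier)

lemma code_cong: "v \<in> V \<Longrightarrow> w \<in> V \<Longrightarrow> q (v - w) = 0 \<Longrightarrow> code v = code w"
  by (simp add: code_eq_iff)

lemma realize_bounded_map:
  assumes t: "bounded_map t" and V: "\<And>v. v \<in> V \<Longrightarrow> t v \<in> V"
  shows "v \<in> V \<Longrightarrow> VV.realize_op t (code v) = code (t v)"
    and "VV.realize_op t \<in> bounded_operators K"
proof -
  obtain C where C: "\<forall>v\<in>W. q (t v) \<le> C\<^sup>2 * q v" using bounded_mapD(4)[OF t] by blast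
  have b: "q (t v) \<le> C\<^sup>2 * q v" if "v \<in> V" for v using C V_W[OF that] by blast
  show "v \<in> V \<Longrightarrow> VV.realize_op t (code v) = code (t v)"
    by (rule VV.realize_op_code[where t = t, OF V bounded_mapD(2)[OF t V_W V_W] bounded_mapD(3)[OF t V_W] b])
  show "VV.realize_op t \<in> bounded_operators K"
    by (rule VV.realize_op_in[where t = t, OF V bounded_mapD(2)[OF t V_W V_W] bounded_mapD(3)[OF t V_W] b])
qed

definition lop :: "('h \<Rightarrow> 'h) \<Rightarrow> (nat \<Rightarrow> 'h \<Rightarrow> 'h) \<Rightarrow> nat \<Rightarrow> 'h \<Rightarrow> 'h" where
  "lop m = VV.realize_op (lft (rep m))"

definition rop :: "('h \<Rightarrow> 'h) \<Rightarrow> (nat \<Rightarrow> 'h \<Rightarrow> 'h) \<Rightarrow> nat \<Rightarrow> 'h \<Rightarrow> 'h" where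
  "rop m = VV.realize_op (rgt (rep (star A m)))"

lemma lop_code:
  assumes m: "m \<in> M" and x: "x \<in> \<theta> m" and v: "v \<in> V"
  shows "lop m (code v) = code (lft x v)"
proof -
  have "lop m (code v) = code (lft (rep m) v)"
    unfolding lop_def by (rule realize_bounded_map(1)[OF bounded_map_lft[OF rep_bounded[OF m]] lft_V[OF m rep_in[OF m]] v])
  also have "\<dots> = code (lft x v)"
    by (intro code_cong lft_V[OF m rep_in[OF m] v] lft_V[OF m x v] lft_cong[OF m rep_in[OF m] x v])
  finally show ?thesis .
qed

lemma rop_code:
  assumes m: "m \<in> M" and x: "x \<in> \<theta> (star A m)" and v: "v \<in> V"
  shows "rop m (code v) = code (rgt x v)"
proof -
  note m' = M_closed(4)[OF m]
  have "rop m (code v) = code (rgt (rep (star A m)) v)"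
    unfolding rop_def by (rule realize_bounded_map(1)[OF bounded_map_rgt[OF rep_bounded[OF m']] rgt_V[OF m' rep_in[OF m']] v])
  also have "\<dots> = code (rgt x v)"
    by (intro code_cong rgt_V[OF m' rep_in[OF m'] v] rgt_V[OF m' x v] rgt_cong[OF m' rep_in[OF m'] x v])
  finally show ?thesis .
qed

lemma lop_in: "m \<in> M \<Longrightarrow> lop m \<in> bounded_operators K"
  unfolding lop_def by (rule realize_bounded_map(2)[OF bounded_map_lft[OF rep_bounded] lft_V[OF _ rep_in]])

lemma rop_in: "m \<in> M \<Longrightarrow> rop m \<in> bounded_operators K"
  unfolding rop_def
  by (rule realize_bounded_map(2)[OF bounded_map_rgt[OF rep_bounded[OF M_closed(4)]]
        rgt_V[OF M_closed(4) rep_in[OF M_closed(4)]]])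

lemma K_op_eqI:
  assumes "S \<in> bounded_operators K" "T \<in> bounded_operators K"
    and "\<And>v. v \<in> V \<Longrightarrow> S (code v) = T (code v)"
  shows "S = T"
  by (rule K.op_eqI[OF assms(1,2)]) (use assms(3) in \<open>auto simp: K_carrier\<close>)

lemma code_in: "v \<in> V \<Longrightarrow> code v \<in> carrier K"
  by (simp add: K_carrier)

lemma B_simps:
  "carrier (all_operators K) = bounded_operators K" "mult (all_operators K) = compose (carrier K)"
  "one (all_operators K) = (\<lambda>x\<in>carrier K. x)"
  "add (all_operators K) = (\<lambda>S T. \<lambda>x\<in>carrier K. S x \<oplus>\<^bsub>K\<^esub> T x)"
  "smult (all_operators K) = (\<lambda>a T. \<lambda>x\<in>carrier K. a \<odot>\<^bsub>K\<^esub> T x)"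
  "star (all_operators K) = adjoint_operator K"
  by (simp_all add: operator_algebra_def)

lemma lop_hom: "lop \<in> star_hom A (all_operators K)"
proof -
  have mult: "lop (m \<otimes>\<^bsub>A\<^esub> n) = compose (carrier K) (lop m) (lop n)" if m: "m \<in> M" and n: "n \<in> M" for m n
  proof (rule K_op_eqI[OF lop_in[OF M_closed(1)[OF m n]] K.compose_in_bounded_operators[OF lop_in[OF m] lop_in[OF n]]])
    fix v assume v: "v \<in> V"
    show "lop (m \<otimes>\<^bsub>A\<^esub> n) (code v) = compose (carrier K) (lop m) (lop n) (code v)"
      unfolding lop_code[OF M_closed(1)[OF m n] \<theta>_ops(3)[OF m rep_in[OF m] n rep_in[OF n]] v]
        compose_eq[OF code_in[OF v]] lop_code[OF n rep_in[OF n] v]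
        lop_code[OF m rep_in[OF m] lft_V[OF n rep_in[OF n] v]] lft_compose[OF V_W[OF v]] ..
  qed
  have add: "lop (m \<oplus>\<^bsub>A\<^esub> n) = (\<lambda>x\<in>carrier K. lop m x \<oplus>\<^bsub>K\<^esub> lop n x)" if m: "m \<in> M" and n: "n \<in> M" for m n
  proof (rule K_op_eqI[OF lop_in[OF M_closed(2)[OF m n]] K.add_in_bounded_operators[OF lop_in[OF m] lop_in[OF n]]])
    fix v assume v: "v \<in> V"
    show "lop (m \<oplus>\<^bsub>A\<^esub> n) (code v) = (\<lambda>x\<in>carrier K. lop m x \<oplus>\<^bsub>K\<^esub> lop n x) (code v)"
      unfolding lop_code[OF M_closed(2)[OF m n] \<theta>_ops(4)[OF m rep_in[OF m] n rep_in[OF n]] v]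
        restrict_apply'[OF code_in[OF v]] lop_code[OF n rep_in[OF n] v] lop_code[OF m rep_in[OF m] v]
        lft_add[OF V_W[OF v]] VV.realization_add[OF lft_V[OF m rep_in[OF m] v] lft_V[OF n rep_in[OF n] v]] ..
  qed
  have smult: "lop (a \<odot>\<^bsub>A\<^esub> m) = (\<lambda>x\<in>carrier K. a \<odot>\<^bsub>K\<^esub> lop m x)" if m: "m \<in> M" for m a
  proof (rule K_op_eqI[OF lop_in[OF M_closed(3)[OF m]] K.smult_in_bounded_operators[OF lop_in[OF m]]])
    fix v assume v: "v \<in> V"
    show "lop (a \<odot>\<^bsub>A\<^esub> m) (code v) = (\<lambda>x\<in>carrier K. a \<odot>\<^bsub>K\<^esub> lop m x) (code v)"
      unfolding lop_code[OF M_closed(3)[OF m] \<theta>_ops(1)[OF m rep_in[OF m]] v]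
        restrict_apply'[OF code_in[OF v]] lop_code[OF m rep_in[OF m] v]
        lft_smult[OF V_W[OF v]] VV.realization_smult[OF lft_V[OF m rep_in[OF m] v]] ..
  qed
  have one: "lop \<one>\<^bsub>A\<^esub> = (\<lambda>x\<in>carrier K. x)"
  proof (rule K_op_eqI[OF lop_in[OF M_closed(5)] K.id_in_bounded_operators])
    fix v assume v: "v \<in> V"
    show "lop \<one>\<^bsub>A\<^esub> (code v) = (\<lambda>x\<in>carrier K. x) (code v)"
      unfolding lop_code[OF M_closed(5) \<theta>_one v] restrict_apply'[OF code_in[OF v]] lft_id[OF V_W[OF v]] ..
  qed
  have star: "adjoint_operator K (lop m) = lop (star A m)" if m: "m \<in> M" for m
  proof (rule K.adjoint_unique[OF lop_in[OF M_closed(4)[OF m]]], unfold K_carrier)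
    fix x y assume "x \<in> code ` V" "y \<in> code ` V"
    then obtain v w where [simp]: "x = code v" "y = code w" and v: "v \<in> V" and w: "w \<in> V" by blast
    show "ip K (lop m x) y = ip K x (lop (star A m) y)"
      using lft_adjoint[OF rep_bounded[OF m] V_W[OF v] V_W[OF w]]
      by (simp add: lop_code[OF m rep_in[OF m] v] lop_code[OF M_closed(4)[OF m] \<theta>_ops(2)[OF m rep_in[OF m]] w]
          VV.realization_ip v w lft_V[OF m rep_in[OF m] v] lft_V[OF M_closed(4)[OF m] \<theta>_ops(2)[OF m rep_in[OF m]] w])
  qed
  have hom: "lop \<in> ring_hom A (all_operators K)"
  proof (rule ring_hom_memI; (unfold A_simps(1))?)
    fix x y assume x: "x \<in> M" and y: "y \<in> M"
    show "lop (x \<otimes>\<^bsub>A\<^esub> y) = lop x \<otimes>\<^bsub>all_operators K\<^esub> lop y"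
      by (simp only: B_simps(2) mult[OF x y])
    show "lop (x \<oplus>\<^bsub>A\<^esub> y) = lop x \<oplus>\<^bsub>all_operators K\<^esub> lop y"
      by (simp only: B_simps(4) add[OF x y])
  next
    show "lop x \<in> carrier (all_operators K)" if "x \<in> M" for x
      unfolding B_simps(1) by (rule lop_in[OF that])
    show "lop \<one>\<^bsub>A\<^esub> = \<one>\<^bsub>all_operators K\<^esub>" by (simp only: B_simps(3) one)
  qed
  show ?thesis
    unfolding star_hom_def
  proof (intro CollectI conjI allI ballI hom; (unfold A_simps(1))?)
    show "lop (a \<odot>\<^bsub>A\<^esub> x) = a \<odot>\<^bsub>all_operators K\<^esub> lop x" if "x \<in> M" for a x
      by (simp only: B_simps(5) smult[OF that])
    show "lop (star A x) = star (all_operators K) (lop x)" if "x \<in> M" for x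
      by (simp only: B_simps(6) star[OF that])
  qed
qed

lemma rop_hom: "rop \<in> star_hom (opposite A) (all_operators K)"
proof -
  have mult: "rop (n \<otimes>\<^bsub>A\<^esub> m) = compose (carrier K) (rop m) (rop n)" if m: "m \<in> M" and n: "n \<in> M" for m n
  proof (rule K_op_eqI[OF rop_in[OF M_closed(1)[OF n m]] K.compose_in_bounded_operators[OF rop_in[OF m] rop_in[OF n]]])
    fix v assume v: "v \<in> V"
    note m' = M_closed(4)[OF m] and n' = M_closed(4)[OF n]
    note c = \<theta>_ops(3)[OF m' rep_in[OF m'] n' rep_in[OF n'], folded M_star(2)[OF n m]]
    show "rop (n \<otimes>\<^bsub>A\<^esub> m) (code v) = compose (carrier K) (rop m) (rop n) (code v)"
      unfolding rop_code[OF M_closed(1)[OF n m] c v]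
        compose_eq[OF code_in[OF v]] rop_code[OF n rep_in[OF n'] v]
        rop_code[OF m rep_in[OF m'] rgt_V[OF n' rep_in[OF n'] v]]
        rgt_compose[OF rep_bounded[OF m'] rep_bounded[OF n'] V_W[OF v]] ..
  qed
  have add: "rop (m \<oplus>\<^bsub>A\<^esub> n) = (\<lambda>x\<in>carrier K. rop m x \<oplus>\<^bsub>K\<^esub> rop n x)" if m: "m \<in> M" and n: "n \<in> M" for m n
  proof (rule K_op_eqI[OF rop_in[OF M_closed(2)[OF m n]] K.add_in_bounded_operators[OF rop_in[OF m] rop_in[OF n]]])
    fix v assume v: "v \<in> V"
    note m' = M_closed(4)[OF m] and n' = M_closed(4)[OF n]
    note c = \<theta>_ops(4)[OF m' rep_in[OF m'] n' rep_in[OF n'], folded M_star(3)[OF m n]]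
    show "rop (m \<oplus>\<^bsub>A\<^esub> n) (code v) = (\<lambda>x\<in>carrier K. rop m x \<oplus>\<^bsub>K\<^esub> rop n x) (code v)"
      unfolding rop_code[OF M_closed(2)[OF m n] c v]
        restrict_apply'[OF code_in[OF v]] rop_code[OF n rep_in[OF n'] v] rop_code[OF m rep_in[OF m'] v]
        rgt_add[OF V_W[OF v]] VV.realization_add[OF rgt_V[OF m' rep_in[OF m'] v] rgt_V[OF n' rep_in[OF n'] v]] ..
  qed
  have smult: "rop (a \<odot>\<^bsub>A\<^esub> m) = (\<lambda>x\<in>carrier K. a \<odot>\<^bsub>K\<^esub> rop m x)" if m: "m \<in> M" for m a
  proof (rule K_op_eqI[OF rop_in[OF M_closed(3)[OF m]] K.smult_in_bounded_operators[OF rop_in[OF m]]])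
    fix v assume v: "v \<in> V"
    note m' = M_closed(4)[OF m]
    note c = \<theta>_ops(1)[OF m' rep_in[OF m'], of "cnj a", folded M_star(4)[OF m]]
    show "rop (a \<odot>\<^bsub>A\<^esub> m) (code v) = (\<lambda>x\<in>carrier K. a \<odot>\<^bsub>K\<^esub> rop m x) (code v)"
      unfolding rop_code[OF M_closed(3)[OF m] c v]
        restrict_apply'[OF code_in[OF v]] rop_code[OF m rep_in[OF m'] v]
        rgt_smult[OF V_W[OF v]] VV.realization_smult[OF rgt_V[OF m' rep_in[OF m'] v]] complex_cnj_cnj ..
  qed
  have one: "rop \<one>\<^bsub>A\<^esub> = (\<lambda>x\<in>carrier K. x)"
  proof (rule K_op_eqI[OF rop_in[OF M_closed(5)] K.id_in_bounded_operators])
    fix v assume v: "v \<in> V"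
    have id: "rgt (\<lambda>i. \<lambda>f\<in>carrier L2. f) v = v"
      unfolding rgt_def
    proof
      fix i
      have "twisted_right (\<omega> i) (\<lambda>f\<in>carrier L2. f) (v i) = twisted_right (\<omega> i) (\<lambda>f. f) (v i)"
        by (rule twisted_right_cong[OF \<omega> W_in[OF V_W[OF v]]]) simp
      then show "twisted_right (\<omega> i) (\<lambda>f\<in>carrier L2. f) (v i) = v i"
        by (simp add: twisted_right_def conj_inv_conj_inv[OF twist_in[OF unit_character_cnj[OF \<omega>] W_in[OF V_W[OF v]]]]
            twist_twist_cnj(1)[OF \<omega> W_in[OF V_W[OF v]]])
    qed
    have "(\<lambda>i. \<lambda>f\<in>carrier L2. f) \<in> \<theta> (star A \<one>\<^bsub>A\<^esub>)" unfolding M_star(5) by (rule \<theta>_one)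
    from rop_code[OF M_closed(5) this v]
    have r: "rop \<one>\<^bsub>A\<^esub> (code v) = code (rgt (\<lambda>i. \<lambda>f\<in>carrier L2. f) v)" .
    show "rop \<one>\<^bsub>A\<^esub> (code v) = (\<lambda>x\<in>carrier K. x) (code v)"
      unfolding r restrict_apply'[OF code_in[OF v]] id ..
  qed
  have star: "adjoint_operator K (rop m) = rop (star A m)" if m: "m \<in> M" for m
  proof (rule K.adjoint_unique[OF rop_in[OF M_closed(4)[OF m]]], unfold K_carrier)
    fix x y assume "x \<in> code ` V" "y \<in> code ` V"
    then obtain v w where [simp]: "x = code v" "y = code w" and v: "v \<in> V" and w: "w \<in> V" by blast
    note m' = M_closed(4)[OF m]
    note c = \<theta>_ops(2)[OF m' rep_in[OF m']]
    show "ip K (rop m x) y = ip K x (rop (star A m) y)"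
      using rgt_adjoint[OF rep_bounded[OF m'] V_W[OF v] V_W[OF w]]
      by (simp add: rop_code[OF m rep_in[OF m'] v] rop_code[OF m' c w]
          VV.realization_ip v w rgt_V[OF m' rep_in[OF m'] v] rgt_V[OF M_closed(4)[OF m'] c w])
  qed
  have opp: "carrier (opposite A) = M" "\<And>x y. x \<otimes>\<^bsub>opposite A\<^esub> y = y \<otimes>\<^bsub>A\<^esub> x" "add (opposite A) = add A"
    "one (opposite A) = one A" "smult (opposite A) = smult A" "star (opposite A) = star A"
    by (simp_all add: opposite_def A_simps(1))
  have hom: "rop \<in> ring_hom (opposite A) (all_operators K)"
  proof (rule ring_hom_memI; (unfold opp(1))?)
    fix x y assume x: "x \<in> M" and y: "y \<in> M"
    show "rop (x \<otimes>\<^bsub>opposite A\<^esub> y) = rop x \<otimes>\<^bsub>all_operators K\<^esub> rop y"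
      by (simp only: B_simps(2) opp(2) mult[OF x y])
    show "rop (x \<oplus>\<^bsub>opposite A\<^esub> y) = rop x \<oplus>\<^bsub>all_operators K\<^esub> rop y"
      by (simp only: B_simps(4) opp(3) add[OF x y])
  next
    show "rop x \<in> carrier (all_operators K)" if "x \<in> M" for x
      unfolding B_simps(1) by (rule rop_in[OF that])
    show "rop \<one>\<^bsub>opposite A\<^esub> = \<one>\<^bsub>all_operators K\<^esub>" by (simp only: B_simps(3) opp(4) one)
  qed
  show ?thesis
    unfolding star_hom_def
  proof (intro CollectI conjI allI ballI hom; (unfold opp(1))?)
    show "rop (a \<odot>\<^bsub>opposite A\<^esub> x) = a \<odot>\<^bsub>all_operators K\<^esub> rop x" if "x \<in> M" for a x
      by (simp only: B_simps(5) opp(5) smult[OF that])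
    show "rop (star (opposite A) x) = star (all_operators K) (rop x)" if "x \<in> M" for x
      by (simp only: B_simps(6) opp(6) star[OF that])
  qed
qed

lemma lop_rop_commute:
  assumes m: "m \<in> M" and n: "n \<in> M" and k: "k \<in> carrier K"
  shows "lop m (rop n k) = rop n (lop m k)"
proof -
  obtain v where v: "v \<in> V" "k = code v" using k unfolding K_carrier by blast
  note n' = M_closed(4)[OF n]
  show ?thesis
    unfolding v(2) rop_code[OF n rep_in[OF n'] v(1)] lop_code[OF m rep_in[OF m] v(1)]
      lop_code[OF m rep_in[OF m] rgt_V[OF n' rep_in[OF n'] v(1)]]
      rop_code[OF n rep_in[OF n'] lft_V[OF m rep_in[OF m] v(1)]]
      lft_rgt_commute[OF rep_bounded[OF m] rep_bounded[OF n'] V_W[OF v(1)]] ..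
qed

text \<open>The trace of \<open>m\<^sup>* m\<close> is the limit of \<open>\<parallel>x\<^sub>i \<delta>\<^sub>1\<parallel>\<^sup>2\<close>.\<close>

lemma trace_norm:
  assumes m: "m \<in> M" and x: "x \<in> \<theta> m"
  shows "Re (\<tau> (star A m \<otimes>\<^bsub>A\<^esub> m)) = q (lft x xi)"
proof -
  note m' = M_closed(4)[OF m]
  note xb = \<theta>_bounded_vN[OF m x]
  have xc: "x i d1 \<in> carrier L2" for i by (rule H.op_closed[OF bounded_vN_op[OF xb] d1_in])
  have "((\<lambda>i. ip L2 (compose (carrier L2) (adjoint_operator L2 (x i)) (x i) d1) d1) \<longlongrightarrow> \<tau> (star A m \<otimes>\<^bsub>A\<^esub> m)) U"
    by (rule \<theta>_trace[OF M_closed(1)[OF m' m] \<theta>_ops(3)[OF m' \<theta>_ops(2)[OF m x] m x]])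
  moreover have "ip L2 (compose (carrier L2) (adjoint_operator L2 (x i)) (x i) d1) d1 = of_real ((hnorm L2 (x i d1))\<^sup>2)" for i
    using H.ip_adjoint_left[OF bounded_vN_op[OF xb] xc d1_in] H.ip_self[OF xc]
    by (simp only: compose_eq[OF d1_in])
  ultimately have "((\<lambda>i. complex_of_real ((hnorm L2 (x i d1))\<^sup>2)) \<longlongrightarrow> \<tau> (star A m \<otimes>\<^bsub>A\<^esub> m)) U" by simp
  from tendsto_Re[OF this] have "((\<lambda>i. (hnorm L2 (lft x xi i))\<^sup>2) \<longlongrightarrow> Re (\<tau> (star A m \<otimes>\<^bsub>A\<^esub> m))) U"
    by (simp add: lft_def)
  then show ?thesis using q_eqI[OF lft_W[OF xb d1_W]] by simp
qed

text \<open>This is the estimate that \<open>normal_mapI\<close> asks for, once with the left and once with the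
  right action in place of \<open>t\<close>.\<close>

lemma Dset_bound:
  assumes t: "\<And>x. bounded_vN x \<Longrightarrow> bounded_map (t x)"
    and f: "\<And>a b. bounded_vN a \<Longrightarrow> bounded_vN b \<Longrightarrow> factors (\<lambda>x. t x (lft a (rgt b xi)))"
    and d: "d \<in> Dset"
  shows "\<exists>C\<ge>0. \<forall>x. bounded_vN x \<longrightarrow> q (t x d) \<le> C * q (lft x xi)"
  using d
proof (induction rule: Dset_induct)
  case zero
  have "q 0 = 0" using q_sc[OF V_zero, of 0] by (simp add: sc_zero)
  then show ?case by (intro exI[of _ 0]) (simp add: bounded_mapD(6)[OF t])
next
  case (add m n d)
  obtain C where C: "C \<ge> 0" "\<forall>x. bounded_vN x \<longrightarrow> q (t x d) \<le> C * q (lft x xi)" using add.IH by blast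
  obtain E where E: "\<forall>x y. bounded_vN x \<longrightarrow> bounded_vN y \<longrightarrow>
     t x (orbit_vector (m, n)) \<in> W \<and> q (t x (orbit_vector (m, n))) \<le> E\<^sup>2 * q (lft x xi) \<and>
     q (t x (orbit_vector (m, n)) - t y (orbit_vector (m, n))) \<le> E\<^sup>2 * q (lft x xi - lft y xi)"
    using f[OF rep_bounded[OF add.hyps(1)] rep_bounded[OF M_closed(4)[OF add.hyps(2)]]]
    unfolding factors_def orbit_vector_def fst_conv snd_conv by blast
  note gW = orbit_vector_W[OF add.hyps(1,2)]
  have dW: "d \<in> W" using add.hyps(3) Dset_W by blast
  have "q (t x (orbit_vector (m, n) + d)) \<le> (2 * E\<^sup>2 + 2 * C) * q (lft x xi)" if x: "bounded_vN x" for x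
  proof -
    have "q (t x (orbit_vector (m, n) + d)) \<le> 2 * q (t x (orbit_vector (m, n))) + 2 * q (t x d)"
      unfolding bounded_mapD(2)[OF t[OF x] gW dW]
      by (rule q_add_le[OF bounded_mapD(1)[OF t[OF x] gW] bounded_mapD(1)[OF t[OF x] dW]])
    also have "\<dots> \<le> 2 * (E\<^sup>2 * q (lft x xi)) + 2 * (C * q (lft x xi))"
      using C(2) E x by (intro add_mono mult_left_mono) auto
    finally show ?thesis by (simp add: algebra_simps)
  qed
  then show ?case using C(1) by (intro exI[of _ "2 * E\<^sup>2 + 2 * C"]) simp
qed

lemma Dset_dense:
  assumes "k \<in> carrier K" "e > 0"
  shows "\<exists>d\<in>code ` Dset. hnorm K (d \<ominus>\<^bsub>K\<^esub> k) < e"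
proof -
  obtain v where v: "v \<in> V" "k = code v" using assms(1) unfolding K_carrier by blast
  obtain d where d: "d \<in> Dset" "q (v - d) < e\<^sup>2"
    using approximableD[of v Dset "e\<^sup>2"] v(1) assms(2) unfolding V_def by auto
  have dV: "d \<in> V" using d(1) Dset_V by blast
  have "hnorm K (code d \<ominus>\<^bsub>K\<^esub> code v) = sqrt (q (v - d))"
    using VV.V_diff[OF dV v(1)] q_commute[OF V_W[OF v(1)] V_W[OF dV]]
    by (simp add: VV.realization_minus[OF dV v(1)] VV.realization_hnorm)
  also have "\<dots> < e" using d(2) assms(2) by (simp add: real_less_lsqrt q_nonneg[OF V_diff[OF V_W[OF v(1)] V_W[OF dV]]])
  finally show ?thesis using d(1) v(2) by blast
qed

lemma code_Dset_subset: "code ` Dset \<subseteq> carrier K"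
  using Dset_V code_in by blast

lemma lop_normal: "normal_map A (all_operators K) lop"
proof (rule K.normal_mapI[where t = \<tau> and D = "code ` Dset"])
  show "abelian_group A" by (rule HM.abelian_group_operator_algebra[OF M_subalgebra])
  show "normal_functional A \<tau>" using \<tau>_state by (simp add: faithful_normal_tracial_state_def)
  show "\<exists>d\<in>code ` Dset. hnorm K (d \<ominus>\<^bsub>K\<^esub> v) < e" if "v \<in> carrier K" "e > 0" for v e
    by (rule Dset_dense[OF that])
  show "code ` Dset \<subseteq> carrier K" by (rule code_Dset_subset)
  fix d assume "d \<in> code ` Dset"
  then obtain w where w: "w \<in> Dset" "d = code w" by blast
  have wV: "w \<in> V" using w(1) Dset_V by blast
  obtain C where C: "C \<ge> 0" "\<forall>x. bounded_vN x \<longrightarrow> q (lft x w) \<le> C * q (lft x xi)"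
    using Dset_bound[OF bounded_map_lft factors_lft w(1)] by blast
  have "hnorm K (lop a d) \<le> sqrt C * sqrt (Re (\<tau> (star A a \<otimes>\<^bsub>A\<^esub> a)))" if a: "a \<in> M" for a
  proof -
    have "hnorm K (lop a d) = sqrt (q (lft (rep a) w))"
      unfolding w(2) lop_code[OF a rep_in[OF a] wV] by (rule VV.realization_hnorm[OF lft_V[OF a rep_in[OF a] wV]])
    also have "\<dots> \<le> sqrt (C * q (lft (rep a) xi))" using C(2) rep_bounded[OF a] by simp
    finally show ?thesis unfolding trace_norm[OF a rep_in[OF a]] by (simp add: real_sqrt_mult)
  qed
  then show "\<exists>C. \<forall>a\<in>carrier A. hnorm K (lop a d) \<le> C * sqrt (Re (\<tau> (star A a \<otimes>\<^bsub>A\<^esub> a)))"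
    unfolding A_simps(1) by blast
next
  fix x assume "x \<in> carrier A"
  then have x: "x \<in> M" by (simp add: A_simps(1))
  show "lop x \<in> bounded_operators K" by (rule lop_in[OF x])
  show "lop (star A x) = adjoint_operator K (lop x)"
    using lop_hom x by (simp add: star_hom_def A_simps(1) B_simps(6))
  show "0 \<le> Re (\<tau> (star A x \<otimes>\<^bsub>A\<^esub> x))"
    unfolding trace_norm[OF x rep_in[OF x]] by (rule q_nonneg[OF lft_W[OF rep_bounded[OF x] d1_W]])
  show "lop (star A x \<otimes>\<^bsub>A\<^esub> x) v = adjoint_operator K (lop x) (lop x v)" if "v \<in> carrier K" for v
  proof -
    have h: "lop \<in> ring_hom A (all_operators K)" using lop_hom by (simp add: star_hom_def)
    have "lop (star A x \<otimes>\<^bsub>A\<^esub> x) = compose (carrier K) (lop (star A x)) (lop x)"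
      using ring_hom_mult[OF h, of "star A x" x] x M_closed(4)[OF x] by (simp add: A_simps(1) B_simps(2))
    then show ?thesis
      using lop_hom x that by (simp add: star_hom_def A_simps(1) B_simps(6) compose_eq)
  qed
  fix y assume y: "y \<in> carrier A"
  show "lop (x \<oplus>\<^bsub>A\<^esub> y) = lop x \<oplus>\<^bsub>all_operators K\<^esub> lop y"
    by (rule ring_hom_add[OF _ _ y]) (use lop_hom x in \<open>simp_all add: star_hom_def A_simps(1)\<close>)
  show "\<tau> (x \<oplus>\<^bsub>A\<^esub> y) = \<tau> x + \<tau> y"
    using \<tau>_state x y by (simp add: faithful_normal_tracial_state_def A_simps(1))
qed

end

context twisted_bimodule
begin

lemma opposite_simps:
  "carrier (opposite A) = M" "x \<otimes>\<^bsub>opposite A\<^esub> y = y \<otimes>\<^bsub>A\<^esub> x" "add (opposite A) = add A"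
  "zero (opposite A) = zero A" "star (opposite A) = star A" "x \<ominus>\<^bsub>opposite A\<^esub> y = x \<ominus>\<^bsub>A\<^esub> y"
  by (simp_all add: opposite_def A_simps(1) a_minus_def a_inv_def)

lemma abelian_group_opposite: "abelian_group (opposite A)"
proof -
  have "abelian_group A" by (rule HM.abelian_group_operator_algebra[OF M_subalgebra])
  then show ?thesis
    by (simp add: abelian_group_def abelian_monoid_def abelian_group_axioms_def opposite_def)
qed

text \<open>Replacing \<open>a\<close> by \<open>a\<^sup>*\<close> exchanges \<open>a\<^sup>* a\<close> and \<open>a a\<^sup>*\<close>.\<close>

lemma algebra_le_opposite: "algebra_le (opposite A) = algebra_le A"
proof (intro ext iffI)
  fix x y
  assume "algebra_le (opposite A) x y"
  then obtain a where a: "a \<in> M" "y \<ominus>\<^bsub>A\<^esub> x = a \<otimes>\<^bsub>A\<^esub> star A a"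
    by (auto simp: algebra_le_def opposite_simps)
  then have "y \<ominus>\<^bsub>A\<^esub> x = star A (star A a) \<otimes>\<^bsub>A\<^esub> star A a" by (simp only: M_star(1)[OF a(1)])
  then show "algebra_le A x y"
    unfolding algebra_le_def A_simps(1) by (rule bexI[OF _ M_closed(4)[OF a(1)]])
next
  fix x y
  assume "algebra_le A x y"
  then obtain a where a: "a \<in> M" "y \<ominus>\<^bsub>A\<^esub> x = star A a \<otimes>\<^bsub>A\<^esub> a"
    unfolding algebra_le_def A_simps(1) by blast
  then have "y \<ominus>\<^bsub>A\<^esub> x = star A a \<otimes>\<^bsub>A\<^esub> star A (star A a)" by (simp only: M_star(1)[OF a(1)])
  then show "algebra_le (opposite A) x y"
    unfolding algebra_le_def opposite_simps by (rule bexI[OF _ M_closed(4)[OF a(1)]])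
qed

lemma normal_functional_opposite: "normal_functional (opposite A) \<tau>"
proof -
  have "self_adjoint (opposite A) = self_adjoint A"
    by (simp add: self_adjoint_def opposite_simps A_simps(1))
  then have "normal_functional (opposite A) \<tau> \<longleftrightarrow> normal_functional A \<tau>"
    by (simp add: normal_functional_def directed_def is_supremum_def algebra_le_opposite)
  then show ?thesis using \<tau>_state by (simp add: faithful_normal_tracial_state_def)
qed

lemma rop_normal: "normal_map (opposite A) (all_operators K) rop"
proof (rule K.normal_mapI[where t = \<tau> and D = "code ` Dset"])
  show "abelian_group (opposite A)" by (rule abelian_group_opposite)
  show "normal_functional (opposite A) \<tau>" by (rule normal_functional_opposite)
  show "\<exists>d\<in>code ` Dset. hnorm K (d \<ominus>\<^bsub>K\<^esub> v) < e" if "v \<in> carrier K" "e > 0" for v e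
    by (rule Dset_dense[OF that])
  show "code ` Dset \<subseteq> carrier K" by (rule code_Dset_subset)
  have trace_norm': "Re (\<tau> (star (opposite A) a \<otimes>\<^bsub>opposite A\<^esub> a)) = q (lft (rep (star A a)) xi)"
    if a: "a \<in> M" for a
    using trace_norm[OF M_closed(4)[OF a] rep_in[OF M_closed(4)[OF a]]]
    by (simp only: opposite_simps M_star(1)[OF a])
  fix d assume "d \<in> code ` Dset"
  then obtain w where w: "w \<in> Dset" "d = code w" by blast
  have wV: "w \<in> V" using w(1) Dset_V by blast
  obtain C where C: "C \<ge> 0" "\<forall>x. bounded_vN x \<longrightarrow> q (rgt x w) \<le> C * q (lft x xi)"
    using Dset_bound[OF bounded_map_rgt factors_rgt w(1)] by blast
  have "hnorm K (rop a d) \<le> sqrt C * sqrt (Re (\<tau> (star (opposite A) a \<otimes>\<^bsub>opposite A\<^esub> a)))" if a: "a \<in> M" for a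
  proof -
    note a' = M_closed(4)[OF a]
    have "hnorm K (rop a d) = sqrt (q (rgt (rep (star A a)) w))"
      unfolding w(2) rop_code[OF a rep_in[OF a'] wV] by (rule VV.realization_hnorm[OF rgt_V[OF a' rep_in[OF a'] wV]])
    also have "\<dots> \<le> sqrt (C * q (lft (rep (star A a)) xi))" using C(2) rep_bounded[OF a'] by simp
    finally show ?thesis unfolding trace_norm'[OF a] by (simp add: real_sqrt_mult)
  qed
  then show "\<exists>C. \<forall>a\<in>carrier (opposite A). hnorm K (rop a d) \<le> C * sqrt (Re (\<tau> (star (opposite A) a \<otimes>\<^bsub>opposite A\<^esub> a)))"
    unfolding opposite_simps(1) by blast
next
  have h: "rop \<in> ring_hom (opposite A) (all_operators K)" using rop_hom by (simp add: star_hom_def)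
  have st: "rop (star A x) = adjoint_operator K (rop x)" if "x \<in> M" for x
    using rop_hom that by (simp add: star_hom_def opposite_simps B_simps(6))
  fix x assume "x \<in> carrier (opposite A)"
  then have x: "x \<in> M" by (simp add: opposite_simps)
  show "rop x \<in> bounded_operators K" by (rule rop_in[OF x])
  show "rop (star (opposite A) x) = adjoint_operator K (rop x)" unfolding opposite_simps by (rule st[OF x])
  show "0 \<le> Re (\<tau> (star (opposite A) x \<otimes>\<^bsub>opposite A\<^esub> x))"
  proof -
    note x' = M_closed(4)[OF x]
    have "0 \<le> q (lft (rep (star A x)) xi)" by (rule q_nonneg[OF lft_W[OF rep_bounded[OF x'] d1_W]])
    then show ?thesis using trace_norm[OF x' rep_in[OF x']] by (simp only: opposite_simps M_star(1)[OF x])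
  qed
  show "rop (star (opposite A) x \<otimes>\<^bsub>opposite A\<^esub> x) v = adjoint_operator K (rop x) (rop x v)"
    if v: "v \<in> carrier K" for v
  proof -
    have "rop (star A x \<otimes>\<^bsub>opposite A\<^esub> x) = compose (carrier K) (rop (star A x)) (rop x)"
      using ring_hom_mult[OF h, of "star A x" x] x M_closed(4)[OF x] by (simp only: opposite_simps(1) B_simps(2))
    then have "rop (star A x \<otimes>\<^bsub>opposite A\<^esub> x) v = rop (star A x) (rop x v)" by (simp add: compose_eq[OF v])
    then show ?thesis by (simp only: opposite_simps(5) st[OF x])
  qed
  fix y assume y: "y \<in> carrier (opposite A)"
  show "rop (x \<oplus>\<^bsub>opposite A\<^esub> y) = rop x \<oplus>\<^bsub>all_operators K\<^esub> rop y"
    by (rule ring_hom_add[OF h _ y]) (simp add: x opposite_simps(1))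
  show "\<tau> (x \<oplus>\<^bsub>opposite A\<^esub> y) = \<tau> x + \<tau> y"
    using \<tau>_state x y by (simp add: faithful_normal_tracial_state_def A_simps(1) opposite_simps)
qed

lemma normal_bimodule_K: "normal_bimodule A K lop rop"
  unfolding normal_bimodule_def A_simps(1)
  by (intro conjI ballI VV.hilbert_space_realization lop_hom lop_normal rop_hom rop_normal lop_rop_commute)

lemma xi_V: "xi \<in> V"
proof -
  note o = M_closed(5)
  have r1: "rep \<one>\<^bsub>A\<^esub> \<in> \<theta> \<one>\<^bsub>A\<^esub>" by (rule rep_in[OF o])
  let ?u = "rgt (rep \<one>\<^bsub>A\<^esub>) xi"
  have u: "?u \<in> W" by (rule rgt_W[OF rep_bounded[OF o] d1_W])
  have "?u \<in> V"
  proof (rule near_V[OF u])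
    show "orbit_vector (\<one>\<^bsub>A\<^esub>, \<one>\<^bsub>A\<^esub>) \<in> V" using orbit_vector_Dset[OF o o] Dset_V by blast
    show "q (?u - orbit_vector (\<one>\<^bsub>A\<^esub>, \<one>\<^bsub>A\<^esub>)) = 0"
      using factors_null[OF factors_lft1[OF rep_bounded[OF o]] o \<theta>_one r1]
      by (simp add: lft_id[OF u] orbit_vector_def M_star(5))
  qed
  then show ?thesis
  proof (rule near_V[OF d1_W])
    show "q (xi - ?u) = 0"
      using factors_null[OF factors_rgt1 o \<theta>_one r1] by (simp add: rgt_id)
  qed
qed

lemma ip_d1: "ip L2 f d1 = f \<one>"
  by (rule ip_delta) simp

lemma rgt_adjoint_xi:
  assumes m: "m \<in> M" and x: "x \<in> \<theta> m"
  shows "rgt (\<lambda>i. adjoint_operator L2 (x i)) xi = (\<lambda>i. twist (\<omega> i) (x i d1))"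
  unfolding rgt_def
  by (intro ext)
     (simp add: twisted_right_delta[OF \<omega> right_invariant_adjoint[OF vN_right_invariant[OF bounded_vN_in[OF \<theta>_bounded_vN[OF m x]]]]]
       H.adjoint_adjoint[OF bounded_vN_op[OF \<theta>_bounded_vN[OF m x]]])

lemma lop_rop_difference:
  assumes m: "m \<in> M" and x: "x \<in> \<theta> m" and v: "v \<in> V"
  shows "hnorm K (lop m (code v) \<ominus>\<^bsub>K\<^esub> rop m (code v)) = sqrt (q (lft x v - rgt (\<lambda>i. adjoint_operator L2 (x i)) v))"
proof -
  note m' = M_closed(4)[OF m] and x' = \<theta>_ops(2)[OF m x]
  note lv = lft_V[OF m x v] and rv = rgt_V[OF m' x' v]
  show ?thesis
    unfolding lop_code[OF m x v] rop_code[OF m x' v] VV.realization_minus[OF lv rv]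
    by (rule VV.realization_hnorm[OF VV.V_diff[OF lv rv]])
qed

text \<open>The vector states of \<open>\<xi>\<close> for both actions are equal to the trace, so only the
  commutators with the elements of \<open>F\<close> have to be small.\<close>

lemma central_vector:
  assumes PT: "\<forall>(H' :: (nat \<Rightarrow> 'h \<Rightarrow> 'h) hilbert) l r. \<forall>\<xi>\<in>carrier H'.
          normal_bimodule A H' l r \<and>
          (\<forall>x\<in>carrier A. nrm A x \<le> 1 \<longrightarrow> cmod (ip H' (l x \<xi>) \<xi> - \<tau> x) \<le> \<delta>) \<and>
          (\<forall>x\<in>carrier A. nrm A x \<le> 1 \<longrightarrow> cmod (ip H' (r x \<xi>) \<xi> - \<tau> x) \<le> \<delta>) \<and>
          (\<forall>y\<in>F. hnorm H' (l y \<xi> \<ominus>\<^bsub>H'\<^esub> r y \<xi>) \<le> \<delta>)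
          \<longrightarrow> (\<exists>\<xi>\<^sub>0\<in>carrier H'. hnorm H' (\<xi> \<ominus>\<^bsub>H'\<^esub> \<xi>\<^sub>0) \<le> \<epsilon> \<and>
                 (\<forall>y\<in>carrier A. l y \<xi>\<^sub>0 = r y \<xi>\<^sub>0))"
    and \<delta>: "\<delta> > 0" and F: "F \<subseteq> M"
    and near: "\<And>y. y \<in> F \<Longrightarrow> q (lft (rep y) xi - (\<lambda>i. twist (\<omega> i) (rep y i d1))) \<le> \<delta>\<^sup>2"
  obtains v where "v \<in> V" "q (xi - v) \<le> \<epsilon>\<^sup>2"
    "\<And>m x. m \<in> M \<Longrightarrow> x \<in> \<theta> m \<Longrightarrow> q (lft x v - rgt (\<lambda>i. adjoint_operator L2 (x i)) v) = 0"
proof -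
  have l: "ip K (lop m (code xi)) (code xi) = \<tau> m" if m: "m \<in> M" for m
  proof -
    have "ip K (lop m (code xi)) (code xi) = uip (lft (rep m) xi) xi"
      unfolding lop_code[OF m rep_in[OF m] xi_V]
      by (rule VV.realization_ip[OF lft_V[OF m rep_in[OF m] xi_V] xi_V])
    also have "\<dots> = \<tau> m"
      using \<theta>_trace[OF m rep_in[OF m]] uip_tendsto[OF lft_W[OF rep_bounded[OF m] d1_W] d1_W]
      by (intro U_unique[of _ _ "\<tau> m"]) (simp_all add: lft_def)
    finally show ?thesis .
  qed
  have r: "ip K (rop m (code xi)) (code xi) = \<tau> m" if m: "m \<in> M" for m
  proof -
    let ?x = "\<lambda>i. adjoint_operator L2 (rep m i)"
    note m' = M_closed(4)[OF m] and x' = \<theta>_ops(2)[OF m rep_in[OF m]]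
    have "ip K (rop m (code xi)) (code xi) = uip (rgt ?x xi) xi"
      unfolding rop_code[OF m x' xi_V] by (rule VV.realization_ip[OF rgt_V[OF m' x' xi_V] xi_V])
    also have "\<dots> = \<tau> m"
    proof (rule U_unique[OF uip_tendsto[OF rgt_W[OF \<theta>_bounded_vN[OF m' x'] d1_W] d1_W]])
      have "ip L2 (twist (\<omega> i) (rep m i d1)) d1 = ip L2 (rep m i d1) d1" for i
        by (simp add: ip_d1 twist_def unit_characterD(4)[OF \<omega>])
      then show "((\<lambda>i. ip L2 (rgt ?x xi i) d1) \<longlongrightarrow> \<tau> m) U"
        unfolding rgt_adjoint_xi[OF m rep_in[OF m]] using \<theta>_trace[OF m rep_in[OF m]] by simp
    qed
    finally show ?thesis .
  qed
  have d: "hnorm K (lop y (code xi) \<ominus>\<^bsub>K\<^esub> rop y (code xi)) \<le> \<delta>" if y: "y \<in> F" for y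
  proof -
    have yM: "y \<in> M" using F y by blast
    have "sqrt (q (lft (rep y) xi - (\<lambda>i. twist (\<omega> i) (rep y i d1)))) \<le> sqrt (\<delta>\<^sup>2)"
      by (rule real_sqrt_le_mono[OF near[OF y]])
    then show ?thesis
      unfolding lop_rop_difference[OF yM rep_in[OF yM] xi_V] rgt_adjoint_xi[OF yM rep_in[OF yM]]
      using \<delta> by simp
  qed
  have "\<exists>\<xi>\<^sub>0\<in>carrier K. hnorm K (code xi \<ominus>\<^bsub>K\<^esub> \<xi>\<^sub>0) \<le> \<epsilon> \<and> (\<forall>y\<in>carrier A. lop y \<xi>\<^sub>0 = rop y \<xi>\<^sub>0)"
  proof (rule PT[rule_format, OF code_in[OF xi_V]], intro conjI ballI impI)
    show "normal_bimodule A K lop rop" by (rule normal_bimodule_K)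
    show "cmod (ip K (lop x (code xi)) (code xi) - \<tau> x) \<le> \<delta>" if "x \<in> carrier A" for x
      using l[of x] that \<delta> by (simp add: A_simps(1))
    show "cmod (ip K (rop x (code xi)) (code xi) - \<tau> x) \<le> \<delta>" if "x \<in> carrier A" for x
      using r[of x] that \<delta> by (simp add: A_simps(1))
    show "hnorm K (lop y (code xi) \<ominus>\<^bsub>K\<^esub> rop y (code xi)) \<le> \<delta>" if "y \<in> F" for y by (rule d[OF that])
  qed
  then obtain v where v: "v \<in> V" "hnorm K (code xi \<ominus>\<^bsub>K\<^esub> code v) \<le> \<epsilon>"
    "\<forall>y\<in>M. lop y (code v) = rop y (code v)"
    unfolding K_carrier A_simps(1) by blast
  show thesis
  proof (rule that[OF v(1)])
    have "sqrt (q (xi - v)) \<le> \<epsilon>"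
      using v(2) by (simp only: VV.realization_minus[OF xi_V v(1)] VV.realization_hnorm[OF VV.V_diff[OF xi_V v(1)]])
    then show "q (xi - v) \<le> \<epsilon>\<^sup>2" by (rule sqrt_le_D)
    fix m x assume m: "m \<in> M" and x: "x \<in> \<theta> m"
    have "lop m (code v) \<in> carrier K" by (rule K.op_closed[OF lop_in[OF m] code_in[OF v(1)]])
    then have "lop m (code v) \<ominus>\<^bsub>K\<^esub> lop m (code v) = \<zero>\<^bsub>K\<^esub>" by (simp add: K.r_neg a_minus_def)
    then have "hnorm K (lop m (code v) \<ominus>\<^bsub>K\<^esub> rop m (code v)) = 0" using v(3) m by simp
    then show "q (lft x v - rgt (\<lambda>i. adjoint_operator L2 (x i)) v) = 0"
      unfolding lop_rop_difference[OF m x v(1)] by simp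
  qed
qed

text \<open>Modulo null vectors \<open>v\<close> is \<open>z \<xi>\<close>, where \<open>z\<close> is the limit of the coefficients of \<open>v\<close> at the
  unit, and \<open>z \<noteq> 0\<close> because \<open>v\<close> is near \<open>\<xi>\<close>.\<close>

lemma unit_vector_central:
  assumes v: "v \<in> W" "q (xi - v) < 1" and conc: "q (v - (\<lambda>i h. v i \<one> * d1 h)) = 0"
    and central: "\<And>m x. m \<in> M \<Longrightarrow> x \<in> \<theta> m \<Longrightarrow> q (lft x v - rgt (\<lambda>i. adjoint_operator L2 (x i)) v) = 0"
    and m: "m \<in> M" and x: "x \<in> \<theta> m"
  shows "q (lft x xi - rgt (\<lambda>i. adjoint_operator L2 (x i)) xi) = 0"
proof -
  obtain C where C: "C > 0" "\<And>i. hnorm L2 (v i) \<le> C" using W_bound[OF v(1)] by blast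
  have nd: "hnorm L2 d1 = 1" by (simp add: hnorm_def ip_d1) (simp add: delta_def)
  have z_bound: "cmod (v i \<one>) \<le> C" for i
    using order_trans[OF H.Cauchy_Schwarz[OF W_in[OF v(1)] d1_in] , of i C] C(2)[of i] by (simp add: nd ip_d1)
  define z where "z = Lim U (\<lambda>i. v i \<one>)"
  have z: "((\<lambda>i. v i \<one>) \<longlongrightarrow> z) U"
    unfolding z_def by (rule ultrafilter_tendsto_bounded[OF ultra z_bound])
  let ?y = "\<lambda>i h. v i \<one> * d1 h" and ?z = "scale_family z xi"
  have n: "hnorm L2 (\<lambda>h. c * d1 h) = cmod c" for c
    using H.hnorm_smult[OF d1_in, of c] by (simp add: ell2_smult nd)
  have cd: "(\<lambda>h. c * d1 h) \<in> carrier L2" for c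
    using H.smult_in[OF d1_in, of c] by (simp add: ell2_smult)
  have yW: "?y \<in> W" by (rule W_I[of _ C]) (simp_all add: cd n z_bound)
  have zW: "?z \<in> W" by (rule W_scale[OF d1_W])
  have "q (?y - ?z) = 0"
  proof (rule q_eqI[OF V_diff[OF yW zW]])
    have "(?y - ?z) i = (\<lambda>h. (v i \<one> - z) * d1 h)" for i
      by (simp add: fun_diff_def scale_family_def algebra_simps)
    then have "hnorm L2 ((?y - ?z) i) = cmod (v i \<one> - z)" for i by (simp add: n)
    moreover have "((\<lambda>i. (cmod (v i \<one> - z))\<^sup>2) \<longlongrightarrow> (cmod (z - z))\<^sup>2) U" by (intro tendsto_intros z)
    ultimately show "((\<lambda>i. (hnorm L2 ((?y - ?z) i))\<^sup>2) \<longlongrightarrow> 0) U" by simp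
  qed
  then have "q (v - ?z) \<le> 0" using q_triangle[OF v(1) yW zW] conc by simp
  then have null: "q (v - ?z) = 0" using q_nonneg[OF V_diff[OF v(1) zW]] by simp
  have "z \<noteq> 0"
  proof
    assume "z = 0"
    then have "?z = 0" by (simp add: sc_zero)
    then have "q (v - 0) = 0" using null by simp
    then have "q ((xi - v) - xi) = 0" using q_minus[OF v(1)] by simp
    then have "q (xi - v) = q xi" by (rule q_null_add(1)[OF V_diff[OF d1_W v(1)] d1_W])
    moreover have "q xi = 1" by (rule q_eqI[OF d1_W]) (simp add: nd)
    ultimately show False using v(2) by simp
  qed
  define t where "t = (\<lambda>v. lft x v - rgt (\<lambda>i. adjoint_operator L2 (x i)) v)"
  have t: "bounded_map t"
    unfolding t_def
    by (rule bounded_map_diff[OF bounded_map_lft[OF \<theta>_bounded_vN[OF m x]]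
          bounded_map_rgt[OF \<theta>_bounded_vN[OF M_closed(4)[OF m] \<theta>_ops(2)[OF m x]]]])
  obtain E where E: "\<forall>v\<in>W. q (t v) \<le> E\<^sup>2 * q v" using bounded_mapD(4)[OF t] by blast
  note tW = bounded_mapD(1)[OF t]
  have "q (t v - t ?z) \<le> 0"
    using E V_diff[OF v(1) zW] null unfolding bounded_mapD(5)[OF t v(1) zW, symmetric] by fastforce
  then have "q (t v - t ?z) = 0" using q_nonneg[OF V_diff[OF tW[OF v(1)] tW[OF zW]]] by simp
  then have "q (t v) = q (t ?z)" by (rule q_null_add(1)[OF tW[OF v(1)] tW[OF zW]])
  moreover have "q (t v) = 0" unfolding t_def by (rule central[OF m x])
  moreover have "q (t ?z) = (cmod z)\<^sup>2 * q (t xi)"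
    unfolding bounded_mapD(3)[OF t d1_W] by (rule q_sc[OF tW[OF d1_W]])
  ultimately show ?thesis using \<open>z \<noteq> 0\<close> by (simp add: t_def)
qed

end

section \<open>No property (T) between the free group factor and its ultrapower\<close>

theorem theorem3:
  fixes U :: "'i filter"
    and H :: "'h hilbert" and M :: "('h \<Rightarrow> 'h) set" and \<tau> :: "('h \<Rightarrow> 'h) \<Rightarrow> complex"
    and \<theta> :: "('h \<Rightarrow> 'h) \<Rightarrow>
      ('i \<Rightarrow> ((bool \<times> bool) list \<Rightarrow> complex) \<Rightarrow> (bool \<times> bool) list \<Rightarrow> complex) set"
  assumes "continuum_hypothesis"
    and "ultrafilter U"
    and "tracial_von_neumann_algebra H M \<tau>"
    and "tracial_embedding (operator_algebra H M) \<tau>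
           (ultrapower (group_vN_algebra F2) (group_trace F2) U)
           (ultrapower_trace (group_trace F2) U) \<theta>"
    and "diagonal (group_vN_algebra F2) (group_trace F2) U ` carrier (group_vN_algebra F2) \<subseteq> \<theta> ` M"
  shows "\<not> property_T (operator_algebra H M) \<tau>"
proof
  assume "property_T (operator_algebra H M) \<tau>"
  then have "\<forall>\<epsilon>>0. \<exists>F \<delta>. finite F \<and> F \<subseteq> carrier (operator_algebra H M) \<and> \<delta> > 0 \<and>
       (\<forall>(K :: (nat \<Rightarrow> 'h \<Rightarrow> 'h) hilbert) l r. \<forall>\<xi>\<in>carrier K.
          normal_bimodule (operator_algebra H M) K l r \<and>
          (\<forall>x\<in>carrier (operator_algebra H M). nrm (operator_algebra H M) x \<le> 1 \<longrightarrow> cmod (ip K (l x \<xi>) \<xi> - \<tau> x) \<le> \<delta>) \<and>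
          (\<forall>x\<in>carrier (operator_algebra H M). nrm (operator_algebra H M) x \<le> 1 \<longrightarrow> cmod (ip K (r x \<xi>) \<xi> - \<tau> x) \<le> \<delta>) \<and>
          (\<forall>y\<in>F. hnorm K (l y \<xi> \<ominus>\<^bsub>K\<^esub> r y \<xi>) \<le> \<delta>)
          \<longrightarrow> (\<exists>\<xi>\<^sub>0\<in>carrier K. hnorm K (\<xi> \<ominus>\<^bsub>K\<^esub> \<xi>\<^sub>0) \<le> \<epsilon> \<and>
                 (\<forall>y\<in>carrier (operator_algebra H M). l y \<xi>\<^sub>0 = r y \<xi>\<^sub>0)))"
    unfolding property_T_def .
  from this[rule_format, of "1/2"] obtain F \<delta> where fin: "finite F"
    and F: "F \<subseteq> carrier (operator_algebra H M)" and \<delta>: "\<delta> > 0"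
    and PT: "\<forall>(K :: (nat \<Rightarrow> 'h \<Rightarrow> 'h) hilbert) l r. \<forall>\<xi>\<in>carrier K.
          normal_bimodule (operator_algebra H M) K l r \<and>
          (\<forall>x\<in>carrier (operator_algebra H M). nrm (operator_algebra H M) x \<le> 1 \<longrightarrow> cmod (ip K (l x \<xi>) \<xi> - \<tau> x) \<le> \<delta>) \<and>
          (\<forall>x\<in>carrier (operator_algebra H M). nrm (operator_algebra H M) x \<le> 1 \<longrightarrow> cmod (ip K (r x \<xi>) \<xi> - \<tau> x) \<le> \<delta>) \<and>
          (\<forall>y\<in>F. hnorm K (l y \<xi> \<ominus>\<^bsub>K\<^esub> r y \<xi>) \<le> \<delta>)
          \<longrightarrow> (\<exists>\<xi>\<^sub>0\<in>carrier K. hnorm K (\<xi> \<ominus>\<^bsub>K\<^esub> \<xi>\<^sub>0) \<le> 1/2 \<and>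
                 (\<forall>y\<in>carrier (operator_algebra H M). l y \<xi>\<^sub>0 = r y \<xi>\<^sub>0))" by auto
  have FM: "F \<subseteq> M" using F by (simp add: operator_algebra_def)
  interpret E: ultrapower_embedding F2 U H M \<tau> \<theta>
    by (intro ultrapower_embedding.intro group_ultraproduct.intro group_l2.intro group_F2
        ultraproduct.intro ultrapower_embedding_axioms.intro assms)
  define x where "x m = (SOME x. x \<in> \<theta> m)" for m
  have x: "x m \<in> \<theta> m" if "m \<in> M" for m
    unfolding x_def using E.\<theta>_nonempty[OF that] by (simp add: some_in_eq)
  define u where "u i m = x m i E.d1" for i m
  have u: "u i m \<in> carrier F2.L2" if "m \<in> M" for i m
    unfolding u_def by (rule L2.op_closed[OF E.bounded_vN_op[OF E.\<theta>_bounded_vN[OF that x[OF that]]] E.d1_in])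
  define D where "D t i m = hnorm F2.L2 (u i m \<ominus>\<^bsub>F2.L2\<^esub> F2.twist (torus_character t) (u i m))" for t i m
  (* At the index i the parameter (1/2)^k is slow enough for property (T) to apply. *)
  define P where "P i k \<longleftrightarrow> (\<forall>m\<in>F. D ((1/2) ^ k) i m \<le> \<delta>)" for i k
  have "\<exists>k. P i k" for i
  proof -
    have "\<forall>\<^sub>F k in sequentially. D ((1/2) ^ k) i m \<le> \<delta>" if "m \<in> F" for m
    proof -
      have "m \<in> M" using FM that by blast
      from twist_continuous_at_0[OF u[OF this] \<delta>] show ?thesis unfolding D_def .
    qed
    then have "\<forall>\<^sub>F k in sequentially. P i k"
      unfolding P_def by (intro eventually_ball_finite fin ballI)
    then show ?thesis using eventually_happens by fastforce
  qed
  then have Least: "P i (LEAST k. P i k)" for i by (rule LeastI_ex)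
  define k where "k i = (LEAST k. P i k)" for i
  have Pk: "P i (k i)" for i unfolding k_def by (rule Least)
  have far: "\<exists>m\<in>F. D ((1/2) ^ k i) i m > \<delta> / 2" if nz: "k i \<noteq> 0" for i
  proof -
    obtain j where j: "k i = Suc j" using not0_implies_Suc[OF nz] by blast
    then have "\<not> P i j" using not_less_Least[of j "P i"] unfolding k_def by simp
    then obtain m where m: "m \<in> F" "D ((1/2) ^ j) i m > \<delta>" unfolding P_def by force
    have "m \<in> M" using FM m(1) by blast
    then have "D (2 * (1/2) ^ Suc j) i m \<le> 2 * D ((1/2) ^ Suc j) i m"
      unfolding D_def by (rule twist_doubling[OF u])
    then show ?thesis using m j by (intro bexI[of _ m]) simp_all
  qed
  (* The least admissible k gives the fastest admissible automorphism. *)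
  interpret T: twisted_bimodule F2 U H M \<tau> \<theta> "\<lambda>i. torus_character ((1/2) ^ k i)"
    by unfold_locales (rule unit_character_torus)
  have rep: "T.rep m = x m" for m by (simp add: T.rep_def x_def)
  obtain v where v: "v \<in> T.V" "E.q (T.xi - v) \<le> (1/2)\<^sup>2"
    and central: "\<And>m x. m \<in> M \<Longrightarrow> x \<in> \<theta> m \<Longrightarrow>
      E.q (T.lft x v - T.rgt (\<lambda>i. adjoint_operator F2.L2 (x i)) v) = 0"
  proof (rule T.central_vector[OF PT \<delta> FM])
    fix m assume m: "m \<in> F"
    then have mM: "m \<in> M" using FM by blast
    let ?w = "\<lambda>i. F2.twist (torus_character ((1/2) ^ k i)) (T.rep m i E.d1)"
    have lW: "T.lft (T.rep m) T.xi \<in> E.W" by (rule T.lft_W[OF T.rep_bounded[OF mM] E.d1_W])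
    have wW: "?w \<in> E.W"
      unfolding T.rgt_adjoint_xi[OF mM T.rep_in[OF mM], symmetric]
      by (rule T.rgt_W[OF E.\<theta>_bounded_vN[OF E.M_closed(4)[OF mM] E.\<theta>_ops(2)[OF mM T.rep_in[OF mM]]] E.d1_W])
    show "E.q (T.lft (T.rep m) T.xi - ?w) \<le> \<delta>\<^sup>2"
    proof (rule E.q_le_bound[OF E.V_diff[OF lW wW]], rule always_eventually, rule allI)
      fix i
      have "hnorm F2.L2 ((T.lft (T.rep m) T.xi - ?w) i) = D ((1/2) ^ k i) i m"
        unfolding E.diff_apply[OF lW wW] by (simp add: T.lft_def D_def u_def rep)
      then show "hnorm F2.L2 ((T.lft (T.rep m) T.xi - ?w) i) \<le> \<delta>"
        using Pk[of i] m unfolding P_def by simp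
    qed
  qed blast
  have vW: "v \<in> E.W" by (rule T.V_W[OF v(1)])
  have diag: "\<exists>m\<in>M. (\<lambda>i. left_translation F2 (gen s)) \<in> \<theta> m" for s
    by (rule E.\<theta>_diagonal[OF F2.left_translation_in_vN[OF gen_carrier] assms(5)])
  let ?\<omega> = "\<lambda>s i. torus_character ((1/2) ^ k i) (gen s)"
  have gen_action: "T.lft (\<lambda>i. left_translation F2 (gen s)) w = (\<lambda>i. F2.ltrans (gen s) (w i))"
    "T.rgt (\<lambda>i. adjoint_operator F2.L2 (left_translation F2 (gen s))) w
      = (\<lambda>i h. ?\<omega> s i * F2.rtrans (inv\<^bsub>F2\<^esub> (gen s)) (w i) h)" if w: "w \<in> E.W" for s w
  proof -
    show "T.lft (\<lambda>i. left_translation F2 (gen s)) w = (\<lambda>i. F2.ltrans (gen s) (w i))"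
      unfolding T.lft_def by (intro ext) (simp only: F2.left_translation_apply[OF E.W_in[OF w]])
    show "T.rgt (\<lambda>i. adjoint_operator F2.L2 (left_translation F2 (gen s))) w
      = (\<lambda>i h. ?\<omega> s i * F2.rtrans (inv\<^bsub>F2\<^esub> (gen s)) (w i) h)"
      unfolding T.rgt_def
    proof (intro ext)
      fix i h
      let ?r = "F2.twisted_right (torus_character ((1/2) ^ k i)) (adjoint_operator F2.L2 (left_translation F2 (gen s))) (w i)"
      show "?r h = ?\<omega> s i * F2.rtrans (inv\<^bsub>F2\<^esub> (gen s)) (w i) h"
      proof (cases "h \<in> carrier F2")
        case True
        then show ?thesis
          using F2.twisted_right_left_translation[OF unit_character_torus gen_carrier E.W_in[OF w] True]
          by (simp add: F2.rtrans_def)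
      next
        case False
        have "?r \<in> carrier F2.L2"
          by (intro F2.twisted_right_in unit_character_torus E.W_in[OF w] L2.adjoint_in_bounded_operators
              F2.left_translation_bounded gen_carrier)
        then show ?thesis using False by (simp add: ell2_carrier F2.rtrans_def)
      qed
    qed
  qed
  have gen_central: "E.q ((\<lambda>i. F2.ltrans (gen s) (w i)) - (\<lambda>i h. ?\<omega> s i * F2.rtrans (inv\<^bsub>F2\<^esub> (gen s)) (w i) h)) = 0"
    if w: "w \<in> E.W" and c: "\<And>m x. m \<in> M \<Longrightarrow> x \<in> \<theta> m \<Longrightarrow>
      E.q (T.lft x w - T.rgt (\<lambda>i. adjoint_operator F2.L2 (x i)) w) = 0" for s w
  proof -
    obtain m where m: "m \<in> M" "(\<lambda>i. left_translation F2 (gen s)) \<in> \<theta> m" using diag by blast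
    from c[OF m] show ?thesis unfolding gen_action[OF w] .
  qed
  have unit: "cmod (?\<omega> s i) = 1" for s i by (simp add: torus_character_def)
  have "E.q (E.res (carrier F2 - {\<one>\<^bsub>F2\<^esub>}) v) = 0"
  proof (rule E.paradoxical_mass[where E = "ends_in True", OF gen_carrier[of True] gen_carrier[of False] vW unit[where s = True] unit[where s = False]
        gen_central[OF vW central] gen_central[OF vW central]])
    have disjoint: "h \<notin> ends_in False" if "h \<in> ends_in True" for h using that by (simp add: ends_in_def)
    have ne: "h \<noteq> []" "h \<in> carrier F2" if "h \<in> ends_in True" for h using that by (simp_all add: ends_in_def)
    show "ends_in True \<subseteq> carrier F2 - {\<one>\<^bsub>F2\<^esub>}" by (auto simp: ends_in_def F2_one)
    show "h \<in> ends_in True \<or> inv\<^bsub>F2\<^esub> (gen True) \<otimes>\<^bsub>F2\<^esub> h \<otimes>\<^bsub>F2\<^esub> gen True \<in> ends_in True"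
      if "h \<in> carrier F2" "h \<noteq> \<one>\<^bsub>F2\<^esub>" for h
      using conjugate_ends_in(3)[of h True] that by (auto simp: F2_one)
    let ?b = "gen False" and ?b' = "inv\<^bsub>F2\<^esub> (gen False)"
    show "?b \<otimes>\<^bsub>F2\<^esub> h \<otimes>\<^bsub>F2\<^esub> ?b' \<notin> ends_in True \<and> ?b' \<otimes>\<^bsub>F2\<^esub> h \<otimes>\<^bsub>F2\<^esub> ?b \<notin> ends_in True"
      if "h \<in> carrier F2" "h \<in> ends_in True" for h
      using conjugate_ends_in(2,4)[OF ne(2,1)[OF that(2)] disjoint[OF that(2)]] by (simp add: ends_in_def)
    show "?b' \<otimes>\<^bsub>F2\<^esub> h \<otimes>\<^bsub>F2\<^esub> ?b \<notin> ends_in True"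
      if h: "h \<in> carrier F2" and h1: "?b \<otimes>\<^bsub>F2\<^esub> h \<otimes>\<^bsub>F2\<^esub> ?b' \<in> ends_in True" for h
    proof
      assume h2: "?b' \<otimes>\<^bsub>F2\<^esub> h \<otimes>\<^bsub>F2\<^esub> ?b \<in> ends_in True"
      have bc: "?b \<in> carrier F2" "?b' \<in> carrier F2" using gen_carrier by simp_all
      have "?b' \<otimes>\<^bsub>F2\<^esub> (?b \<otimes>\<^bsub>F2\<^esub> h \<otimes>\<^bsub>F2\<^esub> ?b') \<otimes>\<^bsub>F2\<^esub> ?b = h"
        "?b \<otimes>\<^bsub>F2\<^esub> (?b' \<otimes>\<^bsub>F2\<^esub> h \<otimes>\<^bsub>F2\<^esub> ?b) \<otimes>\<^bsub>F2\<^esub> ?b' = h"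
        using h bc by (simp_all add: F2.m_assoc, simp_all add: F2.m_assoc[symmetric])
      then show False
        using conjugate_ends_in(4)[OF ne(2,1)[OF h1] disjoint[OF h1]]
          conjugate_ends_in(2)[OF ne(2,1)[OF h2] disjoint[OF h2]] by simp
    qed
  qed
  then have conc: "E.q (v - (\<lambda>i h. v i \<one>\<^bsub>F2\<^esub> * E.d1 h)) = 0" by (rule E.concentrated_at_one[OF vW])
  have near1: "E.q (T.xi - v) < 1" using v(2) by (simp add: power2_eq_square)
  have xi_central: "E.q (T.lft y T.xi - T.rgt (\<lambda>i. adjoint_operator F2.L2 (y i)) T.xi) = 0"
    if "m \<in> M" "y \<in> \<theta> m" for m y
    by (rule T.unit_vector_central[OF vW near1 conc central that])
  have D_lim: "((\<lambda>i. (D ((1/2) ^ k i) i m)\<^sup>2) \<longlongrightarrow> 0) U" if m: "m \<in> F" for m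
  proof -
    have mM: "m \<in> M" using FM m by blast
    let ?r = "T.rgt (\<lambda>i. adjoint_operator F2.L2 (x m i)) T.xi"
    have lW: "T.lft (x m) T.xi \<in> E.W" by (rule T.lft_W[OF E.\<theta>_bounded_vN[OF mM x[OF mM]] E.d1_W])
    have rW: "?r \<in> E.W"
      by (rule T.rgt_W[OF E.\<theta>_bounded_vN[OF E.M_closed(4)[OF mM] E.\<theta>_ops(2)[OF mM x[OF mM]]] E.d1_W])
    have "((\<lambda>i. (hnorm F2.L2 ((T.lft (x m) T.xi - ?r) i))\<^sup>2) \<longlongrightarrow> 0) U"
      using E.q_tendsto[OF E.V_diff[OF lW rW]] unfolding xi_central[OF mM x[OF mM]] .
    then show ?thesis
      unfolding E.diff_apply[OF lW rW] unfolding T.rgt_adjoint_xi[OF mM x[OF mM]] by (simp add: T.lft_def D_def u_def)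
  qed
  have "\<forall>\<^sub>F i in U. k i \<noteq> 0"
  proof -
    let ?a = "gen True"
    let ?l = "\<lambda>i. F2.ltrans ?a (T.xi i)" and ?r = "\<lambda>i h. ?\<omega> True i * F2.rtrans (inv\<^bsub>F2\<^esub> ?a) (T.xi i) h"
    have lW: "?l \<in> E.W" by (rule E.ltrans_W[OF gen_carrier E.d1_W])
    have rW: "?r \<in> E.W" by (rule E.phase_rtrans_W(1)[OF F2.inv_closed[OF gen_carrier] E.d1_W unit])
    have lim: "((\<lambda>i. (hnorm F2.L2 ((?l - ?r) i))\<^sup>2) \<longlongrightarrow> 0) U"
    proof -
      have "E.q (?l - ?r) = 0" by (rule gen_central[OF E.d1_W xi_central])
      then show ?thesis using E.q_tendsto[OF E.V_diff[OF lW rW]] by (simp only:)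
    qed
    have lower: "cmod (1 - cis ((1/2) ^ k i)) \<le> hnorm F2.L2 ((?l - ?r) i)" for i
    proof -
      have "(?l - ?r) i ?a = 1 - cis ((1/2) ^ k i)"
        using gen_carrier by (simp add: fun_diff_def F2.ltrans_def F2.rtrans_def delta_def torus_character_gen)
      moreover have "(cmod ((?l - ?r) i ?a))\<^sup>2 \<le> (hnorm F2.L2 ((?l - ?r) i))\<^sup>2"
        using ell2_finite_sum_le[OF E.W_in[OF E.V_diff[OF lW rW]], of "{?a}" i] gen_carrier by simp
      ultimately have "(cmod (1 - cis ((1/2) ^ k i)))\<^sup>2 \<le> (hnorm F2.L2 ((?l - ?r) i))\<^sup>2" by simp
      then show ?thesis
        by (rule power2_le_imp_le) (rule L2.hnorm_nonneg[OF E.W_in[OF E.V_diff[OF lW rW]]])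
    qed
    (* The parameter 1 belongs to k i = 0; it is excluded since cis 1 is away from 1. *)
    have "cis 1 \<noteq> 1"
    proof
      assume "cis 1 = 1"
      then have "sin (1 :: real) = 0" by (metis cis.sel(2) one_complex.sel(2))
      moreover have "sin (1 :: real) > 0" using pi_gt3 by (intro sin_gt_zero) auto
      ultimately show False by simp
    qed
    then have "(cmod (1 - cis 1))\<^sup>2 > 0" by simp
    then have "\<forall>\<^sub>F i in U. (hnorm F2.L2 ((?l - ?r) i))\<^sup>2 < (cmod (1 - cis 1))\<^sup>2" by (rule order_tendstoD(2)[OF lim])
    then show ?thesis
    proof eventually_elim
      case (elim i)
      then have "hnorm F2.L2 ((?l - ?r) i) < cmod (1 - cis 1)" by (rule power_less_imp_less_base) simp
      from order_le_less_trans[OF lower[of i] this] show ?case by (intro notI) simp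
    qed
  qed
  moreover have "\<forall>\<^sub>F i in U. \<forall>m\<in>F. (D ((1/2) ^ k i) i m)\<^sup>2 < (\<delta> / 2)\<^sup>2"
    by (intro eventually_ball_finite fin ballI order_tendstoD(2)[OF D_lim]) (use \<delta> in simp_all)
  ultimately have "\<forall>\<^sub>F i in U. False"
  proof eventually_elim
    case (elim i)
    obtain m where m: "m \<in> F" "D ((1/2) ^ k i) i m > \<delta> / 2" using far[OF elim(1)] by blast
    have "(\<delta> / 2)\<^sup>2 < (D ((1/2) ^ k i) i m)\<^sup>2" using m(2) \<delta> by (intro power_strict_mono) auto
    then show ?case using elim(2) m(1) by fastforce
  qed
  then show False using assms(2) by (simp add: ultrafilter_def trivial_limit_def)
qed


end
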